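(* Let $f$ satisfy the regularity and summability conditions stated in the context, let $\varepsilon\in(0,\varepsilon_{\max})$, and let $\Gamma(\varepsilon)$ be an admissible foliation (admissible graph) for $f$ and $\varepsilon$. Then the Bellman candidate $B_\varepsilon$ generated by $\Gamma(\varepsilon)$ admits an optimizer at every point $x\in\Omega_\varepsilon$.
   Context: Domains. Let $0<\varepsilon_{\max}\le\infty$ and let $\mathbf g(\cdot;\varepsilon)=(\mathbf g_1,\mathbf g_2):\mathbb R\to\mathbb R^2$, $0\le\varepsilon<\varepsilon_{\max}$, be $C^3$ curves, $C^{3,1}$-smooth in $(t,\varepsilon)$ (the mixed derivative $\partial_t^3\partial_\varepsilon\mathbf g$ is continuous), such that for every $\varepsilon$ (primes denote $\partial_t$) $\mathbf g_1'>0$ and $\mathbf g_2''\mathbf g_1'-\mathbf g_2'\mathbf g_1''>0$. Put $g(t)=(g_1(t),g_2(t))=\mathbf g(t;0)$ and $\Xi_\varepsilon=\{(\mathbf g_1(t;\varepsilon),x_2):t\in\mathbb R,\ x_2>\mathbf g_2(t;\varepsilon)\}$. Assume that for $\varepsilon_1<\varepsilon_2$ one has $\Xi_{\varepsilon_1}\supset\Xi_{\varepsilon_2}$ and $\mathbf g(t;\varepsilon_1)\notin\overline{\Xi_{\varepsilon_2}}$ for all $t$. Assume that for every $\varepsilon\in(0,\varepsilon_{\max})$ and $t\in\mathbb R$ there are two tangent lines from $g(t)$ to $\Xi_\varepsilon$, each meeting the curve $g(\cdot)$ twice. Let $w_L(t;\varepsilon)=\mathbf g(s_L;\varepsilon)$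 and $w_R(t;\varepsilon)=\mathbf g(s_R;\varepsilon)$, $s_R<s_L$, be the tangency points, $S_L(t;\varepsilon)=[g(t),w_L(t;\varepsilon)]$, $S_R(t;\varepsilon)=[g(t),w_R(t;\varepsilon)]$ the tangent segments, and $\kappa_L,\kappa_R$ their slopes; assume $\partial_\varepsilon\kappa_L\ne0$, $\partial_\varepsilon\kappa_R\neq 0$ everywhere. Let $T_\varepsilon(t)$ be the closed curvilinear triangle with vertex $g(t)$ bounded by $S_L(t;\varepsilon)$, $S_R(t;\varepsilon)$ and the arc of $\mathbf g(\cdot;\varepsilon)$ between the two tangency points, and $\Omega_\varepsilon=\bigcup_{t}T_\varepsilon(t)$. The fixed boundary is $\partial_{\rm fixed}\Omega_\varepsilon=g(\mathbb R)$, the free boundary is $\mathbf g(\mathbb R;\varepsilon)$. For each of the two choices $(w,\lambda)=(w_R,\lambda_R)$ and $(w_L,\lambda_L)$ the scalar $\lambda(t;\varepsilon)$ is defined by $\lambda(t)(g(t)-w(t))=w'(t)$; one has $\lambda_R>0>\lambda_L$. Decay assumption on the domain: for all $\varepsilon$, $t_0$, $(1+|w_R(t;\varepsilon)-g(t)|)\exp(-\int_t^{t_0}\lambda_R(\tau;\varepsilon)d\tau)\to0$ as $t\to-\infty$ and $(1+|w_L(t;\varepsilon)-g(t)|)\exp(\int_{t_0}^t\lambda_L(\tau;\varepsilon)d\tau)\to0$ as $t\to+\infty$. Conditions on $f$. Put $\kappa_2=g_2'/g_1'$, $\kappa_3=f'/g_1'$, $\mathfrak K=\kappa_3'/\kappa_2'$,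 $\gamma(t)=(g_1(t),g_2(t),f(t))$. Regularity condition: $f\in C^2(\mathbb R)$ and $\mathfrak K$ is piecewise monotone with finitely many monotonicity intervals. Summability condition: for every $\varepsilon\in(0,\varepsilon_{\max})$, $v\in\mathbb R$, $\int_{-\infty}^v f'(\tau)\exp(-\int_\tau^v\lambda_R(s;\varepsilon)ds)d\tau>-\infty$ and $\int_v^{+\infty}f'(\tau)\exp(\int_v^\tau\lambda_L(s;\varepsilon)ds)d\tau<+\infty$. Figures (fixed $\varepsilon$) and standard candidates. (1) Right tangent domain $\Omega_R(u_1,u_2)$: union of $S_R(t)$, $t$ running over the interval with endpoints $u_1<u_2$ (possibly infinite). Standard candidate: $B(x)=f(t)+(x_1-g_1(t))[\kappa_3(t)+(\kappa(t)-\kappa_2(t))\beta_2(t)]$ for $x\in S_R(t)$, $\kappa=\kappa_R$, where $\beta_2$ solves $(\kappa_2-\kappa)\beta_2'+\kappa_2'\beta_2=\kappa_3'$ and $\beta_2'<0$ in the interior of the interval; if $u_1=-\infty$, $\beta_2(t)=\mathfrak K(t)-\int_{-\infty}^t\exp(-\int_\tau^t\frac{\kappa_2'}{\kappa_2-\kappa})d\mathfrak K(\tau)$, required to be finite. Left tangent domain $\Omega_L(u_1,u_2)$: same with $S_L$, $\kappa=\kappa_L$ and $\beta_2'>0$; if $u_2=+\infty$, $\beta_2(t)=\mathfrak K(t)+\int_t^{+\infty}\exp(\int_t^\tau\frac{\kappa_2'}{\kappa_2-\kappa})d\mathfrak K(\tau)$, required to be finite. (2) Chordal domain $\Omega_{\rm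 ch}([a_0,b_0],[a_1,b_1])$, $a_0<a_1\le b_1<b_0$: union of chords $[g(a),g(b(a))]\subset\Omega_\varepsilon$, $a\in[a_0,a_1]$, with $b$ continuous strictly decreasing, $b(a_0)=b_0$, $b(a_1)=b_1$, each pair $(a,b)=(a,b(a))$ satisfying the cup equation $\det(\gamma'(a),\gamma'(b),\gamma(b)-\gamma(a))=0$, and $\frac{\det(\gamma'(a),\gamma'(b),\gamma''(a))}{\det(g'(a),g'(b))}<0$, $\frac{\det(\gamma'(b),\gamma'(a),\gamma''(b))}{\det(g'(b),g'(a))}<0$ for $a_0<a<a_1$. Standard candidate: affine on each chord with boundary values $f$. (3) Linearity domains. Angle: $\Omega_{\rm ang}(u)=T_\varepsilon(u)$. Multifigure over disjoint closed intervals $\mathfrak a_1<\dots<\mathfrak a_k$, $\mathfrak a_i=[\mathfrak a_i^l,\mathfrak a_i^r]$ (single points allowed; $k\ge2$ or $\mathfrak a_1$ nondegenerate): region bounded by the arcs $g(\mathfrak a_i)$, the chords $[g(\mathfrak a_i^r),g(\mathfrak a_{i+1}^l)]\subset\Omega_\varepsilon$, and either by the chord $[g(\mathfrak a_1^l),g(\mathfrak a_k^r)]\subset\Omega_\varepsilon$ (closed multicup), or by tangents at $g(\mathfrak a_1^l)$ and $g(\mathfrak a_k^r)$ together with the arc of the free boundary between their tangency points, the tangents being $(S_R,S_R)$ (right multitrolleybus), $(S_L,S_L)$ (left multitrolleybus), $(S_L,S_R)$ (multicup) or $(S_R,S_L)$ (multibirdie); for $k=2$ and single points these are called trolleybuses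 and birdies. $\mathfrak a_1$ may be a ray to $-\infty$ for a multicup or a left multitrolleybus, and $\mathfrak a_k$ a ray to $+\infty$ for a multicup or a right multitrolleybus; then the corresponding tangent is absent. Standard candidate: an affine $B$ with $B(g(a))=f(a)$ and $\langle\nabla B,g'(a)\rangle=f'(a)$ for every $a$ with $g(a)$ in the figure. Admissible foliation (graph) for $f$ and $\varepsilon$: a finite decomposition of $\Omega_\varepsilon$ into figures of types (1)–(3) with disjoint interiors, together with a standard candidate on each figure, such that along every segment common to two figures the values and gradients of their standard candidates coincide. The function $B_\varepsilon$ on $\Omega_\varepsilon$ generated by it is the function equal to the chosen standard candidate on each figure. Optimizers. For an interval $I$, $\mathbf A_{\Omega_\varepsilon}(I)$ is the class of summable $\varphi:I\to\partial_{\rm fixed}\Omega_\varepsilon$ with average $\langle\varphi\rangle_J\in\Omega_\varepsilon$ for every subinterval $J\subset I$. Let $\mathrm f(g(t))=f(t)$. An optimizer for $B_\varepsilon$ at $x$ is a function $\varphi\in\mathbf A_{\Omega_\varepsilon}(I)$ with $\langle\varphi\rangle_I=x$ and $B_\varepsilon(x)=\langle\mathrm f(\varphi)\rangle_I$. *)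

theory Defs
  imports "HOL-Analysis.Analysis"
begin

abbreviation vdiff :: "(real \<Rightarrow> 'a::real_normed_vector) \<Rightarrow> real \<Rightarrow> 'a" where
  "vdiff h \<equiv> \<lambda>t. vector_derivative h (at t)"

text \<open>A family of curves is a function \<open>G\<close> with \<open>G e t\<close> the point of the curve with
  index \<open>e\<close> and parameter \<open>t\<close>. The curve \<open>G 0\<close> is the fixed boundary and \<open>G e\<close> the free
  boundary of the domain with index \<open>e\<close>.\<close>

definition param_range :: "ereal \<Rightarrow> real set" where
  "param_range emax = {e. 0 \<le> e \<and> ereal e < emax}"

text \<open>\<open>D i j\<close> is the derivative of order \<open>i\<close> in \<open>t\<close> and of order \<open>j\<close> in \<open>e\<close>;
  at \<open>e = 0\<close> the derivative in \<open>e\<close> is one-sided.\<close>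

definition C31_family :: "ereal \<Rightarrow> (real \<Rightarrow> real \<Rightarrow> real^2) \<Rightarrow> bool" where
  "C31_family emax G \<longleftrightarrow> (\<exists>D :: nat \<Rightarrow> nat \<Rightarrow> real \<Rightarrow> real \<Rightarrow> real^2.
     (\<forall>e\<in>param_range emax. \<forall>t. D 0 0 e t = G e t) \<and>
     (\<forall>i<3. \<forall>j\<le>1. \<forall>e\<in>param_range emax. \<forall>t.
        (D i j e has_vector_derivative D (Suc i) j e t) (at t)) \<and>
     (\<forall>i\<le>3. \<forall>e\<in>param_range emax. \<forall>t.
        ((\<lambda>e'. D i 0 e' t) has_vector_derivative D i 1 e t) (at e within param_range emax)) \<and>
     (\<forall>i\<le>3. \<forall>j\<le>1. continuous_on (param_range emax \<times> UNIV) (\<lambda>(e, t). D i j e t)))"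

definition Xi :: "(real \<Rightarrow> real \<Rightarrow> real^2) \<Rightarrow> real \<Rightarrow> (real^2) set" where
  "Xi G e = {x. \<exists>t. x$1 = G e t $ 1 \<and> x$2 > G e t $ 2}"

text \<open>Under convexity of the curve \<open>G e\<close>, the tangent lines to \<open>Xi G e\<close> are the tangent
  lines of that curve, and different parameters give different lines.\<close>

definition tangent_line :: "(real \<Rightarrow> real \<Rightarrow> real^2) \<Rightarrow> real \<Rightarrow> real \<Rightarrow> (real^2) set" where
  "tangent_line G e s = {G e s + r *\<^sub>R vdiff (G e) s | r. True}"

text \<open>The names of the two sides follow the position of the segment relative to its point of
  tangency: a right tangent lies to the right of it, so that its tangency parameter is the
  smaller one.\<close>

datatype side = Right | Left

fun tangency_param :: "(real \<Rightarrow> real \<Rightarrow> real^2) \<Rightarrow> real \<Rightarrow> side \<Rightarrow> real \<Rightarrow> real" where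
  "tangency_param G e Right t = Min {s. G 0 t \<in> tangent_line G e s}"
| "tangency_param G e Left t = Max {s. G 0 t \<in> tangent_line G e s}"

definition tangency_point :: "(real \<Rightarrow> real \<Rightarrow> real^2) \<Rightarrow> real \<Rightarrow> side \<Rightarrow> real \<Rightarrow> real^2" where
  "tangency_point G e d t = G e (tangency_param G e d t)"

definition tangent_segment :: "(real \<Rightarrow> real \<Rightarrow> real^2) \<Rightarrow> real \<Rightarrow> side \<Rightarrow> real \<Rightarrow> (real^2) set" where
  "tangent_segment G e d t = closed_segment (G 0 t) (tangency_point G e d t)"

definition tangent_slope :: "(real \<Rightarrow> real \<Rightarrow> real^2) \<Rightarrow> real \<Rightarrow> side \<Rightarrow> real \<Rightarrow> real" where
  "tangent_slope G e d t =
     (tangency_point G e d t $ 2 - G 0 t $ 2) / (tangency_point G e d t $ 1 - G 0 t $ 1)"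

definition lam :: "(real \<Rightarrow> real \<Rightarrow> real^2) \<Rightarrow> real \<Rightarrow> side \<Rightarrow> real \<Rightarrow> real" where
  "lam G e d t =
     (THE l. l *\<^sub>R (G 0 t - tangency_point G e d t) = vdiff (tangency_point G e d) t)"

text \<open>The closed region enclosed by a lower and an upper curve which are graphs over the same
  interval of the first coordinate. All the curves bounding the figures below are graphs.\<close>

definition between_graphs :: "(real^2) set \<Rightarrow> (real^2) set \<Rightarrow> (real^2) set" where
  "between_graphs Lo Up =
     {x. \<exists>p\<in>Lo. \<exists>q\<in>Up. p$1 = x$1 \<and> q$1 = x$1 \<and> p$2 \<le> x$2 \<and> x$2 \<le> q$2}"

definition curv_triangle :: "(real \<Rightarrow> real \<Rightarrow> real^2) \<Rightarrow> real \<Rightarrow> real \<Rightarrow> (real^2) set" where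
  "curv_triangle G e t =
     between_graphs (tangent_segment G e Right t \<union> tangent_segment G e Left t)
       (G e ` {tangency_param G e Right t..tangency_param G e Left t})"

definition Omega :: "(real \<Rightarrow> real \<Rightarrow> real^2) \<Rightarrow> real \<Rightarrow> (real^2) set" where
  "Omega G e = (\<Union>t. curv_triangle G e t)"

definition domain_family :: "ereal \<Rightarrow> (real \<Rightarrow> real \<Rightarrow> real^2) \<Rightarrow> bool" where
  "domain_family emax G \<longleftrightarrow>
     0 < emax \<and> C31_family emax G \<and>
     (\<forall>e\<in>param_range emax. \<forall>t.
        vdiff (G e) t $ 1 > 0 \<and>
        vdiff (vdiff (G e)) t $ 2 * vdiff (G e) t $ 1
          - vdiff (G e) t $ 2 * vdiff (vdiff (G e)) t $ 1 > 0) \<and>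
     (\<forall>e1\<in>param_range emax. \<forall>e2\<in>param_range emax. e1 < e2 \<longrightarrow>
        Xi G e2 \<subseteq> Xi G e1 \<and> (\<forall>t. G e1 t \<notin> closure (Xi G e2))) \<and>
     (\<forall>e\<in>param_range emax - {0}. \<forall>t.
        card {s. G 0 t \<in> tangent_line G e s} = 2 \<and>
        (\<forall>s. G 0 t \<in> tangent_line G e s \<longrightarrow>
           card (tangent_line G e s \<inter> range (G 0)) = 2)) \<and>
     (\<forall>e\<in>param_range emax - {0}. \<forall>t d.
        \<exists>k. ((\<lambda>e'. tangent_slope G e' d t) has_real_derivative k) (at e) \<and> k \<noteq> 0) \<and>
     (\<forall>e\<in>param_range emax - {0}. \<forall>t0.
        ((\<lambda>t. (1 + norm (tangency_point G e Right t - G 0 t))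
               * exp (- integral {t..t0} (lam G e Right))) \<longlongrightarrow> 0) at_bot \<and>
        ((\<lambda>t. (1 + norm (tangency_point G e Left t - G 0 t))
               * exp (integral {t0..t} (lam G e Left))) \<longlongrightarrow> 0) at_top)"

definition kappa2 :: "(real \<Rightarrow> real^2) \<Rightarrow> real \<Rightarrow> real" where
  "kappa2 g t = vdiff g t $ 2 / vdiff g t $ 1"

definition kappa3 :: "(real \<Rightarrow> real^2) \<Rightarrow> (real \<Rightarrow> real) \<Rightarrow> real \<Rightarrow> real" where
  "kappa3 g f t = vdiff f t / vdiff g t $ 1"

definition torsion_quot :: "(real \<Rightarrow> real^2) \<Rightarrow> (real \<Rightarrow> real) \<Rightarrow> real \<Rightarrow> real" where
  "torsion_quot g f t = vdiff (kappa3 g f) t / vdiff (kappa2 g) t"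

definition space_curve :: "(real \<Rightarrow> real^2) \<Rightarrow> (real \<Rightarrow> real) \<Rightarrow> real \<Rightarrow> real^3" where
  "space_curve g f t = vector [g t $ 1, g t $ 2, f t]"

definition regularity_condition :: "(real \<Rightarrow> real^2) \<Rightarrow> (real \<Rightarrow> real) \<Rightarrow> bool" where
  "regularity_condition g f \<longleftrightarrow>
     (\<exists>f1 f2. (\<forall>t. (f has_real_derivative f1 t) (at t)) \<and>
        (\<forall>t. (f1 has_real_derivative f2 t) (at t)) \<and> continuous_on UNIV f2) \<and>
     (\<exists>P. finite P \<and> (\<forall>I. is_interval I \<and> I \<inter> P = {} \<longrightarrow>
        mono_on I (torsion_quot g f) \<or> antimono_on I (torsion_quot g f)))"

text \<open>By the regularity condition the derivative of \<open>f\<close> has a constant sign near each of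
  the two infinities, so the integrals in question have values in the extended reals. The first
  one exceeds minus infinity iff the negative part of the integrand is integrable, the second
  one is below infinity iff the positive part is. Note that \<open>ennreal\<close> maps negative reals
  to \<open>0\<close>.\<close>

definition summability_condition ::
  "ereal \<Rightarrow> (real \<Rightarrow> real \<Rightarrow> real^2) \<Rightarrow> (real \<Rightarrow> real) \<Rightarrow> bool" where
  "summability_condition emax G f \<longleftrightarrow> (\<forall>e\<in>param_range emax - {0}. \<forall>v.
     (\<integral>\<^sup>+\<tau>\<in>{..v}. ennreal (- (vdiff f \<tau> * exp (- integral {\<tau>..v} (lam G e Right)))) \<partial>lborel) < \<infinity> \<and>
     (\<integral>\<^sup>+\<tau>\<in>{v..}. ennreal (vdiff f \<tau> * exp (integral {v..\<tau>} (lam G e Left))) \<partial>lborel) < \<infinity>)"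

text \<open>Lebesgue--Stieltjes integral against a continuous function of locally bounded variation;
  the value does not depend on the decomposition into monotone functions.\<close>

definition has_stieltjes_integral ::
  "(real \<Rightarrow> real) \<Rightarrow> (real \<Rightarrow> real) \<Rightarrow> real set \<Rightarrow> real \<Rightarrow> bool" where
  "has_stieltjes_integral h K A y \<longleftrightarrow> (\<exists>P N.
     mono P \<and> mono N \<and> continuous_on UNIV P \<and> continuous_on UNIV N \<and>
     (\<forall>t. K t = P t - N t) \<and>
     set_integrable (interval_measure P) A h \<and> set_integrable (interval_measure N) A h \<and>
     y = (LINT t:A|interval_measure P. h t) - (LINT t:A|interval_measure N. h t))"

definition ereal_interval :: "ereal \<Rightarrow> ereal \<Rightarrow> real set" where
  "ereal_interval u v = {t. u \<le> ereal t \<and> ereal t \<le> v}"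

text \<open>The intervals of a multifigure, from left to right, as pairs of endpoints. The first left
  endpoint may be \<open>-\<infinity>\<close> and the last right endpoint may be \<open>\<infinity>\<close>.\<close>

type_synonym intervals = "(ereal \<times> ereal) list"

definition wf_intervals :: "intervals \<Rightarrow> bool" where
  "wf_intervals A \<longleftrightarrow> A \<noteq> [] \<and>
     (\<forall>(l, r)\<in>set A. l \<le> r \<and> l \<noteq> \<infinity> \<and> r \<noteq> -\<infinity>) \<and>
     (\<forall>i. Suc i < length A \<longrightarrow> snd (A ! i) < fst (A ! Suc i)) \<and>
     (length A \<ge> 2 \<or> fst (hd A) < snd (hd A))"

definition left_end :: "intervals \<Rightarrow> ereal" where
  "left_end A = fst (hd A)"

definition right_end :: "intervals \<Rightarrow> ereal" where
  "right_end A = snd (last A)"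

definition gap_chords :: "(real \<Rightarrow> real^2) \<Rightarrow> intervals \<Rightarrow> (real^2) set" where
  "gap_chords g A = (\<Union>i\<in>{i. Suc i < length A}.
     closed_segment (g (real_of_ereal (snd (A ! i)))) (g (real_of_ereal (fst (A ! Suc i)))))"

definition base_curve :: "(real \<Rightarrow> real^2) \<Rightarrow> intervals \<Rightarrow> (real^2) set" where
  "base_curve g A = (\<Union>(l, r)\<in>set A. g ` ereal_interval l r) \<union> gap_chords g A"

definition closing_chord :: "(real \<Rightarrow> real^2) \<Rightarrow> intervals \<Rightarrow> (real^2) set" where
  "closing_chord g A =
     closed_segment (g (real_of_ereal (left_end A))) (g (real_of_ereal (right_end A)))"

text \<open>\<open>Chordal a0 b0 a1 b1 b\<close> carries the function \<open>b\<close> that pairs the endpoints of the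
  chords. In \<open>Tangent_Multi d1 d2 A\<close> the sides are those of the tangents at the two extreme
  endpoints: \<open>Right Right\<close> is a right multitrolleybus, \<open>Left Left\<close> a left multitrolleybus,
  \<open>Left Right\<close> a multicup and \<open>Right Left\<close> a multibirdie.\<close>

datatype figure =
    Tangents side ereal ereal
  | Chordal real real real real "real \<Rightarrow> real"
  | Angle real
  | Closed_Multicup intervals
  | Tangent_Multi side side intervals

text \<open>A right tangent at the left end, or a left tangent at the right end, leaves the base curve
  outwards and bounds the figure from below; in the other two cases the tangent goes over the
  base curve and bounds the figure from above.\<close>

definition multi_lower ::
  "(real \<Rightarrow> real \<Rightarrow> real^2) \<Rightarrow> real \<Rightarrow> side \<Rightarrow> side \<Rightarrow> intervals \<Rightarrow> (real^2) set" where
  "multi_lower G e d1 d2 A = base_curve (G 0) A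
     \<union> (if left_end A \<noteq> -\<infinity> \<and> d1 = Right
        then tangent_segment G e Right (real_of_ereal (left_end A)) else {})
     \<union> (if right_end A \<noteq> \<infinity> \<and> d2 = Left
        then tangent_segment G e Left (real_of_ereal (right_end A)) else {})"

definition multi_upper ::
  "(real \<Rightarrow> real \<Rightarrow> real^2) \<Rightarrow> real \<Rightarrow> side \<Rightarrow> side \<Rightarrow> intervals \<Rightarrow> (real^2) set" where
  "multi_upper G e d1 d2 A =
     G e ` {s. (left_end A \<noteq> -\<infinity> \<longrightarrow> tangency_param G e d1 (real_of_ereal (left_end A)) \<le> s) \<and>
               (right_end A \<noteq> \<infinity> \<longrightarrow> s \<le> tangency_param G e d2 (real_of_ereal (right_end A)))}
     \<union> (if left_end A \<noteq> -\<infinity> \<and> d1 = Left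
        then tangent_segment G e Left (real_of_ereal (left_end A)) else {})
     \<union> (if right_end A \<noteq> \<infinity> \<and> d2 = Right
        then tangent_segment G e Right (real_of_ereal (right_end A)) else {})"

fun region :: "(real \<Rightarrow> real \<Rightarrow> real^2) \<Rightarrow> real \<Rightarrow> figure \<Rightarrow> (real^2) set" where
  "region G e (Tangents d u1 u2) = (\<Union>t\<in>ereal_interval u1 u2. tangent_segment G e d t)"
| "region G e (Chordal a0 b0 a1 b1 b) = (\<Union>a\<in>{a0..a1}. closed_segment (G 0 a) (G 0 (b a)))"
| "region G e (Angle u) = curv_triangle G e u"
| "region G e (Closed_Multicup A) = between_graphs (base_curve (G 0) A) (closing_chord (G 0) A)"
| "region G e (Tangent_Multi d1 d2 A) =
     between_graphs (multi_lower G e d1 d2 A) (multi_upper G e d1 d2 A)"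

definition cup_equation :: "(real \<Rightarrow> real^2) \<Rightarrow> (real \<Rightarrow> real) \<Rightarrow> real \<Rightarrow> real \<Rightarrow> bool" where
  "cup_equation g f a b \<longleftrightarrow>
     det (vector [vdiff (space_curve g f) a, vdiff (space_curve g f) b,
                  space_curve g f b - space_curve g f a] :: real^3^3) = 0"

definition chord_differential :: "(real \<Rightarrow> real^2) \<Rightarrow> (real \<Rightarrow> real) \<Rightarrow> real \<Rightarrow> real \<Rightarrow> real" where
  "chord_differential g f a b =
     det (vector [vdiff (space_curve g f) a, vdiff (space_curve g f) b,
                  vdiff (vdiff (space_curve g f)) a] :: real^3^3)
     / det (vector [vdiff g a, vdiff g b] :: real^2^2)"

text \<open>In the last clause the condition on the tangency parameters says that the arc of the free
  boundary between the tangency points exists; it is a restriction for multicups only.\<close>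

fun valid_figure ::
  "(real \<Rightarrow> real \<Rightarrow> real^2) \<Rightarrow> real \<Rightarrow> (real \<Rightarrow> real) \<Rightarrow> figure \<Rightarrow> bool" where
  "valid_figure G e f (Tangents d u1 u2) \<longleftrightarrow> u1 < u2"
| "valid_figure G e f (Chordal a0 b0 a1 b1 b) \<longleftrightarrow>
     a0 < a1 \<and> a1 \<le> b1 \<and> b1 < b0 \<and> b a0 = b0 \<and> b a1 = b1 \<and>
     continuous_on {a0..a1} b \<and> strict_antimono_on {a0..a1} b \<and>
     (\<forall>a\<in>{a0..a1}. closed_segment (G 0 a) (G 0 (b a)) \<subseteq> Omega G e \<and>
        cup_equation (G 0) f a (b a)) \<and>
     (\<forall>a\<in>{a0<..<a1}. chord_differential (G 0) f a (b a) < 0 \<and>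
        chord_differential (G 0) f (b a) a < 0)"
| "valid_figure G e f (Angle u) \<longleftrightarrow> True"
| "valid_figure G e f (Closed_Multicup A) \<longleftrightarrow>
     wf_intervals A \<and> left_end A \<noteq> -\<infinity> \<and> right_end A \<noteq> \<infinity> \<and>
     gap_chords (G 0) A \<subseteq> Omega G e \<and> closing_chord (G 0) A \<subseteq> Omega G e"
| "valid_figure G e f (Tangent_Multi d1 d2 A) \<longleftrightarrow>
     wf_intervals A \<and> gap_chords (G 0) A \<subseteq> Omega G e \<and>
     (left_end A = -\<infinity> \<longrightarrow> d1 = Left) \<and> (right_end A = \<infinity> \<longrightarrow> d2 = Right) \<and>
     (left_end A \<noteq> -\<infinity> \<and> right_end A \<noteq> \<infinity> \<longrightarrow>
        tangency_param G e d1 (real_of_ereal (left_end A))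
          \<le> tangency_param G e d2 (real_of_ereal (right_end A)))"

definition tangent_weight ::
  "(real \<Rightarrow> real \<Rightarrow> real^2) \<Rightarrow> real \<Rightarrow> side \<Rightarrow> real \<Rightarrow> real" where
  "tangent_weight G e d t =
     vdiff (kappa2 (G 0)) t / (kappa2 (G 0) t - tangent_slope G e d t)"

definition tangents_candidate ::
  "(real \<Rightarrow> real \<Rightarrow> real^2) \<Rightarrow> real \<Rightarrow> (real \<Rightarrow> real) \<Rightarrow> side \<Rightarrow> ereal \<Rightarrow> ereal \<Rightarrow> (real^2 \<Rightarrow> real) \<Rightarrow> bool" where
  "tangents_candidate G e f d u1 u2 B \<longleftrightarrow> (\<exists>\<beta> \<beta>'.
     (\<forall>t\<in>ereal_interval u1 u2.
        (\<beta> has_real_derivative \<beta>' t) (at t within ereal_interval u1 u2) \<and>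
        (kappa2 (G 0) t - tangent_slope G e d t) * \<beta>' t + vdiff (kappa2 (G 0)) t * \<beta> t
          = vdiff (kappa3 (G 0) f) t) \<and>
     (\<forall>t\<in>interior (ereal_interval u1 u2). case d of Right \<Rightarrow> \<beta>' t < 0 | Left \<Rightarrow> \<beta>' t > 0) \<and>
     (d = Right \<and> u1 = -\<infinity> \<longrightarrow> (\<forall>t\<in>ereal_interval u1 u2. \<exists>y.
        has_stieltjes_integral (\<lambda>\<tau>. exp (- integral {\<tau>..t} (tangent_weight G e Right)))
          (torsion_quot (G 0) f) {..t} y \<and>
        \<beta> t = torsion_quot (G 0) f t - y)) \<and>
     (d = Left \<and> u2 = \<infinity> \<longrightarrow> (\<forall>t\<in>ereal_interval u1 u2. \<exists>y.
        has_stieltjes_integral (\<lambda>\<tau>. exp (integral {t..\<tau>} (tangent_weight G e Left)))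
          (torsion_quot (G 0) f) {t..} y \<and>
        \<beta> t = torsion_quot (G 0) f t + y)) \<and>
     (\<forall>t\<in>ereal_interval u1 u2. \<forall>x\<in>tangent_segment G e d t.
        B x = f t + (x$1 - G 0 t $ 1) *
          (kappa3 (G 0) f t + (tangent_slope G e d t - kappa2 (G 0) t) * \<beta> t)))"

definition chordal_candidate ::
  "(real \<Rightarrow> real^2) \<Rightarrow> (real \<Rightarrow> real) \<Rightarrow> real \<Rightarrow> real \<Rightarrow> (real \<Rightarrow> real) \<Rightarrow> (real^2 \<Rightarrow> real) \<Rightarrow> bool" where
  "chordal_candidate g f a0 a1 b B \<longleftrightarrow> (\<forall>a\<in>{a0..a1}. \<forall>s\<in>{0..1}.
     B ((1 - s) *\<^sub>R g a + s *\<^sub>R g (b a)) = (1 - s) * f a + s * f (b a))"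

definition affine_candidate ::
  "(real \<Rightarrow> real^2) \<Rightarrow> (real \<Rightarrow> real) \<Rightarrow> (real^2) set \<Rightarrow> (real^2 \<Rightarrow> real) \<Rightarrow> bool" where
  "affine_candidate g f S B \<longleftrightarrow> (\<exists>c v.
     (\<forall>x\<in>S. B x = c + v \<bullet> x) \<and>
     (\<forall>a. g a \<in> S \<longrightarrow> B (g a) = f a \<and> v \<bullet> vdiff g a = vdiff f a))"

fun standard_candidate ::
  "(real \<Rightarrow> real \<Rightarrow> real^2) \<Rightarrow> real \<Rightarrow> (real \<Rightarrow> real) \<Rightarrow> figure \<Rightarrow> (real^2 \<Rightarrow> real) \<Rightarrow> bool" where
  "standard_candidate G e f (Tangents d u1 u2) B \<longleftrightarrow> tangents_candidate G e f d u1 u2 B"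
| "standard_candidate G e f (Chordal a0 b0 a1 b1 b) B \<longleftrightarrow> chordal_candidate (G 0) f a0 a1 b B"
| "standard_candidate G e f (Angle u) B \<longleftrightarrow>
     affine_candidate (G 0) f (region G e (Angle u)) B"
| "standard_candidate G e f (Closed_Multicup A) B \<longleftrightarrow>
     affine_candidate (G 0) f (region G e (Closed_Multicup A)) B"
| "standard_candidate G e f (Tangent_Multi d1 d2 A) B \<longleftrightarrow>
     affine_candidate (G 0) f (region G e (Tangent_Multi d1 d2 A)) B"

text \<open>The gradient on the boundary of a figure is taken relative to the figure. The endpoints of
  the segment are left out there: a figure may have a cusp at a point of tangency, and the relative
  gradient is then not unique at that point.\<close>

definition C1_glued ::
  "(real^2) set \<Rightarrow> (real^2 \<Rightarrow> real) \<Rightarrow> (real^2) set \<Rightarrow> (real^2 \<Rightarrow> real) \<Rightarrow> bool" where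
  "C1_glued S1 B1 S2 B2 \<longleftrightarrow>
     (\<forall>p q. p \<noteq> q \<and> closed_segment p q \<subseteq> S1 \<inter> S2 \<longrightarrow>
        (\<forall>x\<in>closed_segment p q. B1 x = B2 x) \<and>
        (\<forall>x\<in>open_segment p q. \<exists>v.
           (B1 has_derivative (\<lambda>h. v \<bullet> h)) (at x within S1) \<and>
           (B2 has_derivative (\<lambda>h. v \<bullet> h)) (at x within S2)))"

definition admissible_foliation ::
  "(real \<Rightarrow> real \<Rightarrow> real^2) \<Rightarrow> real \<Rightarrow> (real \<Rightarrow> real) \<Rightarrow> (figure \<times> (real^2 \<Rightarrow> real)) set \<Rightarrow> bool" where
  "admissible_foliation G e f \<Gamma> \<longleftrightarrow>
     finite \<Gamma> \<and>
     (\<forall>(F, b)\<in>\<Gamma>. valid_figure G e f F \<and> standard_candidate G e f F b) \<and>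
     (\<Union>(F, b)\<in>\<Gamma>. region G e F) = Omega G e \<and>
     (\<forall>(F1, b1)\<in>\<Gamma>. \<forall>(F2, b2)\<in>\<Gamma>. (F1, b1) \<noteq> (F2, b2) \<longrightarrow>
        interior (region G e F1) \<inter> interior (region G e F2) = {} \<and>
        C1_glued (region G e F1) b1 (region G e F2) b2)"

definition generated_candidate ::
  "(real \<Rightarrow> real \<Rightarrow> real^2) \<Rightarrow> real \<Rightarrow> (figure \<times> (real^2 \<Rightarrow> real)) set \<Rightarrow> (real^2 \<Rightarrow> real) \<Rightarrow> bool" where
  "generated_candidate G e \<Gamma> B \<longleftrightarrow> (\<forall>(F, b)\<in>\<Gamma>. \<forall>x\<in>region G e F. B x = b x)"

definition nondeg_interval :: "real set \<Rightarrow> bool" where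
  "nondeg_interval I \<longleftrightarrow> is_interval I \<and> bounded I \<and> interior I \<noteq> {}"

definition average :: "real set \<Rightarrow> (real \<Rightarrow> 'a::{banach, second_countable_topology}) \<Rightarrow> 'a" where
  "average J h = (1 / measure lebesgue J) *\<^sub>R (LINT t:J|lebesgue. h t)"

definition test_class :: "(real \<Rightarrow> real \<Rightarrow> real^2) \<Rightarrow> real \<Rightarrow> real set \<Rightarrow> (real \<Rightarrow> real^2) set" where
  "test_class G e I = {\<phi>.
     set_integrable lebesgue I \<phi> \<and> (\<forall>t\<in>I. \<phi> t \<in> range (G 0)) \<and>
     (\<forall>J. nondeg_interval J \<and> J \<subseteq> I \<longrightarrow> average J \<phi> \<in> Omega G e)}"

text \<open>The function on the fixed boundary whose value at \<open>g t\<close> is \<open>f t\<close>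
  (the curve \<open>g\<close> is injective).\<close>

definition boundary_fun :: "(real \<Rightarrow> real^2) \<Rightarrow> (real \<Rightarrow> real) \<Rightarrow> real^2 \<Rightarrow> real" where
  "boundary_fun g f x = f (inv g x)"

definition is_optimizer ::
  "(real \<Rightarrow> real \<Rightarrow> real^2) \<Rightarrow> real \<Rightarrow> (real \<Rightarrow> real) \<Rightarrow> (real^2 \<Rightarrow> real) \<Rightarrow> real^2 \<Rightarrow>
   real set \<Rightarrow> (real \<Rightarrow> real^2) \<Rightarrow> bool" where
  "is_optimizer G e f B x I \<phi> \<longleftrightarrow>
     nondeg_interval I \<and> \<phi> \<in> test_class G e I \<and> average I \<phi> = x \<and>
     set_integrable lebesgue I (\<lambda>t. boundary_fun (G 0) f (\<phi> t)) \<and>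
     B x = average I (\<lambda>t. boundary_fun (G 0) f (\<phi> t))"

end

theory Submission
  imports Defs
begin

text \<open>An optimizer at \<open>x\<close> is written as \<open>g \<circ> \<alpha>\<close> with a real function \<open>\<alpha>\<close> on an interval
  \<open>[0, T]\<close>. Averages of such a function lie above the fixed boundary by convexity. An average lies
  below the free boundary as soon as it lies below some tangent line of it, so all conditions on averages
  become inequalities \<open>free.height s y \<le> 0\<close>, which are affine in \<open>y\<close>.

  The building blocks are optimizers which lean to the left (\<open>left_opt f s y v\<close>, where \<open>y\<close> is the
  average of the curve and \<open>v\<close> the average of \<open>f\<close>): averages over initial intervals stay to the left of
  \<open>y\<close> and above the parallel through \<open>y\<close> to the tangent line at \<open>s\<close>. This allows to append a constant
  \<open>c\<close> if \<open>g c\<close> lies to the right of \<open>y\<close> and not above that parallel (\<open>left_opt_append\<close>).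
  Optimizers which lean to the right are their mirror images. An optimizer leaning to the left and one
  leaning to the right whose averages lie on one parallel to the tangent line at \<open>s\<close>, not above that line,
  can be joined in any proportion (\<open>opt_join_sides\<close>).

  In a domain of right tangents let \<open>\<tau>\<close> be the exponential of a primitive of \<open>\<lambda>\<^sub>R\<close>. Since
  \<open>w' = \<lambda>\<^sub>R (g - w)\<close>, the inverse function of \<open>\<tau>\<close> has the average \<open>w t\<close> over
  \<open>[0, \<tau> t]\<close>: its averages run along the free boundary. The equation for \<open>\<beta>\<^sub>2\<close> says that the
  value \<open>m\<close> of the candidate at the points of tangency solves \<open>m' = \<lambda>\<^sub>R (f - m)\<close>
  (\<open>fan_value_deriv\<close>), so it is the average of \<open>f\<close> (\<open>left_opt_fan\<close>). Hence an
  optimizer at the first point of tangency is carried along the whole domain. If the domain comes from minus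
  infinity, the integral formula for \<open>\<beta>\<^sub>2\<close> and the decay of the domain make all integrals
  converge (\<open>left_opt_fan_value_from_infinity\<close>), and the optimizer starts there. Appending the constant
  \<open>t\<close> gives the other points of the tangent at \<open>t\<close>.

  In a linearity domain bounded by an arc of the free boundary, draw through \<open>x\<close> the parallel to a
  suitable tangent line of that arc. On both sides it leaves the domain at points for which optimizers
  leaning to the proper side are available: at the fixed boundary, on a chord of the base, or on an
  extreme tangent, where the neighbouring tangent domain supplies one (\<open>left_crossing\<close>,
  \<open>right_crossing\<close>). They are joined, and the value is right because the candidate is affine
  (\<open>plate_opt\<close>). Figures consisting of chords are simpler: all averages stay below a single tangent line,
  and constants can be joined in any order (\<open>flat_opt\<close>).

  It remains to see that the required optimizers on the extreme tangents exist. If a figure begins with the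
  right tangent at \<open>u\<close>, consider the points right below its point of tangency. They lie in another figure.
  Two figures cannot both fill the domain near the free boundary to the right of this point, since their
  interiors are disjoint; so the other figure ends with the same tangent or contains a chord tangent to
  the free boundary there, and it supplies the optimizer, provided that it has got one at its own
  beginning, further left (\<open>delivered_from_left\<close>). As there are finitely many figures, this comes to an
  end. Left tangents are treated symmetrically, from right to left.\<close>


section \<open>Concatenation of functions on intervals\<close>

definition joined :: "real \<Rightarrow> (real \<Rightarrow> 'a) \<Rightarrow> (real \<Rightarrow> 'a) \<Rightarrow> real \<Rightarrow> 'a" where
  "joined T \<alpha> \<beta> x = (if x \<le> T then \<alpha> x else \<beta> (x - T))"

lemma absolutely_integrable_affine:
  fixes \<psi> :: "real \<Rightarrow> 'a::euclidean_space"
  assumes "\<psi> absolutely_integrable_on {a..b}" and "m > 0"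
  shows "(\<lambda>x. \<psi> (m * x + c)) absolutely_integrable_on {(a - c) / m..(b - c) / m}"
proof -
  have "integrable lebesgue (\<lambda>x. indicat_real {a..b} (c + m * x) *\<^sub>R \<psi> (c + m * x))"
    using assms unfolding set_integrable_def
    by (intro lebesgue_integrable_real_affine) auto
  moreover have "indicat_real {a..b} (c + m * x) = indicat_real {(a - c) / m..(b - c) / m} x" for x
    using \<open>m > 0\<close> by (auto simp: indicator_def field_simps)
  ultimately show ?thesis
    unfolding set_integrable_def by (simp add: add.commute)
qed

lemma integral_affine_real:
  fixes \<psi> :: "real \<Rightarrow> 'a::euclidean_space"
  assumes "\<psi> integrable_on {a..b}" and "m > 0"
  shows "integral {(a - c) / m..(b - c) / m} (\<lambda>x. \<psi> (m * x + c)) = (1 / m) *\<^sub>R integral {a..b} \<psi>"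
proof -
  have "(\<psi> has_integral integral {a..b} \<psi>) (cbox a b)"
    using assms(1) by (simp add: integrable_integral)
  from has_integral_affinity'[OF this \<open>m > 0\<close>, of c]
  have "((\<lambda>x. \<psi> (m * x + c)) has_integral (1 / m) *\<^sub>R integral {a..b} \<psi>) {(a - c) / m..(b - c) / m}"
    by (simp add: divide_inverse mult.commute)
  then show ?thesis by (rule integral_unique)
qed

lemma absolutely_integrable_joined:
  fixes \<psi> :: "'b \<Rightarrow> 'a::euclidean_space"
  assumes "(\<lambda>x. \<psi> (\<alpha> x)) absolutely_integrable_on {0..T}"
    and "(\<lambda>x. \<psi> (\<beta> x)) absolutely_integrable_on {0..T'}" and "0 \<le> T" "0 \<le> T'"
  shows "(\<lambda>x. \<psi> (joined T \<alpha> \<beta> x)) absolutely_integrable_on {0..T + T'}"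
proof -
  have "(\<lambda>x. \<psi> (joined T \<alpha> \<beta> x)) absolutely_integrable_on {0..T}"
    using assms(1) by (rule absolutely_integrable_spike[where S="{}"]) (auto simp: joined_def)
  moreover have "(\<lambda>x. \<psi> (\<beta> (x - T))) absolutely_integrable_on {T..T + T'}"
    using absolutely_integrable_affine[OF assms(2), of 1 "-T"] by (simp add: algebra_simps)
  then have "(\<lambda>x. \<psi> (joined T \<alpha> \<beta> x)) absolutely_integrable_on {T..T + T'}"
    by (rule absolutely_integrable_spike[where S="{T}"]) (auto simp: joined_def)
  ultimately have "(\<lambda>x. \<psi> (joined T \<alpha> \<beta> x)) absolutely_integrable_on ({0..T} \<union> {T..T + T'})"
    by (rule absolutely_integrable_Un)
  moreover have "{0..T} \<union> {T..T + T'} = {0..T + T'}" using assms by auto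
  ultimately show ?thesis by simp
qed

lemma integral_joined_left:
  assumes "p \<le> T"
  shows "integral {0..p} (\<lambda>x. \<psi> (joined T \<alpha> \<beta> x)) = integral {0..p} (\<lambda>x. \<psi> (\<alpha> x))"
  by (rule integral_cong) (use assms in \<open>auto simp: joined_def\<close>)

lemma integral_joined_right:
  fixes \<psi> :: "'b \<Rightarrow> 'a::euclidean_space"
  assumes "(\<lambda>x. \<psi> (\<alpha> x)) absolutely_integrable_on {0..T}"
    and "(\<lambda>x. \<psi> (\<beta> x)) absolutely_integrable_on {0..T'}" and "0 \<le> T"
    and "T \<le> q" "q \<le> T + T'"
  shows "integral {0..q} (\<lambda>x. \<psi> (joined T \<alpha> \<beta> x)) =
           integral {0..T} (\<lambda>x. \<psi> (\<alpha> x)) + integral {0..q - T} (\<lambda>x. \<psi> (\<beta> x))"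
proof -
  let ?j = "\<lambda>x. \<psi> (joined T \<alpha> \<beta> x)"
  have \<beta>: "(\<lambda>x. \<psi> (\<beta> x)) absolutely_integrable_on {0..q - T}"
    by (rule absolutely_integrable_on_subinterval[OF assms(2)]) (use assms in auto)
  have "?j absolutely_integrable_on {0..T + (q - T)}"
    using assms(1) \<beta> \<open>0 \<le> T\<close> by (rule absolutely_integrable_joined) (use assms in auto)
  then have "?j integrable_on {0..q}"
    by (simp add: absolutely_integrable_on_def)
  from Henstock_Kurzweil_Integration.integral_combine[OF \<open>0 \<le> T\<close> \<open>T \<le> q\<close> this]
  have "integral {0..q} ?j = integral {0..T} ?j + integral {T..q} ?j" by simp
  also have "integral {T..q} ?j = integral {T..q} (\<lambda>x. \<psi> (\<beta> (x - T)))"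
    by (rule integral_spike[of "{T}"]) (auto simp: joined_def)
  also have "\<dots> = integral {0..q - T} (\<lambda>x. \<psi> (\<beta> x))"
    using integral_affine_real[of "\<lambda>x. \<psi> (\<beta> x)" 0 "q - T" 1 "-T"] \<beta>
    by (simp add: absolutely_integrable_on_def algebra_simps)
  finally show ?thesis by (simp add: integral_joined_left)
qed

section \<open>Convex curves\<close>

lemma has_real_derivative_nth:
  "(\<phi> has_vector_derivative d) (at t within S) \<Longrightarrow> ((\<lambda>x. \<phi> x $ i) has_real_derivative d $ i) (at t within S)"
  for \<phi> :: "real \<Rightarrow> real^2"
  unfolding has_real_derivative_iff_has_vector_derivative
  using bounded_linear.has_vector_derivative[OF bounded_linear_vec_nth] by blast

locale convex_curve =
  fixes c dc ddc :: "real \<Rightarrow> real^2"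
  assumes deriv: "(c has_vector_derivative dc t) (at t)"
    and deriv2: "(dc has_vector_derivative ddc t) (at t)"
    and cont2: "continuous_on UNIV ddc"
    and dc_pos: "dc t $ 1 > 0"
    and convexity: "ddc t $ 2 * dc t $ 1 - dc t $ 2 * ddc t $ 1 > 0"
begin

definition slope :: "real \<Rightarrow> real" where
  "slope t = dc t $ 2 / dc t $ 1"

definition dslope :: "real \<Rightarrow> real" where
  "dslope t = (ddc t $ 2 * dc t $ 1 - dc t $ 2 * ddc t $ 1) / (dc t $ 1)\<^sup>2"

text \<open>The height of a point above the tangent line.\<close>

definition height :: "real \<Rightarrow> real^2 \<Rightarrow> real" where
  "height s y = y $ 2 - c s $ 2 - slope s * (y $ 1 - c s $ 1)"

lemmas deriv_nth = has_real_derivative_nth[OF deriv]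
lemmas deriv2_nth = has_real_derivative_nth[OF deriv2]

lemma cont_c: "continuous_on S c"
  by (meson deriv has_vector_derivative_continuous continuous_at_imp_continuous_on)

lemma cont_dc: "continuous_on S dc"
  by (meson deriv2 has_vector_derivative_continuous continuous_at_imp_continuous_on)

lemma cont_c_nth: "continuous_on S (\<lambda>x. c x $ i)"
  by (intro continuous_intros cont_c)

lemma cont_dc_nth: "continuous_on S (\<lambda>x. dc x $ i)"
  by (intro continuous_intros cont_dc)

lemma dc1_nz [simp]: "dc t $ 1 \<noteq> 0"
  using dc_pos[of t] by simp

lemma slope_deriv: "(slope has_real_derivative dslope t) (at t)"
proof -
  have "((\<lambda>t. dc t $ 2 / dc t $ 1) has_real_derivative dslope t) (at t)"
    unfolding dslope_def using dc_pos[of t]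
    by (auto intro!: derivative_eq_intros deriv2_nth simp: power2_eq_square)
  then show ?thesis by (simp add: slope_def[abs_def])
qed

lemma dslope_pos: "dslope t > 0"
  unfolding dslope_def using convexity[of t] dc_pos[of t] by simp

lemma cont_dslope: "continuous_on S dslope"
proof -
  have "continuous_on S ddc" using cont2 continuous_on_subset by blast
  then show ?thesis
    unfolding dslope_def[abs_def] by (auto intro!: continuous_intros cont_dc)
qed

lemma cont_slope: "continuous_on S slope"
  unfolding slope_def[abs_def] by (auto intro!: continuous_intros cont_dc)

lemma dc2_eq: "dc t $ 2 = slope t * dc t $ 1"
  by (simp add: slope_def)

lemma c1_less: "s < t \<Longrightarrow> c s $ 1 < c t $ 1"
  using DERIV_pos_imp_increasing[of s t "\<lambda>x. c x $ 1"] deriv_nth dc_pos by blast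

lemma c1_less_iff [simp]: "c s $ 1 < c t $ 1 \<longleftrightarrow> s < t"
  by (metis c1_less less_asym linorder_neqE)

lemma c1_le_iff [simp]: "c s $ 1 \<le> c t $ 1 \<longleftrightarrow> s \<le> t"
  by (simp flip: not_less)

lemma c1_eq_iff [simp]: "c s $ 1 = c t $ 1 \<longleftrightarrow> s = t"
  by (metis c1_less_iff less_irrefl linorder_neqE)

lemma inj_c: "inj c"
  by (rule injI) (metis c1_eq_iff)

lemma slope_less: "s < t \<Longrightarrow> slope s < slope t"
  using DERIV_pos_imp_increasing[of s t slope] slope_deriv dslope_pos by blast

lemma slope_less_iff [simp]: "slope s < slope t \<longleftrightarrow> s < t"
  by (metis slope_less less_asym linorder_neqE)

lemma slope_le_iff [simp]: "slope s \<le> slope t \<longleftrightarrow> s \<le> t"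
  by (simp flip: not_less)

lemma height_self [simp]: "height s (c s) = 0"
  by (simp add: height_def)

lemma height_affine:
  "height s ((1 - \<theta>) *\<^sub>R y + \<theta> *\<^sub>R z) = (1 - \<theta>) * height s y + \<theta> * height s z"
  by (simp add: height_def algebra_simps)

lemma height_deriv: "((\<lambda>t. height s (c t)) has_real_derivative dc t $ 1 * (slope t - slope s)) (at t)"
  unfolding height_def using dc2_eq[of t]
  by (auto intro!: derivative_eq_intros deriv_nth simp: algebra_simps)

lemma height_pos:
  assumes "s \<noteq> t"
  shows "height s (c t) > 0"
proof -
  have cont: "continuous_on S (\<lambda>t. height s (c t))" for S
    unfolding height_def by (intro continuous_intros cont_c_nth)
  show ?thesis
  proof (cases "s < t")
    case True
    have "height s (c s) < height s (c t)"
      by (rule DERIV_pos_imp_increasing_open[OF True _ cont])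
        (use height_deriv dc_pos in \<open>fastforce intro!: exI\<close>)
    then show ?thesis by simp
  next
    case False
    with assms have "t < s" by simp
    have "height s (c s) < height s (c t)"
    proof (rule DERIV_neg_imp_decreasing_open[OF \<open>t < s\<close> _ cont])
      fix x assume "t < x" "x < s"
      then show "\<exists>y. ((\<lambda>t. height s (c t)) has_real_derivative y) (at x) \<and> y < 0"
        using height_deriv[of s x] dc_pos[of x]
        by (intro exI[of _ "dc x $ 1 * (slope x - slope s)"]) (simp add: mult_pos_neg)
    qed
    then show ?thesis by simp
  qed
qed

lemma height_nonneg: "height s (c t) \<ge> 0"
  using height_pos[of s t] by (cases "s = t") auto

lemma height_eq_0_iff [simp]: "height s (c t) = 0 \<longleftrightarrow> s = t"
  using height_pos[of s t] by (cases "s = t") auto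

lemma height_diff:
  "height s y - height s' y = height s (c s') + (slope s' - slope s) * (y $ 1 - c s' $ 1)"
  by (simp add: height_def algebra_simps)

text \<open>Rolling the tangent line along the curve towards a vertical line raises its trace there, so
  the height of a point drops while the point of tangency approaches the point from either side.\<close>

lemma height_less_right:
  assumes "s < s'" "c s' $ 1 \<le> y $ 1"
  shows "height s' y < height s y"
  using height_diff[of s y s'] height_pos[of s s'] assms
    mult_nonneg_nonneg[of "slope s' - slope s" "y $ 1 - c s' $ 1"] slope_less[of s s'] by linarith

lemma height_less_left:
  assumes "s' < s" "y $ 1 \<le> c s' $ 1"
  shows "height s' y < height s y"
  using height_diff[of s y s'] height_pos[of s s'] assms
    mult_nonpos_nonpos[of "slope s' - slope s" "y $ 1 - c s' $ 1"] slope_less[of s' s] by linarith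

lemma height_at_same_abscissa:
  "y $ 1 = c s $ 1 \<Longrightarrow> height s y = y $ 2 - c s $ 2"
  by (simp add: height_def)

lemma height_min:
  assumes "y $ 1 = c s $ 1"
  shows "height s y \<le> height s' y"
  using height_less_left[of s s' y] height_less_right[of s' s y] assms
  by (cases s s' rule: linorder_cases) auto

lemma below_chord:
  assumes "s < t" "t < u"
  obtains \<theta> where "0 < \<theta>" "\<theta> < 1" "c t $ 1 = (1 - \<theta>) * c s $ 1 + \<theta> * c u $ 1"
    "c t $ 2 < (1 - \<theta>) * c s $ 2 + \<theta> * c u $ 2"
proof
  let ?d = "c u $ 1 - c s $ 1" and ?\<theta> = "(c t $ 1 - c s $ 1) / (c u $ 1 - c s $ 1)"
  have d: "?d > 0" "c t $ 1 - c s $ 1 > 0" "c t $ 1 < c u $ 1"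
    using assms c1_less[of s u] c1_less[of s t] c1_less[of t u] by auto
  show *: "0 < ?\<theta>" "?\<theta> < 1" using d by auto
  have "?\<theta> * ?d = c t $ 1 - c s $ 1" using d by simp
  moreover have "(1 - ?\<theta>) * c s $ 1 + ?\<theta> * c u $ 1 = c s $ 1 + ?\<theta> * ?d"
    by (simp only: left_diff_distrib right_diff_distrib mult_1_left)
  ultimately show 1: "c t $ 1 = (1 - ?\<theta>) * c s $ 1 + ?\<theta> * c u $ 1" by linarith
  have "0 < (1 - ?\<theta>) * height t (c s) + ?\<theta> * height t (c u)"
    using * assms height_pos[of t s] height_pos[of t u]
    by (intro add_pos_pos mult_pos_pos) auto
  also have "\<dots> = height t ((1 - ?\<theta>) *\<^sub>R c s + ?\<theta> *\<^sub>R c u)" by (simp only: height_affine)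
  also have "\<dots> = (1 - ?\<theta>) * c s $ 2 + ?\<theta> * c u $ 2 - c t $ 2"
    by (subst height_at_same_abscissa) (use 1 in simp_all)
  finally show "c t $ 2 < (1 - ?\<theta>) * c s $ 2 + ?\<theta> * c u $ 2" by simp
qed

lemma abscissa_between:
  assumes "c s $ 1 \<le> x" "x \<le> c t $ 1"
  obtains r where "c r $ 1 = x" "s \<le> r" "r \<le> t"
proof -
  have "s \<le> t" using assms by (metis c1_le_iff order_trans)
  then show ?thesis
    using IVT'[of "\<lambda>r. c r $ 1" s x t] assms cont_c_nth that by blast
qed

end

section \<open>Reflection\<close>

definition refl_pt :: "real^2 \<Rightarrow> real^2" where
  "refl_pt y = vector [- y $ 1, y $ 2]"

lemma refl_pt_nth [simp]: "refl_pt y $ 1 = - y $ 1" "refl_pt y $ 2 = y $ 2"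
  by (simp_all add: refl_pt_def)

lemma vec2_eq_iff: "y = z \<longleftrightarrow> y $ 1 = z $ 1 \<and> y $ 2 = z $ 2" for y z :: "real^2"
  by (simp add: vec_eq_iff forall_2)

lemma refl_pt_refl_pt [simp]: "refl_pt (refl_pt y) = y"
  by (simp add: vec2_eq_iff)

lemma linear_refl_pt: "linear refl_pt"
  by (rule linearI) (simp_all add: vec2_eq_iff)

lemma bounded_linear_refl_pt: "bounded_linear refl_pt"
  using linear_refl_pt by (simp add: linear_conv_bounded_linear)

lemmas refl_pt_linear =
  linear_add[OF linear_refl_pt] linear_scale[OF linear_refl_pt] linear_diff[OF linear_refl_pt]
  linear_neg[OF linear_refl_pt]

text \<open>The image of a curve under the reflection in the vertical axis, run through backwards; its
  first derivative changes sign.\<close>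

definition refl_curve :: "(real \<Rightarrow> real^2) \<Rightarrow> real \<Rightarrow> real^2" where
  "refl_curve c t = refl_pt (c (- t))"

definition refl_deriv :: "(real \<Rightarrow> real^2) \<Rightarrow> real \<Rightarrow> real^2" where
  "refl_deriv d t = - refl_pt (d (- t))"

lemma has_vector_derivative_uminus_arg:
  assumes "(c has_vector_derivative d) (at (- t))"
  shows "((\<lambda>t. c (- t)) has_vector_derivative - d) (at (t::real))"
proof -
  have "((\<lambda>t. - t) has_vector_derivative -1) (at t)"
    by (auto intro!: derivative_eq_intros)
  from vector_diff_chain_at[OF this, of c d] assms show ?thesis by (simp add: o_def)
qed

lemma refl_curve_deriv:
  assumes "\<And>t. (c has_vector_derivative d t) (at t)"
  shows "(refl_curve c has_vector_derivative refl_deriv d t) (at t)"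
  using bounded_linear.has_vector_derivative[OF bounded_linear_refl_pt
      has_vector_derivative_uminus_arg[OF assms]]
  by (simp add: refl_curve_def[abs_def] refl_deriv_def refl_pt_linear)

lemma refl_deriv_deriv:
  assumes "\<And>t. (c has_vector_derivative d t) (at t)"
  shows "(refl_deriv c has_vector_derivative refl_curve d t) (at t)"
  using has_vector_derivative_minus[OF bounded_linear.has_vector_derivative[OF bounded_linear_refl_pt
      has_vector_derivative_uminus_arg[OF assms]]]
  by (simp add: refl_curve_def[abs_def] refl_deriv_def[abs_def] refl_pt_linear)

context convex_curve
begin

lemma convex_curve_refl: "convex_curve (refl_curve c) (refl_deriv dc) (refl_curve ddc)"
proof
  fix t
  show "(refl_curve c has_vector_derivative refl_deriv dc t) (at t)"
    by (rule refl_curve_deriv) (rule deriv)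
  show "(refl_deriv dc has_vector_derivative refl_curve ddc t) (at t)"
    by (rule refl_deriv_deriv) (rule deriv2)
  have "continuous_on UNIV (ddc \<circ> uminus)"
    by (rule continuous_on_compose) (auto intro!: continuous_intros continuous_on_subset[OF cont2])
  then show "continuous_on UNIV (refl_curve ddc)"
    unfolding refl_curve_def[abs_def] o_def
    by (rule bounded_linear.continuous_on[OF bounded_linear_refl_pt])
  show "refl_deriv dc t $ 1 > 0" by (simp add: refl_deriv_def dc_pos)
  show "refl_curve ddc t $ 2 * refl_deriv dc t $ 1 - refl_deriv dc t $ 2 * refl_curve ddc t $ 1 > 0"
    using convexity[of "- t"] by (simp add: refl_deriv_def refl_curve_def)
qed

lemma slope_refl: "convex_curve.slope (refl_deriv dc) t = - slope (- t)"
  by (simp add: convex_curve.slope_def[OF convex_curve_refl] slope_def refl_deriv_def)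

lemma height_refl: "convex_curve.height (refl_curve c) (refl_deriv dc) s (refl_pt y) = height (- s) y"
  by (simp add: convex_curve.height_def[OF convex_curve_refl] height_def slope_refl refl_curve_def
      algebra_simps)

end

section \<open>The strip between two convex curves\<close>

text \<open>Here \<open>g\<close> is the fixed and \<open>h\<close> the free boundary. The locale is closed under the reflection in
  the vertical axis, which exchanges right and left tangents.\<close>

locale strip =
  fixed: convex_curve g dg ddg + free: convex_curve h dh ddh for g dg ddg h dh ddh +
  assumes free_above: "\<exists>t. g t $ 1 = h s $ 1 \<and> g t $ 2 < h s $ 2"
    and two_tangents: "card {s. free.height s (g t) = 0} = 2"
    and tangent_meets_twice: "free.height s (g t) = 0 \<Longrightarrow> \<exists>t'. t' \<noteq> t \<and> free.height s (g t') = 0"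
begin

lemma strip_refl:
  "strip (refl_curve g) (refl_deriv dg) (refl_curve ddg) (refl_curve h) (refl_deriv dh) (refl_curve ddh)"
proof -
  interpret rg: convex_curve "refl_curve g" "refl_deriv dg" "refl_curve ddg"
    by (rule fixed.convex_curve_refl)
  interpret rh: convex_curve "refl_curve h" "refl_deriv dh" "refl_curve ddh"
    by (rule free.convex_curve_refl)
  have ht: "rh.height s (refl_curve g t) = free.height (- s) (g (- t))" for s t
    unfolding refl_curve_def[of g t] by (rule free.height_refl)
  show ?thesis
  proof
    fix s t
    show "\<exists>t. refl_curve g t $ 1 = refl_curve h s $ 1 \<and> refl_curve g t $ 2 < refl_curve h s $ 2"
    proof -
      obtain t where "g t $ 1 = h (- s) $ 1" "g t $ 2 < h (- s) $ 2" using free_above by blast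
      then show ?thesis by (intro exI[of _ "- t"]) (simp add: refl_curve_def)
    qed
    have "{s. rh.height s (refl_curve g t) = 0} = uminus ` {s. free.height s (g (- t)) = 0}"
      unfolding ht by (auto simp: image_iff) (metis minus_minus)
    then show "card {s. rh.height s (refl_curve g t) = 0} = 2"
      by (simp add: card_image two_tangents)
    show "\<exists>t'. t' \<noteq> t \<and> rh.height s (refl_curve g t') = 0" if "rh.height s (refl_curve g t) = 0"
      using that tangent_meets_twice[of "- s" "- t"] unfolding ht by (metis minus_minus)
  qed
qed

lemma above_fixed: 
  assumes "g t $ 1 = h s $ 1"
  shows "g t $ 2 < h s $ 2"
  using free_above[of s] assms by (metis fixed.c1_eq_iff)

lemma fixed_height_free_pos: "fixed.height t (h s) > 0"
proof -
  obtain t' where t': "g t' $ 1 = h s $ 1" "g t' $ 2 < h s $ 2" using free_above by blast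
  have "fixed.height t (h s) = fixed.height t (g t') + (h s $ 2 - g t' $ 2)"
    using t' by (simp add: fixed.height_def)
  then show ?thesis using fixed.height_nonneg[of t t'] t' by linarith
qed

lemma fixed_height_quasiconvex:
  assumes "t1 < t2" "t2 < t3"
  shows "free.height s (g t2) < max (free.height s (g t1)) (free.height s (g t3))"
proof -
  obtain \<theta> where \<theta>: "0 < \<theta>" "\<theta> < 1" "g t2 $ 1 = (1 - \<theta>) * g t1 $ 1 + \<theta> * g t3 $ 1"
    "g t2 $ 2 < (1 - \<theta>) * g t1 $ 2 + \<theta> * g t3 $ 2"
    using fixed.below_chord[OF assms] by blast
  have "free.height s (g t2) < free.height s ((1 - \<theta>) *\<^sub>R g t1 + \<theta> *\<^sub>R g t3)"
    using \<theta> by (simp add: free.height_def)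
  also have "\<dots> = (1 - \<theta>) * free.height s (g t1) + \<theta> * free.height s (g t3)"
    by (rule free.height_affine)
  also have "\<dots> \<le> max (free.height s (g t1)) (free.height s (g t3))"
    using convex_bound_le[of "free.height s (g t1)" "max (free.height s (g t1)) (free.height s (g t3))"
      "free.height s (g t3)" "1 - \<theta>" \<theta>] \<theta> by simp
  finally show ?thesis .
qed

text \<open>If the free boundary did not pass over \<open>g t\<close>, it would stay on one side of this point, and the height of
  the point over the tangent line would be strictly monotone, with at most one zero.\<close>

lemma free_over_fixed: "\<exists>s. h s $ 1 = g t $ 1"
proof (rule ccontr)
  assume *: "\<nexists>s. h s $ 1 = g t $ 1"
  obtain a b where ab: "free.height a (g t) = 0" "free.height b (g t) = 0" "a < b"
  proof -
    have "card {s. free.height s (g t) = 0} = 2" by (rule two_tangents)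
    then obtain a b where "{s. free.height s (g t) = 0} = {a, b}" "a \<noteq> b"
      by (auto simp: card_2_iff)
    then show ?thesis using that[of a b] that[of b a] by (metis (mono_tags) insertI1 insertI2 linorder_neqE mem_Collect_eq)
  qed
  have "h b $ 1 \<le> g t $ 1 \<or> g t $ 1 \<le> h a $ 1"
    using * free.abscissa_between[of a "g t $ 1" b] by (metis linorder_le_cases)
  then show False
    using free.height_less_right[of a b "g t"] free.height_less_left[of a b "g t"] ab by auto
qed

lemma height_under_neg: "h s $ 1 = g t $ 1 \<Longrightarrow> free.height s (g t) < 0"
  using above_fixed[of t s] by (simp add: free.height_at_same_abscissa)

text \<open>The height of \<open>g t\<close> is negative for the parameter above it and strictly monotone on both sides of that
  parameter, so that each side contains one of the two zeros.\<close>

lemma tangency_exist: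
  "\<exists>a b. free.height a (g t) = 0 \<and> free.height b (g t) = 0 \<and> h a $ 1 < g t $ 1 \<and> g t $ 1 < h b $ 1"
proof -
  obtain s where s: "h s $ 1 = g t $ 1" using free_over_fixed by blast
  note neg = height_under_neg[OF s]
  obtain a b where ab: "{s. free.height s (g t) = 0} = {a, b}" "a \<noteq> b"
    using two_tangents[of t] by (auto simp: card_2_iff)
  define a' b' where "a' = min a b" and "b' = max a b"
  have r: "free.height a' (g t) = 0" "free.height b' (g t) = 0" "a' < b'"
    using ab unfolding a'_def b'_def by (auto simp: min_def max_def)
  have "a' < s"
  proof (rule ccontr)
    assume "\<not> a' < s"
    then show False
      using free.height_less_left[of a' b' "g t"] r s neg by (metis free.c1_le_iff less_irrefl not_less)
  qed
  moreover have "s < b'"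
  proof (rule ccontr)
    assume "\<not> s < b'"
    then show False
      using free.height_less_right[of a' b' "g t"] r s neg by (metis free.c1_le_iff less_irrefl not_less)
  qed
  ultimately show ?thesis using r s by (metis free.c1_less_iff)
qed

definition sR :: "real \<Rightarrow> real" where
  "sR t = (THE s. free.height s (g t) = 0 \<and> h s $ 1 < g t $ 1)"

definition sL :: "real \<Rightarrow> real" where
  "sL t = (THE s. free.height s (g t) = 0 \<and> g t $ 1 < h s $ 1)"

lemma sR_eqI: "free.height s (g t) = 0 \<Longrightarrow> h s $ 1 < g t $ 1 \<Longrightarrow> sR t = s"
  unfolding sR_def
  by (rule the_equality)
    (auto, metis free.height_less_right less_imp_le less_irrefl linorder_neqE)

lemma sL_eqI: "free.height s (g t) = 0 \<Longrightarrow> g t $ 1 < h s $ 1 \<Longrightarrow> sL t = s"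
  unfolding sL_def
  by (rule the_equality)
    (auto, metis free.height_less_left less_imp_le less_irrefl linorder_neqE)

lemma sR_root [simp]: "free.height (sR t) (g t) = 0" and h_sR_less: "h (sR t) $ 1 < g t $ 1"
  using tangency_exist[of t] sR_eqI by auto

lemma sL_root [simp]: "free.height (sL t) (g t) = 0" and h_sL_greater: "g t $ 1 < h (sL t) $ 1"
  using tangency_exist[of t] sL_eqI by auto

lemma sR_less_sL: "sR t < sL t"
  using h_sR_less[of t] h_sL_greater[of t] by (metis free.c1_less_iff order_less_trans)

lemma height_fixed_pos_left: "s < sR t \<Longrightarrow> free.height s (g t) > 0"
  using free.height_less_right[of s "sR t" "g t"] h_sR_less[of t] by simp

lemma height_fixed_pos_right: "sL t < s \<Longrightarrow> free.height s (g t) > 0"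
  using free.height_less_left[of "sL t" s "g t"] h_sL_greater[of t] by simp

lemma height_fixed_neg: "sR t < s \<Longrightarrow> s < sL t \<Longrightarrow> free.height s (g t) < 0"
  using free.height_less_right[of "sR t" s "g t"] free.height_less_left[of s "sL t" "g t"]
  by (cases "h s $ 1 \<le> g t $ 1") auto

lemma height_fixed_le_0_iff: "free.height s (g t) \<le> 0 \<longleftrightarrow> sR t \<le> s \<and> s \<le> sL t"
  by (smt (verit) height_fixed_neg height_fixed_pos_left height_fixed_pos_right sL_root sR_root)

lemma height_fixed_less_0_iff: "free.height s (g t) < 0 \<longleftrightarrow> sR t < s \<and> s < sL t"
  by (smt (verit) height_fixed_neg height_fixed_pos_left height_fixed_pos_right sL_root sR_root)

lemma height_fixed_eq_0_iff: "free.height s (g t) = 0 \<longleftrightarrow> s = sR t \<or> s = sL t"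
  by (smt (verit) height_fixed_neg height_fixed_pos_left height_fixed_pos_right sL_root sR_root)

lemma height_beyond_right:
  assumes "free.height s (g t) = 0" "h s $ 1 < g t $ 1" "t < t'"
  shows "free.height s (g t') > 0"
proof -
  obtain u where u: "g u $ 1 = h s $ 1" using free_above by blast
  then have "u < t" using assms by (metis fixed.c1_less_iff)
  then show ?thesis
    using fixed_height_quasiconvex[of u t t' s] height_under_neg[of s u] u assms by auto
qed

lemma sR_strict_mono: "t < t' \<Longrightarrow> sR t < sR t'"
proof -
  assume "t < t'"
  have "free.height (sR t) (g t') > 0"
    using height_beyond_right[of "sR t" t t'] h_sR_less \<open>t < t'\<close> by simp
  moreover have "sR t < sL t'"
    using h_sR_less[of t] fixed.c1_less[OF \<open>t < t'\<close>] h_sL_greater[of t']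
    by (metis free.c1_less_iff order_less_trans)
  ultimately show "sR t < sR t'"
    by (metis height_fixed_le_0_iff less_imp_le not_le)
qed

lemma sR_less_iff [simp]: "sR t < sR t' \<longleftrightarrow> t < t'"
  by (metis sR_strict_mono less_asym linorder_neqE)

lemma sR_le_iff [simp]: "sR t \<le> sR t' \<longleftrightarrow> t \<le> t'"
  by (simp flip: not_less)

lemma sR_eq_iff [simp]: "sR t = sR t' \<longleftrightarrow> t = t'"
  by (metis sR_less_iff less_irrefl linorder_neqE)

lemma isCont_height_fixed: "isCont (\<lambda>t. free.height s (g t)) t"
  unfolding free.height_def
  by (intro continuous_intros) (use fixed.cont_c[of UNIV] in \<open>auto simp: continuous_on_eq_continuous_at\<close>)

text \<open>Whether a parameter lies to the left or to the right of \<open>sR t\<close> is decided by strict inequalities between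
  continuous functions of \<open>t\<close>.\<close>

lemma isCont_sR: "isCont sR t"
  unfolding isCont_def
proof (rule order_tendstoI)
  have c1: "((\<lambda>t. g t $ 1) \<longlongrightarrow> g t $ 1) (at t)"
    using fixed.cont_c_nth[of UNIV 1] by (simp add: continuous_on_eq_continuous_at isCont_def)
  have ch: "((\<lambda>t. free.height a (g t)) \<longlongrightarrow> free.height a (g t)) (at t)" for a
    using isCont_height_fixed by (simp add: isCont_def)
  {
    fix a assume "a < sR t"
    then have "h a $ 1 < g t $ 1" "free.height a (g t) > 0"
      using order_less_trans[OF free.c1_less h_sR_less] height_fixed_pos_left by auto
    then have "\<forall>\<^sub>F t' in at t. h a $ 1 < g t' $ 1 \<and> free.height a (g t') > 0"
      using order_tendstoD(1)[OF c1, of "h a $ 1"] order_tendstoD(1)[OF ch, of 0 a]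
      by (auto intro: eventually_conj)
    then show "\<forall>\<^sub>F t' in at t. a < sR t'"
    proof eventually_elim
      case (elim t')
      then have "a < sL t'" using h_sL_greater[of t'] by (metis free.c1_less_iff order_less_trans)
      then show ?case using elim height_fixed_le_0_iff[of a t'] by linarith
    qed
  next
    fix a assume a: "sR t < a"
    show "\<forall>\<^sub>F t' in at t. sR t' < a"
    proof (cases "g t $ 1 < h a $ 1")
      case True
      then have "\<forall>\<^sub>F t' in at t. g t' $ 1 < h a $ 1"
        using order_tendstoD(2)[OF c1] by blast
      then show ?thesis
        by eventually_elim (metis free.c1_less_iff h_sR_less order_less_trans)
    next
      case False
      then have "a < sL t" using h_sL_greater[of t] by (metis free.c1_less_iff not_less order_le_less_trans)
      then have "\<forall>\<^sub>F t' in at t. free.height a (g t') < 0"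
        using order_tendstoD(2)[OF ch, of a 0] a by (simp add: height_fixed_neg)
      then show ?thesis by eventually_elim (simp add: height_fixed_less_0_iff)
    qed
  }
qed

lemma sR_attained_below:
  assumes "s \<le> sR t"
  shows "\<exists>u\<le>t. sR u = s"
proof -
  obtain u where u: "g u $ 1 = h s $ 1" using free_above by blast
  have "sR u < s" using h_sR_less[of u] u by simp
  then have "u < t" using assms by (metis order_less_le_trans sR_less_iff)
  have "\<exists>x\<ge>u. x \<le> t \<and> sR x = s"
    using \<open>sR u < s\<close> assms \<open>u < t\<close> isCont_sR by (intro IVT) auto
  then show ?thesis by blast
qed

end

text \<open>The two tangents of a point change places under the reflection.\<close>

lemma (in strip) sR_refl:
  "strip.sR (refl_curve g) (refl_curve h) (refl_deriv dh) t = - sL (- t)"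
proof -
  interpret r: strip "refl_curve g" "refl_deriv dg" "refl_curve ddg" "refl_curve h" "refl_deriv dh" "refl_curve ddh"
    by (rule strip_refl)
  show ?thesis
  proof (rule r.sR_eqI)
    show "r.free.height (- sL (- t)) (refl_curve g t) = 0"
      unfolding refl_curve_def[of g] free.height_refl by simp
    show "refl_curve h (- sL (- t)) $ 1 < refl_curve g t $ 1"
      using h_sL_greater[of "- t"] by (simp add: refl_curve_def)
  qed
qed

lemma (in strip) sL_refl:
  "strip.sL (refl_curve g) (refl_curve h) (refl_deriv dh) t = - sR (- t)"
proof -
  interpret r: strip "refl_curve g" "refl_deriv dg" "refl_curve ddg" "refl_curve h" "refl_deriv dh" "refl_curve ddh"
    by (rule strip_refl)
  show ?thesis
  proof (rule r.sL_eqI)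
    show "r.free.height (- sR (- t)) (refl_curve g t) = 0"
      unfolding refl_curve_def[of g] free.height_refl by simp
    show "refl_curve g t $ 1 < refl_curve h (- sR (- t)) $ 1"
      using h_sR_less[of "- t"] by (simp add: refl_curve_def)
  qed
qed

context strip
begin

lemma sL_strict_mono: "t < t' \<Longrightarrow> sL t < sL t'"
  using strip.sR_strict_mono[OF strip_refl, of "- t'" "- t"] by (simp add: sR_refl)

lemma sL_less_iff [simp]: "sL t < sL t' \<longleftrightarrow> t < t'"
  by (metis sL_strict_mono less_asym linorder_neqE)

lemma sL_le_iff [simp]: "sL t \<le> sL t' \<longleftrightarrow> t \<le> t'"
  by (simp flip: not_less)

lemma sL_eq_iff [simp]: "sL t = sL t' \<longleftrightarrow> t = t'"
  by (metis sL_less_iff less_irrefl linorder_neqE)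

lemma sL_attained_above: "sL t \<le> s \<Longrightarrow> \<exists>u\<ge>t. sL u = s"
  using strip.sR_attained_below[OF strip_refl, of "- s" "- t"]
  by (auto simp: sR_refl)

text \<open>Along the fixed boundary the height over a tangent line is quasiconvex, and it is negative below the point of
  tangency. So its two zeros lie on different sides of this point.\<close>

lemma tangent_meets_twice_sides: "(\<exists>t. sR t = s) \<longleftrightarrow> (\<exists>t. sL t = s)"
proof -
  obtain u where u: "g u $ 1 = h s $ 1" using free_above by blast
  note neg = height_under_neg[OF u[symmetric]]
  have side: "sR t = s \<longleftrightarrow> u < t" "sL t = s \<longleftrightarrow> t < u" if "free.height s (g t) = 0" for t
  proof -
    have "u \<noteq> t" using neg that by auto
    then consider "u < t" | "t < u" by linarith
    then show "sR t = s \<longleftrightarrow> u < t" "sL t = s \<longleftrightarrow> t < u"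
      using that sR_eqI[of s t] sL_eqI[of s t] u h_sR_less[of t] h_sL_greater[of t]
      by (metis fixed.c1_less_iff less_asym)+
  qed
  {
    fix t assume t: "free.height s (g t) = 0"
    obtain t' where t': "t' \<noteq> t" "free.height s (g t') = 0" using tangent_meets_twice[OF t] by blast
    have "u < t \<longleftrightarrow> \<not> u < t'"
      using fixed_height_quasiconvex[of u t t' s] fixed_height_quasiconvex[of u t' t s]
        fixed_height_quasiconvex[of t t' u s] fixed_height_quasiconvex[of t' t u s] t t' neg
      by (smt (verit, best))
    moreover have "u \<noteq> t" "u \<noteq> t'" using neg t t' by auto
    ultimately have "(\<exists>t. sR t = s) \<and> (\<exists>t. sL t = s)"
      using side[OF t] side[OF t'(2)] by (metis linorder_neqE)
  }
  then show ?thesis by (metis sL_root sR_root)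
qed

text \<open>By the intermediate value theorem, a parameter missed by \<open>sR\<close> would lie above all values of \<open>sR\<close>
  and, being missed by \<open>sL\<close> as well, below all values of \<open>sL\<close>. But the two functions have the same values.\<close>

lemma sR_surj: "\<exists>t. sR t = s"
proof (rule ccontr)
  assume *: "\<nexists>t. sR t = s"
  then have R: "sR t < s" and L: "s < sL t" for t
    using sR_attained_below[of s t] sL_attained_above[of t s] tangent_meets_twice_sides[of s]
    by (meson not_le)+
  obtain t where "sL t = sR 0" using tangent_meets_twice_sides[of "sR 0"] by blast
  then show False using R[of 0] L[of t] by simp
qed

lemma sL_surj: "\<exists>t. sL t = s"
  using sR_surj tangent_meets_twice_sides by blast

text \<open>The parameters where the tangent line at \<open>s\<close> crosses the fixed boundary.\<close>

definition tp :: "real \<Rightarrow> real" where "tp s = (THE t. sR t = s)"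
definition tm :: "real \<Rightarrow> real" where "tm s = (THE t. sL t = s)"

lemma sR_tp [simp]: "sR (tp s) = s"
  unfolding tp_def by (rule theI') (metis sR_surj sR_eq_iff)

lemma sL_tm [simp]: "sL (tm s) = s"
  unfolding tm_def by (rule theI') (metis sL_surj sL_eq_iff)

lemma tp_sR [simp]: "tp (sR t) = t" and tm_sL [simp]: "tm (sL t) = t"
  by (metis sR_tp sR_eq_iff, metis sL_tm sL_eq_iff)

lemma tp_less_iff [simp]: "tp s < tp s' \<longleftrightarrow> s < s'"
  by (metis sR_less_iff sR_tp)

lemma tm_less_iff [simp]: "tm s < tm s' \<longleftrightarrow> s < s'"
  by (metis sL_less_iff sL_tm)

lemma height_tp [simp]: "free.height s (g (tp s)) = 0" and height_tm [simp]: "free.height s (g (tm s)) = 0"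
  using sR_root[of "tp s"] sL_root[of "tm s"] by simp_all

lemma tm_less_abscissa: "g (tm s) $ 1 < h s $ 1" and abscissa_less_tp: "h s $ 1 < g (tp s) $ 1"
  using h_sL_greater[of "tm s"] h_sR_less[of "tp s"] by simp_all

lemma tm_less_tp: "tm s < tp s"
  using tm_less_abscissa[of s] abscissa_less_tp[of s] by (metis fixed.c1_less_iff less_trans)

lemma height_le_0_between: "free.height s (g t) \<le> 0 \<longleftrightarrow> tm s \<le> t \<and> t \<le> tp s"
  unfolding height_fixed_le_0_iff by (metis sL_le_iff sL_tm sR_le_iff sR_tp)

end

context strip
begin

lemma tangent_slope_sR: "g t $ 2 - h (sR t) $ 2 = free.slope (sR t) * (g t $ 1 - h (sR t) $ 1)"
  using sR_root[of t] unfolding free.height_def by linarith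

lemma slope_sR_less: "free.slope (sR t) < fixed.slope t"
proof -
  have "0 < h (sR t) $ 2 - g t $ 2 - fixed.slope t * (h (sR t) $ 1 - g t $ 1)"
    using fixed_height_free_pos[of t "sR t"] unfolding fixed.height_def .
  also have "\<dots> = (fixed.slope t - free.slope (sR t)) * (g t $ 1 - h (sR t) $ 1)"
    unfolding left_diff_distrib tangent_slope_sR[symmetric] by (simp add: right_diff_distrib)
  finally show ?thesis using h_sR_less[of t] by (simp add: zero_less_mult_iff)
qed

text \<open>The derivative of \<open>sR\<close>, by implicit differentiation of \<open>free.height (sR t) (g t) = 0\<close>.\<close>

definition dsR :: "real \<Rightarrow> real" where
  "dsR t = dg t $ 1 * (fixed.slope t - free.slope (sR t))
     / (free.dslope (sR t) * (g t $ 1 - h (sR t) $ 1))"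

lemma dsR_pos: "dsR t > 0"
  unfolding dsR_def using fixed.dc_pos[of t] slope_sR_less[of t] free.dslope_pos h_sR_less[of t] by simp

lemma cont_sR: "continuous_on S sR"
  by (simp add: continuous_at_imp_continuous_on isCont_sR)

lemma sR_deriv: "(sR has_real_derivative dsR t) (at t)"
proof -
  let ?s = "sR t"
  define D where "D = - (free.dslope ?s * (g t $ 1 - h ?s $ 1))"
  have "((\<lambda>s. free.height s (g t)) has_real_derivative D) (at ?s)"
    unfolding free.height_def D_def using free.dc2_eq[of ?s]
    by (auto intro!: derivative_eq_intros free.deriv_nth free.slope_deriv simp: algebra_simps)
  then obtain C where C: "\<And>z. free.height z (g t) - free.height ?s (g t) = C z * (z - ?s)"
    "isCont C ?s" "C ?s = D"
    unfolding CARAT_DERIV by blast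
  have D: "D < 0" unfolding D_def using free.dslope_pos[of ?s] h_sR_less[of t] by simp
  have lim_sR: "(sR \<longlongrightarrow> ?s) (at t)" using isCont_sR by (simp add: isCont_def)
  have lim_C: "((\<lambda>u. C (sR u)) \<longlongrightarrow> D) (at t)"
    using C(2,3) isCont_sR[of t] isCont_o2[of t sR C] by (simp add: isCont_def)
  have lim_k: "((\<lambda>u. free.slope (sR u)) \<longlongrightarrow> free.slope ?s) (at t)"
    using isCont_o2[OF isCont_sR[of t] DERIV_isCont[OF free.slope_deriv]] by (simp add: isCont_def)
  have dq: "((\<lambda>u. (g u $ i - g t $ i) / (u - t)) \<longlongrightarrow> dg t $ i) (at t)" for i
    using fixed.deriv_nth[of i t] by (simp add: has_field_derivative_iff)
  have "((\<lambda>u. - ((g u $ 2 - g t $ 2) / (u - t) - free.slope (sR u) * ((g u $ 1 - g t $ 1) / (u - t))) / C (sR u))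
      \<longlongrightarrow> - (dg t $ 2 - free.slope ?s * dg t $ 1) / D) (at t)"
    by (intro tendsto_intros dq lim_k lim_C) (use D in simp)
  moreover have "\<forall>\<^sub>F u in at t. - ((g u $ 2 - g t $ 2) / (u - t) - free.slope (sR u) * ((g u $ 1 - g t $ 1) / (u - t))) / C (sR u)
      = (sR u - sR t) / (u - t)"
  proof -
    have "\<forall>\<^sub>F u in at t. C (sR u) < 0" using order_tendstoD(2)[OF lim_C D] .
    moreover have "\<forall>\<^sub>F u in at t. u \<noteq> t" by (simp add: eventually_at_filter)
    ultimately show ?thesis
    proof eventually_elim
      case (elim u)
      have "free.height (sR u) (g u) - free.height (sR u) (g t)
          = (g u $ 2 - g t $ 2) - free.slope (sR u) * (g u $ 1 - g t $ 1)"
        by (simp add: free.height_def algebra_simps)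
      then have *: "C (sR u) * (sR u - ?s) = - ((g u $ 2 - g t $ 2) - free.slope (sR u) * (g u $ 1 - g t $ 1))"
        using C(1)[of "sR u"] by simp
      have "- ((g u $ 2 - g t $ 2) / (u - t) - free.slope (sR u) * ((g u $ 1 - g t $ 1) / (u - t))) / C (sR u)
         = - ((g u $ 2 - g t $ 2) - free.slope (sR u) * (g u $ 1 - g t $ 1)) / (u - t) / C (sR u)"
        by (simp only: diff_divide_distrib times_divide_eq_right minus_divide_left minus_diff_eq
            right_diff_distrib)
      also have "\<dots> = (sR u - ?s) / (u - t)" unfolding *[symmetric] using elim(1) by simp
      finally show ?case .
    qed
  qed
  ultimately have "((\<lambda>u. (sR u - sR t) / (u - t)) \<longlongrightarrow> - (dg t $ 2 - free.slope ?s * dg t $ 1) / D) (at t)"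
    by (rule Lim_transform_eventually)
  moreover have "dg t $ 2 - free.slope ?s * dg t $ 1 = dg t $ 1 * (fixed.slope t - free.slope ?s)"
    unfolding fixed.dc2_eq by (simp add: algebra_simps)
  then have "- (dg t $ 2 - free.slope ?s * dg t $ 1) / D = dsR t"
    unfolding D_def dsR_def by (simp only: minus_divide_divide)
  ultimately show ?thesis by (simp add: has_field_derivative_iff)
qed

definition wR :: "real \<Rightarrow> real^2" where "wR t = h (sR t)"
definition wL :: "real \<Rightarrow> real^2" where "wL t = h (sL t)"

definition lamR :: "real \<Rightarrow> real" where
  "lamR t = dsR t * dh (sR t) $ 1 / (g t $ 1 - wR t $ 1)"

lemma wR_less: "wR t $ 1 < g t $ 1" and wL_greater: "g t $ 1 < wL t $ 1"
  by (simp_all add: wR_def wL_def h_sR_less h_sL_greater)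

lemma lamR_pos: "lamR t > 0"
  unfolding lamR_def using dsR_pos[of t] free.dc_pos wR_less[of t] by simp

lemma tangent_slope_eq: "g t $ 2 - wR t $ 2 = free.slope (sR t) * (g t $ 1 - wR t $ 1)"
  unfolding wR_def by (rule tangent_slope_sR)

lemma wR_deriv: "(wR has_vector_derivative lamR t *\<^sub>R (g t - wR t)) (at t)"
proof -
  have "((h \<circ> sR) has_vector_derivative dsR t *\<^sub>R dh (sR t)) (at t)"
    using sR_deriv[of t] free.deriv[of "sR t"]
    by (intro vector_diff_chain_at) (simp_all add: has_real_derivative_iff_has_vector_derivative)
  moreover have "dsR t *\<^sub>R dh (sR t) = lamR t *\<^sub>R (g t - wR t)"
  proof -
    have 1: "lamR t * (g t $ 1 - wR t $ 1) = dsR t * dh (sR t) $ 1"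
      using wR_less[of t] by (simp add: lamR_def)
    have "lamR t * (g t $ 2 - wR t $ 2) = free.slope (sR t) * (lamR t * (g t $ 1 - wR t $ 1))"
      by (simp only: tangent_slope_eq mult.left_commute)
    also have "\<dots> = dsR t * dh (sR t) $ 2"
      by (simp only: 1 free.dc2_eq mult.left_commute)
    finally show ?thesis using 1 by (simp add: vec2_eq_iff)
  qed
  ultimately have "(h \<circ> sR has_vector_derivative lamR t *\<^sub>R (g t - wR t)) (at t)"
    by (simp only:)
  moreover have "h \<circ> sR = wR" by (simp add: wR_def fun_eq_iff)
  ultimately show ?thesis by (simp only:)
qed

lemma cont_wR: "continuous_on S wR"
  by (intro continuous_at_imp_continuous_on ballI has_vector_derivative_continuous[OF wR_deriv])

lemma cont_lamR: "continuous_on S lamR"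
proof -
  have comp: "continuous_on S (\<lambda>t. \<phi> (sR t))" if "continuous_on UNIV \<phi>" for \<phi> :: "real \<Rightarrow> real"
    by (rule continuous_on_compose2[OF that cont_sR]) simp
  have c1: "continuous_on S (\<lambda>t. dh (sR t) $ 1)" by (rule comp[OF free.cont_dc_nth])
  have c2: "continuous_on S (\<lambda>t. free.slope (sR t))" by (rule comp[OF free.cont_slope])
  have c3: "continuous_on S (\<lambda>t. free.dslope (sR t))" by (rule comp[OF free.cont_dslope])
  have c4: "continuous_on S (\<lambda>t. g t $ 1 - wR t $ 1)"
    by (intro continuous_intros fixed.cont_c cont_wR)
  have "g t $ 1 - wR t $ 1 \<noteq> 0" "free.dslope (sR t) \<noteq> 0" for t
    using wR_less[of t] free.dslope_pos[of "sR t"] by simp_all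
  then show ?thesis
    unfolding lamR_def[abs_def] dsR_def[abs_def] wR_def[symmetric]
    by (intro continuous_on_divide continuous_on_mult continuous_on_diff c1 c2 c3 c4
        fixed.cont_dc_nth fixed.cont_slope) auto
qed

end

section \<open>Optimizers as distributions along the fixed boundary\<close>

context strip
begin

text \<open>A test function is written as \<open>g \<circ> \<alpha>\<close> on an interval \<open>[0, T]\<close>. Whether an average
  stays off the open set above the free boundary is certified by a tangent line that it does not
  exceed; for unnormalized integrals over an interval of length \<open>L\<close> the height above the
  tangent line becomes the following excess.\<close>

definition excess :: "real \<Rightarrow> real^2 \<Rightarrow> real \<Rightarrow> real" where
  "excess s I L = I $ 2 - free.slope s * I $ 1 - L * (h s $ 2 - free.slope s * h s $ 1)"

lemma excess_scaled: "excess s (L *\<^sub>R y) L = L * free.height s y"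
  by (simp add: excess_def free.height_def algebra_simps)

lemma excess_add: "excess s (I + J) (L + M) = excess s I L + excess s J M"
  by (simp add: excess_def algebra_simps)

lemma excess_diff: "excess s (I - J) (L - M) = excess s I L - excess s J M"
  by (simp add: excess_def algebra_simps)

lemma excess_scaleR: "excess s (r *\<^sub>R I) (r * L) = r * excess s I L"
  by (simp add: excess_def algebra_simps)

lemma excess_0 [simp]: "excess s 0 0 = 0"
  by (simp add: excess_def)

definition mom :: "(real \<Rightarrow> real) \<Rightarrow> real \<Rightarrow> real^2" where
  "mom \<alpha> p = integral {0..p} (\<lambda>x. g (\<alpha> x))"

lemma mom_0 [simp]: "mom \<alpha> 0 = 0"
  by (simp add: mom_def)

definition averages_below :: "(real \<Rightarrow> real) \<Rightarrow> real \<Rightarrow> bool" where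
  "averages_below \<alpha> T \<longleftrightarrow> (\<forall>p q. 0 \<le> p \<and> p < q \<and> q \<le> T \<longrightarrow>
     (\<exists>s. excess s (mom \<alpha> q - mom \<alpha> p) (q - p) \<le> 0))"

definition opt :: "(real \<Rightarrow> real) \<Rightarrow> (real \<Rightarrow> real) \<Rightarrow> real \<Rightarrow> real^2 \<Rightarrow> real \<Rightarrow> bool" where
  "opt f \<alpha> T y v \<longleftrightarrow> 0 < T \<and> (\<lambda>x. g (\<alpha> x)) absolutely_integrable_on {0..T} \<and>
     (\<lambda>x. f (\<alpha> x)) absolutely_integrable_on {0..T} \<and>
     mom \<alpha> T = T *\<^sub>R y \<and> integral {0..T} (\<lambda>x. f (\<alpha> x)) = T * v \<and> averages_below \<alpha> T"

text \<open>Averages over initial intervals stay to the upper left of the final average, as seen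
  along the direction of the tangent line at \<open>s\<close>. This is what allows to continue the function
  by larger values of \<open>\<alpha>\<close> without creating averages above the free boundary.\<close>

definition leans :: "real \<Rightarrow> (real \<Rightarrow> real) \<Rightarrow> real \<Rightarrow> real^2 \<Rightarrow> bool" where
  "leans s \<alpha> T y \<longleftrightarrow> (\<forall>p. 0 \<le> p \<and> p \<le> T \<longrightarrow>
     mom \<alpha> p $ 1 \<le> p * y $ 1 \<and> p * free.height s y \<le> excess s (mom \<alpha> p) p)"

text \<open>An optimizer at \<open>y\<close> with value \<open>v\<close> that can be continued to the right.\<close>

definition left_opt :: "(real \<Rightarrow> real) \<Rightarrow> real \<Rightarrow> real^2 \<Rightarrow> real \<Rightarrow> bool" where
  "left_opt f s y v \<longleftrightarrow> (\<exists>\<alpha> T. opt f \<alpha> T y v \<and> leans s \<alpha> T y)"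

text \<open>A larger \<open>s\<close> means a steeper tangent line, above which the initial averages, lying further left, rise
  more than \<open>y\<close>.\<close>

lemma leans_mono:
  assumes "leans s \<alpha> T y" "s \<le> s'"
  shows "leans s' \<alpha> T y"
  unfolding leans_def
proof (intro allI impI conjI)
  fix p assume p: "0 \<le> p \<and> p \<le> T"
  then have *: "mom \<alpha> p $ 1 \<le> p * y $ 1" "p * free.height s y \<le> excess s (mom \<alpha> p) p"
    using assms(1) by (auto simp: leans_def)
  then show "mom \<alpha> p $ 1 \<le> p * y $ 1" by simp
  have "excess s' (mom \<alpha> p) p - p * free.height s' y
      = excess s (mom \<alpha> p) p - p * free.height s y
        + (free.slope s' - free.slope s) * (p * y $ 1 - mom \<alpha> p $ 1)"
    by (simp add: excess_def free.height_def algebra_simps)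
  moreover have "(free.slope s' - free.slope s) * (p * y $ 1 - mom \<alpha> p $ 1) \<ge> 0"
    using * assms(2) by (intro mult_nonneg_nonneg) simp_all
  ultimately show "p * free.height s' y \<le> excess s' (mom \<alpha> p) p" using * by linarith
qed

lemma left_opt_mono: "left_opt f s y v \<Longrightarrow> s \<le> s' \<Longrightarrow> left_opt f s' y v"
  unfolding left_opt_def using leans_mono by blast

lemma mom_rescale:
  assumes "(\<lambda>x. g (\<alpha> x)) absolutely_integrable_on {0..T}" "0 < m" "0 \<le> p" "m * p \<le> T"
  shows "mom (\<lambda>x. \<alpha> (m * x)) p = (1 / m) *\<^sub>R mom \<alpha> (m * p)"
proof -
  have "(\<lambda>x. g (\<alpha> x)) absolutely_integrable_on {0..m * p}"
    by (rule absolutely_integrable_on_subinterval[OF assms(1)]) (use assms in auto)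
  then have "(\<lambda>x. g (\<alpha> x)) integrable_on {0..m * p}" by (simp add: absolutely_integrable_on_def)
  from integral_affine_real[OF this \<open>0 < m\<close>, of 0] show ?thesis
    using \<open>0 < m\<close> by (simp add: mom_def)
qed

lemma opt_rescale:
  assumes "opt f \<alpha> T y v" "0 < T'"
  defines "\<beta> \<equiv> \<lambda>x. \<alpha> (T / T' * x)"
  shows "opt f \<beta> T' y v" and "leans s \<alpha> T y \<Longrightarrow> leans s \<beta> T' y"
    and "0 \<le> p \<Longrightarrow> p \<le> T' \<Longrightarrow> mom \<beta> p = (T' / T) *\<^sub>R mom \<alpha> (T / T' * p)"
proof -
  have T: "0 < T" and gi: "(\<lambda>x. g (\<alpha> x)) absolutely_integrable_on {0..T}"
    and fi: "(\<lambda>x. f (\<alpha> x)) absolutely_integrable_on {0..T}"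
    and my: "mom \<alpha> T = T *\<^sub>R y" and fv: "integral {0..T} (\<lambda>x. f (\<alpha> x)) = T * v"
    and ab: "averages_below \<alpha> T"
    using assms(1) by (auto simp: opt_def)
  define m where "m = T / T'"
  have m: "0 < m" "m * T' = T" "T / m = T'" using T \<open>0 < T'\<close> by (simp_all add: m_def)
  have mle: "m * p \<le> T" if "p \<le> T'" for p using that m by (metis mult_le_cancel_left_pos)
  have mom: "mom \<beta> p = (1 / m) *\<^sub>R mom \<alpha> (m * p)" if "0 \<le> p" "p \<le> T'" for p
    unfolding \<beta>_def m_def[symmetric] using mom_rescale[OF gi m(1) that(1) mle[OF that(2)]] .
  then show "mom \<beta> p = (T' / T) *\<^sub>R mom \<alpha> (T / T' * p)" if "0 \<le> p" "p \<le> T'"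
    using that by (simp add: m_def)
  show "opt f \<beta> T' y v"
    unfolding opt_def
  proof (intro conjI)
    show "(\<lambda>x. g (\<beta> x)) absolutely_integrable_on {0..T'}"
      using absolutely_integrable_affine[OF gi m(1), of 0] m
      by (simp add: \<beta>_def m_def[symmetric])
    show "(\<lambda>x. f (\<beta> x)) absolutely_integrable_on {0..T'}"
      using absolutely_integrable_affine[OF fi m(1), of 0] m
      by (simp add: \<beta>_def m_def[symmetric])
    show "mom \<beta> T' = T' *\<^sub>R y" using mom[of T'] \<open>0 < T'\<close> m my by (simp add: m_def)
    have "integral {0..T / m} (\<lambda>x. f (\<alpha> (m * x))) = (1 / m) * integral {0..T} (\<lambda>x. f (\<alpha> x))"
      using integral_affine_real[of "\<lambda>x. f (\<alpha> x)" 0 T m 0] fi m(1)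
      by (simp add: absolutely_integrable_on_def)
    then show "integral {0..T'} (\<lambda>x. f (\<beta> x)) = T' * v"
      using fv by (simp add: \<beta>_def m_def[symmetric] m(3)) (simp flip: m(3))
    show "averages_below \<beta> T'"
      unfolding averages_below_def
    proof (intro allI impI)
      fix p q assume pq: "0 \<le> p \<and> p < q \<and> q \<le> T'"
      then have "0 \<le> m * p \<and> m * p < m * q \<and> m * q \<le> T" using m mle by simp
      then obtain s where s: "excess s (mom \<alpha> (m * q) - mom \<alpha> (m * p)) (m * q - m * p) \<le> 0"
        using ab unfolding averages_below_def by blast
      have "excess s (mom \<beta> q - mom \<beta> p) (q - p)
          = excess s ((1 / m) *\<^sub>R (mom \<alpha> (m * q) - mom \<alpha> (m * p))) ((1 / m) * (m * q - m * p))"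
      proof -
        have "q - p = (1 / m) * (m * q - m * p)"
          using m by (simp flip: right_diff_distrib)
        then show ?thesis using pq by (simp only: mom scaleR_diff_right) (simp add: mom)
      qed
      also have "\<dots> = (1 / m) * excess s (mom \<alpha> (m * q) - mom \<alpha> (m * p)) (m * q - m * p)"
        by (rule excess_scaleR)
      also have "\<dots> \<le> 0" by (rule mult_nonneg_nonpos) (use s m in simp_all)
      finally show "\<exists>s. excess s (mom \<beta> q - mom \<beta> p) (q - p) \<le> 0" by blast
    qed
  qed (use \<open>0 < T'\<close> in simp)
  show "leans s \<beta> T' y" if l: "leans s \<alpha> T y"
    unfolding leans_def
  proof (intro allI impI)
    fix p assume p: "0 \<le> p \<and> p \<le> T'"
    then have "0 \<le> m * p" "m * p \<le> T" using m mle by auto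
    then have *: "mom \<alpha> (m * p) $ 1 \<le> m * p * y $ 1"
      "m * p * free.height s y \<le> excess s (mom \<alpha> (m * p)) (m * p)"
      using l by (auto simp: leans_def)
    have "excess s (mom \<beta> p) p = (1 / m) * excess s (mom \<alpha> (m * p)) (m * p)"
      using excess_scaleR[of s "1 / m" "mom \<alpha> (m * p)" "m * p"] p m mom by simp
    then have "m * (p * free.height s y) \<le> m * excess s (mom \<beta> p) p"
      using * m by (simp add: mult.assoc)
    then have "p * free.height s y \<le> excess s (mom \<beta> p) p" using m by simp
    moreover have "mom \<beta> p $ 1 \<le> p * y $ 1"
      using * p m by (simp add: mom field_simps)
    ultimately show "mom \<beta> p $ 1 \<le> p * y $ 1 \<and> p * free.height s y \<le> excess s (mom \<beta> p) p"
      by blast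
  qed
qed

lemma opt_const:
  assumes "0 < T"
  shows "opt f (\<lambda>_. c) T (g c) (f c)" and "leans s (\<lambda>_. c) T (g c)"
proof -
  have mom: "mom (\<lambda>_. c) p = p *\<^sub>R g c" if "0 \<le> p" for p using that by (simp add: mom_def)
  have "averages_below (\<lambda>_. c) T"
    unfolding averages_below_def
  proof (intro allI impI exI)
    fix p q :: real assume "0 \<le> p \<and> p < q \<and> q \<le> T"
    then have "mom (\<lambda>_. c) q - mom (\<lambda>_. c) p = (q - p) *\<^sub>R g c" by (simp add: mom algebra_simps)
    then show "excess (sR c) (mom (\<lambda>_. c) q - mom (\<lambda>_. c) p) (q - p) \<le> 0"
      by (simp add: excess_scaled)
  qed
  then show "opt f (\<lambda>_. c) T (g c) (f c)" using assms by (simp add: opt_def mom)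
  show "leans s (\<lambda>_. c) T (g c)" by (simp add: leans_def mom excess_scaled)
qed

lemma left_opt_const: "left_opt f s (g c) (f c)"
  unfolding left_opt_def using opt_const[of 1] by (metis zero_less_one)

lemma mom_joined:
  assumes "opt f \<alpha> T y v" "opt f \<beta> T' z v'"
  shows "p \<le> T \<Longrightarrow> mom (joined T \<alpha> \<beta>) p = mom \<alpha> p"
    and "T \<le> q \<Longrightarrow> q \<le> T + T' \<Longrightarrow> mom (joined T \<alpha> \<beta>) q = T *\<^sub>R y + mom \<beta> (q - T)"
  using assms integral_joined_right[where \<psi>=g and \<alpha>=\<alpha> and T=T and \<beta>=\<beta> and T'=T' and q=q]
  by (auto simp: opt_def mom_def integral_joined_left)

text \<open>Averages over intervals in one of the two parts are under control already; the hypothesis concerns the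
  intervals that contain the junction.\<close>

lemma opt_joined:
  assumes \<alpha>: "opt f \<alpha> T y v" and \<beta>: "opt f \<beta> T' z v'"
    and cross: "\<And>p q. 0 \<le> p \<Longrightarrow> p < T \<Longrightarrow> T < q \<Longrightarrow> q \<le> T + T' \<Longrightarrow>
      \<exists>s. excess s (T *\<^sub>R y - mom \<alpha> p) (T - p) + excess s (mom \<beta> (q - T)) (q - T) \<le> 0"
    and u: "T *\<^sub>R y + T' *\<^sub>R z = (T + T') *\<^sub>R u" "T * v + T' * v' = (T + T') * w"
  shows "opt f (joined T \<alpha> \<beta>) (T + T') u w"
proof -
  note a = \<alpha>[unfolded opt_def] and b = \<beta>[unfolded opt_def]
  note mom = mom_joined[OF \<alpha> \<beta>]
  have T: "0 < T" "0 < T'" using a b by auto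
  show ?thesis
    unfolding opt_def
  proof (intro conjI)
    show "(\<lambda>x. g (joined T \<alpha> \<beta> x)) absolutely_integrable_on {0..T + T'}"
      using a b by (intro absolutely_integrable_joined) auto
    show "(\<lambda>x. f (joined T \<alpha> \<beta> x)) absolutely_integrable_on {0..T + T'}"
      using a b by (intro absolutely_integrable_joined) auto
    show "mom (joined T \<alpha> \<beta>) (T + T') = (T + T') *\<^sub>R u"
      using mom(2)[of "T + T'"] T b u by simp
    show "integral {0..T + T'} (\<lambda>x. f (joined T \<alpha> \<beta> x)) = (T + T') * w"
      using a b u T by (subst integral_joined_right) auto
    show "averages_below (joined T \<alpha> \<beta>) (T + T')"
      unfolding averages_below_def
    proof (intro allI impI)
      fix p q assume pq: "0 \<le> p \<and> p < q \<and> q \<le> T + T'"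
      consider "q \<le> T" | "T \<le> p" | "p < T" "T < q" by linarith
      then show "\<exists>s. excess s (mom (joined T \<alpha> \<beta>) q - mom (joined T \<alpha> \<beta>) p) (q - p) \<le> 0"
      proof cases
        case 1
        then show ?thesis using a pq by (auto simp: mom averages_below_def)
      next
        case 2
        then obtain s where "excess s (mom \<beta> (q - T) - mom \<beta> (p - T)) ((q - T) - (p - T)) \<le> 0"
          using b[THEN conjunct2, THEN conjunct2, THEN conjunct2, THEN conjunct2, THEN conjunct2,
              unfolded averages_below_def, rule_format, of "p - T" "q - T"] pq by auto
        then show ?thesis using 2 pq by (intro exI[of _ s]) (simp add: mom)
      next
        case 3
        then obtain s where "excess s (T *\<^sub>R y - mom \<alpha> p) (T - p) + excess s (mom \<beta> (q - T)) (q - T) \<le> 0"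
          using cross pq by blast
        moreover have "mom (joined T \<alpha> \<beta>) q - mom (joined T \<alpha> \<beta>) p
            = (T *\<^sub>R y - mom \<alpha> p) + mom \<beta> (q - T)"
          using 3 pq by (simp add: mom)
        moreover have "q - p = (T - p) + (q - T)" by simp
        ultimately show ?thesis by (metis excess_add)
      qed
    qed
  qed (use T in simp)
qed

lemma left_opt_append_const:
  assumes \<alpha>: "opt f \<alpha> (1 - \<theta>) y v" "leans s \<alpha> (1 - \<theta>) y"
    and hc: "free.height s (g c) \<le> free.height s y" and yc: "y $ 1 \<le> g c $ 1"
    and \<theta>: "0 < \<theta>" "\<theta> < 1"
    and cross: "\<And>p. 0 \<le> p \<Longrightarrow> p < 1 - \<theta> \<Longrightarrow>
      \<exists>s'. excess s' ((1 - \<theta>) *\<^sub>R y - mom \<alpha> p) (1 - \<theta> - p) \<le> 0 \<and> free.height s' (g c) \<le> 0"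
  shows "left_opt f s ((1 - \<theta>) *\<^sub>R y + \<theta> *\<^sub>R g c) ((1 - \<theta>) * v + \<theta> * f c)"
proof -
  let ?u = "(1 - \<theta>) *\<^sub>R y + \<theta> *\<^sub>R g c" and ?\<gamma> = "joined (1 - \<theta>) \<alpha> (\<lambda>_. c)"
  note c = opt_const(1)[OF \<theta>(1), of f c]
  have momc: "mom (\<lambda>_. c) p = p *\<^sub>R g c" if "0 \<le> p" for p using that by (simp add: mom_def)
  have lean: "p * free.height s y \<le> excess s (mom \<alpha> p) p" "mom \<alpha> p $ 1 \<le> p * y $ 1"
    if "0 \<le> p" "p \<le> 1 - \<theta>" for p
    using \<alpha>(2) that by (auto simp: leans_def)
  have "opt f ?\<gamma> (1 - \<theta> + \<theta>) ?u ((1 - \<theta>) * v + \<theta> * f c)"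
  proof (rule opt_joined[OF \<alpha>(1) c])
    fix p q assume pq: "0 \<le> p" "p < 1 - \<theta>" "1 - \<theta> < q" "q \<le> 1 - \<theta> + \<theta>"
    obtain s' where s': "excess s' ((1 - \<theta>) *\<^sub>R y - mom \<alpha> p) (1 - \<theta> - p) \<le> 0"
      "free.height s' (g c) \<le> 0"
      using cross pq by blast
    have "excess s' (mom (\<lambda>_. c) (q - (1 - \<theta>))) (q - (1 - \<theta>)) \<le> 0"
      using s' pq by (simp add: momc excess_scaled mult_le_0_iff)
    with s' show "\<exists>s. excess s ((1 - \<theta>) *\<^sub>R y - mom \<alpha> p) (1 - \<theta> - p)
        + excess s (mom (\<lambda>_. c) (q - (1 - \<theta>))) (q - (1 - \<theta>)) \<le> 0"
      by (intro exI[of _ s']) linarith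
  qed simp_all
  moreover have "leans s ?\<gamma> 1 ?u"
    unfolding leans_def
  proof (intro allI impI)
    fix p :: real assume p: "0 \<le> p \<and> p \<le> 1"
    let ?m = "mom ?\<gamma> p"
    have hu: "free.height s ?u = (1 - \<theta>) * free.height s y + \<theta> * free.height s (g c)"
      by (rule free.height_affine)
    show "?m $ 1 \<le> p * ?u $ 1 \<and> p * free.height s ?u \<le> excess s ?m p"
    proof (cases "p \<le> 1 - \<theta>")
      case True
      have "y $ 1 \<le> ?u $ 1"
        using mult_left_mono[OF yc, of \<theta>] \<theta> by (simp add: algebra_simps)
      then have "p * y $ 1 \<le> p * ?u $ 1" using p by (simp add: mult_left_mono)
      moreover have "free.height s ?u \<le> free.height s y"
        using mult_left_mono[OF hc, of \<theta>] \<theta> unfolding hu by (simp add: algebra_simps)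
      then have "p * free.height s ?u \<le> p * free.height s y" using p by (simp add: mult_left_mono)
      ultimately show ?thesis
        using True lean[of p] p by (auto simp: mom_joined[OF \<alpha>(1) c] simp del: vector_add_component)
    next
      case False
      let ?r = "(1 - \<theta>) * (1 - p)"
      have r: "0 \<le> ?r" using p \<theta> by simp
      have m: "?m = (1 - \<theta>) *\<^sub>R y + (p - (1 - \<theta>)) *\<^sub>R g c"
        using False p by (simp add: mom_joined[OF \<alpha>(1) c] momc)
      have "p * ?u $ 1 - ?m $ 1 = ?r * (g c $ 1 - y $ 1)"
        unfolding m by (simp add: algebra_simps)
      then have "?m $ 1 \<le> p * ?u $ 1" using mult_nonneg_nonneg[OF r, of "g c $ 1 - y $ 1"] yc by linarith
      moreover have "excess s ?m p = (1 - \<theta>) * free.height s y + (p - (1 - \<theta>)) * free.height s (g c)"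
        unfolding m using excess_add[of s "(1 - \<theta>) *\<^sub>R y" "(p - (1 - \<theta>)) *\<^sub>R g c" "1 - \<theta>" "p - (1 - \<theta>)"]
        by (simp add: excess_scaled)
      then have "excess s ?m p - p * free.height s ?u = ?r * (free.height s y - free.height s (g c))"
        unfolding hu by (simp add: algebra_simps)
      then have "p * free.height s ?u \<le> excess s ?m p"
        using mult_nonneg_nonneg[OF r, of "free.height s y - free.height s (g c)"] hc by linarith
      ultimately show ?thesis by blast
    qed
  qed
  ultimately show ?thesis unfolding left_opt_def by (intro exI[of _ ?\<gamma>] exI[of _ 1]) simp
qed

text \<open>Cutting off an initial interval leaves an average that is at most as high over the tangent line at \<open>s\<close>
  as \<open>y\<close>, hence not above it, and neither is \<open>g c\<close>. So this tangent line serves for all intervals across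
  the junction.\<close>

lemma left_opt_append:
  assumes y: "left_opt f s y v" and hc: "free.height s (g c) \<le> free.height s y"
    and hy: "free.height s y \<le> 0" and yc: "y $ 1 \<le> g c $ 1" and \<theta>: "0 \<le> \<theta>" "\<theta> \<le> 1"
  shows "left_opt f s ((1 - \<theta>) *\<^sub>R y + \<theta> *\<^sub>R g c) ((1 - \<theta>) * v + \<theta> * f c)"
proof -
  consider "\<theta> = 0" | "\<theta> = 1" | "0 < \<theta>" "\<theta> < 1" using \<theta> by linarith
  then show ?thesis
  proof cases
    case 3
    obtain \<alpha>0 T0 where "opt f \<alpha>0 T0 y v" "leans s \<alpha>0 T0 y" using y unfolding left_opt_def by blast
    from opt_rescale[OF this(1), of "1 - \<theta>"] this(2) 3
    obtain \<alpha> where \<alpha>: "opt f \<alpha> (1 - \<theta>) y v" "leans s \<alpha> (1 - \<theta>) y" by auto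
    show ?thesis
    proof (rule left_opt_append_const[OF \<alpha> hc yc 3])
      fix p assume p: "0 \<le> p" "p < 1 - \<theta>"
      have "excess s ((1 - \<theta>) *\<^sub>R y - mom \<alpha> p) (1 - \<theta> - p)
          = (1 - \<theta>) * free.height s y - excess s (mom \<alpha> p) p"
        by (simp add: excess_diff excess_scaled)
      also have "\<dots> \<le> (1 - \<theta> - p) * free.height s y"
        using \<alpha>(2) p by (auto simp: leans_def algebra_simps)
      also have "\<dots> \<le> 0" using hy p by (simp add: mult_le_0_iff)
      finally show "\<exists>s'. excess s' ((1 - \<theta>) *\<^sub>R y - mom \<alpha> p) (1 - \<theta> - p) \<le> 0 \<and> free.height s' (g c) \<le> 0"
        using hc hy by (intro exI[of _ s]) auto
    qed
  qed (use y left_opt_const in simp_all)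
qed

text \<open>A chord lies in the strip iff its endpoints lie below one and the same tangent line of the
  free boundary.\<close>

definition chord_in_strip :: "real \<Rightarrow> real \<Rightarrow> bool" where
  "chord_in_strip a c \<longleftrightarrow> (\<exists>s. free.height s (g a) \<le> 0 \<and> free.height s (g c) \<le> 0)"

text \<open>Across the junction all averages lie on the chord.\<close>

lemma left_opt_chord:
  assumes ac: "chord_in_strip a c" "a \<le> c" and hc: "free.height s (g c) \<le> free.height s (g a)"
    and \<theta>: "0 \<le> \<theta>" "\<theta> \<le> 1"
  shows "left_opt f s ((1 - \<theta>) *\<^sub>R g a + \<theta> *\<^sub>R g c) ((1 - \<theta>) * f a + \<theta> * f c)"
proof -
  consider "\<theta> = 0" | "\<theta> = 1" | "0 < \<theta>" "\<theta> < 1" using \<theta> by linarith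
  then show ?thesis
  proof cases
    case 3
    then have pos: "0 < 1 - \<theta>" by simp
    obtain s' where s': "free.height s' (g a) \<le> 0" "free.height s' (g c) \<le> 0"
      using ac by (auto simp: chord_in_strip_def)
    show ?thesis
    proof (rule left_opt_append_const[OF opt_const[OF pos] hc _ 3])
      fix p assume p: "0 \<le> p" "p < 1 - \<theta>"
      have "(1 - \<theta>) *\<^sub>R g a - mom (\<lambda>_. a) p = (1 - \<theta> - p) *\<^sub>R g a"
        using p by (simp add: mom_def algebra_simps)
      then have "excess s' ((1 - \<theta>) *\<^sub>R g a - mom (\<lambda>_. a) p) (1 - \<theta> - p) = (1 - \<theta> - p) * free.height s' (g a)"
        by (simp add: excess_scaled)
      also have "\<dots> \<le> 0" using s' p by (simp add: mult_le_0_iff)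
      finally show "\<exists>s'. excess s' ((1 - \<theta>) *\<^sub>R g a - mom (\<lambda>_. a) p) (1 - \<theta> - p) \<le> 0
          \<and> free.height s' (g c) \<le> 0"
        using s' by blast
    qed (use ac in simp)
  qed (use left_opt_const in simp_all)
qed

text \<open>Functions all of whose averages lie below one and the same tangent line can be joined freely.\<close>

definition flat_opt :: "(real \<Rightarrow> real) \<Rightarrow> real \<Rightarrow> real^2 \<Rightarrow> real \<Rightarrow> bool" where
  "flat_opt f s y v \<longleftrightarrow> (\<exists>\<alpha> T. opt f \<alpha> T y v \<and>
     (\<forall>p q. 0 \<le> p \<and> p \<le> q \<and> q \<le> T \<longrightarrow> excess s (mom \<alpha> q - mom \<alpha> p) (q - p) \<le> 0))"

lemma flat_opt_const:
  assumes "free.height s (g c) \<le> 0"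
  shows "flat_opt f s (g c) (f c)"
  unfolding flat_opt_def
proof (intro exI conjI allI impI)
  show "opt f (\<lambda>_. c) 1 (g c) (f c)" by (rule opt_const) simp
  fix p q :: real assume pq: "0 \<le> p \<and> p \<le> q \<and> q \<le> 1"
  then have "mom (\<lambda>_. c) q - mom (\<lambda>_. c) p = (q - p) *\<^sub>R g c" by (simp add: mom_def algebra_simps)
  then show "excess s (mom (\<lambda>_. c) q - mom (\<lambda>_. c) p) (q - p) \<le> 0"
    using assms pq by (simp add: excess_scaled mult_le_0_iff)
qed

lemma flat_opt_combine:
  assumes y: "flat_opt f s y v" and z: "flat_opt f s z v'" and \<theta>: "0 \<le> \<theta>" "\<theta> \<le> 1"
  shows "flat_opt f s ((1 - \<theta>) *\<^sub>R y + \<theta> *\<^sub>R z) ((1 - \<theta>) * v + \<theta> * v')"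
proof -
  have rescale: "\<exists>\<alpha>. opt f \<alpha> T y v \<and>
     (\<forall>p q. 0 \<le> p \<and> p \<le> q \<and> q \<le> T \<longrightarrow> excess s (mom \<alpha> q - mom \<alpha> p) (q - p) \<le> 0)"
    if yv: "flat_opt f s y v" and T: "0 < T" for y v T
  proof -
    obtain \<alpha> T0 where \<alpha>: "opt f \<alpha> T0 y v"
      "\<And>p q. 0 \<le> p \<and> p \<le> q \<and> q \<le> T0 \<Longrightarrow> excess s (mom \<alpha> q - mom \<alpha> p) (q - p) \<le> 0"
      using yv unfolding flat_opt_def by blast
    have T0: "0 < T0" using \<alpha>(1) by (simp add: opt_def)
    let ?\<beta> = "\<lambda>x. \<alpha> (T0 / T * x)"
    show ?thesis
    proof (intro exI conjI allI impI)
      show "opt f ?\<beta> T y v" by (rule opt_rescale(1)[OF \<alpha>(1) T])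
      fix p q assume pq: "0 \<le> p \<and> p \<le> q \<and> q \<le> T"
      have "T0 / T * q \<le> T0 / T * T" using T T0 pq by (intro mult_left_mono) auto
      then have "0 \<le> T0 / T * p \<and> T0 / T * p \<le> T0 / T * q \<and> T0 / T * q \<le> T0"
        using pq T T0 by (simp add: divide_right_mono)
      note ex = \<alpha>(2)[OF this]
      have "mom ?\<beta> r = (T / T0) *\<^sub>R mom \<alpha> (T0 / T * r)" if "0 \<le> r" "r \<le> T" for r
        using opt_rescale(3)[OF \<alpha>(1) T that] .
      then have "mom ?\<beta> q - mom ?\<beta> p = (T / T0) *\<^sub>R (mom \<alpha> (T0 / T * q) - mom \<alpha> (T0 / T * p))"
        using pq by (simp only: scaleR_diff_right order_trans[of 0 p q] order_trans[of p q T])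
      moreover have "q - p = (T / T0) * (T0 / T * q - T0 / T * p)"
        using T T0 by (simp add: field_simps)
      ultimately have "excess s (mom ?\<beta> q - mom ?\<beta> p) (q - p)
        = excess s ((T / T0) *\<^sub>R (mom \<alpha> (T0 / T * q) - mom \<alpha> (T0 / T * p))) ((T / T0) * (T0 / T * q - T0 / T * p))"
        by (simp only:)
      also have "\<dots> = (T / T0) * excess s (mom \<alpha> (T0 / T * q) - mom \<alpha> (T0 / T * p)) (T0 / T * q - T0 / T * p)"
        by (rule excess_scaleR)
      also have "\<dots> \<le> 0" by (rule mult_nonneg_nonpos) (use ex T T0 in simp_all)
      finally show "excess s (mom ?\<beta> q - mom ?\<beta> p) (q - p) \<le> 0" .
    qed
  qed
  consider "\<theta> = 0" | "\<theta> = 1" | "0 < \<theta>" "\<theta> < 1" using \<theta> by linarith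
  then show ?thesis
  proof cases
    case 3
    obtain \<alpha> where \<alpha>: "opt f \<alpha> (1 - \<theta>) y v"
      "\<And>p q. 0 \<le> p \<Longrightarrow> p \<le> q \<Longrightarrow> q \<le> 1 - \<theta> \<Longrightarrow> excess s (mom \<alpha> q - mom \<alpha> p) (q - p) \<le> 0"
      using rescale[OF y, of "1 - \<theta>"] 3 by auto
    obtain \<beta> where \<beta>: "opt f \<beta> \<theta> z v'"
      "\<And>p q. 0 \<le> p \<Longrightarrow> p \<le> q \<Longrightarrow> q \<le> \<theta> \<Longrightarrow> excess s (mom \<beta> q - mom \<beta> p) (q - p) \<le> 0"
      using rescale[OF z, of "\<theta>"] 3 by auto
    note mom = mom_joined[OF \<alpha>(1) \<beta>(1)]
    have m\<alpha>: "mom \<alpha> (1 - \<theta>) = (1 - \<theta>) *\<^sub>R y" using \<alpha>(1) by (simp add: opt_def)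
    have cross: "excess s ((1 - \<theta>) *\<^sub>R y - mom \<alpha> p) (1 - \<theta> - p) + excess s (mom \<beta> (q - (1 - \<theta>))) (q - (1 - \<theta>)) \<le> 0"
      if "0 \<le> p" "p \<le> 1 - \<theta>" "1 - \<theta> \<le> q" "q \<le> 1" for p q
      using \<alpha>(2)[of p "1 - \<theta>"] \<beta>(2)[of 0 "q - (1 - \<theta>)"] that by (simp add: m\<alpha>)
    have "opt f (joined (1 - \<theta>) \<alpha> \<beta>) (1 - \<theta> + \<theta>) ((1 - \<theta>) *\<^sub>R y + \<theta> *\<^sub>R z) ((1 - \<theta>) * v + \<theta> * v')"
      by (rule opt_joined[OF \<alpha>(1) \<beta>(1)]) (use cross in \<open>auto intro!: exI[of _ s]\<close>)
    moreover have "excess s (mom (joined (1 - \<theta>) \<alpha> \<beta>) q - mom (joined (1 - \<theta>) \<alpha> \<beta>) p) (q - p) \<le> 0"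
      if pq: "0 \<le> p" "p \<le> q" "q \<le> 1" for p q
    proof -
      consider "q \<le> 1 - \<theta>" | "1 - \<theta> \<le> p" | "p \<le> 1 - \<theta>" "1 - \<theta> \<le> q" by linarith
      then show ?thesis
      proof cases
        case 1
        then show ?thesis using \<alpha>(2) pq by (simp add: mom)
      next
        case 2
        then show ?thesis using \<beta>(2)[of "p - (1 - \<theta>)" "q - (1 - \<theta>)"] pq by (simp add: mom)
      next
        case 3
        have "excess s (((1 - \<theta>) *\<^sub>R y - mom \<alpha> p) + mom \<beta> (q - (1 - \<theta>))) ((1 - \<theta> - p) + (q - (1 - \<theta>))) \<le> 0"
          unfolding excess_add using cross 3 pq by simp
        then show ?thesis using 3 pq by (simp add: mom algebra_simps)
      qed
    qed
    ultimately show ?thesis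
      unfolding flat_opt_def by (intro exI[of _ "joined (1 - \<theta>) \<alpha> \<beta>"] exI[of _ 1]) auto
  qed (use y z in simp_all)
qed

lemma flat_opt_imp_opt: "flat_opt f s y v \<Longrightarrow> \<exists>\<alpha> T. opt f \<alpha> T y v"
  unfolding flat_opt_def by blast

end

section \<open>Change of the time variable\<close>

text \<open>Along a tangent fan the averages of an optimizer run along the free boundary; the time at which
  they pass the point of tangency for \<open>t\<close> is an increasing function \<open>\<tau>\<close>, and the
  optimizer is its inverse.\<close>

locale clock =
  fixes \<tau> \<tau>' v :: "real \<Rightarrow> real"
  assumes \<tau>_deriv: "(\<tau> has_real_derivative \<tau>' t) (at t)"
    and \<tau>_pos: "\<tau> t > 0" and \<tau>'_pos: "\<tau>' t > 0"
    and v_\<tau> [simp]: "v (\<tau> t) = t"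
begin

lemma \<tau>_less: "a < b \<Longrightarrow> \<tau> a < \<tau> b"
  using DERIV_pos_imp_increasing[of a b \<tau>] \<tau>_deriv \<tau>'_pos by blast

lemma \<tau>_less_iff [simp]: "\<tau> a < \<tau> b \<longleftrightarrow> a < b"
  by (metis \<tau>_less less_asym linorder_neqE)

lemma \<tau>_le_iff [simp]: "\<tau> a \<le> \<tau> b \<longleftrightarrow> a \<le> b"
  by (simp flip: not_less)

lemma cont_\<tau>: "continuous_on S \<tau>"
  by (intro continuous_at_imp_continuous_on ballI DERIV_isCont[OF \<tau>_deriv])

lemma \<tau>_attains:
  assumes "\<tau> a \<le> x" "x \<le> \<tau> b"
  obtains t where "a \<le> t" "t \<le> b" "\<tau> t = x"
proof -
  have "\<tau> a \<le> \<tau> b" using assms by linarith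
  then show ?thesis using IVT'[of \<tau> a x b] assms cont_\<tau> that by auto
qed

lemma \<tau>_image: "a \<le> b \<Longrightarrow> \<tau> ` {a..b} = {\<tau> a..\<tau> b}"
  by (auto elim!: \<tau>_attains)

lemma cont_v: "continuous_on {\<tau> a..\<tau> b} v"
proof (cases "a \<le> b")
  case True
  have "continuous_on (\<tau> ` {a..b}) v"
    by (rule continuous_on_inv) (auto intro: cont_\<tau>)
  then show ?thesis using True by (simp add: \<tau>_image)
next
  case False
  then have "{\<tau> a..\<tau> b} = {}" by simp
  then show ?thesis by simp
qed

lemma v_deriv:
  "(v has_real_derivative inverse (\<tau>' t)) (at (\<tau> t))"
proof (rule DERIV_inverse_function[where f=\<tau> and a="\<tau> (t - 1)" and b="\<tau> (t + 1)"])
  show "(\<tau> has_real_derivative \<tau>' t) (at (v (\<tau> t)))" using \<tau>_deriv by simp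
  show "\<tau>' t \<noteq> 0" using \<tau>'_pos[of t] by simp
  show "\<tau> (v y) = y" if "\<tau> (t - 1) < y" "y < \<tau> (t + 1)" for y
    using \<tau>_attains[of "t - 1" y "t + 1"] that by (metis less_imp_le v_\<tau>)
  have "\<tau> t \<in> {\<tau> (t - 1)<..<\<tau> (t + 1)}" by simp
  moreover have "continuous_on {\<tau> (t - 1)<..<\<tau> (t + 1)} v"
    by (rule continuous_on_subset[OF cont_v[of "t - 1" "t + 1"]]) auto
  ultimately show "isCont v (\<tau> t)" by (simp add: continuous_on_eq_continuous_at)
qed simp_all

lemma deriv_along_clock:
  assumes "(M has_vector_derivative \<tau>' t *\<^sub>R \<phi> t) (at t)"
  shows "((\<lambda>x. M (v x)) has_vector_derivative \<phi> t) (at (\<tau> t))"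
proof -
  have "((M \<circ> v) has_vector_derivative inverse (\<tau>' t) *\<^sub>R (\<tau>' t *\<^sub>R \<phi> t)) (at (\<tau> t))"
    using v_deriv[of t] assms
    by (intro vector_diff_chain_at) (simp_all add: has_real_derivative_iff_has_vector_derivative)
  then show ?thesis using \<tau>'_pos[of t] by (simp add: o_def)
qed

lemma integral_along_clock:
  fixes M :: "real \<Rightarrow> 'a::euclidean_space"
  assumes "a \<le> b" and cM: "continuous_on {a..b} M"
    and dM: "\<And>t. a < t \<Longrightarrow> t < b \<Longrightarrow> (M has_vector_derivative \<tau>' t *\<^sub>R \<phi> t) (at t)"
  shows "((\<lambda>x. \<phi> (v x)) has_integral M b - M a) {\<tau> a..\<tau> b}"
proof -
  have "((\<lambda>x. \<phi> (v x)) has_integral M (v (\<tau> b)) - M (v (\<tau> a))) {\<tau> a..\<tau> b}"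
  proof (rule fundamental_theorem_of_calculus_interior)
    have "v ` {\<tau> a..\<tau> b} = {a..b}"
      using \<open>a \<le> b\<close> by (simp add: \<tau>_image[symmetric] image_image)
    then show "continuous_on {\<tau> a..\<tau> b} (\<lambda>x. M (v x))"
      using cM by (intro continuous_on_compose2[OF cM cont_v]) auto
    show "((\<lambda>x. M (v x)) has_vector_derivative \<phi> (v x)) (at x)" if x: "x \<in> {\<tau> a<..<\<tau> b}" for x
    proof -
      obtain t where t: "\<tau> t = x" using x \<tau>_attains[of a x b] by auto
      with x have "a < t" "t < b" by auto
      then show ?thesis using deriv_along_clock[where t=t and M=M and \<phi>=\<phi>, OF dM] t by auto
    qed
  qed (use \<open>a \<le> b\<close> in simp)
  then show ?thesis by simp
qed

lemma absolutely_integrable_along_clock: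
  fixes \<phi> :: "real \<Rightarrow> 'a::euclidean_space"
  assumes "continuous_on {a..b} \<phi>"
  shows "(\<lambda>x. \<phi> (v x)) absolutely_integrable_on {\<tau> a..\<tau> b}"
proof (cases "a \<le> b")
  case True
  then have "v ` {\<tau> a..\<tau> b} = {a..b}" by (simp add: \<tau>_image[symmetric] image_image)
  then have "continuous_on {\<tau> a..\<tau> b} (\<lambda>x. \<phi> (v x))"
    by (intro continuous_on_compose2[OF assms cont_v]) auto
  then show ?thesis by (rule absolutely_integrable_continuous_real)
qed simp

end

text \<open>A derivative of constant sign near minus infinity forces a constant sign of the function there.\<close>

definition sign_at_bot :: "(real \<Rightarrow> real) \<Rightarrow> bool" where
  "sign_at_bot \<phi> \<longleftrightarrow> (\<exists>c. (\<forall>t\<le>c. \<phi> t \<ge> 0) \<or> (\<forall>t\<le>c. \<phi> t \<le> 0))"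

lemma sign_at_bot_minus [simp]: "sign_at_bot (\<lambda>t. - \<phi> t) \<longleftrightarrow> sign_at_bot \<phi>"
  unfolding sign_at_bot_def by auto

lemma sign_at_bot_mult:
  assumes "sign_at_bot \<phi>" "sign_at_bot \<psi>"
  shows "sign_at_bot (\<lambda>t. \<phi> t * \<psi> t)"
proof -
  obtain c d where *: "(\<forall>t\<le>c. \<phi> t \<ge> 0) \<or> (\<forall>t\<le>c. \<phi> t \<le> 0)" "(\<forall>t\<le>d. \<psi> t \<ge> 0) \<or> (\<forall>t\<le>d. \<psi> t \<le> 0)"
    using assms unfolding sign_at_bot_def by blast
  show ?thesis unfolding sign_at_bot_def
  proof (intro exI[of _ "min c d"])
    show "(\<forall>t\<le>min c d. 0 \<le> \<phi> t * \<psi> t) \<or> (\<forall>t\<le>min c d. \<phi> t * \<psi> t \<le> 0)"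
      using * by (auto simp: zero_le_mult_iff mult_le_0_iff)
  qed
qed

lemma sign_at_bot_pos: "(\<And>t. \<phi> t > 0) \<Longrightarrow> sign_at_bot \<phi>"
  unfolding sign_at_bot_def by (auto intro: less_imp_le)

lemma sign_at_bot_monotone:
  assumes "mono_on {..<c} \<phi> \<or> antimono_on {..<c} \<phi>"
  shows "sign_at_bot \<phi>"
proof -
  have inc: "sign_at_bot \<psi>" if "mono_on {..<c} \<psi>" for \<psi> :: "real \<Rightarrow> real"
  proof (cases "\<exists>t<c. \<psi> t \<le> 0")
    case True
    then obtain d where "d < c" "\<psi> d \<le> 0" by blast
    then have "\<forall>t\<le>d. \<psi> t \<le> 0" using that by (auto simp: mono_on_def) (meson order_le_less_trans order_trans)
    then show ?thesis unfolding sign_at_bot_def by blast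
  next
    case False
    then have "\<forall>t\<le>c - 1. \<psi> t \<ge> 0" by (metis diff_less_eq less_add_one less_le_not_le linorder_le_cases order_le_less_trans)
    then show ?thesis unfolding sign_at_bot_def by blast
  qed
  from assms show ?thesis
  proof
    assume "antimono_on {..<c} \<phi>"
    then have "mono_on {..<c} (\<lambda>t. - \<phi> t)" by (auto simp: mono_on_def monotone_on_def)
    from inc[OF this] show ?thesis by simp
  qed (rule inc)
qed

lemma sign_at_bot_deriv:
  assumes "\<And>t. (\<phi> has_real_derivative \<phi>' t) (at t)" and "sign_at_bot \<phi>'"
  shows "sign_at_bot \<phi>"
proof -
  obtain c where c: "(\<forall>t\<le>c. \<phi>' t \<ge> 0) \<or> (\<forall>t\<le>c. \<phi>' t \<le> 0)"
    using assms(2) unfolding sign_at_bot_def by blast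
  from c have "mono_on {..<c} \<phi> \<or> antimono_on {..<c} \<phi>"
  proof
    assume *: "\<forall>t\<le>c. \<phi>' t \<ge> 0"
    have "mono_on {..<c} \<phi>"
    proof (rule mono_onI)
      fix r s assume "r \<in> {..<c}" "s \<in> {..<c}" "r \<le> s"
      then show "\<phi> r \<le> \<phi> s"
        using DERIV_nonneg_imp_nondecreasing[of r s \<phi>] assms(1) * by (metis lessThan_iff less_imp_le order_trans)
    qed
    then show ?thesis by blast
  next
    assume *: "\<forall>t\<le>c. \<phi>' t \<le> 0"
    have "antimono_on {..<c} \<phi>"
    proof (rule monotone_onI)
      fix r s assume "r \<in> {..<c}" "s \<in> {..<c}" "r \<le> s"
      then show "\<phi> r \<ge> \<phi> s"
        using DERIV_nonpos_imp_nonincreasing[of r s \<phi>] assms(1) * by (metis lessThan_iff less_imp_le order_trans)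
    qed
    then show ?thesis by blast
  qed
  then show ?thesis by (rule sign_at_bot_monotone)
qed

text \<open>If \<open>\<integral> N \<phi>'\<close> converges at minus infinity, where \<open>\<phi>'\<close> has a constant sign and
  \<open>N\<close> increases from \<open>0\<close>, then \<open>N \<phi>\<close> vanishes at minus infinity: over
  \<open>[t, c]\<close>, the increment of \<open>\<phi>\<close> times \<open>N t\<close> is at most the integral of
  \<open>N \<phi>'\<close>, whose primitive is \<open>- q\<close>.\<close>

lemma weight_times_primitive_tendsto_0:
  assumes N: "\<And>s t. s \<le> t \<Longrightarrow> N s \<le> N t" "\<And>t. N t > 0" "(N \<longlongrightarrow> 0) at_bot"
    and q: "(q \<longlongrightarrow> 0) at_bot" "\<And>t. t < b \<Longrightarrow> (q has_real_derivative - (N t * \<phi>' t)) (at t)"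
    and \<phi>: "\<And>t. (\<phi> has_real_derivative \<phi>' t) (at t)" "sign_at_bot \<phi>'"
  shows "((\<lambda>t. N t * \<phi> t) \<longlongrightarrow> 0) at_bot"
proof -
  have main: "((\<lambda>t. N t * \<phi> t) \<longlongrightarrow> 0) at_bot"
    if q: "(q \<longlongrightarrow> 0) at_bot" "\<And>t. t < b \<Longrightarrow> (q has_real_derivative - (N t * \<phi>' t)) (at t)"
      and \<phi>: "\<And>t. (\<phi> has_real_derivative \<phi>' t) (at t)" and c: "\<And>t. t \<le> c \<Longrightarrow> \<phi>' t \<ge> 0"
    for q \<phi> \<phi>' c
  proof (rule tendstoI)
    fix \<eta> :: real assume "\<eta> > 0"
    then have "\<forall>\<^sub>F t in at_bot. \<bar>q t\<bar> < \<eta> / 4" using tendstoD[OF q(1), of "\<eta> / 4"] by (simp add: dist_real_def)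
    then obtain c1 where c1: "\<And>t. t \<le> c1 \<Longrightarrow> \<bar>q t\<bar> < \<eta> / 4" by (auto simp: eventually_at_bot_linorder)
    define d where "d = min (min c c1) (b - 1)"
    have "((\<lambda>t. N t * \<bar>\<phi> d\<bar>) \<longlongrightarrow> 0) at_bot" using tendsto_mult_left_zero[OF N(3)] by simp
    then have "\<forall>\<^sub>F t in at_bot. \<bar>N t * \<bar>\<phi> d\<bar>\<bar> < \<eta> / 4"
      using tendstoD[of _ 0 _ "\<eta> / 4"] \<open>\<eta> > 0\<close> by (fastforce simp: dist_real_def)
    moreover have "\<forall>\<^sub>F t in at_bot. t \<le> d" by (rule eventually_le_at_bot)
    ultimately show "\<forall>\<^sub>F t in at_bot. dist (N t * \<phi> t) 0 < \<eta>"
    proof eventually_elim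
      case (elim t)
      let ?r = "\<lambda>x. q x + N t * \<phi> x"
      have "?r d \<le> ?r t"
      proof (rule DERIV_nonpos_imp_nonincreasing[OF elim(2)])
        fix x assume x: "t \<le> x" "x \<le> d"
        have "(q has_real_derivative - (N x * \<phi>' x)) (at x)" using x by (intro q(2)) (simp add: d_def)
        from DERIV_add[OF this DERIV_cmult[OF \<phi>[of x], of "N t"]]
        have "(?r has_real_derivative - (N x * \<phi>' x) + N t * \<phi>' x) (at x)" .
        moreover have "N t * \<phi>' x \<le> N x * \<phi>' x"
          using x N(1)[of t x] c[of x] by (intro mult_right_mono) (auto simp: d_def)
        ultimately show "\<exists>y. (?r has_real_derivative y) (at x) \<and> y \<le> 0" by (intro exI conjI) auto
      qed
      then have up: "N t * (\<phi> d - \<phi> t) \<le> q t - q d" by (simp add: algebra_simps)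
      have "\<phi> t \<le> \<phi> d"
        by (rule DERIV_nonneg_imp_nondecreasing[OF elim(2)])
          (use \<phi> c in \<open>force simp: d_def intro!: exI\<close>)
      then have lo: "0 \<le> N t * (\<phi> d - \<phi> t)" using N(2)[of t] by simp
      have "\<bar>q t\<bar> < \<eta> / 4" "\<bar>q d\<bar> < \<eta> / 4" using c1 elim(2) by (auto simp: d_def)
      moreover have "\<bar>N t * \<phi> d\<bar> < \<eta> / 4" using elim(1) N(2)[of t] by (simp add: abs_mult)
      moreover have "N t * \<phi> t = N t * \<phi> d - N t * (\<phi> d - \<phi> t)" by (simp add: algebra_simps)
      ultimately show ?case using up lo \<open>\<eta> > 0\<close> by (simp add: dist_real_def)
    qed
  qed
  obtain c where c: "(\<forall>t\<le>c. \<phi>' t \<ge> 0) \<or> (\<forall>t\<le>c. \<phi>' t \<le> 0)"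
    using \<phi>(2) unfolding sign_at_bot_def by blast
  from c show ?thesis
  proof
    assume "\<forall>t\<le>c. \<phi>' t \<ge> 0"
    then show ?thesis using main[OF q \<phi>(1)] by blast
  next
    assume le: "\<forall>t\<le>c. \<phi>' t \<le> 0"
    have "((\<lambda>t. N t * (- \<phi> t)) \<longlongrightarrow> 0) at_bot"
    proof (rule main[where q="\<lambda>t. - q t" and \<phi>'="\<lambda>t. - \<phi>' t"])
      show "((\<lambda>t. - q t) \<longlongrightarrow> 0) at_bot" using tendsto_minus[OF q(1)] by simp
      show "((\<lambda>t. - q t) has_real_derivative - (N t * - \<phi>' t)) (at t)" if "t < b" for t
        using DERIV_minus[OF q(2)[OF that]] by simp
      show "((\<lambda>t. - \<phi> t) has_real_derivative - \<phi>' t) (at t)" for t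
        using DERIV_minus[OF \<phi>(1)] .
    qed (use le in auto)
    then show ?thesis using tendsto_minus by fastforce
  qed
qed

context clock
begin

text \<open>The integral from the start of the clock. The values of \<open>\<phi>\<close> may be unbounded there; the
  constant sign turns convergence of the improper integral into integrability.\<close>

lemma integral_along_clock_from_start:
  fixes M \<phi> :: "real \<Rightarrow> real"
  assumes \<tau>0: "(\<tau> \<longlongrightarrow> 0) at_bot" and M0: "(M \<longlongrightarrow> 0) at_bot"
    and cM: "continuous_on {..b} M"
    and dM: "\<And>t. t < b \<Longrightarrow> (M has_real_derivative \<tau>' t * \<phi> t) (at t)"
    and c\<phi>: "continuous_on {..b} \<phi>" and sign: "sign_at_bot \<phi>"
  shows "(\<lambda>x. \<phi> (v x)) absolutely_integrable_on {0..\<tau> b}"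
    and "integral {0..\<tau> b} (\<lambda>x. \<phi> (v x)) = M b"
proof -
  define F where "F x = (if x \<le> 0 then 0 else M (v x))" for x
  have reach: "\<exists>t<b. \<tau> t = x" if x: "0 < x" "x < \<tau> b" for x
  proof -
    have "\<forall>\<^sub>F t in at_bot. \<tau> t < x" using order_tendstoD(2)[OF \<tau>0 x(1)] .
    then obtain a where "\<tau> a < x" by (metis eventually_at_bot_linorder order_refl)
    then show ?thesis using \<tau>_attains[of a x b] x by (metis less_imp_le \<tau>_less_iff)
  qed
  have dF: "(F has_vector_derivative \<phi> (v x)) (at x)" if x: "x \<in> {0<..<\<tau> b}" for x
  proof -
    obtain t where t: "t < b" "\<tau> t = x" using reach x by auto
    have "(M has_vector_derivative \<tau>' t *\<^sub>R \<phi> t) (at t)"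
      using dM[OF t(1)] by (simp add: has_real_derivative_iff_has_vector_derivative)
    from deriv_along_clock[where M=M and \<phi>=\<phi>, OF this] t have "((\<lambda>x. M (v x)) has_vector_derivative \<phi> (v x)) (at x)" by auto
    then show ?thesis
      by (rule has_vector_derivative_transform_within_open[where S="{0<..}"]) (use x in \<open>auto simp: F_def\<close>)
  qed
  have cF: "continuous_on {0..\<tau> b} F"
    unfolding continuous_on_eq_continuous_within
  proof
    fix x assume x: "x \<in> {0..\<tau> b}"
    show "continuous (at x within {0..\<tau> b}) F"
    proof (cases "x = 0")
      case True
      have "\<forall>\<^sub>F x in at 0 within {0..\<tau> b}. dist (F x) 0 < \<eta>" if \<eta>: "\<eta> > 0" for \<eta>
      proof -
        obtain c where c: "\<And>t. t \<le> c \<Longrightarrow> dist (M t) 0 < \<eta>"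
          using tendstoD[OF M0 \<eta>] by (auto simp: eventually_at_bot_linorder)
        have "\<forall>\<^sub>F x in at 0 within {0..\<tau> b}. x < \<tau> c"
          using \<tau>_pos[of c] by (intro order_tendstoD(2)[OF tendsto_ident_at]) auto
        moreover have "\<forall>\<^sub>F x in at 0 within {0..\<tau> b}. x \<in> {0..\<tau> b}"
          by (auto simp: eventually_at_filter)
        moreover have "\<forall>\<^sub>F x in at 0 within {0..\<tau> b}. x < \<tau> b"
          using \<tau>_pos[of b] by (intro order_tendstoD(2)[OF tendsto_ident_at]) auto
        ultimately show ?thesis
        proof eventually_elim
          case (elim x)
          show ?case
          proof (cases "x \<le> 0")
            case False
            then obtain t where t: "\<tau> t = x" using reach elim by (meson not_le)
            then have "t \<le> c" using elim by (metis \<tau>_less_iff less_imp_le)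
            then show ?thesis using c t False by (auto simp: F_def)
          qed (simp add: F_def \<eta>)
        qed
      qed
      then have "(F \<longlongrightarrow> 0) (at 0 within {0..\<tau> b})" by (intro tendstoI)
      then show ?thesis using True by (simp add: continuous_within F_def)
    next
      case False
      then have "0 < x" "x \<le> \<tau> b" using x by auto
      have "\<forall>\<^sub>F t in at_bot. \<tau> t < x" using order_tendstoD(2)[OF \<tau>0 \<open>0 < x\<close>] .
      then obtain a where a: "\<tau> a < x" by (metis eventually_at_bot_linorder order_refl)
      then have "a < b" using \<open>x \<le> \<tau> b\<close> by (metis \<tau>_less_iff order_less_le_trans)
      have "continuous_on {\<tau> a..\<tau> b} (\<lambda>x. M (v x))"
      proof (rule continuous_on_compose2[OF cM cont_v])
        show "v ` {\<tau> a..\<tau> b} \<subseteq> {..b}"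
          using \<tau>_image[of a b] \<open>a < b\<close> by (auto elim!: \<tau>_attains)
      qed
      then have "continuous (at x within {\<tau> a..\<tau> b}) (\<lambda>x. M (v x))"
        using a \<open>x \<le> \<tau> b\<close> by (simp add: continuous_on_eq_continuous_within)
      moreover have "at x within {\<tau> a..\<tau> b} = at x within {0..\<tau> b}"
        by (rule at_within_nhd[where S="{\<tau> a<..}"]) (use a \<tau>_pos[of a] in auto)
      ultimately have "continuous (at x within {0..\<tau> b}) (\<lambda>x. M (v x))" by simp
      then show ?thesis
        by (rule continuous_transform_within[where \<delta>=x]) (use \<open>0 < x\<close> \<open>x \<le> \<tau> b\<close> in \<open>auto simp: F_def dist_real_def\<close>)
    qed
  qed
  have int: "((\<lambda>x. \<phi> (v x)) has_integral M b) {0..\<tau> b}"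
    using fundamental_theorem_of_calculus_interior[OF _ cF dF] \<tau>_pos[of b]
    by (simp add: F_def) 
  then show "integral {0..\<tau> b} (\<lambda>x. \<phi> (v x)) = M b" by (rule integral_unique)
  obtain c0 where c0: "(\<forall>t\<le>c0. \<phi> t \<ge> 0) \<or> (\<forall>t\<le>c0. \<phi> t \<le> 0)"
    using sign unfolding sign_at_bot_def by blast
  define c where "c = min c0 b"
  have c: "(\<forall>t\<le>c. \<phi> t \<ge> 0) \<or> (\<forall>t\<le>c. \<phi> t \<le> 0)" "c \<le> b" using c0 by (auto simp: c_def)
  have "{0..\<tau> c} \<subseteq> {0..\<tau> b}" using c(2) by auto
  then have int0: "(\<lambda>x. \<phi> (v x)) integrable_on {0..\<tau> c}"
    using int integrable_on_subinterval by blast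
  have vle: "v x \<le> c" if x: "x \<in> {0..\<tau> c} - {0}" for x
  proof (cases "x = \<tau> b")
    case True
    then show ?thesis using x by simp
  next
    case False
    moreover have "x \<le> \<tau> b" using x c(2) by (auto intro: order_trans[of x "\<tau> c"])
    ultimately have "0 < x" "x < \<tau> b" using x by auto
    then obtain t where "\<tau> t = x" using reach by blast
    then show ?thesis using x by auto
  qed
  let ?z = "\<lambda>x. if x = 0 then 0 else \<phi> (v x)"
  have "?z integrable_on {0..\<tau> c}"
    by (rule integrable_spike[OF int0, of "{0}"]) auto
  then have "?z absolutely_integrable_on {0..\<tau> c}"
    using c(1)
  proof (elim disjE)
    assume "?z integrable_on {0..\<tau> c}" "\<forall>t\<le>c. \<phi> t \<ge> 0"
    then show ?thesis using vle by (intro nonnegative_absolutely_integrable_1) auto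
  next
    assume *: "?z integrable_on {0..\<tau> c}" "\<forall>t\<le>c. \<phi> t \<le> 0"
    then have "(\<lambda>x. - ?z x) absolutely_integrable_on {0..\<tau> c}"
      using vle by (intro nonnegative_absolutely_integrable_1 integrable_neg) auto
    then have "(\<lambda>x. (-1) *\<^sub>R ?z x) absolutely_integrable_on {0..\<tau> c}" by simp
    then show ?thesis unfolding absolutely_integrable_on_scaleR_iff by simp
  qed
  then have "(\<lambda>x. \<phi> (v x)) absolutely_integrable_on {0..\<tau> c}"
    by (rule absolutely_integrable_spike[of _ _ "{0}"]) auto
  moreover have "continuous_on {c..b} \<phi>" by (rule continuous_on_subset[OF c\<phi>]) auto
  then have "(\<lambda>x. \<phi> (v x)) absolutely_integrable_on {\<tau> c..\<tau> b}"
    by (rule absolutely_integrable_along_clock)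
  ultimately have "(\<lambda>x. \<phi> (v x)) absolutely_integrable_on ({0..\<tau> c} \<union> {\<tau> c..\<tau> b})"
    by (rule absolutely_integrable_Un)
  moreover have "{0..\<tau> c} \<union> {\<tau> c..\<tau> b} = {0..\<tau> b}" 
  proof -
    have "\<tau> c \<le> \<tau> b" using c(2) by simp
    then show ?thesis using \<tau>_pos[of c] by (simp add: ivl_disj_un_two_touch less_imp_le)
  qed
  ultimately show "(\<lambda>x. \<phi> (v x)) absolutely_integrable_on {0..\<tau> b}" by simp
qed

end

section \<open>Optimizers along a fan of right tangents\<close>

context strip
begin

lemma clock_exists: obtains \<tau> v where "clock \<tau> (\<lambda>t. lamR t * \<tau> t) v"
proof -
  have "\<exists>F. \<forall>x::real. - \<infinity> < ereal x \<longrightarrow> ereal x < \<infinity> \<longrightarrow> (F has_vector_derivative lamR x) (at x)"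
    by (rule einterval_antiderivative)
      (use cont_lamR[of UNIV] in \<open>auto simp: continuous_on_eq_continuous_at\<close>)
  then obtain \<Lambda> where \<Lambda>: "\<And>t. (\<Lambda> has_real_derivative lamR t) (at t)"
    by (auto simp: has_real_derivative_iff_has_vector_derivative)
  have d: "((\<lambda>t. exp (\<Lambda> t)) has_real_derivative lamR t * exp (\<Lambda> t)) (at t)" for t
    using DERIV_chain2[OF DERIV_exp \<Lambda>] by (simp add: mult.commute)
  have less: "exp (\<Lambda> a) < exp (\<Lambda> b)" if "a < b" for a b
    by (rule DERIV_pos_imp_increasing[OF that]) (use d lamR_pos in \<open>fastforce intro!: exI\<close>)
  have "inj (\<lambda>t. exp (\<Lambda> t))"
    by (rule linorder_injI) (use less in fastforce)
  then have "clock (\<lambda>t. exp (\<Lambda> t)) (\<lambda>t. lamR t * exp (\<Lambda> t)) (inv (\<lambda>t. exp (\<Lambda> t)))"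
    by unfold_locales (use d lamR_pos in \<open>auto simp: inv_f_f[of "\<lambda>t. exp (\<Lambda> t)"]\<close>)
  then show ?thesis by (rule that)
qed

text \<open>The equation for \<open>w\<close> says that \<open>\<tau> w\<close> is a primitive of \<open>g\<close> with respect to
  \<open>\<tau>\<close>, so \<open>w t\<close> is the average of the inverse of \<open>\<tau>\<close> on the curve over \<open>[0, \<tau> t]\<close>.\<close>

lemma clock_times_wR_deriv:
  assumes "clock \<tau> (\<lambda>t. lamR t * \<tau> t) v"
  shows "((\<lambda>t. \<tau> t *\<^sub>R wR t) has_vector_derivative (lamR t * \<tau> t) *\<^sub>R g t) (at t)"
proof -
  have "(\<tau> has_real_derivative lamR t * \<tau> t) (at t)" using assms by (rule clock.\<tau>_deriv)
  from has_vector_derivative_scaleR[OF this wR_deriv[of t]]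
  have "((\<lambda>t. \<tau> t *\<^sub>R wR t) has_vector_derivative
      \<tau> t *\<^sub>R (lamR t *\<^sub>R (g t - wR t)) + (lamR t * \<tau> t) *\<^sub>R wR t) (at t)" .
  moreover have "\<tau> t *\<^sub>R (lamR t *\<^sub>R (g t - wR t)) + (lamR t * \<tau> t) *\<^sub>R wR t = (lamR t * \<tau> t) *\<^sub>R g t"
    by (simp add: algebra_simps)
  ultimately show ?thesis by (simp only:)
qed

lemma clock_times_value_deriv:
  assumes "clock \<tau> (\<lambda>t. lamR t * \<tau> t) v"
    and "(m has_real_derivative lamR t * (y - m t)) (at t)"
  shows "((\<lambda>t. \<tau> t * m t) has_real_derivative (lamR t * \<tau> t) * y) (at t)"
proof -
  have "(\<tau> has_real_derivative lamR t * \<tau> t) (at t)" using assms(1) by (rule clock.\<tau>_deriv)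
  from DERIV_mult'[OF this assms(2)] show ?thesis by (simp add: algebra_simps)
qed

lemma height_wR_nonneg: "free.height s (wR t) \<ge> 0"
  by (simp add: wR_def free.height_nonneg)

text \<open>Averages over \<open>[0, \<tau> t]\<close> sit at the point of tangency for \<open>t\<close>. An average over
  \<open>[p, \<tau> t]\<close> then lies below the tangent line at that point, because the average over
  \<open>[0, p]\<close> lies above it.\<close>

lemma left_opt_fan:
  assumes u: "u1 < u2" and cm: "continuous_on {u1..u2} m"
    and dm: "\<And>t. u1 < t \<Longrightarrow> t < u2 \<Longrightarrow> (m has_real_derivative lamR t * (f t - m t)) (at t)"
    and cf: "continuous_on {u1..u2} f"
    and start: "left_opt f (sR u1) (wR u1) (m u1)"
  shows "left_opt f (sR u2) (wR u2) (m u2)"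
proof -
  obtain \<tau> v where ck: "clock \<tau> (\<lambda>t. lamR t * \<tau> t) v" using clock_exists .
  interpret clock \<tau> "\<lambda>t. lamR t * \<tau> t" v by (rule ck)
  define T0 T1 where "T0 = \<tau> u1" and "T1 = \<tau> u2 - \<tau> u1"
  have T: "0 < T0" "0 < T1" "T0 + T1 = \<tau> u2" using u \<tau>_pos[of u1] by (simp_all add: T0_def T1_def)
  obtain \<alpha>0 T' where "opt f \<alpha>0 T' (wR u1) (m u1)" "leans (sR u1) \<alpha>0 T' (wR u1)"
    using start unfolding left_opt_def by blast
  from opt_rescale(1,2)[OF this(1) T(1)] this(2)
  obtain \<alpha> where \<alpha>: "opt f \<alpha> T0 (wR u1) (m u1)" "leans (sR u1) \<alpha> T0 (wR u1)" by blast
  define \<beta> where "\<beta> x = v (T0 + x)" for x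
  have time: "\<exists>t. u1 \<le> t \<and> t \<le> u2 \<and> \<tau> t = T0 + p" if "0 \<le> p" "p \<le> T1" for p
    using \<tau>_attains[of u1 "T0 + p" u2] that by (auto simp: T0_def T1_def)
  have gi: "(\<lambda>x. g (v x)) absolutely_integrable_on {T0..\<tau> u2}"
    unfolding T0_def by (rule absolutely_integrable_along_clock[OF fixed.cont_c])
  have fi: "(\<lambda>x. f (v x)) absolutely_integrable_on {T0..\<tau> u2}"
    unfolding T0_def by (rule absolutely_integrable_along_clock[OF cf])
  have "(\<lambda>x. g (\<beta> x)) absolutely_integrable_on {0..T1}"
    using absolutely_integrable_affine[OF gi, of 1 T0] T by (simp add: \<beta>_def add.commute T1_def T0_def)
  moreover have "(\<lambda>x. f (\<beta> x)) absolutely_integrable_on {0..T1}"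
    using absolutely_integrable_affine[OF fi, of 1 T0] T by (simp add: \<beta>_def add.commute T1_def T0_def)
  moreover have mom: "mom \<beta> p = \<tau> t *\<^sub>R wR t - T0 *\<^sub>R wR u1"
    if t: "u1 \<le> t" "t \<le> u2" "\<tau> t = T0 + p" for t p
  proof -
    have i: "((\<lambda>x. g (v x)) has_integral \<tau> t *\<^sub>R wR t - \<tau> u1 *\<^sub>R wR u1) {\<tau> u1..\<tau> t}"
      by (rule integral_along_clock[OF t(1) _ clock_times_wR_deriv[OF ck]])
        (intro continuous_intros cont_\<tau> cont_wR)
    then have "(\<lambda>x. g (v x)) integrable_on {T0..T0 + p}"
      using t by (auto simp: T0_def integrable_on_def)
    from integral_affine_real[OF this, of 1 T0] i t show ?thesis
      by (simp add: mom_def \<beta>_def add.commute T0_def integral_unique)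
  qed
  moreover have "integral {0..T1} (\<lambda>x. f (\<beta> x)) = \<tau> u2 * m u2 - T0 * m u1"
  proof -
    have i: "((\<lambda>x. f (v x)) has_integral \<tau> u2 * m u2 - \<tau> u1 * m u1) {\<tau> u1..\<tau> u2}"
    proof (rule integral_along_clock)
      show "continuous_on {u1..u2} (\<lambda>t. \<tau> t * m t)" by (intro continuous_intros cont_\<tau> cm)
      show "((\<lambda>t. \<tau> t * m t) has_vector_derivative (lamR t * \<tau> t) *\<^sub>R f t) (at t)"
        if "u1 < t" "t < u2" for t
        using clock_times_value_deriv[where m=m, OF ck dm[OF that]]
        by (simp add: has_real_derivative_iff_has_vector_derivative)
    qed (use u in simp)
    then have "(\<lambda>x. f (v x)) integrable_on {T0..\<tau> u2}" by (auto simp: T0_def integrable_on_def)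
    from integral_affine_real[OF this, of 1 T0] i show ?thesis
      by (simp add: \<beta>_def add.commute T0_def T1_def integral_unique)
  qed
  moreover have "averages_below \<beta> T1"
    unfolding averages_below_def
  proof (intro allI impI)
    fix p q assume pq: "0 \<le> p \<and> p < q \<and> q \<le> T1"
    obtain t where t: "u1 \<le> t" "t \<le> u2" "\<tau> t = T0 + p" using time pq by (meson less_imp_le order_trans)
    obtain t' where t': "u1 \<le> t'" "t' \<le> u2" "\<tau> t' = T0 + q" using time pq by (meson less_imp_le order_trans)
    have "mom \<beta> q - mom \<beta> p = \<tau> t' *\<^sub>R wR t' - \<tau> t *\<^sub>R wR t" "q - p = \<tau> t' - \<tau> t"
      using mom t t' by simp_all
    then have "excess (sR t') (mom \<beta> q - mom \<beta> p) (q - p) = - (\<tau> t * free.height (sR t') (wR t))"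
      by (simp add: excess_diff excess_scaled wR_def)
    also have "\<dots> \<le> 0" using \<tau>_pos[of t] height_wR_nonneg by simp
    finally show "\<exists>s. excess s (mom \<beta> q - mom \<beta> p) (q - p) \<le> 0" by blast
  qed
  ultimately have \<beta>: "opt f \<beta> T1 ((1 / T1) *\<^sub>R (\<tau> u2 *\<^sub>R wR u2 - T0 *\<^sub>R wR u1)) ((\<tau> u2 * m u2 - T0 * m u1) / T1)"
    using T u mom[of u2 T1] by (simp add: opt_def)
  have early: "0 \<le> excess s (mom \<alpha> p) p" "mom \<alpha> p $ 1 \<le> p * wR u1 $ 1"
    if p: "0 \<le> p" "p \<le> T0" and s: "sR u1 \<le> s" for p s
  proof -
    have "leans s \<alpha> T0 (wR u1)" using leans_mono[OF \<alpha>(2) s] .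
    then have "p * free.height s (wR u1) \<le> excess s (mom \<alpha> p) p" and "mom \<alpha> p $ 1 \<le> p * wR u1 $ 1"
      using p by (auto simp: leans_def)
    moreover have "0 \<le> p * free.height s (wR u1)" using p height_wR_nonneg by simp
    ultimately show "0 \<le> excess s (mom \<alpha> p) p" "mom \<alpha> p $ 1 \<le> p * wR u1 $ 1" by auto
  qed
  have "opt f (joined T0 \<alpha> \<beta>) (T0 + T1) (wR u2) (m u2)"
  proof (rule opt_joined[OF \<alpha>(1) \<beta>])
    fix p q assume pq: "0 \<le> p" "p < T0" "T0 < q" "q \<le> T0 + T1"
    obtain t where t: "u1 \<le> t" "t \<le> u2" "\<tau> t = T0 + (q - T0)"
      using time[of "q - T0"] pq by auto
    have "excess (sR t) (mom \<beta> (q - T0)) (q - T0) = excess (sR t) (\<tau> t *\<^sub>R wR t - T0 *\<^sub>R wR u1) (\<tau> t - T0)"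
      using t by (simp add: mom)
    also have "\<dots> = - (T0 * free.height (sR t) (wR u1))"
      by (simp add: excess_diff excess_scaled wR_def)
    finally have "excess (sR t) (T0 *\<^sub>R wR u1 - mom \<alpha> p) (T0 - p) + excess (sR t) (mom \<beta> (q - T0)) (q - T0)
        = - excess (sR t) (mom \<alpha> p) p"
      by (simp add: excess_diff excess_scaled)
    also have "\<dots> \<le> 0" using early(1)[of p "sR t"] pq t by simp
    finally show "\<exists>s. excess s (T0 *\<^sub>R wR u1 - mom \<alpha> p) (T0 - p) + excess s (mom \<beta> (q - T0)) (q - T0) \<le> 0"
      by blast
  next
    show "T0 *\<^sub>R wR u1 + T1 *\<^sub>R ((1 / T1) *\<^sub>R (\<tau> u2 *\<^sub>R wR u2 - T0 *\<^sub>R wR u1)) = (T0 + T1) *\<^sub>R wR u2"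
      using T by simp
    show "T0 * m u1 + T1 * ((\<tau> u2 * m u2 - T0 * m u1) / T1) = (T0 + T1) * m u2"
      using T by simp
  qed
  moreover have "leans (sR u2) (joined T0 \<alpha> \<beta>) (T0 + T1) (wR u2)"
    unfolding leans_def
  proof (intro allI impI)
    fix p assume p: "0 \<le> p \<and> p \<le> T0 + T1"
    have h0: "free.height (sR u2) (wR u2) = 0" by (simp add: wR_def)
    show "mom (joined T0 \<alpha> \<beta>) p $ 1 \<le> p * wR u2 $ 1
        \<and> p * free.height (sR u2) (wR u2) \<le> excess (sR u2) (mom (joined T0 \<alpha> \<beta>) p) p"
    proof (cases "p \<le> T0")
      case True
      have "wR u1 $ 1 \<le> wR u2 $ 1" using u by (simp add: wR_def)
      then have "p * wR u1 $ 1 \<le> p * wR u2 $ 1" using p by (simp add: mult_left_mono)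
      then show ?thesis
        using early[of p "sR u2"] p True u h0 by (simp add: mom_joined[OF \<alpha>(1) \<beta>])
    next
      case False
      obtain t where t: "u1 \<le> t" "t \<le> u2" "\<tau> t = T0 + (p - T0)"
        using time[of "p - T0"] p False by auto
      have "mom (joined T0 \<alpha> \<beta>) p = p *\<^sub>R wR t"
        using False p t by (simp add: mom_joined[OF \<alpha>(1) \<beta>] mom)
      moreover have "p * wR t $ 1 \<le> p * wR u2 $ 1" using t p by (simp add: wR_def mult_left_mono)
      ultimately show ?thesis using p h0 height_wR_nonneg[of "sR u2" t] by (simp add: excess_scaled)
    qed
  qed
  ultimately show ?thesis unfolding left_opt_def by blast
qed

text \<open>When the fan comes from minus infinity, the inverse of \<open>\<tau>\<close> is the whole optimizer. The constant signs
  of the derivatives make the functions integrable near time zero, the limits make their averages the right ones.\<close>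

lemma left_opt_fan_from_infinity:
  assumes ck: "clock \<tau> (\<lambda>t. lamR t * \<tau> t) v" and \<tau>0: "(\<tau> \<longlongrightarrow> 0) at_bot"
    and w0: "\<And>i. ((\<lambda>t. \<tau> t * (wR t $ i - g t $ i)) \<longlongrightarrow> 0) at_bot"
    and m0: "((\<lambda>t. \<tau> t * (m t - f t)) \<longlongrightarrow> 0) at_bot"
    and cm: "continuous_on {..u} m"
    and dm: "\<And>t. t < u \<Longrightarrow> (m has_real_derivative lamR t * (f t - m t)) (at t)"
    and df: "\<And>t. (f has_real_derivative f' t) (at t)" and sign: "sign_at_bot f'"
    and sign2: "sign_at_bot (\<lambda>t. dg t $ 2)"
  shows "left_opt f (sR u) (wR u) (m u)"
proof -
  interpret clock \<tau> "\<lambda>t. lamR t * \<tau> t" v by (rule ck)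
  have scalar: "(\<lambda>x. \<phi> (v x)) absolutely_integrable_on {0..\<tau> t}"
    "integral {0..\<tau> t} (\<lambda>x. \<phi> (v x)) = \<tau> t * \<mu> t"
    if 0: "((\<lambda>t. \<tau> t * (\<mu> t - \<phi> t)) \<longlongrightarrow> 0) at_bot"
      and c: "continuous_on {..u} \<mu>"
      and d\<mu>: "\<And>t. t < u \<Longrightarrow> (\<mu> has_real_derivative lamR t * (\<phi> t - \<mu> t)) (at t)"
      and d\<phi>: "\<And>t. (\<phi> has_real_derivative \<phi>' t) (at t)" and s: "sign_at_bot \<phi>'" and t: "t \<le> u"
    for \<phi> \<phi>' \<mu> t
  proof -
    have c\<phi>: "continuous_on S \<phi>" for S
      by (intro continuous_at_imp_continuous_on ballI DERIV_isCont[OF d\<phi>])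
    have "((\<lambda>t. \<tau> t * \<phi> t) \<longlongrightarrow> 0) at_bot"
    proof (rule weight_times_primitive_tendsto_0[OF _ \<tau>_pos \<tau>0 0 _ d\<phi> s])
      fix t assume "t < u"
      from DERIV_mult'[OF \<tau>_deriv[of t] DERIV_diff[OF d\<mu>[OF this] d\<phi>[of t]]]
      show "((\<lambda>t. \<tau> t * (\<mu> t - \<phi> t)) has_real_derivative - (\<tau> t * \<phi>' t)) (at t)"
        by (simp add: algebra_simps)
    qed simp
    from tendsto_add[OF 0 this] have M0: "((\<lambda>t. \<tau> t * \<mu> t) \<longlongrightarrow> 0) at_bot"
      by (simp add: algebra_simps)
    have cM: "continuous_on {..t} (\<lambda>t. \<tau> t * \<mu> t)"
      by (intro continuous_intros cont_\<tau> continuous_on_subset[OF c]) (use t in auto)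
    have dM: "((\<lambda>t. \<tau> t * \<mu> t) has_real_derivative (lamR r * \<tau> r) * \<phi> r) (at r)" if "r < t" for r
      using clock_times_value_deriv[where m=\<mu>, OF ck d\<mu>[of r]] that t by simp
    have s\<phi>: "sign_at_bot \<phi>" using sign_at_bot_deriv[OF d\<phi> s] .
    show "(\<lambda>x. \<phi> (v x)) absolutely_integrable_on {0..\<tau> t}"
      "integral {0..\<tau> t} (\<lambda>x. \<phi> (v x)) = \<tau> t * \<mu> t"
      using integral_along_clock_from_start[OF \<tau>0 M0 cM dM c\<phi> s\<phi>] by auto
  qed
  note f_int = scalar[where \<phi>=f and \<phi>'=f' and \<mu>=m, OF m0 cm dm df sign]
  have dw: "((\<lambda>t. wR t $ i) has_real_derivative lamR t * (g t $ i - wR t $ i)) (at t)" for t i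
    using has_real_derivative_nth[OF wR_deriv[of t]] by simp
  have cw: "continuous_on S (\<lambda>t. wR t $ i)" for S i by (intro continuous_intros cont_wR)
  have "sign_at_bot (\<lambda>t. dg t $ 1)" by (rule sign_at_bot_pos) (rule fixed.dc_pos)
  with sign2 have "sign_at_bot (\<lambda>t. dg t $ i)" for i :: 2
    using exhaust_2[of i] by auto
  note sign_g = this
  have g_int: "(\<lambda>x. g (v x) $ i) absolutely_integrable_on {0..\<tau> t}"
    "integral {0..\<tau> t} (\<lambda>x. g (v x) $ i) = \<tau> t * wR t $ i" if "t \<le> u" for t i
    using scalar[where \<phi>="\<lambda>t. g t $ i" and \<phi>'="\<lambda>t. dg t $ i" and \<mu>="\<lambda>t. wR t $ i",
        OF w0 cw dw fixed.deriv_nth sign_g that] by auto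
  have gi: "(\<lambda>x. g (v x)) absolutely_integrable_on {0..\<tau> u}"
  proof (rule absolutely_integrable_componentwise)
    fix b :: "real^2" assume "b \<in> Basis"
    then obtain i where "b = axis i 1" by (auto simp: Basis_vec_def)
    then show "(\<lambda>x. g (v x) \<bullet> b) absolutely_integrable_on {0..\<tau> u}"
      using g_int(1)[of u i] by (simp add: inner_axis)
  qed
  have mom: "mom v (\<tau> t) = \<tau> t *\<^sub>R wR t" if t: "t \<le> u" for t
  proof -
    have "(\<lambda>x. g (v x)) absolutely_integrable_on {0..\<tau> t}"
      by (rule absolutely_integrable_on_subinterval[OF gi]) (use t in auto)
    then have i: "(\<lambda>x. g (v x)) integrable_on {0..\<tau> t}" by (simp add: absolutely_integrable_on_def)
    have "mom v (\<tau> t) $ i = \<tau> t * wR t $ i" for i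
      unfolding mom_def using integral_component_eq_cart[OF i, of i] g_int(2)[OF t, of i] by simp
    then show ?thesis by (simp add: vec_eq_iff)
  qed
  have time: "\<exists>t\<le>u. \<tau> t = p" if p: "0 < p" "p \<le> \<tau> u" for p
  proof -
    obtain a where a: "\<tau> a < p"
      using order_tendstoD(2)[OF \<tau>0 \<open>0 < p\<close>] by (auto simp: eventually_at_bot_linorder)
    obtain t where "a \<le> t" "t \<le> u" "\<tau> t = p"
      by (rule \<tau>_attains[of a p u]) (use a p in simp_all)
    then show ?thesis by blast
  qed
  have prefix: "0 \<le> excess s (mom v p) p" if p: "0 \<le> p" "p \<le> \<tau> u" for p s
  proof (cases "p = 0")
    case False
    then obtain t where t: "t \<le> u" "\<tau> t = p" using time[of p] p by auto
    have "mom v p = p *\<^sub>R wR t" using mom[OF t(1)] t(2) by simp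
    then show ?thesis using p height_wR_nonneg[of s t] by (simp add: excess_scaled)
  qed simp
  have "opt f v (\<tau> u) (wR u) (m u)"
    unfolding opt_def
  proof (intro conjI)
    show "averages_below v (\<tau> u)"
      unfolding averages_below_def
    proof (intro allI impI)
      fix p q assume pq: "0 \<le> p \<and> p < q \<and> q \<le> \<tau> u"
      then obtain t where t: "t \<le> u" "\<tau> t = q" using time[of q] by auto
      have "excess (sR t) (mom v q) q = 0" using mom[OF t(1)] t(2) by (auto simp: excess_scaled wR_def)
      then have "excess (sR t) (mom v q - mom v p) (q - p) \<le> 0"
        using prefix[of p "sR t"] pq by (simp add: excess_diff)
      then show "\<exists>s. excess s (mom v q - mom v p) (q - p) \<le> 0" by blast
    qed
  qed (use \<tau>_pos mom[of u] f_int[of u] gi in auto)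
  moreover have "leans (sR u) v (\<tau> u) (wR u)"
    unfolding leans_def
  proof (intro allI impI conjI)
    fix p assume p: "0 \<le> p \<and> p \<le> \<tau> u"
    show "p * free.height (sR u) (wR u) \<le> excess (sR u) (mom v p) p"
      using prefix p by (simp add: wR_def)
    show "mom v p $ 1 \<le> p * wR u $ 1"
    proof (cases "p = 0")
      case False
      then obtain t where t: "t \<le> u" "\<tau> t = p" using time[of p] p by auto
      have "mom v p = p *\<^sub>R wR t" using mom[OF t(1)] t(2) by simp
      then show ?thesis using p t(1) by (simp add: wR_def mult_left_mono)
    qed simp
  qed
  ultimately show ?thesis unfolding left_opt_def by blast
qed

end

section \<open>Stieltjes integrals\<close>

text \<open>By continuity, both measures of a compact interval are the increment of \<open>P\<close> over the reflected
  interval.\<close>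

lemma interval_measure_reflect:
  assumes P: "mono P" "continuous_on UNIV P"
  shows "interval_measure (\<lambda>t. - P (- t)) = distr (interval_measure P) borel uminus"
proof -
  have m: "mono (\<lambda>t. - P (- t))" using P(1) by (auto simp: mono_def)
  have c: "continuous_on UNIV (\<lambda>t. - P (- t))"
    by (intro continuous_intros continuous_on_compose2[OF P(2)]) auto
  have eq: "emeasure (interval_measure (\<lambda>t. - P (- t))) {a..b} = emeasure (distr (interval_measure P) borel uminus) {a..b}"
    for a b :: real
  proof (cases "a \<le> b")
    case True
    have "uminus -` {a..b} = {- b..- a}" by (auto simp: minus_le_iff le_minus_iff)
    then have "emeasure (distr (interval_measure P) borel uminus) {a..b} = emeasure (interval_measure P) {- b..- a}"
      by (subst emeasure_distr) auto
    also have "\<dots> = P (- a) - P (- b)"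
      using emeasure_interval_measure_Icc[of "- b" "- a" P] True monoD[OF P(1)] P(2) by simp
    also have "\<dots> = emeasure (interval_measure (\<lambda>t. - P (- t))) {a..b}"
      using emeasure_interval_measure_Icc[of a b "\<lambda>t. - P (- t)"] True monoD[OF m] c by simp
    finally show ?thesis by simp
  qed simp
  show ?thesis
  proof (rule measure_eqI_generator_eq[where E="range (\<lambda>(a, b). {a..b})" and \<Omega>=UNIV
        and A="\<lambda>n. {- real n..real n}"])
    show "Int_stable (range (\<lambda>(a, b). {a..b::real}))"
    proof (rule Int_stableI)
      fix X Y assume "X \<in> range (\<lambda>(a, b). {a..b::real})" "Y \<in> range (\<lambda>(a, b). {a..b::real})"
      then obtain a b c d where "X = {a..b}" "Y = {c..d}" by auto
      then have "X \<inter> Y = (\<lambda>(a, b). {a..b}) (max a c, min b d)" by auto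
      then show "X \<inter> Y \<in> range (\<lambda>(a, b). {a..b::real})" by (rule range_eqI)
    qed
    show "sets (interval_measure (\<lambda>t. - P (- t))) = sigma_sets UNIV (range (\<lambda>(a, b). {a..b}))"
      by (simp add: borel_eq_atLeastAtMost)
    show "sets (distr (interval_measure P) borel uminus) = sigma_sets UNIV (range (\<lambda>(a, b). {a..b}))"
      by (simp add: borel_eq_atLeastAtMost)
    show "(\<Union>n. {- real n..real n}) = UNIV"
    proof -
      have "\<exists>n. - real n \<le> x \<and> x \<le> real n" for x
      proof -
        obtain n where "\<bar>x\<bar> \<le> real n" using real_arch_simple by blast
        then show ?thesis by (intro exI[of _ n]) linarith
      qed
      then show ?thesis by auto
    qed
    show "emeasure (interval_measure (\<lambda>t. - P (- t))) {- real n..real n} \<noteq> \<infinity>" for n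
      using emeasure_interval_measure_Icc[of "- real n" "real n" "\<lambda>t. - P (- t)"] monoD[OF m] c by simp
  qed (use eq in auto)
qed

lemma has_stieltjes_integral_reflect:
  assumes "has_stieltjes_integral h K {u..} y"
  shows "has_stieltjes_integral (\<lambda>t. h (- t)) (\<lambda>t. K (- t)) {..- u} (- y)"
proof -
  obtain P N where PN: "mono P" "mono N" "continuous_on UNIV P" "continuous_on UNIV N" "\<And>t. K t = P t - N t"
    and int: "set_integrable (interval_measure P) {u..} h" "set_integrable (interval_measure N) {u..} h"
    and y: "y = (LINT t:{u..}|interval_measure P. h t) - (LINT t:{u..}|interval_measure N. h t)"
    using assms unfolding has_stieltjes_integral_def by auto
  have key: "set_integrable (interval_measure (\<lambda>t. - P (- t))) {..- u} (\<lambda>t. h (- t))"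
    "(LINT t:{..- u}|interval_measure (\<lambda>t. - P (- t)). h (- t)) = (LINT t:{u..}|interval_measure P. h t)"
    if P: "mono P" "continuous_on UNIV P" and i: "set_integrable (interval_measure P) {u..} h" for P
  proof -
    let ?F = "\<lambda>t. indicat_real {u..} t *\<^sub>R h t" and ?G = "\<lambda>t. indicat_real {..- u} t *\<^sub>R h (- t)"
    have F: "integrable (interval_measure P) ?F" using i by (simp add: set_integrable_def)
    then have Fm: "?F \<in> borel_measurable borel"
      using borel_measurable_integrable[OF F] measurable_cong_sets[OF sets_interval_measure refl] by blast
    have um: "uminus \<in> measurable (interval_measure P) borel"
      by measurable
    have "?G = (\<lambda>t. ?F (- t))" by (auto simp: fun_eq_iff indicator_def)
    moreover have "(\<lambda>t. ?F (- t)) \<in> borel_measurable borel"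
      using measurable_compose[OF borel_measurable_uminus[OF measurable_ident] Fm] by simp
    ultimately have Gm: "?G \<in> borel_measurable borel" by simp
    have GF: "(\<lambda>t. ?G (- t)) = ?F" by (auto simp: fun_eq_iff indicator_def)
    show "set_integrable (interval_measure (\<lambda>t. - P (- t))) {..- u} (\<lambda>t. h (- t))"
      unfolding set_integrable_def interval_measure_reflect[OF P] integrable_distr_eq[OF um Gm] GF by (rule F)
    show "(LINT t:{..- u}|interval_measure (\<lambda>t. - P (- t)). h (- t)) = (LINT t:{u..}|interval_measure P. h t)"
      unfolding set_lebesgue_integral_def interval_measure_reflect[OF P] integral_distr[OF um Gm] GF by simp
  qed
  show ?thesis
    unfolding has_stieltjes_integral_def
  proof (intro exI conjI allI)
    let ?P = "\<lambda>t. - N (- t)" and ?N = "\<lambda>t. - P (- t)"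
    show "mono ?P" "mono ?N" using PN(1,2) by (auto simp: mono_def)
    show "continuous_on UNIV ?P" "continuous_on UNIV ?N"
      by (intro continuous_intros continuous_on_compose2[OF PN(3)] continuous_on_compose2[OF PN(4)]; simp)+
    show "K (- t) = ?P t - ?N t" for t using PN(5) by simp
    show "set_integrable (interval_measure ?P) {..- u} (\<lambda>t. h (- t))"
      "set_integrable (interval_measure ?N) {..- u} (\<lambda>t. h (- t))"
      using key PN int by auto
    show "- y = (LINT t:{..- u}|interval_measure ?P. h (- t)) - (LINT t:{..- u}|interval_measure ?N. h (- t))"
      using key PN int y by simp
  qed
qed

text \<open>For a positive increasing weight \<open>\<rho>\<close> and a continuous increasing \<open>P\<close>, the
  increment of \<open>\<integral> \<rho> dP - \<rho> P\<close> agrees with \<open>- P \<integral> d\<rho>\<close> up to second order. This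
  is integration by parts in differential form.\<close>

lemma stieltjes_by_parts:
  fixes \<rho> P :: "real \<Rightarrow> real"
  assumes \<rho>: "\<And>t. \<rho> t > 0" "\<And>s t. s \<le> t \<Longrightarrow> \<rho> s \<le> \<rho> t" "\<And>t. (\<rho> has_real_derivative \<rho>' t) (at t)"
    and \<rho>0: "(\<rho> \<longlongrightarrow> 0) at_bot"
    and P: "mono P" "continuous_on UNIV P"
    and int: "set_integrable (interval_measure P) {..u} \<rho>"
  defines "Z \<equiv> \<lambda>t. (LINT s:{..t}|interval_measure P. \<rho> s) - \<rho> t * P t"
  shows "t \<le> u \<Longrightarrow> (Z has_real_derivative - (\<rho>' t * P t)) (at t within {..u})"
    and "(Z \<longlongrightarrow> 0) at_bot"
proof -
  let ?M = "interval_measure P"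
  define Y where "Y t = (LINT s:{..t}|?M. \<rho> s)" for t
  have Pm: "P s \<le> P t" if "s \<le> t" for s t using P(1) that by (rule monoD)
  have i: "set_integrable ?M {..t} \<rho>" if "t \<le> u" for t
    by (rule set_integrable_subset[OF int]) (use that in auto)
  have em: "emeasure ?M {s<..t} = ennreal (P t - P s)" if "s \<le> t" for s t
    using P that Pm by (intro emeasure_interval_measure_Ioc)
      (auto simp: continuous_on_eq_continuous_at intro: continuous_at_imp_continuous_at_within)
  have me: "measure ?M {s<..t} = P t - P s" if "s \<le> t" for s t
    using em[OF that] Pm[OF that] by (simp add: measure_def)
  have ic: "set_integrable ?M {s<..t} (\<lambda>_. r)" and icv: "(LINT x:{s<..t}|?M. r) = r * (P t - P s)"
    if "s \<le> t" for s t r :: real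
  proof -
    have "integrable ?M (indicat_real {s<..t})"
      using em[OF that] by (intro integrable_real_indicator) auto
    then show "set_integrable ?M {s<..t} (\<lambda>_. r)" unfolding set_integrable_def by simp
    show "(LINT x:{s<..t}|?M. r) = r * (P t - P s)"
      unfolding set_lebesgue_integral_def using me[OF that] by simp
  qed
  have Ybounds: "\<rho> s * (P t - P s) \<le> Y t - Y s" "Y t - Y s \<le> \<rho> t * (P t - P s)" if "s \<le> t" "t \<le> u" for s t
  proof -
    have i2: "set_integrable ?M {s<..t} \<rho>"
      by (rule set_integrable_subset[OF int]) (use that in auto)
    have un: "{..t} = {..s} \<union> {s<..t}" using that by auto
    have "Y t = Y s + (LINT x:{s<..t}|?M. \<rho> x)"
      unfolding Y_def un by (rule set_integral_Un) (use i[of s] i2 that in auto)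
    moreover have "(LINT x:{s<..t}|?M. \<rho> s) \<le> (LINT x:{s<..t}|?M. \<rho> x)"
      by (rule set_integral_mono[OF ic i2]) (use that \<rho>(2) in auto)
    moreover have "(LINT x:{s<..t}|?M. \<rho> x) \<le> (LINT x:{s<..t}|?M. \<rho> t)"
      by (rule set_integral_mono[OF i2 ic]) (use that \<rho>(2) in auto)
    ultimately show "\<rho> s * (P t - P s) \<le> Y t - Y s" "Y t - Y s \<le> \<rho> t * (P t - P s)"
      using that by (simp_all add: icv)
  qed
  have step: "\<bar>Z t - Z s + P s * (\<rho> t - \<rho> s)\<bar> \<le> \<bar>P t - P s\<bar> * \<bar>\<rho> t - \<rho> s\<bar>" if "s \<le> u" "t \<le> u" for s t
  proof -
    have *: "Z b - Z a + P a * (\<rho> b - \<rho> a) \<le> 0" "- ((P b - P a) * (\<rho> b - \<rho> a)) \<le> Z b - Z a + P a * (\<rho> b - \<rho> a)"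
      if "a \<le> b" "b \<le> u" for a b
      using Ybounds[OF that] by (simp_all add: Z_def Y_def[symmetric] algebra_simps)
    have ab: "\<bar>P t - P s\<bar> * \<bar>\<rho> t - \<rho> s\<bar> = (P t - P s) * (\<rho> t - \<rho> s)"
    proof -
      have "0 \<le> (P t - P s) * (\<rho> t - \<rho> s)"
        using Pm[of s t] \<rho>(2)[of s t] Pm[of t s] \<rho>(2)[of t s]
        by (cases "s \<le> t") (simp_all add: mult_nonpos_nonpos)
      then show ?thesis by (simp flip: abs_mult)
    qed
    show ?thesis
    proof (cases "s \<le> t")
      case True
      then show ?thesis using *[of s t] that unfolding ab by (simp add: abs_le_iff)
    next
      case False
      have flip: "A = - X - Q \<Longrightarrow> X \<le> 0 \<Longrightarrow> - Q \<le> X \<Longrightarrow> \<bar>A\<bar> \<le> Q" for A X Q :: real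
        by linarith
      have "\<bar>Z t - Z s + P s * (\<rho> t - \<rho> s)\<bar> \<le> (P s - P t) * (\<rho> s - \<rho> t)"
        by (rule flip[OF _ *[of t s]]) (use that False in \<open>simp_all add: left_diff_distrib right_diff_distrib\<close>)
      also have "\<dots> = (P t - P s) * (\<rho> t - \<rho> s)" by algebra
      finally show ?thesis unfolding ab .
    qed
  qed
  show "(Z has_real_derivative - (\<rho>' t * P t)) (at t within {..u})" if t: "t \<le> u"
    unfolding has_field_derivative_iff
  proof -
    have d\<rho>: "((\<lambda>s. (\<rho> s - \<rho> t) / (s - t)) \<longlongrightarrow> \<rho>' t) (at t within {..u})"
      using has_field_derivative_at_within[OF \<rho>(3)[of t], of "{..u}"] by (simp add: has_field_derivative_iff)
    have cP: "((\<lambda>s. P s - P t) \<longlongrightarrow> 0) (at t within {..u})"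
    proof -
      have "(P \<longlongrightarrow> P t) (at t)" using P(2) by (simp add: continuous_on_eq_continuous_at isCont_def)
      then have "(P \<longlongrightarrow> P t) (at t within {..u})" by (rule tendsto_within_subset) (rule subset_UNIV)
      then show ?thesis by (rule LIM_zero)
    qed
    have "((\<lambda>s. \<bar>P s - P t\<bar> * \<bar>(\<rho> s - \<rho> t) / (s - t)\<bar>) \<longlongrightarrow> 0 * \<bar>\<rho>' t\<bar>) (at t within {..u})"
      by (rule tendsto_mult[OF tendsto_rabs_zero[OF cP] tendsto_rabs[OF d\<rho>]])
    then have bound0: "((\<lambda>s. \<bar>P s - P t\<bar> * \<bar>(\<rho> s - \<rho> t) / (s - t)\<bar>) \<longlongrightarrow> 0) (at t within {..u})" by simp
    have rem: "((\<lambda>s. (Z s - Z t) / (s - t) + P t * ((\<rho> s - \<rho> t) / (s - t))) \<longlongrightarrow> 0) (at t within {..u})"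
    proof (rule Lim_null_comparison[OF _ bound0])
      have "\<forall>\<^sub>F s in at t within {..u}. s \<in> {..u}" by (auto simp: eventually_at_filter)
      then show "\<forall>\<^sub>F s in at t within {..u}. norm ((Z s - Z t) / (s - t) + P t * ((\<rho> s - \<rho> t) / (s - t)))
          \<le> \<bar>P s - P t\<bar> * \<bar>(\<rho> s - \<rho> t) / (s - t)\<bar>"
      proof eventually_elim
        case (elim s)
        have "(Z s - Z t) / (s - t) + P t * ((\<rho> s - \<rho> t) / (s - t)) = (Z s - Z t + P t * (\<rho> s - \<rho> t)) / (s - t)"
          by (simp add: add_divide_distrib)
        moreover have "\<bar>(Z s - Z t + P t * (\<rho> s - \<rho> t)) / (s - t)\<bar> \<le> \<bar>P s - P t\<bar> * \<bar>\<rho> s - \<rho> t\<bar> / \<bar>s - t\<bar>"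
          unfolding abs_divide by (rule divide_right_mono) (use step[of t s] t elim in auto)
        ultimately show ?case by simp
      qed
    qed
    have "((\<lambda>s. ((Z s - Z t) / (s - t) + P t * ((\<rho> s - \<rho> t) / (s - t))) - P t * ((\<rho> s - \<rho> t) / (s - t)))
        \<longlongrightarrow> 0 - P t * \<rho>' t) (at t within {..u})"
      by (intro tendsto_diff rem tendsto_mult tendsto_const d\<rho>)
    then show "((\<lambda>s. (Z s - Z t) / (s - t)) \<longlongrightarrow> - (\<rho>' t * P t)) (at t within {..u})"
      by (simp add: mult.commute)
  qed
  have Y_nonneg: "Y t \<ge> 0" for t
    unfolding Y_def set_lebesgue_integral_def
    by (rule Bochner_Integration.integral_nonneg) (simp add: indicator_def less_imp_le[OF \<rho>(1)])
  have Y_mono: "Y s \<le> Y t" if "s \<le> t" "t \<le> u" for s t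
  proof -
    have "0 \<le> \<rho> s * (P t - P s)"
      using \<rho>(1)[of s] Pm[OF that(1)] by (intro mult_nonneg_nonneg) linarith+
    then show ?thesis using Ybounds(1)[OF that] by linarith
  qed
  have Y0: "(Y \<longlongrightarrow> 0) at_bot"
  proof (rule tendstoI)
    fix \<eta> :: real assume "\<eta> > 0"
    have "(\<lambda>n. LINT s:{..u - real n}|?M. \<rho> s) \<longlonglongrightarrow> (LINT s:(\<Inter>n. {..u - real n})|?M. \<rho> s)"
      by (rule set_integral_cont_down) (use int in \<open>auto simp: decseq_def\<close>)
    moreover have "(\<Inter>n. {..u - real n}) = {}"
    proof -
      have "\<exists>n. \<not> x \<le> u - real n" for x using reals_Archimedean2[of "u - x"] by (auto simp: not_le algebra_simps)
      then show ?thesis by auto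
    qed
    ultimately have "(\<lambda>n. Y (u - real n)) \<longlonglongrightarrow> 0" by (simp add: Y_def set_lebesgue_integral_def)
    from tendstoD[OF this \<open>\<eta> > 0\<close>] obtain n where n: "\<bar>Y (u - real n)\<bar> < \<eta>"
      by (auto simp: eventually_sequentially dist_real_def)
    have "\<forall>\<^sub>F t in at_bot. t \<le> u - real n" by (rule eventually_le_at_bot)
    then show "\<forall>\<^sub>F t in at_bot. dist (Y t) 0 < \<eta>"
    proof eventually_elim
      case (elim t)
      then show ?case using Y_mono[OF elim] Y_nonneg[of t] n by (simp add: dist_real_def)
    qed
  qed
  have "((\<lambda>t. \<rho> t * P t) \<longlongrightarrow> 0) at_bot"
  proof (rule tendstoI)
    fix \<eta> :: real assume "\<eta> > 0"
    then have "\<forall>\<^sub>F t in at_bot. \<bar>Y t\<bar> < \<eta> / 2" using tendstoD[OF Y0, of "\<eta> / 2"] by (simp add: dist_real_def)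
    then obtain c0 where c0: "\<And>t. t \<le> c0 \<Longrightarrow> \<bar>Y t\<bar> < \<eta> / 2" by (auto simp: eventually_at_bot_linorder)
    define c where "c = min c0 u"
    have "((\<lambda>t. \<rho> t * \<bar>P c\<bar>) \<longlongrightarrow> 0) at_bot" using tendsto_mult_left_zero[OF \<rho>0] by simp
    then have "\<forall>\<^sub>F t in at_bot. dist (\<rho> t * \<bar>P c\<bar>) 0 < \<eta> / 2" using \<open>\<eta> > 0\<close> by (intro tendstoD) auto
    moreover have "\<forall>\<^sub>F t in at_bot. t \<le> c" by (rule eventually_le_at_bot)
    ultimately show "\<forall>\<^sub>F t in at_bot. dist (\<rho> t * P t) 0 < \<eta>"
    proof eventually_elim
      case (elim t)
      have "\<rho> t * (P c - P t) \<le> Y c - Y t" using Ybounds(1)[OF elim(2)] by (simp add: c_def)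
      moreover have "0 \<le> \<rho> t * (P c - P t)" using \<rho>(1)[of t] Pm[OF elim(2)] by simp
      moreover have "\<bar>Y c\<bar> < \<eta> / 2" using c0 by (simp add: c_def)
      moreover have "\<bar>\<rho> t * P c\<bar> < \<eta> / 2" using elim(1) \<rho>(1)[of t] by (simp add: abs_mult dist_real_def)
      moreover have "\<rho> t * P t = \<rho> t * P c - \<rho> t * (P c - P t)" by (simp add: algebra_simps)
      ultimately show ?case using Y_nonneg[of t] by (simp add: dist_real_def)
    qed
  qed
  from tendsto_diff[OF Y0 this] show "(Z \<longlongrightarrow> 0) at_bot" by (simp add: Z_def Y_def)
qed

text \<open>The function \<open>\<beta>\<close> is determined by a linear equation up to a multiple of \<open>1 / \<rho>\<close>.
  The integral formula at a single point singles out the solution for which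
  \<open>\<rho> \<beta>\<close> vanishes at minus infinity.\<close>

lemma stieltjes_solution_tendsto_0:
  assumes \<rho>: "\<And>t. \<rho> t > 0" "\<And>s t. s \<le> t \<Longrightarrow> \<rho> s \<le> \<rho> t" "\<And>t. (\<rho> has_real_derivative \<rho>' t) (at t)"
    and \<rho>0: "(\<rho> \<longlongrightarrow> 0) at_bot"
    and ode: "\<And>t. t \<le> u \<Longrightarrow> ((\<lambda>t. \<rho> t * \<beta> t) has_real_derivative \<rho>' t * K t) (at t within {..u})"
    and st: "has_stieltjes_integral h K {..u} y" and h: "\<And>t. t \<le> u \<Longrightarrow> h t = \<rho> t / \<rho> u"
    and \<beta>u: "\<beta> u = K u - y"
  shows "((\<lambda>t. \<rho> t * \<beta> t) \<longlongrightarrow> 0) at_bot"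
proof -
  obtain P N where PN: "mono P" "mono N" "continuous_on UNIV P" "continuous_on UNIV N" "\<And>t. K t = P t - N t"
    and int: "set_integrable (interval_measure P) {..u} h" "set_integrable (interval_measure N) {..u} h"
    and y: "y = (LINT t:{..u}|interval_measure P. h t) - (LINT t:{..u}|interval_measure N. h t)"
    using st unfolding has_stieltjes_integral_def by auto
  have conv: "set_integrable (interval_measure Q) {..u} \<rho>"
    "(LINT t:{..u}|interval_measure Q. \<rho> t) = \<rho> u * (LINT t:{..u}|interval_measure Q. h t)"
    if "set_integrable (interval_measure Q) {..u} h" for Q
  proof -
    have eq: "\<rho> t = \<rho> u * h t" if t: "t \<in> {..u}" for t
    proof -
      have "h t = \<rho> t / \<rho> u" using t by (intro h) simp
      then show ?thesis using \<rho>(1)[of u] by simp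
    qed
    have "set_integrable (interval_measure Q) {..u} (\<lambda>t. \<rho> u * h t)"
      by (rule set_integrable_mult_right) (rule that)
    moreover have "set_integrable (interval_measure Q) {..u} (\<lambda>t. \<rho> u * h t) = set_integrable (interval_measure Q) {..u} \<rho>"
      by (rule set_integrable_cong[OF refl refl]) (rule eq[symmetric])
    ultimately show "set_integrable (interval_measure Q) {..u} \<rho>" by (simp only:)
    have "(LINT t:{..u}|interval_measure Q. \<rho> t) = (LINT t:{..u}|interval_measure Q. \<rho> u * h t)"
      by (rule set_lebesgue_integral_cong) (simp, intro allI impI, rule eq)
    also have "\<dots> = \<rho> u * (LINT t:{..u}|interval_measure Q. h t)" by (rule set_integral_mult_right)
    finally show "(LINT t:{..u}|interval_measure Q. \<rho> t) = \<rho> u * (LINT t:{..u}|interval_measure Q. h t)" .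
  qed
  define ZP ZN where "ZP t = (LINT s:{..t}|interval_measure P. \<rho> s) - \<rho> t * P t"
    and "ZN t = (LINT s:{..t}|interval_measure N. \<rho> s) - \<rho> t * N t" for t
  note zP = stieltjes_by_parts[OF \<rho> \<rho>0 PN(1,3) conv(1)[OF int(1)], folded ZP_def]
  note zN = stieltjes_by_parts[OF \<rho> \<rho>0 PN(2,4) conv(1)[OF int(2)], folded ZN_def]
  have d: "((\<lambda>t. ZP t - ZN t + \<rho> t * \<beta> t) has_real_derivative 0) (at t within {..u})" if "t \<in> {..u}" for t
  proof -
    have "((\<lambda>t. ZP t - ZN t + \<rho> t * \<beta> t) has_real_derivative
        - (\<rho>' t * P t) - - (\<rho>' t * N t) + \<rho>' t * K t) (at t within {..u})"
      by (intro DERIV_add DERIV_diff zP zN ode) (use that in auto)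
    then show ?thesis by (simp add: PN(5) algebra_simps)
  qed
  obtain c where c: "\<And>t. t \<in> {..u} \<Longrightarrow> ZP t - ZN t + \<rho> t * \<beta> t = c"
    using has_field_derivative_zero_constant[OF convex_real_interval(2) d] by blast
  have "\<rho> u * \<beta> u = \<rho> u * (P u - N u) - \<rho> u * y" unfolding \<beta>u PN(5) by (simp add: algebra_simps)
  then have "ZP u - ZN u + \<rho> u * \<beta> u = 0"
    unfolding ZP_def ZN_def conv(2)[OF int(1)] conv(2)[OF int(2)] y by (simp add: algebra_simps)
  with c[of u] have "c = 0" by simp
  have "((\<lambda>t. ZN t - ZP t) \<longlongrightarrow> 0 - 0) at_bot" by (intro tendsto_diff zP(2) zN(2))
  moreover have "\<forall>\<^sub>F t in at_bot. ZN t - ZP t = \<rho> t * \<beta> t"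
    using eventually_le_at_bot[of u]
  proof eventually_elim
    case (elim t)
    then show ?case using c[of t] \<open>c = 0\<close> by simp
  qed
  ultimately have "((\<lambda>t. \<rho> t * \<beta> t) \<longlongrightarrow> 0 - 0) at_bot" by (rule Lim_transform_eventually)
  then show ?thesis by simp
qed

section \<open>The value along a fan of right tangents\<close>

context strip
begin

text \<open>The slope of \<open>f\<close> against the first coordinate, its derivative, and the value
  prescribed at the point of tangency.\<close>

definition k3 :: "(real \<Rightarrow> real) \<Rightarrow> real \<Rightarrow> real" where
  "k3 f' t = f' t / dg t $ 1"

definition dk3 :: "(real \<Rightarrow> real) \<Rightarrow> (real \<Rightarrow> real) \<Rightarrow> real \<Rightarrow> real" where
  "dk3 f' f'' t = (f'' t * dg t $ 1 - f' t * ddg t $ 1) / (dg t $ 1)\<^sup>2"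

definition fan_value :: "(real \<Rightarrow> real) \<Rightarrow> (real \<Rightarrow> real) \<Rightarrow> (real \<Rightarrow> real) \<Rightarrow> real \<Rightarrow> real" where
  "fan_value f f' \<beta> t = f t + (wR t $ 1 - g t $ 1) *
     (k3 f' t + (free.slope (sR t) - fixed.slope t) * \<beta> t)"

lemma k3_deriv:
  assumes "(f' has_real_derivative f'' t) (at t)"
  shows "(k3 f' has_real_derivative dk3 f' f'' t) (at t)"
proof -
  have "((\<lambda>t. f' t / dg t $ 1) has_real_derivative dk3 f' f'' t) (at t)"
    unfolding dk3_def by (auto intro!: derivative_eq_intros assms fixed.deriv2_nth simp: power2_eq_square)
  then show ?thesis by (simp add: k3_def[abs_def])
qed

lemma slope_along_fan_deriv:
  "((\<lambda>t. free.slope (sR t)) has_real_derivative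
     dg t $ 1 * (fixed.slope t - free.slope (sR t)) / (g t $ 1 - wR t $ 1)) (at t)"
proof -
  have "((\<lambda>t. free.slope (sR t)) has_real_derivative free.dslope (sR t) * dsR t) (at t)"
    by (rule DERIV_chain2[OF free.slope_deriv sR_deriv])
  moreover have "free.dslope (sR t) * dsR t = dg t $ 1 * (fixed.slope t - free.slope (sR t)) / (g t $ 1 - wR t $ 1)"
    using free.dslope_pos[of "sR t"] by (simp add: dsR_def wR_def)
  ultimately show ?thesis by simp
qed

lemma wR1_deriv: "((\<lambda>t. wR t $ 1) has_real_derivative lamR t * (g t $ 1 - wR t $ 1)) (at t)"
  using has_real_derivative_nth[OF wR_deriv[of t], of 1] by simp

text \<open>The equation for \<open>\<beta>\<close> is the one under which the value at the point of tangency behaves like the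
  average of \<open>f\<close> along the clock.\<close>

lemma fan_value_deriv:
  assumes f: "(f has_real_derivative f' t) (at t)" and f': "(f' has_real_derivative f'' t) (at t)"
    and \<beta>: "(\<beta> has_real_derivative \<beta>' t) (at t)"
    and ode: "(fixed.slope t - free.slope (sR t)) * \<beta>' t + fixed.dslope t * \<beta> t = dk3 f' f'' t"
  shows "(fan_value f f' \<beta> has_real_derivative lamR t * (f t - fan_value f f' \<beta> t)) (at t)"
proof -
  define L k k2 p where "L = g t $ 1 - wR t $ 1" and "k = free.slope (sR t)" and "k2 = fixed.slope t"
    and "p = k3 f' t + (k - k2) * \<beta> t"
  have L: "L > 0" using wR_less[of t] by (simp add: L_def)
  have dp: "((\<lambda>t. k3 f' t + (free.slope (sR t) - fixed.slope t) * \<beta> t) has_real_derivative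
      dg t $ 1 * (k2 - k) / L * \<beta> t) (at t)"
  proof -
    have "((\<lambda>t. k3 f' t + (free.slope (sR t) - fixed.slope t) * \<beta> t) has_real_derivative
      dk3 f' f'' t + ((k - k2) * \<beta>' t + (dg t $ 1 * (k2 - k) / L - fixed.dslope t) * \<beta> t)) (at t)"
      unfolding L_def k_def k2_def
      by (rule DERIV_add[OF k3_deriv[where f'=f' and f''=f'', OF f'] DERIV_mult'[OF DERIV_diff[OF slope_along_fan_deriv fixed.slope_deriv] \<beta>]])
    moreover have "dk3 f' f'' t + ((k - k2) * \<beta>' t + (dg t $ 1 * (k2 - k) / L - fixed.dslope t) * \<beta> t)
        = dg t $ 1 * (k2 - k) / L * \<beta> t"
      unfolding ode[symmetric] k_def k2_def by (simp add: left_diff_distrib)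
    ultimately show ?thesis by simp
  qed
  have "(fan_value f f' \<beta> has_real_derivative
      f' t + ((wR t $ 1 - g t $ 1) * (dg t $ 1 * (k2 - k) / L * \<beta> t) + (lamR t * L - dg t $ 1) * p)) (at t)"
    unfolding fan_value_def[abs_def] L_def p_def k_def k2_def
    using DERIV_add[OF f DERIV_mult'[OF DERIV_diff[OF wR1_deriv fixed.deriv_nth[of 1]] dp]]
    by (simp add: L_def k_def k2_def)
  moreover have "f' t + ((wR t $ 1 - g t $ 1) * (dg t $ 1 * (k2 - k) / L * \<beta> t) + (lamR t * L - dg t $ 1) * p)
      = lamR t * (f t - fan_value f f' \<beta> t)"
  proof -
    have "wR t $ 1 - g t $ 1 = - L" by (simp add: L_def)
    then have "(wR t $ 1 - g t $ 1) * (dg t $ 1 * (k2 - k) / L * \<beta> t) = - (dg t $ 1 * (k2 - k) * \<beta> t)"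
      using L by simp
    moreover have "f' t = k3 f' t * dg t $ 1" by (simp add: k3_def)
    moreover have "f t - fan_value f f' \<beta> t = L * p"
      unfolding fan_value_def L_def p_def k_def k2_def by (simp only: left_diff_distrib)
    moreover have "k3 f' t * dg t $ 1 + (- (dg t $ 1 * (k2 - k) * \<beta> t) + (lamR t * L - dg t $ 1) * p)
        = lamR t * (L * p)"
      unfolding p_def by algebra
    ultimately show ?thesis by (simp only:)
  qed
  ultimately show ?thesis by (simp only:)
qed

lemma continuous_on_fan_value:
  assumes "continuous_on S f" "continuous_on S f'" "continuous_on S \<beta>"
  shows "continuous_on S (fan_value f f' \<beta>)"
  unfolding fan_value_def[abs_def] k3_def
  by (intro continuous_intros assms cont_wR fixed.cont_c fixed.cont_dc fixed.cont_slope
      continuous_on_compose2[OF free.cont_slope cont_sR]) (use fixed.dc1_nz in auto)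

text \<open>With \<open>N = \<tau> (g\<^sub>1 - w\<^sub>1)\<close> and \<open>\<rho> = N (\<kappa>\<^sub>2 - \<kappa>)\<close> one has \<open>\<rho>' = N \<kappa>\<^sub>2'\<close>,
  so that \<open>\<rho>\<close> is the integrating factor of the equation for \<open>\<beta>\<close>.\<close>

definition fan_weight :: "(real \<Rightarrow> real) \<Rightarrow> real \<Rightarrow> real" where
  "fan_weight \<tau> t = \<tau> t * (g t $ 1 - wR t $ 1) * (fixed.slope t - free.slope (sR t))"

context
  fixes \<tau> v
  assumes ck: "clock \<tau> (\<lambda>t. lamR t * \<tau> t) v"
begin

interpretation clock \<tau> "\<lambda>t. lamR t * \<tau> t" v by (rule ck)

lemma clock_gap_pos: "\<tau> t * (g t $ 1 - wR t $ 1) > 0"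
  using \<tau>_pos[of t] wR_less[of t] by simp

lemma clock_gap_deriv: "((\<lambda>t. \<tau> t * (g t $ 1 - wR t $ 1)) has_real_derivative \<tau> t * dg t $ 1) (at t)"
  using DERIV_mult'[OF \<tau>_deriv[of t] DERIV_diff[OF fixed.deriv_nth[of 1 t] wR1_deriv[of t]]]
  by (simp add: algebra_simps)

lemma clock_gap_mono: "s \<le> t \<Longrightarrow> \<tau> s * (g s $ 1 - wR s $ 1) \<le> \<tau> t * (g t $ 1 - wR t $ 1)"
proof -
  assume "s \<le> t"
  have "\<exists>y. ((\<lambda>t. \<tau> t * (g t $ 1 - wR t $ 1)) has_real_derivative y) (at x) \<and> 0 \<le> y" for x
    using clock_gap_deriv[of x] \<tau>_pos[of x] fixed.dc_pos[of x]
    by (intro exI[of _ "\<tau> x * dg x $ 1"]) simp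
  then show ?thesis by (intro DERIV_nonneg_imp_nondecreasing[OF \<open>s \<le> t\<close>])
qed

lemma fan_weight_pos: "fan_weight \<tau> t > 0"
  unfolding fan_weight_def using clock_gap_pos[of t] slope_sR_less[of t] by simp

lemma fan_weight_deriv:
  "(fan_weight \<tau> has_real_derivative \<tau> t * (g t $ 1 - wR t $ 1) * fixed.dslope t) (at t)"
proof -
  let ?L = "g t $ 1 - wR t $ 1" and ?D = "fixed.slope t - free.slope (sR t)"
  have L: "?L > 0" using wR_less[of t] by simp
  have "(fan_weight \<tau> has_real_derivative
      \<tau> t * ?L * (fixed.dslope t - dg t $ 1 * ?D / ?L) + \<tau> t * dg t $ 1 * ?D) (at t)"
    unfolding fan_weight_def[abs_def]
    by (rule DERIV_mult'[OF clock_gap_deriv DERIV_diff[OF fixed.slope_deriv slope_along_fan_deriv]])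
  moreover have "\<tau> t * ?L * (fixed.dslope t - dg t $ 1 * ?D / ?L) + \<tau> t * dg t $ 1 * ?D
      = \<tau> t * ?L * fixed.dslope t"
  proof -
    have "a * l * (b - r / l) + a * r = a * l * b" if "l \<noteq> 0" for a b r l :: real
      using that by (simp add: field_simps)
    from this[of ?L "\<tau> t" "fixed.dslope t" "dg t $ 1 * ?D"] L show ?thesis
      by (simp only: mult.assoc)
  qed
  ultimately show ?thesis by simp
qed

lemma fan_weight_mono: "s \<le> t \<Longrightarrow> fan_weight \<tau> s \<le> fan_weight \<tau> t"
proof -
  assume "s \<le> t"
  have "\<exists>y. (fan_weight \<tau> has_real_derivative y) (at x) \<and> 0 \<le> y" for x
    using fan_weight_deriv[of x] clock_gap_pos[of x] fixed.dslope_pos[of x]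
    by (intro exI[of _ "\<tau> x * (g x $ 1 - wR x $ 1) * fixed.dslope x"]) simp
  then show ?thesis by (intro DERIV_nonneg_imp_nondecreasing[OF \<open>s \<le> t\<close>])
qed

context
  assumes decay: "((\<lambda>t. (1 + norm (wR t - g t)) * \<tau> t) \<longlongrightarrow> 0) at_bot"
begin

lemma clock_tendsto_0: "(\<tau> \<longlongrightarrow> 0) at_bot"
  by (rule Lim_null_comparison[OF _ decay])
    (use \<tau>_pos in \<open>auto intro!: always_eventually mult_right_mono simp: distrib_right less_imp_le\<close>)

lemma clock_difference_tendsto_0: "((\<lambda>t. \<tau> t * (wR t $ i - g t $ i)) \<longlongrightarrow> 0) at_bot"
proof (rule Lim_null_comparison[OF _ decay])
  have "norm (\<tau> t * (wR t $ i - g t $ i)) \<le> (1 + norm (wR t - g t)) * \<tau> t" for t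
  proof -
    have "norm (\<tau> t * (wR t $ i - g t $ i)) = \<bar>(wR t - g t) $ i\<bar> * \<tau> t"
      using \<tau>_pos[of t] by (simp add: abs_mult)
    also have "\<dots> \<le> (1 + norm (wR t - g t)) * \<tau> t"
      using \<tau>_pos[of t] component_le_norm_cart[of "wR t - g t" i] by (intro mult_right_mono) auto
    finally show ?thesis .
  qed
  then show "\<forall>\<^sub>F t in at_bot. norm (\<tau> t * (wR t $ i - g t $ i)) \<le> (1 + norm (wR t - g t)) * \<tau> t"
    by (intro always_eventually allI)
qed

lemma clock_gap_tendsto_0: "((\<lambda>t. \<tau> t * (g t $ 1 - wR t $ 1)) \<longlongrightarrow> 0) at_bot"
  using tendsto_minus[OF clock_difference_tendsto_0[of 1]] by (simp add: algebra_simps)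

text \<open>Being monotone and positive, the weight has a limit at minus infinity. Hence
  \<open>\<integral> N \<kappa>\<^sub>2'\<close> converges there and \<open>N \<kappa>\<^sub>2\<close> vanishes, while \<open>N \<kappa> = \<tau> (g\<^sub>2 - w\<^sub>2)\<close>
  vanishes by the decay of the domain.\<close>

lemma fan_weight_tendsto_0: "(fan_weight \<tau> \<longlongrightarrow> 0) at_bot"
proof -
  define l where "l = Inf (range (fan_weight \<tau>))"
  have bdd: "bdd_below (range (fan_weight \<tau>))"
    using fan_weight_pos by (intro bdd_belowI[of _ 0]) (auto intro: less_imp_le)
  have "(fan_weight \<tau> \<longlongrightarrow> l) at_bot"
  proof (rule tendstoI)
    fix \<eta> :: real assume "\<eta> > 0"
    then obtain c where c: "fan_weight \<tau> c < l + \<eta>"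
      using cInf_lessD[of "range (fan_weight \<tau>)" "l + \<eta>"] unfolding l_def by auto
    have "\<forall>\<^sub>F t in at_bot. t \<le> c" by (rule eventually_le_at_bot)
    then show "\<forall>\<^sub>F t in at_bot. dist (fan_weight \<tau> t) l < \<eta>"
    proof eventually_elim
      case (elim t)
      have "l \<le> fan_weight \<tau> t" unfolding l_def using bdd by (intro cInf_lower) auto
      then show ?case using fan_weight_mono[OF elim] c by (simp add: dist_real_def)
    qed
  qed
  then have q: "((\<lambda>t. l - fan_weight \<tau> t) \<longlongrightarrow> 0) at_bot"
    using tendsto_diff[OF tendsto_const, of "fan_weight \<tau>" l at_bot l] by simp
  have "((\<lambda>t. \<tau> t * (g t $ 1 - wR t $ 1) * fixed.slope t) \<longlongrightarrow> 0) at_bot"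
  proof (rule weight_times_primitive_tendsto_0[OF clock_gap_mono clock_gap_pos clock_gap_tendsto_0 q])
    fix t
    show "((\<lambda>t. l - fan_weight \<tau> t) has_real_derivative - (\<tau> t * (g t $ 1 - wR t $ 1) * fixed.dslope t)) (at t)"
      using DERIV_diff[OF DERIV_const fan_weight_deriv[of t]] by simp
  qed (auto intro: fixed.slope_deriv sign_at_bot_pos fixed.dslope_pos)
  moreover have "\<tau> t * (wR t $ 2 - g t $ 2) = - (\<tau> t * (g t $ 1 - wR t $ 1) * free.slope (sR t))" for t
  proof -
    have "wR t $ 2 - g t $ 2 = - (free.slope (sR t) * (g t $ 1 - wR t $ 1))"
      using tangent_slope_eq[of t] by linarith
    then show ?thesis by simp
  qed
  with clock_difference_tendsto_0[of 2]
  have "((\<lambda>t. - (\<tau> t * (g t $ 1 - wR t $ 1) * free.slope (sR t))) \<longlongrightarrow> 0) at_bot" by simp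
  ultimately have "((\<lambda>t. \<tau> t * (g t $ 1 - wR t $ 1) * fixed.slope t
      + - (\<tau> t * (g t $ 1 - wR t $ 1) * free.slope (sR t))) \<longlongrightarrow> 0 + 0) at_bot"
    by (rule tendsto_add)
  then show ?thesis by (simp add: fan_weight_def[abs_def] right_diff_distrib)
qed

text \<open>The summability needed for an optimizer coming from minus infinity: it suffices that
  \<open>\<rho> \<beta>\<close> vanishes there.\<close>

lemma left_opt_fan_value_from_infinity:
  assumes f: "\<And>t. (f has_real_derivative f' t) (at t)" and f': "\<And>t. (f' has_real_derivative f'' t) (at t)"
    and sign: "sign_at_bot (\<lambda>t. dk3 f' f'' t / fixed.dslope t)"
    and c\<beta>: "continuous_on {..u} \<beta>" and \<beta>: "\<And>t. t < u \<Longrightarrow> (\<beta> has_real_derivative \<beta>' t) (at t)"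
    and ode: "\<And>t. t < u \<Longrightarrow> (fixed.slope t - free.slope (sR t)) * \<beta>' t + fixed.dslope t * \<beta> t = dk3 f' f'' t"
    and \<rho>\<beta>: "((\<lambda>t. fan_weight \<tau> t * \<beta> t) \<longlongrightarrow> 0) at_bot"
  shows "left_opt f (sR u) (wR u) (fan_value f f' \<beta> u)"
proof -
  have dk3_eq: "(\<lambda>t. dk3 f' f'' t / fixed.dslope t * fixed.dslope t) = dk3 f' f''"
    using fixed.dslope_pos by (auto simp: fun_eq_iff less_imp_neq[symmetric])
  have s_dk3: "sign_at_bot (dk3 f' f'')"
    using sign_at_bot_mult[OF sign sign_at_bot_pos[of fixed.dslope, OF fixed.dslope_pos]]
    unfolding dk3_eq .
  have s_f': "sign_at_bot f'"
  proof -
    have "sign_at_bot (k3 f')" using sign_at_bot_deriv[OF k3_deriv[OF f'] s_dk3] .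
    from sign_at_bot_mult[OF this sign_at_bot_pos[of "\<lambda>t. dg t $ 1"]] fixed.dc_pos
    have "sign_at_bot (\<lambda>t. k3 f' t * dg t $ 1)" by simp
    then show ?thesis by (simp add: k3_def)
  qed
  have s_g2: "sign_at_bot (\<lambda>t. dg t $ 2)"
  proof -
    have "sign_at_bot fixed.slope"
      by (rule sign_at_bot_deriv[OF fixed.slope_deriv]) (auto intro: sign_at_bot_pos fixed.dslope_pos)
    from sign_at_bot_mult[OF this sign_at_bot_pos[of "\<lambda>t. dg t $ 1"]] fixed.dc_pos
    show ?thesis by (simp flip: fixed.dc2_eq)
  qed
  have Nk3: "((\<lambda>t. \<tau> t * (g t $ 1 - wR t $ 1) * k3 f' t) \<longlongrightarrow> 0) at_bot"
  proof (rule weight_times_primitive_tendsto_0[OF clock_gap_mono clock_gap_pos clock_gap_tendsto_0 _ _ k3_deriv[OF f'] s_dk3])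
    show "((\<lambda>t. - (fan_weight \<tau> t * \<beta> t)) \<longlongrightarrow> 0) at_bot" using tendsto_minus[OF \<rho>\<beta>] by simp
    fix t assume t: "t < u"
    have "((\<lambda>t. - (fan_weight \<tau> t * \<beta> t)) has_real_derivative
        - (fan_weight \<tau> t * \<beta>' t + \<tau> t * (g t $ 1 - wR t $ 1) * fixed.dslope t * \<beta> t)) (at t)"
      by (rule DERIV_minus[OF DERIV_mult'[OF fan_weight_deriv \<beta>[OF t]]])
    then show "((\<lambda>t. - (fan_weight \<tau> t * \<beta> t)) has_real_derivative
        - (\<tau> t * (g t $ 1 - wR t $ 1) * dk3 f' f'' t)) (at t)"
      unfolding ode[OF t, symmetric] fan_weight_def by (simp add: distrib_left mult.assoc)
  qed
  have m0: "((\<lambda>t. \<tau> t * (fan_value f f' \<beta> t - f t)) \<longlongrightarrow> 0) at_bot"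
  proof -
    have "\<tau> t * (fan_value f f' \<beta> t - f t) = fan_weight \<tau> t * \<beta> t - \<tau> t * (g t $ 1 - wR t $ 1) * k3 f' t" for t
      by (simp add: fan_value_def fan_weight_def algebra_simps)
    then show ?thesis using tendsto_diff[OF \<rho>\<beta> Nk3] by simp
  qed
  show ?thesis
  proof (rule left_opt_fan_from_infinity[OF ck clock_tendsto_0 clock_difference_tendsto_0 m0 _ _ f s_f' s_g2])
    show "continuous_on {..u} (fan_value f f' \<beta>)"
      by (intro continuous_on_fan_value c\<beta> continuous_at_imp_continuous_on ballI DERIV_isCont[OF f] DERIV_isCont[OF f'])
    show "(fan_value f f' \<beta> has_real_derivative lamR t * (f t - fan_value f f' \<beta> t)) (at t)" if "t < u" for t
      by (rule fan_value_deriv[where f=f and f'=f' and f''=f'' and \<beta>=\<beta> and \<beta>'=\<beta>', OF f f' \<beta>[OF that] ode[OF that]])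
  qed
qed

end

end

end

section \<open>Joining optimizers from the two sides\<close>

lemma absolutely_integrable_reverse:
  fixes \<psi> :: "real \<Rightarrow> 'a::euclidean_space"
  assumes "\<psi> absolutely_integrable_on {0..T}"
  shows "(\<lambda>x. \<psi> (T - x)) absolutely_integrable_on {0..T}"
proof -
  have "(\<lambda>x. \<psi> (- x)) absolutely_integrable_on {- T..- 0}"
    using assms by (subst absolutely_integrable_reflect_real)
  from absolutely_integrable_affine[OF this, of 1 "- T"] show ?thesis by simp
qed

lemma integral_reverse:
  fixes \<psi> :: "real \<Rightarrow> 'a::euclidean_space"
  assumes "\<psi> absolutely_integrable_on {0..T}" and q: "0 \<le> q" "q \<le> T"
  shows "integral {0..q} (\<lambda>x. \<psi> (T - x)) = integral {0..T} \<psi> - integral {0..T - q} \<psi>"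
proof -
  have i: "\<psi> integrable_on {0..T}" using assms(1) by (simp add: absolutely_integrable_on_def)
  have "\<psi> integrable_on {T - q..T}" by (rule integrable_on_subinterval[OF i]) (use q in auto)
  then have "(\<psi> has_integral integral {T - q..T} \<psi>) {T - q..T}" by (rule integrable_integral)
  then have refl: "((\<lambda>x. \<psi> (- x)) has_integral integral {T - q..T} \<psi>) {- T..- (T - q)}"
    by (rule has_integral_reflect_lemma_real)
  then have "(\<lambda>x. \<psi> (- x)) integrable_on {- T..- (T - q)}" by (rule has_integral_integrable)
  from integral_affine_real[OF this, of 1 "- T"]
  have "integral {0..q} (\<lambda>x. \<psi> (T - x)) = integral {- T..- (T - q)} (\<lambda>x. \<psi> (- x))" by simp
  also have "\<dots> = integral {T - q..T} \<psi>" using refl by (rule integral_unique)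
  also have "\<dots> = integral {0..T} \<psi> - integral {0..T - q} \<psi>"
    using Henstock_Kurzweil_Integration.integral_combine[of 0 "T - q" T \<psi>] q i
    by (simp add: eq_diff_eq add.commute)
  finally show ?thesis .
qed

context strip
begin

text \<open>Optimizers leaning to the other side, expressed through the reflected strip.\<close>

definition right_opt :: "(real \<Rightarrow> real) \<Rightarrow> real \<Rightarrow> real^2 \<Rightarrow> real \<Rightarrow> bool" where
  "right_opt f s z v \<longleftrightarrow> strip.left_opt (refl_curve g) (refl_curve h) (refl_deriv dh)
     (\<lambda>t. f (- t)) (- s) (refl_pt z) v"

text \<open>An optimizer of the reflected strip, read backwards, is an optimizer of the strip; what was known about initial
  intervals now holds for final ones.\<close>

lemma right_opt_reversed:
  assumes "right_opt f s z v"
  obtains \<beta> T where "opt f \<beta> T z v"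
    and "\<And>q. 0 \<le> q \<Longrightarrow> q \<le> T \<Longrightarrow> (T - q) * free.height s z \<le> excess s (T *\<^sub>R z - mom \<beta> q) (T - q)"
proof -
  interpret r: strip "refl_curve g" "refl_deriv dg" "refl_curve ddg" "refl_curve h" "refl_deriv dh" "refl_curve ddh"
    by (rule strip_refl)
  obtain \<alpha> T where \<alpha>: "r.opt (\<lambda>t. f (- t)) \<alpha> T (refl_pt z) v" "r.leans (- s) \<alpha> T (refl_pt z)"
    using assms unfolding right_opt_def r.left_opt_def by blast
  define \<beta> where "\<beta> x = - \<alpha> (T - x)" for x
  have T: "0 < T" using \<alpha>(1) by (simp add: r.opt_def)
  have gi: "(\<lambda>x. g (- \<alpha> x)) absolutely_integrable_on {0..T}"
  proof -
    have "(\<lambda>x. refl_curve g (\<alpha> x)) absolutely_integrable_on {0..T}" using \<alpha>(1) by (simp add: r.opt_def)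
    from absolutely_integrable_linear[OF this bounded_linear_refl_pt] show ?thesis
      by (simp add: o_def refl_curve_def)
  qed
  have fi: "(\<lambda>x. f (- \<alpha> x)) absolutely_integrable_on {0..T}" using \<alpha>(1) by (simp add: r.opt_def)
  have rmom: "integral {0..p} (\<lambda>x. g (- \<alpha> x)) = refl_pt (r.mom \<alpha> p)" if "p \<le> T" for p
  proof -
    have "(\<lambda>x. g (- \<alpha> x)) absolutely_integrable_on {0..p}"
      by (rule absolutely_integrable_on_subinterval[OF gi]) (use that in auto)
    then have "(\<lambda>x. g (- \<alpha> x)) integrable_on {0..p}" by (simp add: absolutely_integrable_on_def)
    from integral_linear[OF this bounded_linear_refl_pt]
    have "r.mom \<alpha> p = refl_pt (integral {0..p} (\<lambda>x. g (- \<alpha> x)))"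
      by (simp add: r.mom_def o_def refl_curve_def)
    then show ?thesis by simp
  qed
  have mT: "integral {0..T} (\<lambda>x. g (- \<alpha> x)) = T *\<^sub>R z"
    using \<alpha>(1) rmom[of T] by (simp add: r.opt_def refl_pt_linear)
  have mom: "mom \<beta> q = T *\<^sub>R z - refl_pt (r.mom \<alpha> (T - q))" if "0 \<le> q" "q \<le> T" for q
    using integral_reverse[OF gi that] rmom[of "T - q"] that by (simp add: mom_def \<beta>_def mT)
  have ex: "r.excess (- s) I L = excess s (refl_pt I) L" for s I L
    by (simp add: r.excess_def excess_def free.slope_refl refl_curve_def)
  have "averages_below \<beta> T"
    unfolding averages_below_def
  proof (intro allI impI)
    fix p q assume pq: "0 \<le> p \<and> p < q \<and> q \<le> T"
    then obtain s' where "r.excess s' (r.mom \<alpha> (T - p) - r.mom \<alpha> (T - q)) ((T - p) - (T - q)) \<le> 0"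
      using \<alpha>(1) unfolding r.opt_def r.averages_below_def
      by (metis diff_ge_0_iff_ge diff_le_eq diff_strict_left_mono le_add_same_cancel1)
    then have "excess (- s') (refl_pt (r.mom \<alpha> (T - p) - r.mom \<alpha> (T - q))) ((T - p) - (T - q)) \<le> 0"
      using ex[of "- s'"] by simp
    then show "\<exists>s. excess s (mom \<beta> q - mom \<beta> p) (q - p) \<le> 0"
      using pq by (intro exI[of _ "- s'"]) (simp add: mom refl_pt_linear)
  qed
  moreover have "(\<lambda>x. g (\<beta> x)) absolutely_integrable_on {0..T}"
    using absolutely_integrable_reverse[OF gi] by (simp add: \<beta>_def)
  moreover have "(\<lambda>x. f (\<beta> x)) absolutely_integrable_on {0..T}"
    using absolutely_integrable_reverse[OF fi] by (simp add: \<beta>_def)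
  moreover have "integral {0..T} (\<lambda>x. f (\<beta> x)) = T * v"
    using integral_reverse[OF fi, of T] T \<alpha>(1) by (simp add: \<beta>_def r.opt_def)
  ultimately have "opt f \<beta> T z v"
    using T mom[of T] by (simp add: opt_def refl_pt_linear(4)[of 0, simplified] linear_0[OF linear_refl_pt])
  moreover have "(T - q) * free.height s z \<le> excess s (T *\<^sub>R z - mom \<beta> q) (T - q)" if "0 \<le> q" "q \<le> T" for q
  proof -
    have "(T - q) * r.free.height (- s) (refl_pt z) \<le> r.excess (- s) (r.mom \<alpha> (T - q)) (T - q)"
      using \<alpha>(2) that unfolding r.leans_def by simp
    then show ?thesis unfolding ex mom[OF that] by (simp add: free.height_refl)
  qed
  ultimately show ?thesis by (rule that)
qed

lemma right_opt_imp_opt: "right_opt f s z v \<Longrightarrow> \<exists>\<beta> T. opt f \<beta> T z v"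
  using right_opt_reversed by metis

text \<open>The excess over the line parallel to the tangent line through \<open>y\<close> and \<open>z\<close> is zero for
  the whole function and nonnegative for initial and final parts; so it is nonpositive for
  intervals containing the junction.\<close>

lemma opt_join_sides:
  assumes y: "left_opt f s y v" and z: "right_opt f s z v'"
    and c: "free.height s y = c" "free.height s z = c" "c \<le> 0" and \<theta>: "0 \<le> \<theta>" "\<theta> \<le> 1"
  shows "\<exists>\<alpha> T. opt f \<alpha> T ((1 - \<theta>) *\<^sub>R y + \<theta> *\<^sub>R z) ((1 - \<theta>) * v + \<theta> * v')"
proof -
  obtain \<alpha>0 T0 where \<alpha>0: "opt f \<alpha>0 T0 y v" "leans s \<alpha>0 T0 y" using y unfolding left_opt_def by blast
  obtain \<beta>0 T1 where \<beta>0: "opt f \<beta>0 T1 z v'"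
    "\<And>q. 0 \<le> q \<Longrightarrow> q \<le> T1 \<Longrightarrow> (T1 - q) * free.height s z \<le> excess s (T1 *\<^sub>R z - mom \<beta>0 q) (T1 - q)"
    using right_opt_reversed[OF z] by blast
  consider "\<theta> = 0" | "\<theta> = 1" | "0 < \<theta>" "\<theta> < 1" using \<theta> by linarith
  then show ?thesis
  proof cases
    case 3
    \<comment> \<open>The right part keeps its length \<open>T1\<close>; the left one gets the length of the right weight.\<close>
    have T1: "0 < T1" using \<beta>0(1) by (simp add: opt_def)
    define T where "T = T1 * (1 - \<theta>) / \<theta>"
    have T: "0 < T" using 3 T1 by (simp add: T_def)
    from opt_rescale(1,2)[OF \<alpha>0(1) T] \<alpha>0(2)
    obtain \<alpha> where \<alpha>: "opt f \<alpha> T y v" "leans s \<alpha> T y" by blast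
    have "T + T1 = T1 / \<theta>" using 3 by (simp add: T_def field_simps)
    then have weights: "T = (T + T1) * (1 - \<theta>)" "T1 = (T + T1) * \<theta>"
      using 3 by (simp_all add: T_def)
    have "opt f (joined T \<alpha> \<beta>0) (T + T1) ((1 - \<theta>) *\<^sub>R y + \<theta> *\<^sub>R z) ((1 - \<theta>) * v + \<theta> * v')"
    proof (rule opt_joined[OF \<alpha>(1) \<beta>0(1)])
      fix p q assume pq: "0 \<le> p" "p < T" "T < q" "q \<le> T + T1"
      have "p * c \<le> excess s (mom \<alpha> p) p" using \<alpha>(2) pq c by (auto simp: leans_def)
      then have 1: "excess s (T *\<^sub>R y - mom \<alpha> p) (T - p) \<le> (T - p) * c"
        using c by (simp add: excess_diff excess_scaled algebra_simps)
      have "(T1 - (q - T)) * c \<le> excess s (T1 *\<^sub>R z - mom \<beta>0 (q - T)) (T1 - (q - T))"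
        using \<beta>0(2)[of "q - T"] pq c by simp
      also have "\<dots> = T1 * c - excess s (mom \<beta>0 (q - T)) (q - T)"
        by (simp only: excess_diff excess_scaled c)
      finally have 2: "excess s (mom \<beta>0 (q - T)) (q - T) \<le> (q - T) * c"
        by (simp add: algebra_simps)
      have "(T - p) * c + (q - T) * c \<le> 0" using pq c(3) by (simp add: mult_nonneg_nonpos add_nonpos_nonpos)
      with 1 2 show "\<exists>s. excess s (T *\<^sub>R y - mom \<alpha> p) (T - p) + excess s (mom \<beta>0 (q - T)) (q - T) \<le> 0"
        by (intro exI[of _ s]) linarith
    next
      show "T *\<^sub>R y + T1 *\<^sub>R z = (T + T1) *\<^sub>R ((1 - \<theta>) *\<^sub>R y + \<theta> *\<^sub>R z)"
        unfolding scaleR_add_right scaleR_scaleR weights[symmetric] ..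
      show "T * v + T1 * v' = (T + T1) * ((1 - \<theta>) * v + \<theta> * v')"
        unfolding distrib_left mult.assoc[symmetric] weights[symmetric] ..
    qed
    then show ?thesis by blast
  qed (use \<alpha>0 \<beta>0 in auto)
qed

section \<open>Cutting a linearity domain by a line\<close>

text \<open>The parameters of the base of a linearity domain form a set \<open>Z\<close>; its gaps are bridged by
  chords.\<close>

definition gaps_bridged :: "real set \<Rightarrow> bool" where
  "gaps_bridged Z \<longleftrightarrow> (\<forall>\<tau>. \<tau> \<notin> Z \<and> (\<exists>a\<in>Z. a < \<tau>) \<and> (\<exists>c\<in>Z. \<tau> < c) \<longrightarrow>
     (\<exists>r\<in>Z. \<exists>l\<in>Z. r < \<tau> \<and> \<tau> < l \<and> {r<..<l} \<inter> Z = {} \<and> chord_in_strip r l))"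

definition on_base :: "real set \<Rightarrow> real^2 \<Rightarrow> bool" where
  "on_base Z p \<longleftrightarrow> (\<exists>r\<in>Z. \<exists>l\<in>Z. \<exists>\<theta>. r \<le> l \<and> chord_in_strip r l \<and> 0 \<le> \<theta> \<and> \<theta> \<le> 1 \<and>
     p = (1 - \<theta>) *\<^sub>R g r + \<theta> *\<^sub>R g l)"

text \<open>A fan of right tangents ends at the first parameter \<open>A\<close> of \<open>Z\<close>, and an optimizer is known at its
  point of tangency.\<close>

definition fed_from_left :: "(real \<Rightarrow> real) \<Rightarrow> real set \<Rightarrow> real \<Rightarrow> (real^2 \<Rightarrow> real) \<Rightarrow> bool" where
  "fed_from_left f Z A val \<longleftrightarrow> A \<in> Z \<and> (\<forall>a\<in>Z. A \<le> a) \<and> left_opt f (sR A) (wR A) (val (wR A))"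

definition fed_from_right :: "(real \<Rightarrow> real) \<Rightarrow> real set \<Rightarrow> real \<Rightarrow> (real^2 \<Rightarrow> real) \<Rightarrow> bool" where
  "fed_from_right f Z C val \<longleftrightarrow> C \<in> Z \<and> (\<forall>a\<in>Z. a \<le> C) \<and> right_opt f (sL C) (wL C) (val (wL C))"

lemma level_on_segment:
  fixes a b c :: real
  assumes "b \<le> c" "c \<le> a"
  obtains \<mu> where "0 \<le> \<mu>" "\<mu> \<le> 1" "(1 - \<mu>) * a + \<mu> * b = c"
proof (cases "a = b")
  case True
  then show ?thesis using assms that[of 0] by simp
next
  case False
  then have "a - b > 0" using assms by simp
  then have "(1 - (a - c) / (a - b)) * a + (a - c) / (a - b) * b = a - (a - c) / (a - b) * (a - b)"
    by (simp add: left_diff_distrib right_diff_distrib)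
  then show ?thesis using \<open>a - b > 0\<close> assms that[of "(a - c) / (a - b)"] by simp
qed

lemma affine_combination:
  fixes n :: "real^2"
  shows "(1 - \<theta>) * (k + n \<bullet> y) + \<theta> * (k + n \<bullet> z) = k + n \<bullet> ((1 - \<theta>) *\<^sub>R y + \<theta> *\<^sub>R z)"
  by (simp add: inner_simps algebra_simps)

text \<open>On the extreme right tangent, the optimizer at the point of tangency is continued by the constant \<open>A\<close>.\<close>

lemma left_opt_on_tangent:
  assumes w: "left_opt f (sR A) (wR A) (k + n \<bullet> wR A)" and A: "f A = k + n \<bullet> g A"
    and s: "sR A \<le> s" and \<theta>: "0 \<le> \<theta>" "\<theta> \<le> 1"
  shows "left_opt f s ((1 - \<theta>) *\<^sub>R wR A + \<theta> *\<^sub>R g A) (k + n \<bullet> ((1 - \<theta>) *\<^sub>R wR A + \<theta> *\<^sub>R g A))"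
proof -
  have "left_opt f (sR A) ((1 - \<theta>) *\<^sub>R wR A + \<theta> *\<^sub>R g A) ((1 - \<theta>) * (k + n \<bullet> wR A) + \<theta> * f A)"
    by (rule left_opt_append[OF w]) (use \<theta> wR_less[of A] in \<open>auto simp: wR_def\<close>)
  then have "left_opt f (sR A) ((1 - \<theta>) *\<^sub>R wR A + \<theta> *\<^sub>R g A) (k + n \<bullet> ((1 - \<theta>) *\<^sub>R wR A + \<theta> *\<^sub>R g A))"
    unfolding A affine_combination .
  then show ?thesis using s by (rule left_opt_mono)
qed

text \<open>Follow the line at level \<open>c\<close> to the left of the base point \<open>p\<close>, which lies below it, to where
  the line leaves the linearity domain: there it crosses the arc, a bridging chord or the extreme
  right tangent.\<close>

lemma left_crossing:
  assumes gaps: "gaps_bridged Z" and aff: "\<And>a. a \<in> Z \<Longrightarrow> f a = k + n \<bullet> g a"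
    and left: "(\<exists>a\<in>Z. a \<le> tm s) \<or> (fed_from_left f Z A (\<lambda>y. k + n \<bullet> y) \<and> sR A \<le> s)"
    and p: "on_base Z p
      \<or> (fed_from_left f Z A (\<lambda>y. k + n \<bullet> y) \<and> sR A \<le> s \<and> p \<in> closed_segment (wR A) (g A))
      \<or> (\<exists>C\<in>Z. p \<in> closed_segment (g C) (wL C))"
    and c: "free.height s p \<le> c" "c \<le> 0"
  shows "\<exists>y. left_opt f s y (k + n \<bullet> y) \<and> free.height s y = c \<and> y $ 1 \<le> p $ 1"
proof -
  have hw: "free.height s (wR A) \<ge> 0" for A by (rule height_wR_nonneg)
  have on_chord: "left_opt f s ((1 - \<theta>) *\<^sub>R g r + \<theta> *\<^sub>R g l) (k + n \<bullet> ((1 - \<theta>) *\<^sub>R g r + \<theta> *\<^sub>R g l))"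
    if "r \<in> Z" "l \<in> Z" "r \<le> l" "chord_in_strip r l" "free.height s (g l) \<le> free.height s (g r)"
      "0 \<le> \<theta>" "\<theta> \<le> 1" for r l \<theta>
    using left_opt_chord[of r l s \<theta> f] that by (simp add: aff affine_combination)
  have from_low_point: ?thesis if \<sigma>: "\<sigma> \<in> Z" "free.height s (g \<sigma>) \<le> c" "g \<sigma> $ 1 \<le> p $ 1" for \<sigma>
  proof -
    have "tm s \<le> \<sigma>" using \<sigma>(2) c(2) height_le_0_between[of s \<sigma>] by linarith
    then obtain a where a: "tm s \<le> a" "a \<le> \<sigma>" "free.height s (g a) = c"
      using IVT2[of "\<lambda>t. free.height s (g t)" \<sigma> c "tm s"] \<sigma>(2) c(2) isCont_height_fixed by auto
    show ?thesis
    proof (cases "a \<in> Z")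
      case True
      then have "left_opt f s (g a) (k + n \<bullet> g a)" using left_opt_const[of f s a] by (simp add: aff)
      then show ?thesis using a \<sigma>(3) by (intro exI[of _ "g a"]) (auto intro: order_trans[of _ "g \<sigma> $ 1"])
    next
      case False
      then have "a < \<sigma>" using a \<sigma>(1) by (metis order_less_le)
      show ?thesis
      proof (cases "\<exists>a0\<in>Z. a0 < a")
        case True
        then obtain r l where rl: "r \<in> Z" "l \<in> Z" "r < a" "a < l" "{r<..<l} \<inter> Z = {}" "chord_in_strip r l"
          using gaps False \<sigma>(1) \<open>a < \<sigma>\<close> unfolding gaps_bridged_def by meson
        have "l \<le> \<sigma>" using rl \<sigma>(1) \<open>a < \<sigma>\<close> by (meson IntI disjoint_iff greaterThanLessThan_iff less_trans not_le)
        have r: "c < free.height s (g r)"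
          using fixed_height_quasiconvex[OF rl(3) \<open>a < \<sigma>\<close>, of s] a(3) \<sigma>(2) by (auto simp: max_def split: if_splits)
        have l: "free.height s (g l) \<le> c"
        proof (cases "l = \<sigma>")
          case False
          then show ?thesis
            using fixed_height_quasiconvex[of a l \<sigma> s] rl(4) \<open>l \<le> \<sigma>\<close> a(3) \<sigma>(2)
            by (auto simp: max_def split: if_splits)
        qed (use \<sigma> in simp)
        obtain \<mu> where \<mu>: "0 \<le> \<mu>" "\<mu> \<le> 1" "(1 - \<mu>) * free.height s (g r) + \<mu> * free.height s (g l) = c"
          using level_on_segment[OF l less_imp_le[OF r]] .
        let ?y = "(1 - \<mu>) *\<^sub>R g r + \<mu> *\<^sub>R g l"
        have "?y $ 1 \<le> g l $ 1"
          using convex_bound_le[of "g r $ 1" "g l $ 1" "g l $ 1" "1 - \<mu>" \<mu>] \<mu> rl by simp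
        also have "\<dots> \<le> p $ 1" using \<open>l \<le> \<sigma>\<close> \<sigma>(3) by (auto intro: order_trans[of _ "g \<sigma> $ 1"])
        finally have "?y $ 1 \<le> p $ 1" .
        then show ?thesis
          using on_chord[of r l \<mu>] rl r l \<mu> by (intro exI[of _ ?y]) (simp add: free.height_affine del: vector_add_component)
      next
        case False
        with left \<open>a \<notin> Z\<close> a(1) have A: "fed_from_left f Z A (\<lambda>y. k + n \<bullet> y)" "sR A \<le> s"
          by (metis order_le_less order_le_less_trans)+
        then have AZ: "A \<in> Z" "\<And>b. b \<in> Z \<Longrightarrow> A \<le> b" by (auto simp: fed_from_left_def)
        have "a < A" using False \<open>a \<notin> Z\<close> AZ(1) by (metis linorder_neqE)
        have "A \<le> \<sigma>" using AZ \<sigma>(1) by blast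
        have l: "free.height s (g A) \<le> c"
        proof (cases "A = \<sigma>")
          case False
          then show ?thesis
            using fixed_height_quasiconvex[of a A \<sigma> s] \<open>a < A\<close> \<open>A \<le> \<sigma>\<close> a(3) \<sigma>(2)
            by (auto simp: max_def split: if_splits)
        qed (use \<sigma> in simp)
        obtain \<mu> where \<mu>: "0 \<le> \<mu>" "\<mu> \<le> 1" "(1 - \<mu>) * free.height s (wR A) + \<mu> * free.height s (g A) = c"
          using level_on_segment[OF l order_trans[OF c(2) hw]] .
        let ?y = "(1 - \<mu>) *\<^sub>R wR A + \<mu> *\<^sub>R g A"
        have "?y $ 1 \<le> g A $ 1"
          using convex_bound_le[of "wR A $ 1" "g A $ 1" "g A $ 1" "1 - \<mu>" \<mu>] \<mu> wR_less[of A] by simp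
        also have "\<dots> \<le> p $ 1" using \<open>A \<le> \<sigma>\<close> \<sigma>(3) by (auto intro: order_trans[of _ "g \<sigma> $ 1"])
        finally have "?y $ 1 \<le> p $ 1" .
        moreover have "left_opt f s ?y (k + n \<bullet> ?y)"
          by (rule left_opt_on_tangent) (use A \<mu> aff[OF AZ(1)] in \<open>auto simp: fed_from_left_def\<close>)
        ultimately show ?thesis
          using \<mu> by (intro exI[of _ ?y]) (simp add: free.height_affine del: vector_add_component)
      qed
    qed
  qed
  from p consider (base) "on_base Z p"
    | (R) "fed_from_left f Z A (\<lambda>y. k + n \<bullet> y)" "sR A \<le> s" "p \<in> closed_segment (wR A) (g A)"
    | (L) C where "C \<in> Z" "p \<in> closed_segment (g C) (wL C)" by blast
  then show ?thesis
  proof cases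
    case base
    then obtain r l \<theta> where rl: "r \<in> Z" "l \<in> Z" "r \<le> l" "chord_in_strip r l" "0 \<le> \<theta>" "\<theta> \<le> 1"
      "p = (1 - \<theta>) *\<^sub>R g r + \<theta> *\<^sub>R g l"
      unfolding on_base_def by blast
    have p1: "p $ 1 = g r $ 1 + \<theta> * (g l $ 1 - g r $ 1)" unfolding rl(7) by (simp add: algebra_simps)
    have d: "0 \<le> g l $ 1 - g r $ 1" using rl(3) by simp
    show ?thesis
    proof (cases "free.height s (g r) \<le> c")
      case True
      then show ?thesis using from_low_point[OF rl(1)] p1 d rl(5) by simp
    next
      case False
      obtain \<mu> where \<mu>: "0 \<le> \<mu>" "\<mu> \<le> 1" "(1 - \<mu>) * free.height s (g r) + \<mu> * free.height s p = c"
        using level_on_segment[of "free.height s p" c "free.height s (g r)"] c False by auto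
      let ?y = "(1 - \<mu> * \<theta>) *\<^sub>R g r + (\<mu> * \<theta>) *\<^sub>R g l"
      have hp: "free.height s p = (1 - \<theta>) * free.height s (g r) + \<theta> * free.height s (g l)"
        unfolding rl(7) by (rule free.height_affine)
      have "free.height s ?y = c"
        unfolding free.height_affine using \<mu>(3) unfolding hp by (simp add: algebra_simps)
      moreover have \<mu>\<theta>: "\<mu> * \<theta> \<le> \<theta>" "0 \<le> \<mu> * \<theta>" using \<mu> rl(5) mult_right_mono[of \<mu> 1 \<theta>] by auto
      then have "?y $ 1 \<le> p $ 1"
        using mult_right_mono[OF \<mu>\<theta>(1) d] unfolding p1 by (simp add: algebra_simps)
      moreover have "free.height s (g l) \<le> free.height s (g r)"
      proof (rule ccontr)
        assume "\<not> ?thesis"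
        then have "\<theta> * free.height s (g r) \<le> \<theta> * free.height s (g l)" using rl(5) by (intro mult_left_mono) auto
        then have "free.height s (g r) \<le> free.height s p" unfolding hp by (simp add: algebra_simps)
        then show False using False c by simp
      qed
      then have "left_opt f s ?y (k + n \<bullet> ?y)" using on_chord[of r l "\<mu> * \<theta>"] rl \<mu>\<theta> by simp
      ultimately show ?thesis by blast
    qed
  next
    case R
    then obtain \<theta> where \<theta>: "0 \<le> \<theta>" "\<theta> \<le> 1" "p = (1 - \<theta>) *\<^sub>R wR A + \<theta> *\<^sub>R g A" by (auto simp: in_segment)
    have p1: "p $ 1 = wR A $ 1 + \<theta> * (g A $ 1 - wR A $ 1)" unfolding \<theta>(3) by (simp add: algebra_simps)
    have d: "0 \<le> g A $ 1 - wR A $ 1" using wR_less[of A] by simp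
    obtain \<mu> where \<mu>: "0 \<le> \<mu>" "\<mu> \<le> 1" "(1 - \<mu>) * free.height s (wR A) + \<mu> * free.height s p = c"
      using level_on_segment[OF c(1) order_trans[OF c(2) hw]] .
    let ?y = "(1 - \<mu> * \<theta>) *\<^sub>R wR A + (\<mu> * \<theta>) *\<^sub>R g A"
    have hp: "free.height s p = (1 - \<theta>) * free.height s (wR A) + \<theta> * free.height s (g A)"
      unfolding \<theta>(3) by (rule free.height_affine)
    have "free.height s ?y = c"
      unfolding free.height_affine using \<mu>(3) unfolding hp by (simp add: algebra_simps)
    moreover have \<mu>\<theta>: "\<mu> * \<theta> \<le> \<theta>" "0 \<le> \<mu> * \<theta>" using \<mu> \<theta>(1) mult_right_mono[of \<mu> 1 \<theta>] by auto
    then have "?y $ 1 \<le> p $ 1"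
      using mult_right_mono[OF \<mu>\<theta>(1) d] unfolding p1 by (simp add: algebra_simps)
    moreover have "left_opt f s ?y (k + n \<bullet> ?y)"
      by (rule left_opt_on_tangent) (use R \<mu>\<theta> \<theta>(2) aff in \<open>auto simp: fed_from_left_def\<close>)
    ultimately show ?thesis by blast
  next
    case L
    then obtain \<theta> where \<theta>: "0 \<le> \<theta>" "\<theta> \<le> 1" "p = (1 - \<theta>) *\<^sub>R g C + \<theta> *\<^sub>R wL C" by (auto simp: in_segment)
    have hwL: "free.height s (wL C) \<ge> 0" by (simp add: wL_def free.height_nonneg)
    have hp: "free.height s p = (1 - \<theta>) * free.height s (g C) + \<theta> * free.height s (wL C)"
      unfolding \<theta>(3) by (rule free.height_affine)
    have "free.height s (g C) \<le> c"
    proof (cases "\<theta> = 1")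
      case True
      then have "free.height s (wL C) = 0" "c = 0" using hp c hwL by auto
      then have "s = sL C" by (simp add: wL_def)
      then show ?thesis using \<open>c = 0\<close> by simp
    next
      case False
      then have pos: "0 < 1 - \<theta>" using \<theta> by simp
      have "(1 - \<theta>) * free.height s (g C) \<le> c"
        using hp c(1) mult_nonneg_nonneg[OF \<theta>(1) hwL] by linarith
      also have "c \<le> (1 - \<theta>) * c" using mult_nonneg_nonpos[OF \<theta>(1) c(2)] by (simp add: left_diff_distrib)
      finally show ?thesis using pos by simp
    qed
    moreover have "g C $ 1 \<le> p $ 1"
      using mult_nonneg_nonneg[OF \<theta>(1), of "wL C $ 1 - g C $ 1"] wL_greater[of C]
      unfolding \<theta>(3) by (simp add: algebra_simps)
    ultimately show ?thesis using from_low_point L(1) by blast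
  qed
qed

end

lemma (in strip) wR_refl: "strip.wR (refl_curve g) (refl_curve h) (refl_deriv dh) t = refl_pt (wL (- t))"
  by (simp add: strip.wR_def[OF strip_refl] wL_def sR_refl refl_curve_def)

lemma (in strip) wL_refl: "strip.wL (refl_curve g) (refl_curve h) (refl_deriv dh) t = refl_pt (wR (- t))"
  by (simp add: strip.wL_def[OF strip_refl] wR_def sL_refl refl_curve_def)

lemma (in strip) tm_refl: "strip.tm (refl_curve g) (refl_curve h) (refl_deriv dh) s = - tp (- s)"
proof -
  have "strip.sL (refl_curve g) (refl_curve h) (refl_deriv dh) (- tp (- s)) = s" by (simp add: sL_refl)
  then show ?thesis using strip.tm_sL[OF strip_refl] by metis
qed

lemma (in strip) chord_in_strip_refl:
  "strip.chord_in_strip (refl_curve g) (refl_curve h) (refl_deriv dh) a c \<longleftrightarrow> chord_in_strip (- c) (- a)"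
proof -
  interpret r: strip "refl_curve g" "refl_deriv dg" "refl_curve ddg" "refl_curve h" "refl_deriv dh" "refl_curve ddh"
    by (rule strip_refl)
  have ht: "r.free.height s (refl_curve g t) = free.height (- s) (g (- t))" for s t
    unfolding refl_curve_def[of g t] by (rule free.height_refl)
  show ?thesis
    unfolding r.chord_in_strip_def chord_in_strip_def ht by (metis minus_minus)
qed

context strip
begin

lemma refl_pt_affine: "refl_pt ((1 - \<theta>) *\<^sub>R y + \<theta> *\<^sub>R z) = (1 - \<theta>) *\<^sub>R refl_pt y + \<theta> *\<^sub>R refl_pt z"
  by (simp add: vec2_eq_iff algebra_simps)

lemma refl_pt_segment: "p \<in> closed_segment y z \<Longrightarrow> refl_pt p \<in> closed_segment (refl_pt y) (refl_pt z)"
  by (auto simp: in_segment refl_pt_affine)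

lemma refl_pt_inner: "refl_pt n \<bullet> refl_pt y = n \<bullet> y"
  by (simp add: inner_vec_def sum_2)

lemma right_crossing:
  assumes gaps: "gaps_bridged Z" and aff: "\<And>a. a \<in> Z \<Longrightarrow> f a = k + n \<bullet> g a"
    and right: "(\<exists>a\<in>Z. tp s \<le> a) \<or> (fed_from_right f Z C (\<lambda>y. k + n \<bullet> y) \<and> s \<le> sL C)"
    and p: "on_base Z p
      \<or> (fed_from_right f Z C (\<lambda>y. k + n \<bullet> y) \<and> s \<le> sL C \<and> p \<in> closed_segment (g C) (wL C))
      \<or> (\<exists>A\<in>Z. p \<in> closed_segment (wR A) (g A))"
    and c: "free.height s p \<le> c" "c \<le> 0"
  shows "\<exists>z. right_opt f s z (k + n \<bullet> z) \<and> free.height s z = c \<and> p $ 1 \<le> z $ 1"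
proof -
  interpret r: strip "refl_curve g" "refl_deriv dg" "refl_curve ddg" "refl_curve h" "refl_deriv dh" "refl_curve ddh"
    by (rule strip_refl)
  have gr: "refl_curve g t = refl_pt (g (- t))" for t by (simp add: refl_curve_def)
  have fed: "r.fed_from_left (\<lambda>t. f (- t)) (uminus ` Z) (- C) (\<lambda>y. k + refl_pt n \<bullet> y) \<and> r.sR (- C) \<le> - s"
    if "fed_from_right f Z C (\<lambda>y. k + n \<bullet> y) \<and> s \<le> sL C"
    using that unfolding fed_from_right_def r.fed_from_left_def right_opt_def
    by (simp add: sR_refl wR_refl refl_pt_inner)
  have "\<exists>y. r.left_opt (\<lambda>t. f (- t)) (- s) y (k + refl_pt n \<bullet> y) \<and> r.free.height (- s) y = c \<and> y $ 1 \<le> refl_pt p $ 1"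
  proof (rule r.left_crossing[where Z="uminus ` Z" and A="- C"])
    show "r.gaps_bridged (uminus ` Z)"
      unfolding r.gaps_bridged_def
    proof (intro allI impI)
      fix \<tau> assume "\<tau> \<notin> uminus ` Z \<and> (\<exists>a\<in>uminus ` Z. a < \<tau>) \<and> (\<exists>c\<in>uminus ` Z. \<tau> < c)"
      then obtain a b where ab: "- \<tau> \<notin> Z" "a \<in> Z" "b \<in> Z" "- a < \<tau>" "\<tau> < - b"
        by (auto simp: image_iff) (metis minus_minus)
      then have "- \<tau> \<notin> Z" "b < - \<tau>" "- \<tau> < a" by linarith+
      with ab(2,3) obtain r' l' where rl: "r' \<in> Z" "l' \<in> Z" "r' < - \<tau>" "- \<tau> < l'" "{r'<..<l'} \<inter> Z = {}" "chord_in_strip r' l'"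
        using gaps unfolding gaps_bridged_def by meson
      have "{- l'<..<- r'} \<inter> uminus ` Z = {}" using rl(5) by (auto simp: disjoint_iff)
      then show "\<exists>r\<in>uminus ` Z. \<exists>l\<in>uminus ` Z. r < \<tau> \<and> \<tau> < l \<and> {r<..<l} \<inter> uminus ` Z = {} \<and> r.chord_in_strip r l"
        using rl by (intro bexI[of _ "- l'"] bexI[of _ "- r'"]) (auto simp: chord_in_strip_refl)
    qed
    show "f (- a) = k + refl_pt n \<bullet> refl_curve g a" if "a \<in> uminus ` Z" for a
      using that aff by (auto simp: gr refl_pt_inner)
    show "(\<exists>a\<in>uminus ` Z. a \<le> r.tm (- s))
        \<or> (r.fed_from_left (\<lambda>t. f (- t)) (uminus ` Z) (- C) (\<lambda>y. k + refl_pt n \<bullet> y) \<and> r.sR (- C) \<le> - s)"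
      using right fed by (auto simp: tm_refl)
    show "r.on_base (uminus ` Z) (refl_pt p)
      \<or> (r.fed_from_left (\<lambda>t. f (- t)) (uminus ` Z) (- C) (\<lambda>y. k + refl_pt n \<bullet> y) \<and> r.sR (- C) \<le> - s
          \<and> refl_pt p \<in> closed_segment (r.wR (- C)) (refl_curve g (- C)))
      \<or> (\<exists>C\<in>uminus ` Z. refl_pt p \<in> closed_segment (refl_curve g C) (r.wL C))"
      using p
    proof (elim disjE)
      assume "on_base Z p"
      then obtain r' l' \<theta> where rl: "r' \<in> Z" "l' \<in> Z" "r' \<le> l'" "chord_in_strip r' l'" "0 \<le> \<theta>" "\<theta> \<le> 1"
        "p = (1 - \<theta>) *\<^sub>R g r' + \<theta> *\<^sub>R g l'"
        unfolding on_base_def by blast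
      have "refl_pt p = (1 - (1 - \<theta>)) *\<^sub>R refl_curve g (- l') + (1 - \<theta>) *\<^sub>R refl_curve g (- r')"
        unfolding rl(7) refl_pt_affine gr by (simp add: add.commute)
      then have "r.on_base (uminus ` Z) (refl_pt p)"
        unfolding r.on_base_def using rl
        by (intro bexI[of _ "- l'"] bexI[of _ "- r'"] exI[of _ "1 - \<theta>"]) (auto simp: chord_in_strip_refl)
      then show ?thesis by blast
    next
      assume *: "fed_from_right f Z C (\<lambda>y. k + n \<bullet> y) \<and> s \<le> sL C \<and> p \<in> closed_segment (g C) (wL C)"
      then have "refl_pt p \<in> closed_segment (r.wR (- C)) (refl_curve g (- C))"
        using refl_pt_segment[of p "g C" "wL C"] by (simp add: wR_refl gr closed_segment_commute)
      then show ?thesis using fed * by blast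
    next
      assume "\<exists>A\<in>Z. p \<in> closed_segment (wR A) (g A)"
      then obtain A where A: "A \<in> Z" "p \<in> closed_segment (wR A) (g A)" by blast
      then have "refl_pt p \<in> closed_segment (refl_curve g (- A)) (r.wL (- A))"
        using refl_pt_segment[of p "wR A" "g A"] by (simp add: wL_refl gr closed_segment_commute)
      then show ?thesis using A(1) by blast
    qed
    show "r.free.height (- s) (refl_pt p) \<le> c" using c(1) by (simp add: free.height_refl)
  qed (rule c(2))
  then obtain y where y: "r.left_opt (\<lambda>t. f (- t)) (- s) y (k + refl_pt n \<bullet> y)"
    "r.free.height (- s) y = c" "y $ 1 \<le> refl_pt p $ 1" by blast
  show ?thesis
  proof (intro exI conjI)
    show "right_opt f s (refl_pt y) (k + n \<bullet> refl_pt y)"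
      using y(1) refl_pt_inner[of n "refl_pt y"] by (simp add: right_opt_def)
    show "free.height s (refl_pt y) = c" using y(2) free.height_refl[of "- s" "refl_pt y"] by simp
    show "p $ 1 \<le> refl_pt y $ 1" using y(3) by simp
  qed
qed

lemma opt_between_crossings:
  assumes y: "left_opt f s y (k + n \<bullet> y)" and z: "right_opt f s z (k + n \<bullet> z)"
    and c: "free.height s y = free.height s x" "free.height s z = free.height s x" "free.height s x \<le> 0"
    and x1: "y $ 1 \<le> x $ 1" "x $ 1 \<le> z $ 1"
  shows "\<exists>\<alpha> T. opt f \<alpha> T x (k + n \<bullet> x)"
proof -
  obtain \<theta> where \<theta>: "0 \<le> \<theta>" "\<theta> \<le> 1" "(1 - \<theta>) * (- (y $ 1)) + \<theta> * (- (z $ 1)) = - (x $ 1)"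
    using level_on_segment[of "- (z $ 1)" "- (x $ 1)" "- (y $ 1)"] x1 by auto
  let ?u = "(1 - \<theta>) *\<^sub>R y + \<theta> *\<^sub>R z"
  have u1: "?u $ 1 = x $ 1" using \<theta>(3) by simp
  have "free.height s ?u = (1 - \<theta>) * free.height s y + \<theta> * free.height s z" by (rule free.height_affine)
  also have "\<dots> = free.height s x" unfolding c by (simp add: algebra_simps)
  finally have "?u $ 2 = x $ 2" using u1 unfolding free.height_def by simp
  with u1 have u: "?u = x" by (simp add: vec2_eq_iff)
  from opt_join_sides[OF y z c \<theta>(1,2)] show ?thesis unfolding affine_combination u .
qed

end

section \<open>Tangent fans\<close>

lemma exp_integral_of_log_derivative:
  fixes \<rho> :: "real \<Rightarrow> real"
  assumes \<rho>: "\<And>t. \<rho> t > 0" "\<And>t. (\<rho> has_real_derivative W t * \<rho> t) (at t)" and "a \<le> b"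
  shows "exp (- integral {a..b} W) = \<rho> a / \<rho> b"
proof -
  have "(W has_integral ln (\<rho> b) - ln (\<rho> a)) {a..b}"
  proof (rule fundamental_theorem_of_calculus[OF \<open>a \<le> b\<close>])
    fix t
    have "((\<lambda>t. ln (\<rho> t)) has_real_derivative 1 / \<rho> t * (W t * \<rho> t)) (at t)"
      by (rule DERIV_chain2[OF DERIV_ln_divide[OF \<rho>(1)] \<rho>(2)])
    then have "((\<lambda>t. ln (\<rho> t)) has_real_derivative W t) (at t)" using \<rho>(1)[of t] by simp
    then show "((\<lambda>t. ln (\<rho> t)) has_vector_derivative W t) (at t within {a..b})"
      by (simp add: has_real_derivative_iff_has_vector_derivative has_vector_derivative_at_within)
  qed
  then have "- integral {a..b} W = ln (\<rho> a) - ln (\<rho> b)" by (simp add: integral_unique)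
  also have "\<dots> = ln (\<rho> a / \<rho> b)" using \<rho>(1)[of a] \<rho>(1)[of b] by (simp add: ln_div)
  finally show ?thesis using \<rho>(1)[of a] \<rho>(1)[of b] by simp
qed

context strip
begin

text \<open>The reference point \<open>0\<close> influences the exponential by a constant factor.\<close>

definition decays :: bool where
  "decays \<longleftrightarrow> ((\<lambda>t. (1 + norm (wR t - g t)) * exp (- integral {t..0} lamR)) \<longlongrightarrow> 0) at_bot"

lemma decays_clock:
  assumes decays and ck: "clock \<tau> (\<lambda>t. lamR t * \<tau> t) v"
  shows "((\<lambda>t. (1 + norm (wR t - g t)) * \<tau> t) \<longlongrightarrow> 0) at_bot"
proof -
  have \<tau>: "\<tau> t > 0" "(\<tau> has_real_derivative lamR t * \<tau> t) (at t)" for t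
    using clock.\<tau>_pos[OF ck] clock.\<tau>_deriv[OF ck] by auto
  have "((\<lambda>t. (1 + norm (wR t - g t)) * exp (- integral {t..0} lamR) * \<tau> 0) \<longlongrightarrow> 0 * \<tau> 0) at_bot"
    using assms(1) unfolding decays_def by (rule tendsto_mult[OF _ tendsto_const])
  moreover have "\<forall>\<^sub>F t in at_bot. (1 + norm (wR t - g t)) * exp (- integral {t..0} lamR) * \<tau> 0
      = (1 + norm (wR t - g t)) * \<tau> t"
    using eventually_le_at_bot[of "0::real"]
  proof eventually_elim
    case (elim t)
    have "exp (- integral {t..0} lamR) * \<tau> 0 = \<tau> t"
      using exp_integral_of_log_derivative[OF \<tau> elim] \<tau>(1)[of 0] by simp
    then show ?case by (simp only: mult.assoc)
  qed
  ultimately have "((\<lambda>t. (1 + norm (wR t - g t)) * \<tau> t) \<longlongrightarrow> 0 * \<tau> 0) at_bot"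
    by (rule Lim_transform_eventually)
  then show ?thesis by simp
qed

definition fan_equation ::
  "(real \<Rightarrow> real) \<Rightarrow> (real \<Rightarrow> real) \<Rightarrow> real set \<Rightarrow> (real \<Rightarrow> real) \<Rightarrow> (real \<Rightarrow> real) \<Rightarrow> bool" where
  "fan_equation f' f'' I \<beta> \<beta>' \<longleftrightarrow> (\<forall>t\<in>I. (\<beta> has_real_derivative \<beta>' t) (at t within I) \<and>
     (fixed.slope t - free.slope (sR t)) * \<beta>' t + fixed.dslope t * \<beta> t = dk3 f' f'' t)"

lemma fan_equation_interior:
  assumes "fan_equation f' f'' I \<beta> \<beta>'" "t \<in> interior I"
  shows "(\<beta> has_real_derivative \<beta>' t) (at t)"
    and "(fixed.slope t - free.slope (sR t)) * \<beta>' t + fixed.dslope t * \<beta> t = dk3 f' f'' t"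
proof -
  have "t \<in> I" using assms(2) interior_subset by blast
  then show "(\<beta> has_real_derivative \<beta>' t) (at t)"
    "(fixed.slope t - free.slope (sR t)) * \<beta>' t + fixed.dslope t * \<beta> t = dk3 f' f'' t"
    using assms(1) at_within_interior[OF assms(2)] unfolding fan_equation_def by auto
qed

lemma fan_equation_continuous: "fan_equation f' f'' I \<beta> \<beta>' \<Longrightarrow> continuous_on I \<beta>"
  unfolding fan_equation_def by (meson DERIV_continuous_on)

lemma left_opt_along_fan:
  assumes f: "\<And>t. (f has_real_derivative f' t) (at t)" and f': "\<And>t. (f' has_real_derivative f'' t) (at t)"
    and I: "fan_equation f' f'' I \<beta> \<beta>'" "{u1..u2} \<subseteq> I" and u: "u1 \<le> u2"
    and start: "left_opt f (sR u1) (wR u1) (fan_value f f' \<beta> u1)"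
  shows "left_opt f (sR u2) (wR u2) (fan_value f f' \<beta> u2)"
proof (cases "u1 = u2")
  case False
  have cont: "continuous_on S f" "continuous_on S f'" for S
    by (intro continuous_at_imp_continuous_on ballI DERIV_isCont[OF f] DERIV_isCont[OF f'])+
  show ?thesis
  proof (rule left_opt_fan[where m="fan_value f f' \<beta>", OF _ _ _ cont(1) start])
    show "continuous_on {u1..u2} (fan_value f f' \<beta>)"
      by (intro continuous_on_fan_value cont continuous_on_subset[OF fan_equation_continuous[OF I(1)] I(2)])
    fix t assume t: "u1 < t" "t < u2"
    have "{u1<..<u2} \<subseteq> interior I" using I(2) by (intro interior_maximal) auto
    with t have "t \<in> interior I" by auto
    from fan_equation_interior[OF I(1) this]
    show "(fan_value f f' \<beta> has_real_derivative lamR t * (f t - fan_value f f' \<beta> t)) (at t)"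
      by (intro fan_value_deriv[where f''=f'' and \<beta>'=\<beta>'] f f')
  qed (use u False in simp)
qed (use start in simp)

lemma left_opt_fan_stieltjes:
  assumes decays and f: "\<And>t. (f has_real_derivative f' t) (at t)" and f': "\<And>t. (f' has_real_derivative f'' t) (at t)"
    and sign: "sign_at_bot (\<lambda>t. dk3 f' f'' t / fixed.dslope t)"
    and I: "fan_equation f' f'' I \<beta> \<beta>'" "{..u} \<subseteq> I"
    and st: "has_stieltjes_integral (\<lambda>\<tau>. exp (- integral {\<tau>..u} (\<lambda>t. fixed.dslope t / (fixed.slope t - free.slope (sR t)))))
        (\<lambda>t. dk3 f' f'' t / fixed.dslope t) {..u} y"
    and \<beta>u: "\<beta> u = dk3 f' f'' u / fixed.dslope u - y"
  shows "left_opt f (sR u) (wR u) (fan_value f f' \<beta> u)"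
proof -
  obtain \<tau> v where ck: "clock \<tau> (\<lambda>t. lamR t * \<tau> t) v" using clock_exists .
  note dec = decays_clock[OF assms(1) ck]
  let ?\<rho> = "fan_weight \<tau>" and ?W = "\<lambda>t. fixed.dslope t / (fixed.slope t - free.slope (sR t))"
  let ?\<rho>' = "\<lambda>t. \<tau> t * (g t $ 1 - wR t $ 1) * fixed.dslope t"
  have W: "?W t * ?\<rho> t = ?\<rho>' t" for t
    using slope_sR_less[of t] by (simp add: fan_weight_def)
  have log: "(?\<rho> has_real_derivative ?W t * ?\<rho> t) (at t)" for t
    unfolding W by (rule fan_weight_deriv[OF ck])
  have \<rho>\<beta>: "((\<lambda>t. ?\<rho> t * \<beta> t) \<longlongrightarrow> 0) at_bot"
  proof (rule stieltjes_solution_tendsto_0[where \<rho>="fan_weight \<tau>" and \<beta>=\<beta> and u=u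
        and K="\<lambda>t. dk3 f' f'' t / fixed.dslope t", OF fan_weight_pos[OF ck] fan_weight_mono[OF ck]
        fan_weight_deriv[OF ck] fan_weight_tendsto_0[OF ck dec] _ st _ \<beta>u])
    fix t assume t: "t \<le> u"
    show "exp (- integral {t..u} ?W) = ?\<rho> t / ?\<rho> u"
      by (rule exp_integral_of_log_derivative[OF fan_weight_pos[OF ck] log t])
    have "t \<in> I" using t I(2) by auto
    then have \<beta>: "(\<beta> has_real_derivative \<beta>' t) (at t within {..u})"
      and ode: "dk3 f' f'' t = (fixed.slope t - free.slope (sR t)) * \<beta>' t + fixed.dslope t * \<beta> t"
      using I unfolding fan_equation_def by (auto intro: DERIV_subset)
    have "((\<lambda>t. ?\<rho> t * \<beta> t) has_real_derivative ?\<rho> t * \<beta>' t + ?\<rho>' t * \<beta> t) (at t within {..u})"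
      by (rule DERIV_mult'[OF has_field_derivative_at_within[OF fan_weight_deriv[OF ck]] \<beta>])
    moreover have "?\<rho>' t * (dk3 f' f'' t / fixed.dslope t) = \<tau> t * (g t $ 1 - wR t $ 1) * dk3 f' f'' t"
      using fixed.dslope_pos[of t] by simp
    moreover have "\<tau> t * (g t $ 1 - wR t $ 1) * dk3 f' f'' t = ?\<rho> t * \<beta>' t + ?\<rho>' t * \<beta> t"
      unfolding ode fan_weight_def by (simp only: distrib_left mult.assoc)
    ultimately show "((\<lambda>t. ?\<rho> t * \<beta> t) has_real_derivative ?\<rho>' t * (dk3 f' f'' t / fixed.dslope t)) (at t within {..u})"
      by (simp only:)
  qed
  have "{..<u} \<subseteq> interior I" using I(2) by (intro interior_maximal) auto
  then have int: "t \<in> interior I" if "t < u" for t using that by auto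
  show ?thesis
    by (rule left_opt_fan_value_from_infinity[OF ck dec f f' sign
          continuous_on_subset[OF fan_equation_continuous[OF I(1)] I(2)]
          fan_equation_interior[OF I(1) int] \<rho>\<beta>])
qed

text \<open>The same for fans of left tangents, by reflection.\<close>

definition left_fan_equation ::
  "(real \<Rightarrow> real) \<Rightarrow> (real \<Rightarrow> real) \<Rightarrow> real set \<Rightarrow> (real \<Rightarrow> real) \<Rightarrow> (real \<Rightarrow> real) \<Rightarrow> bool" where
  "left_fan_equation f' f'' I \<beta> \<beta>' \<longleftrightarrow> (\<forall>t\<in>I. (\<beta> has_real_derivative \<beta>' t) (at t within I) \<and>
     (fixed.slope t - free.slope (sL t)) * \<beta>' t + fixed.dslope t * \<beta> t = dk3 f' f'' t)"

definition left_fan_value :: "(real \<Rightarrow> real) \<Rightarrow> (real \<Rightarrow> real) \<Rightarrow> (real \<Rightarrow> real) \<Rightarrow> real \<Rightarrow> real" where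
  "left_fan_value f f' \<beta> t = f t + (wL t $ 1 - g t $ 1) *
     (k3 f' t + (free.slope (sL t) - fixed.slope t) * \<beta> t)"

lemma DERIV_uminus_arg:
  fixes \<phi> :: "real \<Rightarrow> real"
  assumes "(\<phi> has_real_derivative d) (at (- t) within S)"
  shows "((\<lambda>t. \<phi> (- t)) has_real_derivative - d) (at t within uminus ` S)"
proof -
  have "(\<phi> has_real_derivative d) (at (- t) within uminus ` (uminus ` S))"
    using assms by (simp add: image_image)
  moreover have "(uminus has_real_derivative -1) (at t within uminus ` S)"
    by (auto intro!: derivative_eq_intros)
  ultimately have "((\<phi> \<circ> uminus) has_real_derivative d * -1) (at t within uminus ` S)"
    by (rule DERIV_image_chain)
  then show ?thesis by (simp add: o_def)
qed

context
  fixes f f' f'' :: "real \<Rightarrow> real"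
  assumes f: "\<And>t. (f has_real_derivative f' t) (at t)" and f': "\<And>t. (f' has_real_derivative f'' t) (at t)"
begin

interpretation r: strip "refl_curve g" "refl_deriv dg" "refl_curve ddg" "refl_curve h" "refl_deriv dh" "refl_curve ddh"
  by (rule strip_refl)

lemma dslope_refl: "r.fixed.dslope t = fixed.dslope (- t)"
  by (simp add: r.fixed.dslope_def fixed.dslope_def refl_curve_def refl_deriv_def)

lemma dk3_refl: "r.dk3 (\<lambda>t. - f' (- t)) (\<lambda>t. f'' (- t)) t = dk3 f' f'' (- t)"
  by (simp add: r.dk3_def dk3_def refl_curve_def refl_deriv_def)

lemma fan_value_refl:
  "r.fan_value (\<lambda>t. f (- t)) (\<lambda>t. - f' (- t)) (\<lambda>t. \<beta> (- t)) t = left_fan_value f f' \<beta> (- t)"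
proof -
  have "r.k3 (\<lambda>t. - f' (- t)) t = - k3 f' (- t)" by (simp add: r.k3_def k3_def refl_deriv_def)
  then show ?thesis
    unfolding r.fan_value_def left_fan_value_def
    by (simp add: free.slope_refl fixed.slope_refl sR_refl wR_refl refl_curve_def algebra_simps)
qed

lemma fan_equation_refl:
  assumes "left_fan_equation f' f'' I \<beta> \<beta>'"
  shows "r.fan_equation (\<lambda>t. - f' (- t)) (\<lambda>t. f'' (- t)) (uminus ` I) (\<lambda>t. \<beta> (- t)) (\<lambda>t. - \<beta>' (- t))"
  unfolding r.fan_equation_def
proof
  fix t assume "t \<in> uminus ` I"
  then have t: "- t \<in> I" by auto
  then have \<beta>: "(\<beta> has_real_derivative \<beta>' (- t)) (at (- t) within I)"
    and ode: "(fixed.slope (- t) - free.slope (sL (- t))) * \<beta>' (- t) + fixed.dslope (- t) * \<beta> (- t) = dk3 f' f'' (- t)"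
    using assms unfolding left_fan_equation_def by auto
  have "(r.fixed.slope t - r.free.slope (r.sR t)) * - \<beta>' (- t) + r.fixed.dslope t * \<beta> (- t)
      = (fixed.slope (- t) - free.slope (sL (- t))) * \<beta>' (- t) + fixed.dslope (- t) * \<beta> (- t)"
    by (simp add: free.slope_refl fixed.slope_refl sR_refl dslope_refl algebra_simps)
  then show "((\<lambda>t. \<beta> (- t)) has_real_derivative - \<beta>' (- t)) (at t within uminus ` I) \<and>
      (r.fixed.slope t - r.free.slope (r.sR t)) * - \<beta>' (- t) + r.fixed.dslope t * \<beta> (- t)
        = r.dk3 (\<lambda>t. - f' (- t)) (\<lambda>t. f'' (- t)) t"
    using DERIV_uminus_arg[OF \<beta>] ode by (simp add: dk3_refl)
qed

lemma f_refl_deriv: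
  "((\<lambda>t. f (- t)) has_real_derivative - f' (- t)) (at t)"
  "((\<lambda>t. - f' (- t)) has_real_derivative f'' (- t)) (at t)"
  using DERIV_uminus_arg[of f "f' (- t)" t UNIV] f[of "- t"]
    DERIV_minus[OF DERIV_uminus_arg[of f' "f'' (- t)" t UNIV]] f'[of "- t"] by auto

lemma right_opt_along_fan:
  assumes I: "left_fan_equation f' f'' I \<beta> \<beta>'" "{u1..u2} \<subseteq> I" and u: "u1 \<le> u2"
    and start: "right_opt f (sL u2) (wL u2) (left_fan_value f f' \<beta> u2)"
  shows "right_opt f (sL u1) (wL u1) (left_fan_value f f' \<beta> u1)"
proof -
  have "r.left_opt (\<lambda>t. f (- t)) (r.sR (- u1)) (r.wR (- u1))
      (r.fan_value (\<lambda>t. f (- t)) (\<lambda>t. - f' (- t)) (\<lambda>t. \<beta> (- t)) (- u1))"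
  proof (rule r.left_opt_along_fan[OF f_refl_deriv fan_equation_refl[OF I(1)]])
    show "{- u2..- u1} \<subseteq> uminus ` I" using I(2) by (auto intro!: image_eqI[where x="- _"])
    show "r.left_opt (\<lambda>t. f (- t)) (r.sR (- u2)) (r.wR (- u2))
      (r.fan_value (\<lambda>t. f (- t)) (\<lambda>t. - f' (- t)) (\<lambda>t. \<beta> (- t)) (- u2))"
      using start by (simp add: fan_value_refl sR_refl wR_refl right_opt_def)
  qed (use u in simp)
  then show ?thesis by (simp add: fan_value_refl sR_refl wR_refl right_opt_def)
qed

lemma right_opt_fan_stieltjes:
  assumes dec: "r.decays" and sign: "sign_at_bot (\<lambda>t. dk3 f' f'' (- t) / fixed.dslope (- t))"
    and I: "left_fan_equation f' f'' I \<beta> \<beta>'" "{u..} \<subseteq> I"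
    and st: "has_stieltjes_integral (\<lambda>\<tau>. exp (integral {u..\<tau>} (\<lambda>t. fixed.dslope t / (fixed.slope t - free.slope (sL t)))))
        (\<lambda>t. dk3 f' f'' t / fixed.dslope t) {u..} y"
    and \<beta>u: "\<beta> u = dk3 f' f'' u / fixed.dslope u + y"
  shows "right_opt f (sL u) (wL u) (left_fan_value f f' \<beta> u)"
proof -
  have W: "(\<lambda>t. r.fixed.dslope t / (r.fixed.slope t - r.free.slope (r.sR t)))
      = (\<lambda>t. - (fixed.dslope (- t) / (fixed.slope (- t) - free.slope (sL (- t)))))"
    by (simp add: fun_eq_iff dslope_refl fixed.slope_refl free.slope_refl sR_refl minus_divide_right)
  have int: "- integral {\<tau>..- u} (\<lambda>t. r.fixed.dslope t / (r.fixed.slope t - r.free.slope (r.sR t)))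
      = integral {u..- \<tau>} (\<lambda>t. fixed.dslope t / (fixed.slope t - free.slope (sL t)))" for \<tau>
    unfolding W
    using Henstock_Kurzweil_Integration.integral_reflect_real[of "- \<tau>" u "\<lambda>t. fixed.dslope t / (fixed.slope t - free.slope (sL t))"]
    by simp
  have K: "(\<lambda>t. r.dk3 (\<lambda>t. - f' (- t)) (\<lambda>t. f'' (- t)) t / r.fixed.dslope t) = (\<lambda>t. dk3 f' f'' (- t) / fixed.dslope (- t))"
    by (simp add: fun_eq_iff dk3_refl dslope_refl)
  have "r.left_opt (\<lambda>t. f (- t)) (r.sR (- u)) (r.wR (- u))
      (r.fan_value (\<lambda>t. f (- t)) (\<lambda>t. - f' (- t)) (\<lambda>t. \<beta> (- t)) (- u))"
  proof (rule r.left_opt_fan_stieltjes[OF dec f_refl_deriv _ fan_equation_refl[OF I(1)]])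
    show "sign_at_bot (\<lambda>t. r.dk3 (\<lambda>t. - f' (- t)) (\<lambda>t. f'' (- t)) t / r.fixed.dslope t)"
      unfolding K by (rule sign)
    show "{..- u} \<subseteq> uminus ` I" using I(2) by (auto intro!: image_eqI[where x="- _"])
    show "has_stieltjes_integral
      (\<lambda>\<tau>. exp (- integral {\<tau>..- u} (\<lambda>t. r.fixed.dslope t / (r.fixed.slope t - r.free.slope (r.sR t)))))
      (\<lambda>t. r.dk3 (\<lambda>t. - f' (- t)) (\<lambda>t. f'' (- t)) t / r.fixed.dslope t) {..- u} (- y)"
      unfolding int K using has_stieltjes_integral_reflect[OF st] .
    show "\<beta> (- (- u)) = r.dk3 (\<lambda>t. - f' (- t)) (\<lambda>t. f'' (- t)) (- u) / r.fixed.dslope (- u) - (- y)"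
      using \<beta>u by (simp add: dk3_refl dslope_refl)
  qed
  then show ?thesis by (simp add: fan_value_refl sR_refl wR_refl right_opt_def)
qed

end

end

section \<open>The domain of the Bellman function\<close>

definition velocity :: "(real \<Rightarrow> 'a::real_normed_vector) \<Rightarrow> real \<Rightarrow> 'a" where
  "velocity c t = vector_derivative c (at t)"

lemma velocity_eqI: "(\<And>t. (c has_vector_derivative d t) (at t)) \<Longrightarrow> velocity c = d"
  by (simp add: fun_eq_iff velocity_def vector_derivative_at)

lemma velocity_abs: "(\<lambda>t. vector_derivative c (at t)) = velocity c"
  by (simp add: fun_eq_iff velocity_def)

lemma C31_family_velocities:
  assumes "C31_family emax G" "e \<in> param_range emax"
  shows "(G e has_vector_derivative velocity (G e) t) (at t)"
    and "(velocity (G e) has_vector_derivative velocity (velocity (G e)) t) (at t)"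
    and "continuous_on UNIV (velocity (velocity (G e)))"
proof -
  obtain D :: "nat \<Rightarrow> nat \<Rightarrow> real \<Rightarrow> real \<Rightarrow> real^2" where
    D0: "\<forall>e\<in>param_range emax. \<forall>t. D 0 0 e t = G e t" and
    D: "\<forall>i<3. \<forall>j\<le>1. \<forall>e\<in>param_range emax. \<forall>t. (D i j e has_vector_derivative D (Suc i) j e t) (at t)"
    using assms(1) unfolding C31_family_def by auto
  have G: "G e = D 0 0 e" using D0 assms(2) by auto
  have d: "(D i 0 e has_vector_derivative D (Suc i) 0 e t) (at t)" if "i < 3" for i t
    using D assms(2) that by auto
  have v1: "velocity (G e) = D 1 0 e" unfolding G by (rule velocity_eqI) (use d[of 0] in simp)
  have v2: "velocity (velocity (G e)) = D 2 0 e"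
    unfolding v1 by (rule velocity_eqI) (use d[of 1] in \<open>simp add: numeral_2_eq_2\<close>)
  show "(G e has_vector_derivative velocity (G e) t) (at t)" using d[of 0] by (simp add: v1) (simp add: G)
  show "(velocity (G e) has_vector_derivative velocity (velocity (G e)) t) (at t)"
    unfolding v2 unfolding v1 using d[of 1] by (simp add: numeral_2_eq_2)
  show "continuous_on UNIV (velocity (velocity (G e)))"
    unfolding v2 by (intro continuous_at_imp_continuous_on ballI has_vector_derivative_continuous[OF d]) simp
qed

locale bellman_domain =
  fixes emax :: ereal and G :: "real \<Rightarrow> real \<Rightarrow> real^2" and f :: "real \<Rightarrow> real" and \<epsilon> :: real
  assumes domain: "domain_family emax G" and regular: "regularity_condition (G 0) f"
    and \<epsilon>_pos: "0 < \<epsilon>" and \<epsilon>_less: "ereal \<epsilon> < emax"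
begin

lemma params: "0 \<in> param_range emax" "\<epsilon> \<in> param_range emax" "\<epsilon> \<in> param_range emax - {0}"
  using \<epsilon>_pos \<epsilon>_less domain by (auto simp: param_range_def domain_family_def zero_ereal_def[symmetric])

lemma convex_curve_G:
  assumes "e \<in> param_range emax"
  shows "convex_curve (G e) (velocity (G e)) (velocity (velocity (G e)))"
proof
  have C: "C31_family emax G" using domain by (simp add: domain_family_def)
  fix t
  show "(G e has_vector_derivative velocity (G e) t) (at t)"
    "(velocity (G e) has_vector_derivative velocity (velocity (G e)) t) (at t)"
    "continuous_on UNIV (velocity (velocity (G e)))"
    using C31_family_velocities[OF C assms] by auto
  show "velocity (G e) t $ 1 > 0"
    "velocity (velocity (G e)) t $ 2 * velocity (G e) t $ 1 - velocity (G e) t $ 2 * velocity (velocity (G e)) t $ 1 > 0"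
    using domain assms unfolding domain_family_def velocity_abs by (auto simp: velocity_def[symmetric])
qed

lemma tangent_line_iff:
  assumes "e \<in> param_range emax"
  shows "y \<in> tangent_line G e s \<longleftrightarrow> convex_curve.height (G e) (velocity (G e)) s y = 0"
proof -
  interpret c: convex_curve "G e" "velocity (G e)" "velocity (velocity (G e))" using assms by (rule convex_curve_G)
  show ?thesis
  proof
    assume "y \<in> tangent_line G e s"
    then obtain r where "y = G e s + r *\<^sub>R velocity (G e) s" unfolding tangent_line_def velocity_def by blast
    then show "c.height s y = 0" by (simp add: c.height_def c.dc2_eq)
  next
    assume 0: "c.height s y = 0"
    define r where "r = (y $ 1 - G e s $ 1) / velocity (G e) s $ 1"
    have "r * velocity (G e) s $ 1 = y $ 1 - G e s $ 1" by (simp add: r_def)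
    moreover have "r * velocity (G e) s $ 2 = c.slope s * (r * velocity (G e) s $ 1)"
      by (simp only: c.dc2_eq mult.left_commute)
    ultimately have "y = G e s + r *\<^sub>R velocity (G e) s"
      using 0 by (simp add: vec2_eq_iff c.height_def)
    then show "y \<in> tangent_line G e s" unfolding tangent_line_def velocity_def by blast
  qed
qed

lemma strip_G:
  "strip (G 0) (velocity (G 0)) (velocity (velocity (G 0))) (G \<epsilon>) (velocity (G \<epsilon>)) (velocity (velocity (G \<epsilon>)))"
proof -
  interpret g: convex_curve "G 0" "velocity (G 0)" "velocity (velocity (G 0))" by (rule convex_curve_G[OF params(1)])
  interpret h: convex_curve "G \<epsilon>" "velocity (G \<epsilon>)" "velocity (velocity (G \<epsilon>))" by (rule convex_curve_G[OF params(2)])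
  have nest: "Xi G \<epsilon> \<subseteq> Xi G 0" and out: "G 0 t \<notin> closure (Xi G \<epsilon>)" for t
    using domain params \<epsilon>_pos unfolding domain_family_def by blast+
  show ?thesis
  proof
    fix s t
    let ?up = "\<lambda>\<delta>. G \<epsilon> s + axis 2 \<delta> :: real^2"
    have up: "?up \<delta> \<in> Xi G \<epsilon>" if "\<delta> > 0" for \<delta>
      using that unfolding Xi_def by (auto simp: axis_def intro!: exI[of _ s])
    show "\<exists>t. G 0 t $ 1 = G \<epsilon> s $ 1 \<and> G 0 t $ 2 < G \<epsilon> s $ 2"
    proof -
      have *: "\<exists>t. G 0 t $ 1 = G \<epsilon> s $ 1 \<and> G 0 t $ 2 < G \<epsilon> s $ 2 + \<delta>" if "\<delta> > 0" for \<delta>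
        using subsetD[OF nest up[OF that]] unfolding Xi_def by (auto simp: axis_def)
      obtain t where t: "G 0 t $ 1 = G \<epsilon> s $ 1" using *[of 1] by auto
      have "G 0 t $ 2 < G \<epsilon> s $ 2 + \<delta>" if "\<delta> > 0" for \<delta>
        using *[OF that] t by (metis g.c1_eq_iff)
      then have "G 0 t $ 2 \<le> G \<epsilon> s $ 2" by (metis field_le_epsilon less_imp_le)
      moreover have "G 0 t $ 2 \<noteq> G \<epsilon> s $ 2"
      proof
        assume "G 0 t $ 2 = G \<epsilon> s $ 2"
        with t have eq: "G 0 t = G \<epsilon> s" by (simp add: vec2_eq_iff)
        have "G \<epsilon> s \<in> closure (Xi G \<epsilon>)"
          unfolding closure_approachable
        proof (intro allI impI)
          fix \<delta> :: real assume "0 < \<delta>"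
          then show "\<exists>y\<in>Xi G \<epsilon>. dist y (G \<epsilon> s) < \<delta>"
            using up[of "\<delta> / 2"] norm_le_l1_cart[of "axis 2 (\<delta> / 2) :: real^2"]
            by (intro bexI[of _ "?up (\<delta> / 2)"]) (simp_all add: dist_norm sum_2 axis_def)
        qed
        with out[of t] eq show False by simp
      qed
      ultimately show ?thesis using t by (intro exI[of _ t]) simp
    qed
    have two: "card {s. G 0 t \<in> tangent_line G \<epsilon> s} = 2"
      "\<And>s. G 0 t \<in> tangent_line G \<epsilon> s \<Longrightarrow> card (tangent_line G \<epsilon> s \<inter> range (G 0)) = 2" for t
      using domain params(3) unfolding domain_family_def by blast+
    show "card {s. h.height s (G 0 t) = 0} = 2"
      using two(1)[of t] by (simp add: tangent_line_iff[OF params(2)])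
    show "\<exists>t'. t' \<noteq> t \<and> h.height s (G 0 t') = 0" if "h.height s (G 0 t) = 0"
    proof -
      have t: "G 0 t \<in> tangent_line G \<epsilon> s" using that by (simp add: tangent_line_iff[OF params(2)])
      from two(2)[OF t] obtain a b where ab: "tangent_line G \<epsilon> s \<inter> range (G 0) = {a, b}" "a \<noteq> b"
        by (auto simp: card_2_iff)
      then obtain y where y: "y \<in> tangent_line G \<epsilon> s" "y \<in> range (G 0)" "y \<noteq> G 0 t"
        by (metis Int_iff insertI1 insert_commute)
      then obtain t' where "y = G 0 t'" by blast
      with y show ?thesis by (intro exI[of _ t']) (auto simp: tangent_line_iff[OF params(2)])
    qed
  qed
qed

sublocale strip "G 0" "velocity (G 0)" "velocity (velocity (G 0))" "G \<epsilon>" "velocity (G \<epsilon>)" "velocity (velocity (G \<epsilon>))"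
  by (rule strip_G)

sublocale r: strip "refl_curve (G 0)" "refl_deriv (velocity (G 0))" "refl_curve (velocity (velocity (G 0)))"
  "refl_curve (G \<epsilon>)" "refl_deriv (velocity (G \<epsilon>))" "refl_curve (velocity (velocity (G \<epsilon>)))"
  by (rule strip_refl)

abbreviation "g \<equiv> G 0"
abbreviation "h \<equiv> G \<epsilon>"

subsection \<open>Tangents\<close>

lemma tangency_param_eq: "tangency_param G \<epsilon> Right = sR" "tangency_param G \<epsilon> Left = sL"
proof -
  have "{s. g t \<in> tangent_line G \<epsilon> s} = {sR t, sL t}" for t
    by (auto simp: tangent_line_iff[OF params(2)] height_fixed_eq_0_iff)
  then show "tangency_param G \<epsilon> Right = sR" "tangency_param G \<epsilon> Left = sL"
    using sR_less_sL by (auto simp: fun_eq_iff min_def max_def less_imp_le not_le)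
qed

lemma tangency_point_eq: "tangency_point G \<epsilon> Right = wR" "tangency_point G \<epsilon> Left = wL"
  by (simp_all add: fun_eq_iff tangency_point_def tangency_param_eq wR_def wL_def)

lemma tangent_segment_eq:
  "tangent_segment G \<epsilon> Right t = closed_segment (wR t) (g t)"
  "tangent_segment G \<epsilon> Left t = closed_segment (g t) (wL t)"
  by (simp_all add: tangent_segment_def tangency_point_eq closed_segment_commute)

lemma tangent_slope_left: "g t $ 2 - wL t $ 2 = free.slope (sL t) * (g t $ 1 - wL t $ 1)"
  using sL_root[of t] unfolding free.height_def wL_def by linarith

lemma tangent_slope_eqs:
  "tangent_slope G \<epsilon> Right t = free.slope (sR t)" "tangent_slope G \<epsilon> Left t = free.slope (sL t)"
proof -
  have "wR t $ 1 - g t $ 1 \<noteq> 0" "wL t $ 1 - g t $ 1 \<noteq> 0" using wR_less[of t] wL_greater[of t] by auto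
  moreover have "wR t $ 2 - g t $ 2 = free.slope (sR t) * (wR t $ 1 - g t $ 1)"
    using tangent_slope_eq[of t] by (simp add: algebra_simps)
  moreover have "wL t $ 2 - g t $ 2 = free.slope (sL t) * (wL t $ 1 - g t $ 1)"
    using tangent_slope_left[of t] by (simp add: algebra_simps)
  ultimately show "tangent_slope G \<epsilon> Right t = free.slope (sR t)" "tangent_slope G \<epsilon> Left t = free.slope (sL t)"
    by (simp_all add: tangent_slope_def tangency_point_eq)
qed

lemma wL_deriv: "(wL has_vector_derivative (- r.lamR (- t)) *\<^sub>R (g t - wL t)) (at t)"
proof -
  have "wL = refl_curve r.wR" by (simp add: fun_eq_iff wR_refl refl_curve_def)
  moreover have "(refl_curve r.wR has_vector_derivative
      refl_deriv (\<lambda>t. r.lamR t *\<^sub>R (refl_curve g t - r.wR t)) t) (at t)"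
    by (rule refl_curve_deriv) (rule r.wR_deriv)
  moreover have "refl_deriv (\<lambda>t. r.lamR t *\<^sub>R (refl_curve g t - r.wR t)) t = (- r.lamR (- t)) *\<^sub>R (g t - wL t)"
    by (simp add: refl_deriv_def refl_pt_linear wR_refl refl_curve_def)
  ultimately show ?thesis by simp
qed

lemma lam_eq: "lam G \<epsilon> Right t = lamR t" "lam G \<epsilon> Left t = - r.lamR (- t)"
proof -
  have the: "(THE l. l *\<^sub>R v = k *\<^sub>R v) = k" if "v \<noteq> 0" for k :: real and v :: "real^2"
    using that by (intro the_equality) (simp_all add: scaleR_cancel_right)
  have nz: "g t - wR t \<noteq> 0" "g t - wL t \<noteq> 0" using wR_less[of t] wL_greater[of t] by auto
  show "lam G \<epsilon> Right t = lamR t"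
    unfolding lam_def tangency_point_eq vector_derivative_at[OF wR_deriv] by (rule the[OF nz(1)])
  show "lam G \<epsilon> Left t = - r.lamR (- t)"
    unfolding lam_def tangency_point_eq vector_derivative_at[OF wL_deriv] by (rule the[OF nz(2)])
qed

lemma decays_right: decays
proof -
  have "((\<lambda>t. (1 + norm (tangency_point G \<epsilon> Right t - G 0 t)) * exp (- integral {t..0} (lam G \<epsilon> Right))) \<longlongrightarrow> 0) at_bot"
    using domain params(3) unfolding domain_family_def by blast
  moreover have "lam G \<epsilon> Right = lamR" by (simp add: fun_eq_iff lam_eq)
  ultimately show ?thesis by (simp add: decays_def tangency_point_eq)
qed

lemma norm_refl_pt: "norm (refl_pt y) = norm y"
  by (simp add: norm_eq_sqrt_inner inner_vec_def sum_2)

lemma decays_left: r.decays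
proof -
  have "((\<lambda>t. (1 + norm (tangency_point G \<epsilon> Left t - G 0 t)) * exp (integral {0..t} (lam G \<epsilon> Left))) \<longlongrightarrow> 0) at_top"
    using domain params(3) unfolding domain_family_def by blast
  then have "((\<lambda>t. (1 + norm (tangency_point G \<epsilon> Left (- t) - G 0 (- t))) * exp (integral {0..- t} (lam G \<epsilon> Left))) \<longlongrightarrow> 0) at_bot"
    by (subst (asm) filterlim_at_top_mirror)
  moreover have "norm (tangency_point G \<epsilon> Left (- t) - G 0 (- t)) = norm (r.wR t - refl_curve g t)" for t
    using norm_refl_pt[of "wL (- t) - g (- t)"]
    by (simp add: tangency_point_eq wR_refl refl_curve_def refl_pt_linear)
  moreover have "integral {0..- t} (lam G \<epsilon> Left) = - integral {t..0} r.lamR" for t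
  proof -
    have "lam G \<epsilon> Left = (\<lambda>t. - r.lamR (- t))" by (simp add: fun_eq_iff lam_eq)
    then show ?thesis
      using Henstock_Kurzweil_Integration.integral_reflect_real[of 0 t r.lamR] by simp
  qed
  ultimately show ?thesis by (simp add: r.decays_def)
qed

subsection \<open>The boundary function\<close>

abbreviation "f' \<equiv> velocity f"
abbreviation "f'' \<equiv> velocity (velocity f)"

lemma f_deriv: "(f has_real_derivative f' t) (at t)" and f'_deriv: "(f' has_real_derivative f'' t) (at t)"
proof -
  from conjunct1[OF regular[unfolded regularity_condition_def]]
  obtain f1 f2 where *: "\<forall>t. (f has_real_derivative f1 t) (at t)" "\<forall>t. (f1 has_real_derivative f2 t) (at t)"
    by (elim exE conjE) (rule that)
  have d: "(f has_vector_derivative f1 t) (at t)" "(f1 has_vector_derivative f2 t) (at t)" for t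
    using spec[OF *(1), of t] spec[OF *(2), of t]
    by (simp_all only: has_real_derivative_iff_has_vector_derivative)
  have v: "f' = f1" "velocity f1 = f2" by (rule velocity_eqI[OF d(1)], rule velocity_eqI[OF d(2)])
  show "(f has_real_derivative f' t) (at t)" unfolding v(1) by (rule spec[OF *(1)])
  show "(f' has_real_derivative f'' t) (at t)" unfolding v by (rule spec[OF *(2)])
qed

lemma kappa2_eq: "kappa2 g = fixed.slope"
  by (simp add: fun_eq_iff kappa2_def fixed.slope_def velocity_def)

lemma kappa3_eq: "kappa3 g f = k3 f'"
  by (simp add: fun_eq_iff kappa3_def k3_def velocity_def)

lemma vdiff_kappa2: "vector_derivative (kappa2 g) (at t) = fixed.dslope t"
  unfolding kappa2_eq using fixed.slope_deriv
  by (intro vector_derivative_at) (simp add: has_real_derivative_iff_has_vector_derivative)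

lemma vdiff_kappa3: "vector_derivative (kappa3 g f) (at t) = dk3 f' f'' t"
  unfolding kappa3_eq using k3_deriv[of f' f'' t] f'_deriv
  by (intro vector_derivative_at) (simp add: has_real_derivative_iff_has_vector_derivative)

lemma torsion_quot_eq: "torsion_quot g f = (\<lambda>t. dk3 f' f'' t / fixed.dslope t)"
  by (simp add: fun_eq_iff torsion_quot_def vdiff_kappa2 vdiff_kappa3)

lemma torsion_quot_signs:
  "sign_at_bot (\<lambda>t. dk3 f' f'' t / fixed.dslope t)"
  "sign_at_bot (\<lambda>t. dk3 f' f'' (- t) / fixed.dslope (- t))"
proof -
  have "\<exists>P. finite P \<and> (\<forall>I. is_interval I \<and> I \<inter> P = {} \<longrightarrow>
      mono_on I (torsion_quot g f) \<or> antimono_on I (torsion_quot g f))"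
    using regular unfolding regularity_condition_def by (rule conjunct2)
  then obtain P where P: "finite P" "\<forall>I. is_interval I \<and> I \<inter> P = {} \<longrightarrow>
      mono_on I (torsion_quot g f) \<or> antimono_on I (torsion_quot g f)"
    by (elim exE conjE)
  obtain c where c: "\<And>p. p \<in> P \<Longrightarrow> \<bar>p\<bar> \<le> c" using finite_imp_bounded[OF P(1)] by (auto simp: bounded_iff)
  have "{..<- c} \<inter> P = {}" "{c<..} \<inter> P = {}" using c by force+
  then have m: "mono_on {..<- c} (torsion_quot g f) \<or> antimono_on {..<- c} (torsion_quot g f)"
    "mono_on {c<..} (torsion_quot g f) \<or> antimono_on {c<..} (torsion_quot g f)"
    using P(2)[rule_format, of "{..<- c}"] P(2)[rule_format, of "{c<..}"] by (simp_all add: is_interval_io is_interval_oi)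
  show "sign_at_bot (\<lambda>t. dk3 f' f'' t / fixed.dslope t)"
    using sign_at_bot_monotone[OF m(1)] by (simp only: torsion_quot_eq)
  have "mono_on {..<- c} (\<lambda>t. torsion_quot g f (- t)) \<or> antimono_on {..<- c} (\<lambda>t. torsion_quot g f (- t))"
    using m(2)
  proof
    assume "mono_on {c<..} (torsion_quot g f)"
    then have "antimono_on {..<- c} (\<lambda>t. torsion_quot g f (- t))" by (simp add: monotone_on_def)
    then show ?thesis ..
  next
    assume "antimono_on {c<..} (torsion_quot g f)"
    then have "mono_on {..<- c} (\<lambda>t. torsion_quot g f (- t))" by (simp add: monotone_on_def)
    then show ?thesis ..
  qed
  then have "sign_at_bot (\<lambda>t. torsion_quot g f (- t))" by (rule sign_at_bot_monotone)
  then show "sign_at_bot (\<lambda>t. dk3 f' f'' (- t) / fixed.dslope (- t))" by (simp only: torsion_quot_eq)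
qed


subsection \<open>Optimizers in tangent domains\<close>

lemma convex_ereal_interval: "t1 \<in> ereal_interval u v \<Longrightarrow> t2 \<in> ereal_interval u v \<Longrightarrow> {t1..t2} \<subseteq> ereal_interval u v"
  by (cases u; cases v; force simp: ereal_interval_def)

lemma right_fan_value:
  assumes "tangents_candidate G \<epsilon> f Right u1 u2 B"
  obtains \<beta> \<beta>' where "fan_equation f' f'' (ereal_interval u1 u2) \<beta> \<beta>'"
    and "\<And>t. t \<in> ereal_interval u1 u2 \<Longrightarrow> B (wR t) = fan_value f f' \<beta> t"
    and "\<And>t \<theta>. t \<in> ereal_interval u1 u2 \<Longrightarrow> 0 \<le> \<theta> \<Longrightarrow> \<theta> \<le> 1 \<Longrightarrow>
      B ((1 - \<theta>) *\<^sub>R wR t + \<theta> *\<^sub>R g t) = (1 - \<theta>) * B (wR t) + \<theta> * f t"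
    and "\<And>t. u1 = -\<infinity> \<Longrightarrow> t \<in> ereal_interval u1 u2 \<Longrightarrow> \<exists>y.
        has_stieltjes_integral (\<lambda>\<tau>. exp (- integral {\<tau>..t} (\<lambda>t. fixed.dslope t / (fixed.slope t - free.slope (sR t)))))
          (\<lambda>t. dk3 f' f'' t / fixed.dslope t) {..t} y \<and> \<beta> t = dk3 f' f'' t / fixed.dslope t - y"
proof -
  have W: "tangent_weight G \<epsilon> Right = (\<lambda>t. fixed.dslope t / (fixed.slope t - free.slope (sR t)))"
    by (simp add: fun_eq_iff tangent_weight_def vdiff_kappa2[unfolded kappa2_eq] kappa2_eq tangent_slope_eqs)
  note def = assms[unfolded tangents_candidate_def W torsion_quot_eq tangent_slope_eqs kappa2_eq
      vdiff_kappa2[unfolded kappa2_eq] kappa3_eq vdiff_kappa3[unfolded kappa3_eq] tangent_segment_eq]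
  obtain \<beta> \<beta>' where
    eq: "\<forall>t\<in>ereal_interval u1 u2. (\<beta> has_real_derivative \<beta>' t) (at t within ereal_interval u1 u2) \<and>
       (fixed.slope t - free.slope (sR t)) * \<beta>' t + fixed.dslope t * \<beta> t = dk3 f' f'' t" and
    st: "Right = Right \<and> u1 = -\<infinity> \<longrightarrow> (\<forall>t\<in>ereal_interval u1 u2. \<exists>y.
        has_stieltjes_integral (\<lambda>\<tau>. exp (- integral {\<tau>..t} (\<lambda>t. fixed.dslope t / (fixed.slope t - free.slope (sR t)))))
          (\<lambda>t. dk3 f' f'' t / fixed.dslope t) {..t} y \<and> \<beta> t = dk3 f' f'' t / fixed.dslope t - y)" and
    B: "\<forall>t\<in>ereal_interval u1 u2. \<forall>x\<in>closed_segment (wR t) (g t).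
        B x = f t + (x $ 1 - g t $ 1) * (k3 f' t + (free.slope (sR t) - fixed.slope t) * \<beta> t)"
    using def by (elim exE conjE) (rule that; assumption)
  have Bw: "B (wR t) = fan_value f f' \<beta> t" if "t \<in> ereal_interval u1 u2" for t
    using B that by (simp add: fan_value_def)
  show thesis
  proof (rule that[of \<beta> \<beta>'])
    show "fan_equation f' f'' (ereal_interval u1 u2) \<beta> \<beta>'" using eq by (simp add: fan_equation_def)
    fix t \<theta> assume t: "t \<in> ereal_interval u1 u2" and \<theta>: "0 \<le> (\<theta>::real)" "\<theta> \<le> 1"
    let ?x = "(1 - \<theta>) *\<^sub>R wR t + \<theta> *\<^sub>R g t"
    have "?x \<in> closed_segment (wR t) (g t)" using \<theta> by (auto simp: in_segment)
    then have "B ?x = f t + (?x $ 1 - g t $ 1) * (k3 f' t + (free.slope (sR t) - fixed.slope t) * \<beta> t)"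
      using B t by blast
    moreover have "?x $ 1 - g t $ 1 = (1 - \<theta>) * (wR t $ 1 - g t $ 1)" by (simp add: algebra_simps)
    ultimately show "B ?x = (1 - \<theta>) * B (wR t) + \<theta> * f t"
      unfolding Bw[OF t] fan_value_def by (simp only: mult.assoc distrib_left) (simp add: algebra_simps)
  qed (use Bw in simp, use st in blast)
qed

lemma left_fan_value:
  assumes "tangents_candidate G \<epsilon> f Left u1 u2 B"
  obtains \<beta> \<beta>' where "left_fan_equation f' f'' (ereal_interval u1 u2) \<beta> \<beta>'"
    and "\<And>t. t \<in> ereal_interval u1 u2 \<Longrightarrow> B (wL t) = left_fan_value f f' \<beta> t"
    and "\<And>t \<theta>. t \<in> ereal_interval u1 u2 \<Longrightarrow> 0 \<le> \<theta> \<Longrightarrow> \<theta> \<le> 1 \<Longrightarrow>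
      B ((1 - \<theta>) *\<^sub>R wL t + \<theta> *\<^sub>R g t) = (1 - \<theta>) * B (wL t) + \<theta> * f t"
    and "\<And>t. u2 = \<infinity> \<Longrightarrow> t \<in> ereal_interval u1 u2 \<Longrightarrow> \<exists>y.
        has_stieltjes_integral (\<lambda>\<tau>. exp (integral {t..\<tau>} (\<lambda>t. fixed.dslope t / (fixed.slope t - free.slope (sL t)))))
          (\<lambda>t. dk3 f' f'' t / fixed.dslope t) {t..} y \<and> \<beta> t = dk3 f' f'' t / fixed.dslope t + y"
proof -
  have W: "tangent_weight G \<epsilon> Left = (\<lambda>t. fixed.dslope t / (fixed.slope t - free.slope (sL t)))"
    by (simp add: fun_eq_iff tangent_weight_def vdiff_kappa2[unfolded kappa2_eq] kappa2_eq tangent_slope_eqs)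
  note def = assms[unfolded tangents_candidate_def W torsion_quot_eq tangent_slope_eqs kappa2_eq
      vdiff_kappa2[unfolded kappa2_eq] kappa3_eq vdiff_kappa3[unfolded kappa3_eq] tangent_segment_eq]
  obtain \<beta> \<beta>' where
    eq: "\<forall>t\<in>ereal_interval u1 u2. (\<beta> has_real_derivative \<beta>' t) (at t within ereal_interval u1 u2) \<and>
       (fixed.slope t - free.slope (sL t)) * \<beta>' t + fixed.dslope t * \<beta> t = dk3 f' f'' t" and
    st: "Left = Left \<and> u2 = \<infinity> \<longrightarrow> (\<forall>t\<in>ereal_interval u1 u2. \<exists>y.
        has_stieltjes_integral (\<lambda>\<tau>. exp (integral {t..\<tau>} (\<lambda>t. fixed.dslope t / (fixed.slope t - free.slope (sL t)))))
          (\<lambda>t. dk3 f' f'' t / fixed.dslope t) {t..} y \<and> \<beta> t = dk3 f' f'' t / fixed.dslope t + y)" and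
    B: "\<forall>t\<in>ereal_interval u1 u2. \<forall>x\<in>closed_segment (g t) (wL t).
        B x = f t + (x $ 1 - g t $ 1) * (k3 f' t + (free.slope (sL t) - fixed.slope t) * \<beta> t)"
    using def by (elim exE conjE) (rule that; assumption)
  have Bw: "B (wL t) = left_fan_value f f' \<beta> t" if "t \<in> ereal_interval u1 u2" for t
    using B that by (simp add: left_fan_value_def)
  show thesis
  proof (rule that[of \<beta> \<beta>'])
    show "left_fan_equation f' f'' (ereal_interval u1 u2) \<beta> \<beta>'" using eq by (simp add: left_fan_equation_def)
    fix t \<theta> assume t: "t \<in> ereal_interval u1 u2" and \<theta>: "0 \<le> (\<theta>::real)" "\<theta> \<le> 1"
    let ?x = "(1 - \<theta>) *\<^sub>R wL t + \<theta> *\<^sub>R g t"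
    have "?x \<in> closed_segment (wL t) (g t)" using \<theta> by (auto simp: in_segment)
    then have "?x \<in> closed_segment (g t) (wL t)" by (simp add: closed_segment_commute)
    then have "B ?x = f t + (?x $ 1 - g t $ 1) * (k3 f' t + (free.slope (sL t) - fixed.slope t) * \<beta> t)"
      using B t by blast
    moreover have "?x $ 1 - g t $ 1 = (1 - \<theta>) * (wL t $ 1 - g t $ 1)" by (simp add: algebra_simps)
    ultimately show "B ?x = (1 - \<theta>) * B (wL t) + \<theta> * f t"
      unfolding Bw[OF t] left_fan_value_def by (simp only: mult.assoc distrib_left) (simp add: algebra_simps)
  qed (use Bw in simp, use st in blast)
qed

lemma right_fan_delivers:
  assumes B: "tangents_candidate G \<epsilon> f Right u1 u2 B" and t: "t \<in> ereal_interval u1 u2" and u: "u1 < u2"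
    and start: "\<And>u. u1 = ereal u \<Longrightarrow> left_opt f (sR u) (wR u) (B (wR u))"
  shows "left_opt f (sR t) (wR t) (B (wR t))"
proof -
  obtain \<beta> \<beta>' where \<beta>: "fan_equation f' f'' (ereal_interval u1 u2) \<beta> \<beta>'"
    "\<And>t. t \<in> ereal_interval u1 u2 \<Longrightarrow> B (wR t) = fan_value f f' \<beta> t"
    and st: "\<And>t. u1 = -\<infinity> \<Longrightarrow> t \<in> ereal_interval u1 u2 \<Longrightarrow> \<exists>y.
        has_stieltjes_integral (\<lambda>\<tau>. exp (- integral {\<tau>..t} (\<lambda>t. fixed.dslope t / (fixed.slope t - free.slope (sR t)))))
          (\<lambda>t. dk3 f' f'' t / fixed.dslope t) {..t} y \<and> \<beta> t = dk3 f' f'' t / fixed.dslope t - y"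
    by (rule right_fan_value[OF B]) blast
  show ?thesis
  proof (cases u1)
    case (real u)
    have u': "u \<in> ereal_interval u1 u2" "u \<le> t" using real u t by (auto simp: ereal_interval_def)
    show ?thesis
      unfolding \<beta>(2)[OF t]
      by (rule left_opt_along_fan[OF f_deriv f'_deriv \<beta>(1) convex_ereal_interval[OF u'(1) t] u'(2)])
        (use start[OF real] \<beta>(2)[OF u'(1)] in simp)
  next
    case MInf
    have I: "{..t} \<subseteq> ereal_interval u1 u2"
      using t MInf by (cases u2; force simp: ereal_interval_def)
    obtain y where y: "has_stieltjes_integral (\<lambda>\<tau>. exp (- integral {\<tau>..t} (\<lambda>t. fixed.dslope t / (fixed.slope t - free.slope (sR t)))))
          (\<lambda>t. dk3 f' f'' t / fixed.dslope t) {..t} y" "\<beta> t = dk3 f' f'' t / fixed.dslope t - y"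
      using st[OF MInf t] by blast
    show ?thesis
      unfolding \<beta>(2)[OF t]
      by (rule left_opt_fan_stieltjes[OF decays_right f_deriv f'_deriv torsion_quot_signs(1) \<beta>(1) I y])
  qed (use u in auto)
qed

lemma left_fan_delivers:
  assumes B: "tangents_candidate G \<epsilon> f Left u1 u2 B" and t: "t \<in> ereal_interval u1 u2" and u: "u1 < u2"
    and start: "\<And>u. u2 = ereal u \<Longrightarrow> right_opt f (sL u) (wL u) (B (wL u))"
  shows "right_opt f (sL t) (wL t) (B (wL t))"
proof -
  obtain \<beta> \<beta>' where \<beta>: "left_fan_equation f' f'' (ereal_interval u1 u2) \<beta> \<beta>'"
    "\<And>t. t \<in> ereal_interval u1 u2 \<Longrightarrow> B (wL t) = left_fan_value f f' \<beta> t"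
    and st: "\<And>t. u2 = \<infinity> \<Longrightarrow> t \<in> ereal_interval u1 u2 \<Longrightarrow> \<exists>y.
        has_stieltjes_integral (\<lambda>\<tau>. exp (integral {t..\<tau>} (\<lambda>t. fixed.dslope t / (fixed.slope t - free.slope (sL t)))))
          (\<lambda>t. dk3 f' f'' t / fixed.dslope t) {t..} y \<and> \<beta> t = dk3 f' f'' t / fixed.dslope t + y"
    by (rule left_fan_value[OF B]) blast
  show ?thesis
  proof (cases u2)
    case (real u)
    have u': "u \<in> ereal_interval u1 u2" "t \<le> u" using real u t by (auto simp: ereal_interval_def)
    show ?thesis
      unfolding \<beta>(2)[OF t]
      by (rule right_opt_along_fan[OF f_deriv f'_deriv \<beta>(1) convex_ereal_interval[OF t u'(1)] u'(2)])
        (use start[OF real] \<beta>(2)[OF u'(1)] in simp)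
  next
    case PInf
    have I: "{t..} \<subseteq> ereal_interval u1 u2"
      using t PInf by (cases u1; force simp: ereal_interval_def)
    obtain y where y: "has_stieltjes_integral (\<lambda>\<tau>. exp (integral {t..\<tau>} (\<lambda>t. fixed.dslope t / (fixed.slope t - free.slope (sL t)))))
          (\<lambda>t. dk3 f' f'' t / fixed.dslope t) {t..} y" "\<beta> t = dk3 f' f'' t / fixed.dslope t + y"
      using st[OF PInf t] by blast
    show ?thesis
      unfolding \<beta>(2)[OF t]
      by (rule right_opt_fan_stieltjes[OF f_deriv f'_deriv decays_left torsion_quot_signs(2) \<beta>(1) I y])
  qed (use u in auto)
qed

end

section \<open>From distributions to optimizers\<close>

lemma bounded_interval_hull:
  fixes J :: "real set"
  assumes "nondeg_interval J"
  obtains p q where "p < q" "J \<subseteq> {p..q}" "{p<..<q} \<subseteq> J"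
proof -
  have J: "is_interval J" "bounded J" "interior J \<noteq> {}" using assms by (auto simp: nondeg_interval_def)
  then have ne: "J \<noteq> {}" by auto
  have bdd: "bdd_above J" "bdd_below J" using J(2) bounded_imp_bdd_above bounded_imp_bdd_below by auto
  have sub: "J \<subseteq> {Inf J..Sup J}" using bdd by (auto intro: cInf_lower cSup_upper)
  have inner: "{Inf J<..<Sup J} \<subseteq> J"
  proof
    fix x assume "x \<in> {Inf J<..<Sup J}"
    then obtain a b where "a \<in> J" "a < x" "b \<in> J" "x < b"
      using cInf_lessD[OF ne, of x] less_cSupD[OF ne, of x] by auto
    then show "x \<in> J" using mem_is_interval_1_I[OF J(1), of a b x] by auto
  qed
  have "Inf J < Sup J"
  proof (rule ccontr)
    assume "\<not> Inf J < Sup J"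
    then have "J \<subseteq> {Inf J}" using sub by auto
    then have "interior J \<subseteq> interior {Inf J}" by (rule interior_mono)
    then show False using J(3) by simp
  qed
  then show ?thesis using sub inner that by blast
qed

lemma average_eq_integral:
  fixes \<phi> :: "real \<Rightarrow> 'a::euclidean_space"
  assumes int: "\<phi> absolutely_integrable_on {p..q}" and "p < q" and J: "nondeg_interval J" "J \<subseteq> {p..q}" "{p<..<q} \<subseteq> J"
  shows "average J \<phi> = (1 / (q - p)) *\<^sub>R integral {p..q} \<phi>"
proof -
  have lm: "J \<in> lmeasurable"
    using J(1) by (intro measurable_convex) (auto simp: nondeg_interval_def is_interval_convex)
  have spike: "integral J \<psi> = integral {p..q} \<psi>" for \<psi> :: "real \<Rightarrow> 'b::euclidean_space"
  proof (rule integral_spike_set)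
    have "{x \<in> J - {p..q}. \<psi> x \<noteq> 0} = {}" using J(2) by auto
    then show "negligible {x \<in> J - {p..q}. \<psi> x \<noteq> 0}" by (simp only: negligible_empty)
    have "{x \<in> {p..q} - J. \<psi> x \<noteq> 0} \<subseteq> {p, q}" using J(3) by force
    then show "negligible {x \<in> {p..q} - J. \<psi> x \<noteq> 0}" by (rule negligible_subset[rotated]) simp
  qed
  have "measure lebesgue J = integral J (\<lambda>x. 1)" by (rule lmeasure_integral[OF lm])
  also have "\<dots> = q - p" using spike[of "\<lambda>x. 1 :: real"] \<open>p < q\<close> by simp
  finally have m: "measure lebesgue J = q - p" .
  have "set_integrable lebesgue J \<phi>"
    by (rule set_integrable_subset[OF int _ J(2)]) (use lm in auto)
  then have "(LINT t:J|lebesgue. \<phi> t) = integral J \<phi>" by (rule set_lebesgue_integral_eq_integral)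
  then show ?thesis by (simp add: average_def m spike)
qed

lemma positive_integrand_not_0:
  fixes \<psi> :: "real \<Rightarrow> real"
  assumes int: "\<psi> absolutely_integrable_on {p..q}" and "p < q" and pos: "\<And>x. x \<in> {p..q} \<Longrightarrow> \<psi> x > 0"
  shows "integral {p..q} \<psi> \<noteq> 0"
proof
  assume 0: "integral {p..q} \<psi> = 0"
  let ?F = "\<lambda>x. indicat_real {p..q} x *\<^sub>R \<psi> x"
  have i: "integrable lebesgue ?F" using int by (simp add: set_integrable_def)
  have "integral\<^sup>L lebesgue ?F = 0"
    using set_lebesgue_integral_eq_integral(2)[OF int] 0 by (simp add: set_lebesgue_integral_def)
  moreover have "AE x in lebesgue. 0 \<le> ?F x" by (rule AE_I2) (use pos in \<open>auto simp: indicator_def less_imp_le\<close>)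
  ultimately have "AE x in lebesgue. ?F x = 0" using integral_nonneg_eq_0_iff_AE[OF i] by blast
  then have "AE x in lebesgue. x \<notin> {p..q}"
  proof (rule AE_mp, intro AE_I2 impI)
    fix x assume "?F x = 0"
    then show "x \<notin> {p..q}" using pos[of x] by auto
  qed
  then have "{p..q} \<in> null_sets lebesgue" by (subst (asm) AE_iff_null_sets[symmetric]) auto
  then have "measure lebesgue {p..q} = 0" by (auto simp: measure_eq_0_null_sets)
  then show False using \<open>p < q\<close> by simp
qed

context bellman_domain
begin

lemma Omega_iff:
  "x \<in> Omega G \<epsilon> \<longleftrightarrow> (\<exists>t s. g t $ 1 = x $ 1 \<and> h s $ 1 = x $ 1 \<and> g t $ 2 \<le> x $ 2 \<and> x $ 2 \<le> h s $ 2)"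
proof
  assume "x \<in> Omega G \<epsilon>"
  then obtain t0 p s where p: "p \<in> closed_segment (wR t0) (g t0) \<or> p \<in> closed_segment (g t0) (wL t0)"
    "p $ 1 = x $ 1" "p $ 2 \<le> x $ 2" and s: "h s $ 1 = x $ 1" "x $ 2 \<le> h s $ 2"
    unfolding Omega_def curv_triangle_def between_graphs_def tangent_segment_eq by blast
  obtain t where t: "g t $ 1 = h s $ 1" using free_above by blast
  have ends: "0 \<le> fixed.height t (wR t0)" "0 \<le> fixed.height t (wL t0)" "0 \<le> fixed.height t (g t0)"
    using fixed_height_free_pos fixed.height_nonneg by (simp_all add: wR_def wL_def less_imp_le)
  have "0 \<le> fixed.height t p"
    using p(1) ends by (auto simp: in_segment fixed.height_affine)
  then have "g t $ 2 \<le> p $ 2" using t s p by (simp add: fixed.height_at_same_abscissa)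
  then show "\<exists>t s. g t $ 1 = x $ 1 \<and> h s $ 1 = x $ 1 \<and> g t $ 2 \<le> x $ 2 \<and> x $ 2 \<le> h s $ 2"
    using t s p by (intro exI[of _ t] exI[of _ s]) auto
next
  assume "\<exists>t s. g t $ 1 = x $ 1 \<and> h s $ 1 = x $ 1 \<and> g t $ 2 \<le> x $ 2 \<and> x $ 2 \<le> h s $ 2"
  then obtain t s where ts: "g t $ 1 = x $ 1" "h s $ 1 = x $ 1" "g t $ 2 \<le> x $ 2" "x $ 2 \<le> h s $ 2" by blast
  have "h (sR t) $ 1 < h s $ 1" "h s $ 1 < h (sL t) $ 1" using h_sR_less[of t] h_sL_greater[of t] ts by auto
  then have "sR t \<le> s" "s \<le> sL t" by auto
  then have "h s \<in> h ` {sR t..sL t}" by auto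
  moreover have "g t \<in> closed_segment (wR t) (g t)" by simp
  ultimately have "x \<in> curv_triangle G \<epsilon> t"
    unfolding curv_triangle_def between_graphs_def tangent_segment_eq tangency_param_eq
    using ts by blast
  then show "x \<in> Omega G \<epsilon>" unfolding Omega_def by blast
qed

lemma in_OmegaI:
  assumes "g t $ 1 = x $ 1" "g t $ 2 \<le> x $ 2" "free.height s x \<le> 0"
  shows "x \<in> Omega G \<epsilon>"
proof -
  obtain s' where s': "h s' $ 1 = x $ 1" using free_over_fixed[of t] assms(1) by metis
  have "free.height s' x \<le> 0" using free.height_min[of x s' s] s' assms(3) by simp
  then have "x $ 2 \<le> h s' $ 2" using s' by (simp add: free.height_at_same_abscissa)
  then show ?thesis unfolding Omega_iff using assms s' by blast
qed

lemma in_OmegaE: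
  assumes "x \<in> Omega G \<epsilon>"
  obtains t s where "g t $ 1 = x $ 1" "h s $ 1 = x $ 1" "g t $ 2 \<le> x $ 2" "x $ 2 \<le> h s $ 2" "free.height s x \<le> 0"
proof -
  obtain t s where "g t $ 1 = x $ 1" "h s $ 1 = x $ 1" "g t $ 2 \<le> x $ 2" "x $ 2 \<le> h s $ 2"
    using assms unfolding Omega_iff by blast
  then show ?thesis using that[of t s] by (simp add: free.height_at_same_abscissa)
qed

text \<open>Averages of the fixed boundary lie above it by convexity. The first coordinate needs a strict
  inequality, because its range is an open interval.\<close>

lemma average_above_fixed:
  assumes int: "(\<lambda>x. g (\<alpha> x)) absolutely_integrable_on {p..q}" and pq: "p < q"
    and y: "integral {p..q} (\<lambda>x. g (\<alpha> x)) = (q - p) *\<^sub>R y"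
  shows "\<exists>t. g t $ 1 = y $ 1 \<and> g t $ 2 \<le> y $ 2"
proof -
  have hi: "(\<lambda>x. g (\<alpha> x)) integrable_on {p..q}" using int by (simp add: absolutely_integrable_on_def)
  have lin: "integral {p..q} (\<lambda>x. L (g (\<alpha> x))) = (q - p) * L y"
      "(\<lambda>x. L (g (\<alpha> x))) integrable_on {p..q}" "(\<lambda>x. L (g (\<alpha> x))) absolutely_integrable_on {p..q}"
    if L: "bounded_linear L" for L :: "real^2 \<Rightarrow> real"
  proof -
    interpret L: bounded_linear L by (rule L)
    show "integral {p..q} (\<lambda>x. L (g (\<alpha> x))) = (q - p) * L y"
      using integral_linear[OF hi L] by (simp add: o_def y L.scale)
    show "(\<lambda>x. L (g (\<alpha> x))) integrable_on {p..q}"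
      using integrable_linear[OF hi L] by (simp add: o_def)
    show "(\<lambda>x. L (g (\<alpha> x))) absolutely_integrable_on {p..q}"
      using absolutely_integrable_linear[OF int L] by (simp add: o_def)
  qed
  have c1: "(\<lambda>x. r * (g (\<alpha> x) $ 1 - y $ 1)) absolutely_integrable_on {p..q}"
    and i1: "integral {p..q} (\<lambda>x. r * (g (\<alpha> x) $ 1 - y $ 1)) = 0" for r
  proof -
    have 1: "(\<lambda>x. g (\<alpha> x) $ 1) absolutely_integrable_on {p..q}" "(\<lambda>x. g (\<alpha> x) $ 1) integrable_on {p..q}"
      "integral {p..q} (\<lambda>x. g (\<alpha> x) $ 1) = (q - p) * y $ 1"
      using lin[OF bounded_linear_vec_nth[of 1]] by auto
    have "(\<lambda>x. g (\<alpha> x) $ 1 - y $ 1) absolutely_integrable_on {p..q}"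
      by (intro set_integral_diff(1) 1 absolutely_integrable_on_const) auto
    then show "(\<lambda>x. r * (g (\<alpha> x) $ 1 - y $ 1)) absolutely_integrable_on {p..q}" by simp
    have "integral {p..q} (\<lambda>x. g (\<alpha> x) $ 1 - y $ 1) = 0"
      using 1 pq by (subst Henstock_Kurzweil_Integration.integral_diff) auto
    then show "integral {p..q} (\<lambda>x. r * (g (\<alpha> x) $ 1 - y $ 1)) = 0" by simp
  qed
  have "\<exists>t. g t $ 1 \<le> y $ 1"
  proof (rule ccontr)
    assume "\<not> ?thesis"
    then show False using positive_integrand_not_0[OF c1[of 1] pq] i1[of 1] by (simp add: not_le)
  qed
  moreover have "\<exists>t. y $ 1 \<le> g t $ 1"
  proof (rule ccontr)
    assume "\<not> ?thesis"
    then show False using positive_integrand_not_0[OF c1[of "-1"] pq] i1[of "-1"] by (simp add: not_le)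
  qed
  ultimately obtain t where t: "g t $ 1 = y $ 1" by (metis fixed.abscissa_between)
  let ?L = "\<lambda>z::real^2. z $ 2 - fixed.slope t * z $ 1"
  have L: "bounded_linear ?L"
    by (intro bounded_linear_sub bounded_linear_vec_nth bounded_linear_const_mult)
  have low: "?L (g t) \<le> ?L (g r)" for r
    using fixed.height_nonneg[of t r] by (simp add: fixed.height_def algebra_simps)
  have "integral {p..q} (\<lambda>x. ?L (g t)) \<le> integral {p..q} (\<lambda>x. ?L (g (\<alpha> x)))"
    by (intro integral_le lin(2)[OF L] low) auto
  then have "(q - p) * ?L (g t) \<le> (q - p) * ?L y" unfolding lin(1)[OF L] using pq by simp
  then have "?L (g t) \<le> ?L y" using pq by simp
  then show ?thesis using t by (intro exI[of _ t]) simp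
qed

text \<open>An average that is above the fixed boundary and not above some tangent line of the free boundary belongs to the
  domain.\<close>

lemma opt_gives_optimizer:
  assumes opt: "opt f \<alpha> T x v" and Bx: "B x = v"
  shows "\<exists>I \<phi>. is_optimizer G \<epsilon> f B x I \<phi>"
proof (intro exI)
  note o = opt[unfolded opt_def]
  let ?\<phi> = "\<lambda>s. g (\<alpha> s)"
  have T: "0 < T" and gi: "?\<phi> absolutely_integrable_on {0..T}"
    and fi: "(\<lambda>s. f (\<alpha> s)) absolutely_integrable_on {0..T}" using o by auto
  have I: "nondeg_interval {0..T}" using T by (simp add: nondeg_interval_def is_interval_cc)
  have bf: "boundary_fun g f (?\<phi> s) = f (\<alpha> s)" for s
    by (simp add: boundary_fun_def inv_f_f[OF fixed.inj_c])
  have "average J ?\<phi> \<in> Omega G \<epsilon>" if J: "nondeg_interval J" "J \<subseteq> {0..T}" for J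
  proof -
    obtain p q where pq: "p < q" "J \<subseteq> {p..q}" "{p<..<q} \<subseteq> J" using bounded_interval_hull[OF J(1)] .
    have "closure {p<..<q} \<subseteq> closure {0..T}" using pq(3) J(2) by (intro closure_mono) auto
    then have sub: "0 \<le> p" "q \<le> T" using pq(1) by auto
    have i: "?\<phi> absolutely_integrable_on {p..q}"
      by (rule absolutely_integrable_on_subinterval[OF gi]) (use sub in auto)
    have hk: "?\<phi> integrable_on {0..q}"
      using absolutely_integrable_on_subinterval[OF gi, of 0 q] sub by (auto simp: absolutely_integrable_on_def)
    have m: "integral {p..q} ?\<phi> = mom \<alpha> q - mom \<alpha> p"
      using Henstock_Kurzweil_Integration.integral_combine[OF sub(1) less_imp_le[OF pq(1)] hk]
      by (simp add: mom_def eq_diff_eq add.commute)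
    define y where "y = (1 / (q - p)) *\<^sub>R integral {p..q} ?\<phi>"
    have y: "integral {p..q} ?\<phi> = (q - p) *\<^sub>R y" using pq(1) by (simp add: y_def)
    have "\<exists>s. excess s (mom \<alpha> q - mom \<alpha> p) (q - p) \<le> 0"
      using o sub pq(1) unfolding averages_below_def by blast
    then obtain s where s: "(q - p) * free.height s y \<le> 0"
      unfolding m[symmetric] y excess_scaled by blast
    then have "free.height s y \<le> 0" using pq(1) by (simp add: mult_le_0_iff)
    moreover obtain t where "g t $ 1 = y $ 1" "g t $ 2 \<le> y $ 2" using average_above_fixed[OF i pq(1) y] by blast
    ultimately have "y \<in> Omega G \<epsilon>" by (intro in_OmegaI)
    then show ?thesis using average_eq_integral[OF i pq(1) J(1) pq(2,3)] by (simp add: y_def)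
  qed
  then have test: "?\<phi> \<in> test_class G \<epsilon> {0..T}" using gi by (auto simp: test_class_def)
  have "{0<..<T} \<subseteq> {0..T}" by auto
  then have avg: "average {0..T} ?\<phi> = x" "average {0..T} (\<lambda>s. f (\<alpha> s)) = v"
    using average_eq_integral[OF gi T I] average_eq_integral[OF fi T I] o by (auto simp: mom_def)
  show "is_optimizer G \<epsilon> f B x {0..T} ?\<phi>"
    using I test avg fi Bx by (simp add: is_optimizer_def bf)
qed

section \<open>Chords and neighbourhoods of the free boundary\<close>

lemma on_line_in_segment:
  assumes "free.height s y = c" "free.height s z = c" "free.height s x = c" "y $ 1 \<le> x $ 1" "x $ 1 \<le> z $ 1"
  obtains \<theta> where "0 \<le> \<theta>" "\<theta> \<le> 1" "x = (1 - \<theta>) *\<^sub>R y + \<theta> *\<^sub>R z"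
proof -
  obtain \<theta> where \<theta>: "0 \<le> \<theta>" "\<theta> \<le> 1" "(1 - \<theta>) * (- (y $ 1)) + \<theta> * (- (z $ 1)) = - (x $ 1)"
    using level_on_segment[of "- (z $ 1)" "- (x $ 1)" "- (y $ 1)"] assms by auto
  let ?u = "(1 - \<theta>) *\<^sub>R y + \<theta> *\<^sub>R z"
  have u1: "?u $ 1 = x $ 1" using \<theta>(3) by simp
  have "free.height s ?u = (1 - \<theta>) * c + \<theta> * c" unfolding free.height_affine assms ..
  also have "\<dots> = free.height s x" unfolding assms by (simp add: algebra_simps)
  finally have "?u $ 2 = x $ 2" using u1 unfolding free.height_def by simp
  with u1 have "x = ?u" by (simp add: vec2_eq_iff)
  then show ?thesis using \<theta> that by blast
qed

lemma abscissa_on_segment: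
  fixes y z :: "real^2"
  assumes "y $ 1 \<le> x1" "x1 \<le> z $ 1"
  obtains p where "p \<in> closed_segment y z" "p $ 1 = x1"
proof -
  obtain \<theta> where "0 \<le> \<theta>" "\<theta> \<le> 1" "(1 - \<theta>) * (- (y $ 1)) + \<theta> * (- (z $ 1)) = - x1"
    using level_on_segment[of "- (z $ 1)" "- x1" "- (y $ 1)"] assms by auto
  then show ?thesis using that[of "(1 - \<theta>) *\<^sub>R y + \<theta> *\<^sub>R z"] by (auto simp: in_segment)
qed

text \<open>The left tangent at the left end of a chord in the strip passes above the other end.\<close>

lemma chord_below_left_tangent:
  assumes chord: "closed_segment (g a) (g c) \<subseteq> Omega G \<epsilon>" and "a \<le> c"
  shows "free.height (sL a) (g c) \<le> 0"
proof (cases "g c $ 1 \<le> wL a $ 1")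
  case True
  then have "g c $ 1 < g (tp (sL a)) $ 1" using abscissa_less_tp[of "sL a"] by (simp add: wL_def del: fixed.c1_less_iff)
  then show ?thesis using \<open>a \<le> c\<close> by (simp add: height_le_0_between)
next
  case False
  obtain z where z: "z \<in> closed_segment (g a) (g c)" "z $ 1 = wL a $ 1"
    using abscissa_on_segment[of "g a" "wL a $ 1" "g c"] False wL_greater[of a] by auto
  then obtain s where s: "h s $ 1 = z $ 1" "z $ 2 \<le> h s $ 2" using chord by (blast elim: in_OmegaE)
  then have "s = sL a" using z(2) by (simp add: wL_def)
  then have hz: "free.height (sL a) z \<le> 0" using s by (simp add: free.height_at_same_abscissa)
  obtain \<theta> where \<theta>: "0 \<le> \<theta>" "\<theta> \<le> 1" "z = (1 - \<theta>) *\<^sub>R g a + \<theta> *\<^sub>R g c" using z(1) by (auto simp: in_segment)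
  have "\<theta> \<noteq> 0" using \<theta>(3) z(2) wL_greater[of a] by auto
  moreover have "free.height (sL a) z = \<theta> * free.height (sL a) (g c)" unfolding \<theta>(3) free.height_affine by simp
  ultimately show ?thesis using hz \<theta>(1) by (simp add: mult_le_0_iff)
qed

lemma chord_in_strip_if_in_Omega:
  assumes "closed_segment (g a) (g c) \<subseteq> Omega G \<epsilon>" "a \<le> c"
  shows "chord_in_strip a c"
  unfolding chord_in_strip_def using chord_below_left_tangent[OF assms] by (intro exI[of _ "sL a"]) simp

lemma chord_touching_free_boundary:
  assumes chord: "closed_segment (g a) (g c) \<subseteq> Omega G \<epsilon>" and "a \<le> c" and hs: "h s \<in> closed_segment (g a) (g c)"
  shows "a = tm s" "c = tp s"
proof -
  obtain \<theta> where \<theta>: "0 \<le> \<theta>" "\<theta> \<le> 1" "h s = (1 - \<theta>) *\<^sub>R g a + \<theta> *\<^sub>R g c" using hs by (auto simp: in_segment)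
  have eq: "free.height (sL a) (h s) = \<theta> * free.height (sL a) (g c)" unfolding \<theta>(3) free.height_affine by simp
  have le: "\<theta> * free.height (sL a) (g c) \<le> 0"
    using chord_below_left_tangent[OF chord \<open>a \<le> c\<close>] \<theta>(1) by (simp add: mult_nonneg_nonpos)
  then have s: "sL a = s" using eq free.height_nonneg[of "sL a" s] by (metis antisym free.height_eq_0_iff)
  then show "a = tm s" by (metis tm_sL)
  have off: "h s \<noteq> g r" for r using above_fixed[of r s] by auto
  have "\<theta> \<noteq> 0" using \<theta>(3) off[of a] by auto
  have "a \<noteq> c" using \<theta>(3) off[of a] by (auto simp flip: scaleR_add_left)
  have "free.height s (g c) = 0" using eq s \<open>\<theta> \<noteq> 0\<close> by simp
  then have "s = sR c" using s \<open>a \<noteq> c\<close> by (auto simp: height_fixed_eq_0_iff)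
  then show "c = tp s" by simp
qed

text \<open>A set is thick at a parameter of the free boundary if it contains the part of the domain near
  that point. Two sets thick at a common point have interior points in common.\<close>

definition thick :: "(real^2) set \<Rightarrow> real \<Rightarrow> bool" where
  "thick R s \<longleftrightarrow> (\<forall>\<^sub>F y in nhds (h s). y \<in> Omega G \<epsilon> \<longrightarrow> y \<in> R)"

lemma thick_interiors_meet:
  assumes "thick R s" "thick R' s"
  shows "interior R \<inter> interior R' \<noteq> {}"
proof -
  have "\<forall>\<^sub>F y in nhds (h s). y \<in> Omega G \<epsilon> \<longrightarrow> y \<in> R \<inter> R'"
    using assms unfolding thick_def by eventually_elim auto
  then obtain U where U: "open U" "h s \<in> U" "\<And>y. y \<in> U \<Longrightarrow> y \<in> Omega G \<epsilon> \<Longrightarrow> y \<in> R \<inter> R'"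
    unfolding eventually_nhds by blast
  obtain t where t: "g t $ 1 = h s $ 1" "g t $ 2 < h s $ 2" using free_above by blast
  have "((\<lambda>r. g r $ 2) \<longlongrightarrow> g t $ 2) (at t)"
    using fixed.cont_c_nth[of UNIV 2] by (simp add: continuous_on_eq_continuous_at isCont_def)
  from order_tendstoD(2)[OF this t(2)] obtain d where d: "d > 0" "\<And>r. r \<noteq> t \<Longrightarrow> dist r t < d \<Longrightarrow> g r $ 2 < h s $ 2"
    unfolding eventually_at by blast
  define a b m where "a = t - d / 2" and "b = t + d / 2" and "m = max (g a $ 2) (g b $ 2)"
  have ab: "a < t" "t < b" "m < h s $ 2" using d(1) d(2)[of a] d(2)[of b] by (auto simp: a_def b_def m_def dist_real_def)
  define V where "V = {y::real^2. g a $ 1 < y $ 1} \<inter> {y. y $ 1 < g b $ 1} \<inter> {y. m < y $ 2} \<inter> {y. free.height s y < 0}"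
  have "open V"
    unfolding V_def free.height_def by (intro open_Int open_Collect_less continuous_intros)
  have "V \<subseteq> Omega G \<epsilon>"
  proof
    fix y assume y: "y \<in> V"
    then have y1: "g a $ 1 < y $ 1" "y $ 1 < g b $ 1" by (auto simp: V_def)
    obtain r where r: "g r $ 1 = y $ 1"
      using fixed.abscissa_between[of a "y $ 1" b] y1 by auto
    then have r: "g r $ 1 = y $ 1" "a < r" "r < b" using y1 by (simp_all flip: r)
    obtain \<theta> where \<theta>: "0 < \<theta>" "\<theta> < 1" "g r $ 2 < (1 - \<theta>) * g a $ 2 + \<theta> * g b $ 2"
      using fixed.below_chord[OF r(2,3)] by blast
    moreover have "(1 - \<theta>) * g a $ 2 + \<theta> * g b $ 2 \<le> m"
      using convex_bound_le[of "g a $ 2" m "g b $ 2" "1 - \<theta>" \<theta>] \<theta> by (simp add: m_def)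
    moreover have "m < y $ 2" using y by (simp add: V_def)
    ultimately have "g r $ 2 \<le> y $ 2" by linarith
    then show "y \<in> Omega G \<epsilon>" using r(1) y by (intro in_OmegaI[of r y s]) (auto simp: V_def)
  qed
  have "((\<lambda>\<delta>. h s - axis 2 \<delta>) \<longlongrightarrow> h s) (at_right 0)"
  proof (rule vec_tendstoI)
    fix i :: 2
    show "((\<lambda>\<delta>. (h s - axis 2 \<delta>) $ i) \<longlongrightarrow> h s $ i) (at_right 0)"
      using exhaust_2[of i] by (auto simp: axis_def intro!: tendsto_eq_intros)
  qed
  then have "\<forall>\<^sub>F \<delta> in at_right 0. h s - axis 2 \<delta> \<in> U" using U(1,2) by (rule topological_tendstoD)
  moreover have "\<forall>\<^sub>F \<delta> in at_right (0::real). \<delta> < h s $ 2 - m"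
    using ab(3) by (intro order_tendstoD(2)[OF tendsto_ident_at]) simp
  moreover have "\<forall>\<^sub>F \<delta> in at_right (0::real). 0 < \<delta>" by (rule eventually_at_right_less)
  ultimately have "\<forall>\<^sub>F \<delta> in at_right 0. h s - axis 2 \<delta> \<in> U \<inter> V"
  proof eventually_elim
    case (elim \<delta>)
    have "g a $ 1 < h s $ 1" "h s $ 1 < g b $ 1" unfolding t(1)[symmetric] using ab by simp_all
    then show ?case using elim by (simp add: V_def axis_def free.height_def)
  qed
  then obtain \<delta> :: real where \<delta>: "h s - axis 2 \<delta> \<in> U \<inter> V"
    using eventually_happens[of _ "at_right (0::real)"] by (auto simp: trivial_limit_at_right_real)
  have "U \<inter> V \<subseteq> R \<inter> R'" using U(3) \<open>V \<subseteq> Omega G \<epsilon>\<close> by blast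
  then have "h s - axis 2 \<delta> \<in> interior (R \<inter> R')"
    using \<delta> U(1) \<open>open V\<close> by (meson interior_maximal open_Int subsetD)
  then show ?thesis by (auto simp: interior_Int)
qed


section \<open>Which figures meet the free boundary at a given point\<close>

text \<open>A figure is hit at \<open>s\<close> if it contains points arbitrarily close below the point of the free
  boundary with this parameter.\<close>

definition hit :: "(real^2) set \<Rightarrow> real \<Rightarrow> bool" where
  "hit R s \<longleftrightarrow> (\<forall>\<eta>>0. \<exists>\<delta>>0. \<delta> < \<eta> \<and> h s - axis 2 \<delta> \<in> R)"

lemma axis_2_nth [simp]: "axis 2 \<delta> $ (1::2) = 0" "axis 2 \<delta> $ (2::2) = \<delta>"
  by (simp_all add: axis_def)

lemma height_below: "free.height r (h s - axis 2 \<delta>) = free.height r (h s) - \<delta>"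
  by (simp add: free.height_def)

lemma on_right_tangent:
  assumes "y \<in> closed_segment (wR t) (g t)"
  shows "free.height (sR t) y = 0" "wR t $ 1 \<le> y $ 1" "y $ 1 \<le> g t $ 1"
proof -
  obtain \<theta> where \<theta>: "0 \<le> \<theta>" "\<theta> \<le> 1" "y = (1 - \<theta>) *\<^sub>R wR t + \<theta> *\<^sub>R g t" using assms by (auto simp: in_segment)
  show "free.height (sR t) y = 0" unfolding \<theta>(3) free.height_affine by (simp add: wR_def)
  have "y $ 1 = wR t $ 1 + \<theta> * (g t $ 1 - wR t $ 1)" "y $ 1 = g t $ 1 - (1 - \<theta>) * (g t $ 1 - wR t $ 1)"
    unfolding \<theta>(3) by (simp_all add: algebra_simps)
  moreover have "0 \<le> \<theta> * (g t $ 1 - wR t $ 1)" "0 \<le> (1 - \<theta>) * (g t $ 1 - wR t $ 1)"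
    using \<theta> wR_less[of t] by simp_all
  ultimately show "wR t $ 1 \<le> y $ 1" "y $ 1 \<le> g t $ 1" by linarith+
qed

lemma on_left_tangent:
  assumes "y \<in> closed_segment (g t) (wL t)"
  shows "free.height (sL t) y = 0" "g t $ 1 \<le> y $ 1" "y $ 1 \<le> wL t $ 1"
proof -
  obtain \<theta> where \<theta>: "0 \<le> \<theta>" "\<theta> \<le> 1" "y = (1 - \<theta>) *\<^sub>R g t + \<theta> *\<^sub>R wL t" using assms by (auto simp: in_segment)
  show "free.height (sL t) y = 0" unfolding \<theta>(3) free.height_affine by (simp add: wL_def)
  have "y $ 1 = g t $ 1 + \<theta> * (wL t $ 1 - g t $ 1)" "y $ 1 = wL t $ 1 - (1 - \<theta>) * (wL t $ 1 - g t $ 1)"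
    unfolding \<theta>(3) by (simp_all add: algebra_simps)
  moreover have "0 \<le> \<theta> * (wL t $ 1 - g t $ 1)" "0 \<le> (1 - \<theta>) * (wL t $ 1 - g t $ 1)"
    using \<theta> wL_greater[of t] by simp_all
  ultimately show "g t $ 1 \<le> y $ 1" "y $ 1 \<le> wL t $ 1" by linarith+
qed

text \<open>A point below \<open>h s\<close> on a right tangent belongs to a tangent at a parameter before \<open>tp s\<close>. If all
  parameters of the fan stayed away from \<open>tp s\<close>, then the height of \<open>h s\<close> over all its tangents
  would be bounded away from zero.\<close>

lemma right_fan_hit:
  assumes "hit (region G \<epsilon> (Tangents Right u1 u2)) s"
  shows "u1 < ereal (tp s)" "ereal (tp s) \<le> u2"
proof -
  have tangents: "\<exists>\<delta> t. 0 < \<delta> \<and> \<delta> < \<eta> \<and> t \<in> ereal_interval u1 u2 \<and> sR t < s \<and>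
      free.height (sR t) (h s) = \<delta>" if "\<eta> > 0" for \<eta>
  proof -
    obtain \<delta> t where *: "0 < \<delta>" "\<delta> < \<eta>" "t \<in> ereal_interval u1 u2" "h s - axis 2 \<delta> \<in> closed_segment (wR t) (g t)"
      using assms \<open>\<eta> > 0\<close> unfolding hit_def by (auto simp: tangent_segment_eq)
    have ht: "free.height (sR t) (h s) = \<delta>" using on_right_tangent(1)[OF *(4)] by (simp add: height_below)
    have "sR t \<le> s" using on_right_tangent(2)[OF *(4)] by (simp add: wR_def)
    moreover have "sR t \<noteq> s" using ht *(1) by auto
    ultimately show ?thesis using * ht by (intro exI[of _ \<delta>] exI[of _ t]) auto
  qed
  obtain t where t: "t \<in> ereal_interval u1 u2" "sR t < s" using tangents[of 1] by auto
  then have "t < tp s" by (metis sR_less_iff sR_tp)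
  then have "ereal t < ereal (tp s)" by simp
  moreover have "u1 \<le> ereal t" using t(1) by (simp add: ereal_interval_def)
  ultimately show "u1 < ereal (tp s)" by (rule order_le_less_trans[rotated])
  show "ereal (tp s) \<le> u2"
  proof (rule ccontr)
    assume "\<not> ?thesis"
    then have "u2 < ereal (tp s)" by simp
    then obtain U where U: "u2 < ereal U" "U < tp s" using ereal_dense2[of u2 "ereal (tp s)"] by auto
    have less: "sR U < s" using U(2) by (metis sR_less_iff sR_tp)
    then have "free.height (sR U) (h s) > 0" by (intro free.height_pos) simp
    then obtain \<delta> t' where t': "\<delta> < free.height (sR U) (h s)" "t' \<in> ereal_interval u1 u2"
      "free.height (sR t') (h s) = \<delta>" using tangents by blast
    have "ereal t' \<le> u2" using t'(2) by (simp add: ereal_interval_def)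
    then have "ereal t' < ereal U" using U(1) by (rule order_le_less_trans)
    then have "sR t' < sR U" by simp
    then have "free.height (sR U) (h s) < free.height (sR t') (h s)"
      using less by (intro free.height_less_right) auto
    then show False using t' by simp
  qed
qed

lemma left_fan_hit:
  assumes "hit (region G \<epsilon> (Tangents Left u1 u2)) s"
  shows "u1 \<le> ereal (tm s)" "ereal (tm s) < u2"
proof -
  have tangents: "\<exists>\<delta> t. 0 < \<delta> \<and> \<delta> < \<eta> \<and> t \<in> ereal_interval u1 u2 \<and> s < sL t \<and>
      free.height (sL t) (h s) = \<delta>" if "\<eta> > 0" for \<eta>
  proof -
    obtain \<delta> t where *: "0 < \<delta>" "\<delta> < \<eta>" "t \<in> ereal_interval u1 u2" "h s - axis 2 \<delta> \<in> closed_segment (g t) (wL t)"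
      using assms \<open>\<eta> > 0\<close> unfolding hit_def by (auto simp: tangent_segment_eq)
    have ht: "free.height (sL t) (h s) = \<delta>" using on_left_tangent(1)[OF *(4)] by (simp add: height_below)
    have "s \<le> sL t" using on_left_tangent(3)[OF *(4)] by (simp add: wL_def)
    moreover have "sL t \<noteq> s" using ht *(1) by auto
    ultimately show ?thesis using * ht by (intro exI[of _ \<delta>] exI[of _ t]) auto
  qed
  obtain t where t: "t \<in> ereal_interval u1 u2" "s < sL t" using tangents[of 1] by auto
  then have "tm s < t" by (metis sL_less_iff sL_tm)
  then have "ereal (tm s) < ereal t" by simp
  moreover have "ereal t \<le> u2" using t(1) by (simp add: ereal_interval_def)
  ultimately show "ereal (tm s) < u2" by (rule order_less_le_trans)
  show "u1 \<le> ereal (tm s)"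
  proof (rule ccontr)
    assume "\<not> ?thesis"
    then have "ereal (tm s) < u1" by simp
    then obtain U where U: "ereal U < u1" "tm s < U" using ereal_dense2[of "ereal (tm s)" u1] by auto
    have less: "s < sL U" using U(2) by (metis sL_less_iff sL_tm)
    then have "free.height (sL U) (h s) > 0" by (intro free.height_pos) simp
    then obtain \<delta> t' where t': "\<delta> < free.height (sL U) (h s)" "t' \<in> ereal_interval u1 u2"
      "free.height (sL t') (h s) = \<delta>" using tangents by blast
    have "u1 \<le> ereal t'" using t'(2) by (simp add: ereal_interval_def)
    with U(1) have "ereal U < ereal t'" by (rule order_less_le_trans)
    then have "sL U < sL t'" by simp
    then have "free.height (sL U) (h s) < free.height (sL t') (h s)"
      using less by (intro free.height_less_left) auto
    then show False using t' by simp
  qed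
qed

lemma eventually_height_pos: "free.height r y > 0 \<Longrightarrow> \<forall>\<^sub>F z in nhds y. free.height r z > 0"
  and eventually_abscissa: "a < y $ 1 \<Longrightarrow> \<forall>\<^sub>F z in nhds y. a < z $ 1"
    "y $ 1 < a \<Longrightarrow> \<forall>\<^sub>F z in nhds y. z $ 1 < a"
proof -
  have op: "\<forall>\<^sub>F z in nhds y. P z" if "open (Collect P)" "P y" for P :: "real^2 \<Rightarrow> bool"
    using that eventually_nhds by blast
  show "free.height r y > 0 \<Longrightarrow> \<forall>\<^sub>F z in nhds y. free.height r z > 0"
    unfolding free.height_def by (intro op open_Collect_less continuous_intros)
  show "a < y $ 1 \<Longrightarrow> \<forall>\<^sub>F z in nhds y. a < z $ 1" "y $ 1 < a \<Longrightarrow> \<forall>\<^sub>F z in nhds y. z $ 1 < a"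
    by (intro op open_Collect_less continuous_intros; simp)+
qed

lemma isCont_height_param: "isCont (\<lambda>r. free.height r y) r"
proof -
  have "continuous_on UNIV (\<lambda>r. free.height r y)"
    unfolding free.height_def by (intro continuous_intros free.cont_c free.cont_slope)
  then show ?thesis by (simp add: continuous_on_eq_continuous_at)
qed

text \<open>A point of the domain near the free boundary lies on a right tangent whose point of tangency
  is slightly to the left, and on a left tangent whose point of tangency is slightly to the right.\<close>

lemma thick_right_fan:
  assumes "u1 < ereal (tp s)" "ereal (tp s) < u2"
  shows "thick (region G \<epsilon> (Tangents Right u1 u2)) s"
proof -
  obtain t3 t4 where t34: "u1 < ereal t3" "t3 < tp s" "tp s < t4" "ereal t4 < u2"
    using ereal_dense2[OF assms(1)] ereal_dense2[OF assms(2)] by auto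
  have s34: "sR t3 < s" "s < sR t4" using t34 by (metis sR_less_iff sR_tp)+
  have "\<forall>\<^sub>F y in nhds (h s). free.height (sR t3) y > 0"
    using s34 by (intro eventually_height_pos free.height_pos) simp
  moreover have "\<forall>\<^sub>F y in nhds (h s). h (sR t3) $ 1 < y $ 1" "\<forall>\<^sub>F y in nhds (h s). y $ 1 < h (sR t4) $ 1"
    using s34 by (auto intro!: eventually_abscissa)
  ultimately show ?thesis
    unfolding thick_def
  proof eventually_elim
    case (elim y)
    show ?case
    proof
      assume "y \<in> Omega G \<epsilon>"
      from in_OmegaE[OF this] obtain \<tau> r where \<tau>: "g \<tau> $ 1 = y $ 1" "g \<tau> $ 2 \<le> y $ 2"
        and r: "h r $ 1 = y $ 1" "free.height r y \<le> 0" by metis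
      have "sR t3 < r" "r < sR t4" using elim(2,3)[folded r(1)] by simp_all
      then obtain q where q: "sR t3 \<le> q" "q \<le> r" "free.height q y = 0"
        using IVT2[of "\<lambda>r. free.height r y" r 0 "sR t3"] r(2) elim(1) isCont_height_param by auto
      define t where "t = tp q"
      have t: "sR t = q" by (simp add: t_def)
      have "sR t3 \<le> sR t" "sR t \<le> sR t4" unfolding t using q \<open>r < sR t4\<close> by linarith+
      then have "ereal t3 \<le> ereal t" "ereal t \<le> ereal t4" by simp_all
      then have "u1 \<le> ereal t" "ereal t \<le> u2"
        using order_trans[OF less_imp_le[OF t34(1)]] order_trans[OF _ less_imp_le[OF t34(4)]] by simp_all
      moreover have "free.height q (g \<tau>) \<le> free.height q y" using \<tau> by (simp add: free.height_def)
      then have "\<tau> \<le> t" using q(3) height_le_0_between[of q \<tau>] by (simp add: t_def)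
      then have "y $ 1 \<le> g t $ 1" unfolding \<tau>(1)[symmetric] by simp
      moreover have "wR t $ 1 \<le> y $ 1" using q(2) r(1)[symmetric] by (simp add: wR_def t)
      ultimately have "y \<in> closed_segment (wR t) (g t)"
        using on_line_in_segment[of q "wR t" 0 "g t" y] q(3) t by (auto simp: wR_def in_segment t_def)
      with \<open>u1 \<le> ereal t\<close> \<open>ereal t \<le> u2\<close> show "y \<in> region G \<epsilon> (Tangents Right u1 u2)"
        by (auto simp: tangent_segment_eq ereal_interval_def)
    qed
  qed
qed

lemma thick_left_fan:
  assumes "u1 < ereal (tm s)" "ereal (tm s) < u2"
  shows "thick (region G \<epsilon> (Tangents Left u1 u2)) s"
proof -
  obtain t3 t4 where t34: "u1 < ereal t3" "t3 < tm s" "tm s < t4" "ereal t4 < u2"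
    using ereal_dense2[OF assms(1)] ereal_dense2[OF assms(2)] by auto
  have s34: "sL t3 < s" "s < sL t4" using t34 by (metis sL_less_iff sL_tm)+
  have "\<forall>\<^sub>F y in nhds (h s). free.height (sL t4) y > 0"
    using s34 by (intro eventually_height_pos free.height_pos) simp
  moreover have "\<forall>\<^sub>F y in nhds (h s). h (sL t3) $ 1 < y $ 1" "\<forall>\<^sub>F y in nhds (h s). y $ 1 < h (sL t4) $ 1"
    using s34 by (auto intro!: eventually_abscissa)
  ultimately show ?thesis
    unfolding thick_def
  proof eventually_elim
    case (elim y)
    show ?case
    proof
      assume "y \<in> Omega G \<epsilon>"
      from in_OmegaE[OF this] obtain \<tau> r where \<tau>: "g \<tau> $ 1 = y $ 1" "g \<tau> $ 2 \<le> y $ 2"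
        and r: "h r $ 1 = y $ 1" "free.height r y \<le> 0" by metis
      have "sL t3 < r" "r < sL t4" using elim(2,3)[folded r(1)] by simp_all
      then obtain q where q: "r \<le> q" "q \<le> sL t4" "free.height q y = 0"
        using IVT[of "\<lambda>r. free.height r y" r 0 "sL t4"] r(2) elim(1) isCont_height_param by auto
      define t where "t = tm q"
      have t: "sL t = q" by (simp add: t_def)
      have "sL t3 \<le> sL t" "sL t \<le> sL t4" unfolding t using q \<open>sL t3 < r\<close> by linarith+
      then have "ereal t3 \<le> ereal t" "ereal t \<le> ereal t4" by simp_all
      then have "u1 \<le> ereal t" "ereal t \<le> u2"
        using order_trans[OF less_imp_le[OF t34(1)]] order_trans[OF _ less_imp_le[OF t34(4)]] by simp_all
      moreover have "free.height q (g \<tau>) \<le> free.height q y" using \<tau> by (simp add: free.height_def)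
      then have "t \<le> \<tau>" using q(3) height_le_0_between[of q \<tau>] by (simp add: t_def)
      then have "g t $ 1 \<le> y $ 1" unfolding \<tau>(1)[symmetric] by simp
      moreover have "y $ 1 \<le> wL t $ 1" using q(1) r(1)[symmetric] by (simp add: wL_def t)
      ultimately have "y \<in> closed_segment (g t) (wL t)"
        using on_line_in_segment[of q "g t" 0 "wL t" y] q(3) t by (auto simp: wL_def in_segment t_def)
      with \<open>u1 \<le> ereal t\<close> \<open>ereal t \<le> u2\<close> show "y \<in> region G \<epsilon> (Tangents Left u1 u2)"
        by (auto simp: tangent_segment_eq ereal_interval_def)
    qed
  qed
qed

section \<open>Linearity domains along the free boundary\<close>

definition params_of :: "intervals \<Rightarrow> real set" where
  "params_of A = (\<Union>(l, r)\<in>set A. ereal_interval l r)"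

definition sorted_intervals :: "intervals \<Rightarrow> bool" where
  "sorted_intervals A \<longleftrightarrow> A \<noteq> [] \<and> (\<forall>(l, r)\<in>set A. l \<le> r \<and> l \<noteq> \<infinity> \<and> r \<noteq> -\<infinity>) \<and>
     (\<forall>i. Suc i < length A \<longrightarrow> snd (A ! i) < fst (A ! Suc i))"

lemma sorted_intervals_nth:
  assumes "sorted_intervals A" "i < length A"
  shows "fst (A ! i) \<le> snd (A ! i)" "fst (A ! i) \<noteq> \<infinity>" "snd (A ! i) \<noteq> -\<infinity>"
proof -
  have "A ! i \<in> set A" using assms(2) by simp
  then show "fst (A ! i) \<le> snd (A ! i)" "fst (A ! i) \<noteq> \<infinity>" "snd (A ! i) \<noteq> -\<infinity>"
    using assms(1) unfolding sorted_intervals_def by (auto simp: case_prod_unfold)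
qed

lemma sorted_intervals_less:
  assumes A: "sorted_intervals A" and "i < j" "j < length A"
  shows "snd (A ! i) < fst (A ! j)"
  using assms(2,3)
proof (induction j)
  case (Suc j)
  have step: "snd (A ! j) < fst (A ! Suc j)" using A Suc.prems unfolding sorted_intervals_def by blast
  show ?case
  proof (cases "i = j")
    case False
    then have "snd (A ! i) < fst (A ! j)" using Suc by simp
    also have "\<dots> \<le> snd (A ! j)" using sorted_intervals_nth(1)[OF A] Suc.prems by simp
    also note step
    finally show ?thesis .
  qed (use step in simp)
qed simp

lemma params_ofE:
  assumes "a \<in> params_of A"
  obtains i where "i < length A" "fst (A ! i) \<le> ereal a" "ereal a \<le> snd (A ! i)"
proof -
  obtain l r where "(l, r) \<in> set A" "l \<le> ereal a" "ereal a \<le> r"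
    using assms unfolding params_of_def ereal_interval_def by auto
  then show ?thesis using that by (metis fst_conv in_set_conv_nth snd_conv)
qed

lemma params_ofI: "i < length A \<Longrightarrow> fst (A ! i) \<le> ereal a \<Longrightarrow> ereal a \<le> snd (A ! i) \<Longrightarrow> a \<in> params_of A"
  unfolding params_of_def ereal_interval_def by (auto intro!: bexI[of _ "A ! i"] simp: case_prod_unfold)

context
  fixes A :: intervals
  assumes A: "sorted_intervals A" and gaps: "gap_chords g A \<subseteq> Omega G \<epsilon>"
begin

lemma ends_nth: "left_end A = fst (A ! 0)" "right_end A = snd (A ! (length A - 1))" "0 < length A"
  using A unfolding sorted_intervals_def left_end_def right_end_def
  by (simp_all add: hd_conv_nth last_conv_nth)

lemma ends_bound:
  assumes "a \<in> params_of A"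
  shows "left_end A \<le> ereal a" "ereal a \<le> right_end A"
proof -
  obtain i where i: "i < length A" "fst (A ! i) \<le> ereal a" "ereal a \<le> snd (A ! i)" using params_ofE[OF assms] .
  show "left_end A \<le> ereal a"
  proof (cases "i = 0")
    case False
    then have "snd (A ! 0) < fst (A ! i)" using sorted_intervals_less[OF A] i by simp
    then show ?thesis
      using i(2) sorted_intervals_nth(1)[OF A ends_nth(3)] unfolding ends_nth(1) by (meson less_imp_le order_trans)
  qed (use i ends_nth in simp)
  show "ereal a \<le> right_end A"
  proof (cases "i = length A - 1")
    case False
    then have "snd (A ! i) < fst (A ! (length A - 1))" using sorted_intervals_less[OF A] i by simp
    moreover have "fst (A ! (length A - 1)) \<le> snd (A ! (length A - 1))"
      using sorted_intervals_nth(1)[OF A] ends_nth(3) by simp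
    ultimately show ?thesis using i(3) unfolding ends_nth(2) by (meson less_imp_le order_trans)
  qed (use i ends_nth in simp)
qed

lemma ereal_real_if_finite: "x \<noteq> \<infinity> \<Longrightarrow> x \<noteq> -\<infinity> \<Longrightarrow> x = ereal (real_of_ereal x)"
  by (cases x) auto

lemma left_end_real: "left_end A \<noteq> -\<infinity> \<Longrightarrow> left_end A = ereal (real_of_ereal (left_end A))"
  and right_end_real: "right_end A \<noteq> \<infinity> \<Longrightarrow> right_end A = ereal (real_of_ereal (right_end A))"
  using sorted_intervals_nth(2)[OF A, of 0] sorted_intervals_nth(3)[OF A, of "length A - 1"] ends_nth
  by (auto intro!: ereal_real_if_finite)

lemma left_end_in: "left_end A = ereal a \<Longrightarrow> a \<in> params_of A"
  using params_ofI[of 0 A a] sorted_intervals_nth(1)[OF A, of 0] ends_nth by simp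

lemma right_end_in: "right_end A = ereal a \<Longrightarrow> a \<in> params_of A"
  using params_ofI[of "length A - 1" A a] sorted_intervals_nth(1)[OF A, of "length A - 1"] ends_nth by simp

lemma left_unbounded:
  assumes "left_end A = -\<infinity>"
  shows "\<exists>a\<in>params_of A. a < \<tau>"
proof -
  have "snd (A ! 0) \<noteq> -\<infinity>" using sorted_intervals_nth(3)[OF A ends_nth(3)] .
  then have "-\<infinity> < min (snd (A ! 0)) (ereal \<tau>)" by simp
  then obtain a where "-\<infinity> < ereal a" "ereal a < min (snd (A ! 0)) (ereal \<tau>)" using ereal_dense2 by blast
  then have "a \<in> params_of A" "a < \<tau>"
    using params_ofI[of 0 A a] ends_nth(3) assms[unfolded ends_nth(1)] by (simp_all add: less_imp_le)
  then show ?thesis by blast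
qed

lemma right_unbounded:
  assumes "right_end A = \<infinity>"
  shows "\<exists>a\<in>params_of A. \<tau> < a"
proof -
  have "fst (A ! (length A - 1)) \<noteq> \<infinity>" using sorted_intervals_nth(2)[OF A] ends_nth(3) by simp
  then have "max (fst (A ! (length A - 1))) (ereal \<tau>) < \<infinity>" by (simp add: max_less_iff_conj del: ereal_infty_less)
  then obtain a where "max (fst (A ! (length A - 1))) (ereal \<tau>) < ereal a" using ereal_dense2 by blast
  then have "a \<in> params_of A" "\<tau> < a"
    using params_ofI[of "length A - 1" A a] ends_nth(3) assms[unfolded ends_nth(2)] by (simp_all add: less_imp_le)
  then show ?thesis by blast
qed

definition is_gap :: "real \<Rightarrow> real \<Rightarrow> bool" where
  "is_gap r l \<longleftrightarrow> (\<exists>i. Suc i < length A \<and> snd (A ! i) = ereal r \<and> fst (A ! Suc i) = ereal l)"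

lemma is_gap_facts:
  assumes "is_gap r l"
  shows "r < l" "r \<in> params_of A" "l \<in> params_of A" "{r<..<l} \<inter> params_of A = {}"
    "closed_segment (g r) (g l) \<subseteq> gap_chords g A" "chord_in_strip r l"
proof -
  obtain i where i: "Suc i < length A" "snd (A ! i) = ereal r" "fst (A ! Suc i) = ereal l"
    using assms unfolding is_gap_def by blast
  have "snd (A ! i) < fst (A ! Suc i)" using A i(1) unfolding sorted_intervals_def by blast
  then show "r < l" using i by simp
  show "r \<in> params_of A" using params_ofI[of i A r] i sorted_intervals_nth(1)[OF A, of i] by simp
  show "l \<in> params_of A" using params_ofI[of "Suc i" A l] i sorted_intervals_nth(1)[OF A, of "Suc i"] by simp
  show "{r<..<l} \<inter> params_of A = {}"
  proof (rule ccontr)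
    assume "\<not> ?thesis"
    then obtain a where a: "r < a" "a < l" "a \<in> params_of A" by auto
    then obtain j where j: "j < length A" "fst (A ! j) \<le> ereal a" "ereal a \<le> snd (A ! j)" using params_ofE by blast
    show False
    proof (cases "j \<le> i")
      case True
      then have "snd (A ! j) \<le> snd (A ! i)"
        using sorted_intervals_less[OF A, of j i] sorted_intervals_nth(1)[OF A, of i] i(1)
        by (cases "j = i") (auto intro: less_imp_le order_trans)
      then have "ereal a \<le> ereal r" using j(3) i(2) by (metis order_trans)
      then show ?thesis using a by simp
    next
      case False
      then have "fst (A ! Suc i) \<le> fst (A ! j)"
        using sorted_intervals_less[OF A, of "Suc i" j] sorted_intervals_nth(1)[OF A, of "Suc i"] i(1) j(1)
        by (cases "j = Suc i") (auto intro: less_imp_le order_trans)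
      then have "ereal l \<le> ereal a" using j(2) i(3) by (metis order_trans)
      then show ?thesis using a by simp
    qed
  qed
  show seg: "closed_segment (g r) (g l) \<subseteq> gap_chords g A"
    unfolding gap_chords_def using i by (intro UN_upper[of i, THEN subset_trans[rotated]]) auto
  show "chord_in_strip r l"
    using chord_in_strip_if_in_Omega[of r l] seg gaps \<open>r < l\<close> by auto
qed

lemma gap_around:
  assumes "\<tau> \<notin> params_of A" "left_end A \<le> ereal \<tau>" "ereal \<tau> \<le> right_end A"
  obtains r l where "is_gap r l" "r < \<tau>" "\<tau> < l"
proof -
  let ?P = "\<lambda>i. i < length A \<and> fst (A ! i) \<le> ereal \<tau>"
  define i where "i = (GREATEST i. ?P i)"
  have P0: "?P 0" using assms(2) ends_nth by simp
  have Pi: "?P i" unfolding i_def by (rule GreatestI_nat[of ?P 0 "length A"]) (use P0 in simp_all)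
  have max: "j \<le> i" if "?P j" for j
    unfolding i_def by (rule Greatest_le_nat[of ?P j "length A"]) (use that in simp_all)
  have less: "snd (A ! i) < ereal \<tau>"
    using Pi assms(1) params_ofI[of i A \<tau>] by (metis not_less)
  have i: "Suc i < length A"
  proof (rule ccontr)
    assume "\<not> ?thesis"
    then have "i = length A - 1" using Pi by linarith
    then show False using less assms(3) ends_nth(2) by simp
  qed
  have greater: "ereal \<tau> < fst (A ! Suc i)" using max[of "Suc i"] i by (metis Suc_n_not_le_n not_less)
  have "snd (A ! i) \<noteq> -\<infinity>" "fst (A ! Suc i) \<noteq> \<infinity>"
    using sorted_intervals_nth[OF A] i by auto
  with less greater obtain r l where "snd (A ! i) = ereal r" "fst (A ! Suc i) = ereal l" "r < \<tau>" "\<tau> < l"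
    by (cases "snd (A ! i)"; cases "fst (A ! Suc i)") auto
  then show ?thesis using i that[of r l] unfolding is_gap_def by blast
qed

lemma finite_gaps: "finite {(r, l). is_gap r l}"
proof (rule finite_subset)
  show "{(r, l). is_gap r l} \<subseteq> (\<lambda>i. (real_of_ereal (snd (A ! i)), real_of_ereal (fst (A ! Suc i)))) ` {..<length A}"
  proof clarify
    fix r l assume "is_gap r l"
    then obtain i where i: "Suc i < length A" "snd (A ! i) = ereal r" "fst (A ! Suc i) = ereal l"
      unfolding is_gap_def by blast
    then show "(r, l) \<in> (\<lambda>i. (real_of_ereal (snd (A ! i)), real_of_ereal (fst (A ! Suc i)))) ` {..<length A}"
      by (intro image_eqI[of _ _ i]) auto
  qed
qed simp

lemma gaps_bridged_params: "gaps_bridged (params_of A)"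
  unfolding gaps_bridged_def
proof (intro allI impI)
  fix \<tau> assume \<tau>: "\<tau> \<notin> params_of A \<and> (\<exists>a\<in>params_of A. a < \<tau>) \<and> (\<exists>c\<in>params_of A. \<tau> < c)"
  then obtain a c where ac: "a \<in> params_of A" "a < \<tau>" "c \<in> params_of A" "\<tau> < c" by blast
  have "left_end A \<le> ereal \<tau>" "ereal \<tau> \<le> right_end A"
    using order_trans[OF ends_bound(1)[OF ac(1)], of "ereal \<tau>"] order_trans[OF _ ends_bound(2)[OF ac(3)], of "ereal \<tau>"] ac(2,4)
    by simp_all
  with \<tau> obtain r l where "is_gap r l" "r < \<tau>" "\<tau> < l" using gap_around by blast
  then show "\<exists>r\<in>params_of A. \<exists>l\<in>params_of A. r < \<tau> \<and> \<tau> < l \<and> {r<..<l} \<inter> params_of A = {} \<and> chord_in_strip r l"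
    using is_gap_facts by blast
qed

lemma base_curve_iff:
  "p \<in> base_curve g A \<longleftrightarrow> (\<exists>a\<in>params_of A. p = g a) \<or> (\<exists>r l. is_gap r l \<and> p \<in> closed_segment (g r) (g l))"
proof
  assume "p \<in> base_curve g A"
  then consider "p \<in> (\<Union>(l, r)\<in>set A. g ` ereal_interval l r)" | "p \<in> gap_chords g A" unfolding base_curve_def by blast
  then show "(\<exists>a\<in>params_of A. p = g a) \<or> (\<exists>r l. is_gap r l \<and> p \<in> closed_segment (g r) (g l))"
  proof cases
    case 1
    then show ?thesis unfolding params_of_def by auto
  next
    case 2
    then obtain i where i: "Suc i < length A"
      "p \<in> closed_segment (g (real_of_ereal (snd (A ! i)))) (g (real_of_ereal (fst (A ! Suc i))))"
      unfolding gap_chords_def by blast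
    have "snd (A ! i) < fst (A ! Suc i)" using A i(1) unfolding sorted_intervals_def by blast
    moreover have "snd (A ! i) \<noteq> -\<infinity>" "fst (A ! Suc i) \<noteq> \<infinity>" using sorted_intervals_nth[OF A] i(1) by auto
    ultimately have "is_gap (real_of_ereal (snd (A ! i))) (real_of_ereal (fst (A ! Suc i)))"
      unfolding is_gap_def using i(1) by (intro exI[of _ i]) (auto intro!: ereal_real_if_finite)
    then show ?thesis using i(2) by blast
  qed
next
  assume "(\<exists>a\<in>params_of A. p = g a) \<or> (\<exists>r l. is_gap r l \<and> p \<in> closed_segment (g r) (g l))"
  then show "p \<in> base_curve g A"
    using is_gap_facts(5) unfolding base_curve_def params_of_def by blast
qed

lemma base_curve_on_base:
  assumes "p \<in> base_curve g A"
  shows "on_base (params_of A) p"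
proof -
  from assms consider a where "a \<in> params_of A" "p = g a" | r l where "is_gap r l" "p \<in> closed_segment (g r) (g l)"
    unfolding base_curve_iff by blast
  then show ?thesis
  proof cases
    case (1 a)
    have "chord_in_strip a a" unfolding chord_in_strip_def by (intro exI[of _ "sR a"]) simp
    then show ?thesis unfolding on_base_def using 1 by (intro bexI[of _ a] exI[of _ 0]) auto
  next
    case (2 r l)
    then show ?thesis
      unfolding on_base_def using is_gap_facts[OF 2(1)]
      by (intro bexI[of _ r] bexI[of _ l]) (auto simp: in_segment)
  qed
qed

lemma on_base_bounds:
  assumes "on_base (params_of A) p"
  shows "left_end A = ereal a \<Longrightarrow> g a $ 1 \<le> p $ 1" "right_end A = ereal c \<Longrightarrow> p $ 1 \<le> g c $ 1"
proof -
  obtain r l \<theta> where rl: "r \<in> params_of A" "l \<in> params_of A" "0 \<le> \<theta>" "\<theta> \<le> 1" "p = (1 - \<theta>) *\<^sub>R g r + \<theta> *\<^sub>R g l"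
    using assms unfolding on_base_def by blast
  have p1: "p $ 1 = (1 - \<theta>) * g r $ 1 + \<theta> * g l $ 1" unfolding rl(5) by simp
  show "p $ 1 \<le> g c $ 1" if "right_end A = ereal c"
    unfolding p1 using ends_bound(2)[OF rl(1)] ends_bound(2)[OF rl(2)] that rl(3,4)
    by (intro convex_bound_le) simp_all
  show "g a $ 1 \<le> p $ 1" if "left_end A = ereal a"
  proof -
    have "(1 - \<theta>) * (- (g r $ 1)) + \<theta> * (- (g l $ 1)) \<le> - (g a $ 1)"
      using ends_bound(1)[OF rl(1)] ends_bound(1)[OF rl(2)] that rl(3,4) by (intro convex_bound_le) simp_all
    then show ?thesis unfolding p1 by simp
  qed
qed

end


lemma right_opt_append:
  assumes z: "right_opt f s z v" and hc: "free.height s (g c) \<le> free.height s z"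
    and hz: "free.height s z \<le> 0" and zc: "g c $ 1 \<le> z $ 1" and \<theta>: "0 \<le> \<theta>" "\<theta> \<le> 1"
  shows "right_opt f s ((1 - \<theta>) *\<^sub>R z + \<theta> *\<^sub>R g c) ((1 - \<theta>) * v + \<theta> * f c)"
proof -
  have gr: "refl_curve g (- c) = refl_pt (g c)" by (simp add: refl_curve_def)
  show ?thesis
    unfolding right_opt_def refl_pt_affine
    using r.left_opt_append[of "\<lambda>t. f (- t)" "- s" "refl_pt z" v "- c" \<theta>] z hc hz zc \<theta>
    by (simp add: right_opt_def gr free.height_refl)
qed

lemma right_opt_chord:
  assumes ac: "chord_in_strip a c" "a \<le> c" and hc: "free.height s (g a) \<le> free.height s (g c)"
    and \<theta>: "0 \<le> \<theta>" "\<theta> \<le> 1"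
  shows "right_opt f s ((1 - \<theta>) *\<^sub>R g c + \<theta> *\<^sub>R g a) ((1 - \<theta>) * f c + \<theta> * f a)"
proof -
  have gr: "refl_curve g (- t) = refl_pt (g t)" for t by (simp add: refl_curve_def)
  show ?thesis
    unfolding right_opt_def refl_pt_affine
    using r.left_opt_chord[of "- c" "- a" "- s" \<theta> "\<lambda>t. f (- t)"] ac hc \<theta>
    by (simp add: gr free.height_refl chord_in_strip_refl)
qed

lemma gap_chord_below:
  assumes "is_gap A r l" "p \<in> closed_segment (g r) (g l)" "gap_chords g A \<subseteq> Omega G \<epsilon>" "sorted_intervals A"
    "p $ 1 = h s $ 1"
  shows "p $ 2 \<le> h s $ 2"
proof -
  have "p \<in> Omega G \<epsilon>" using is_gap_facts(5)[OF assms(4,3,1)] assms(2,3) by blast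
  from in_OmegaE[OF this] obtain s' where s': "h s' $ 1 = p $ 1" "p $ 2 \<le> h s' $ 2" by metis
  then have "s' = s" using assms(5) by simp
  then show ?thesis using s' by simp
qed

text \<open>A linearity domain touching the free boundary: a multifigure with tangents or an angle. Unlike
  for multifigures, the list may consist of one single point.\<close>

definition plate :: "side \<Rightarrow> side \<Rightarrow> intervals \<Rightarrow> bool" where
  "plate d1 d2 A \<longleftrightarrow> sorted_intervals A \<and> gap_chords g A \<subseteq> Omega G \<epsilon> \<and>
     (left_end A = -\<infinity> \<longrightarrow> d1 = Left) \<and> (right_end A = \<infinity> \<longrightarrow> d2 = Right) \<and>
     (\<forall>a c. left_end A = ereal a \<longrightarrow> right_end A = ereal c \<longrightarrow>
        tangency_param G \<epsilon> d1 a \<le> tangency_param G \<epsilon> d2 c)"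

definition arc_from :: "side \<Rightarrow> intervals \<Rightarrow> real \<Rightarrow> bool" where
  "arc_from d A s \<longleftrightarrow> (\<forall>a. left_end A = ereal a \<longrightarrow> tangency_param G \<epsilon> d a \<le> s)"

definition arc_to :: "side \<Rightarrow> intervals \<Rightarrow> real \<Rightarrow> bool" where
  "arc_to d A s \<longleftrightarrow> (\<forall>c. right_end A = ereal c \<longrightarrow> s \<le> tangency_param G \<epsilon> d c)"

context
  fixes d1 d2 :: side and A :: intervals
  assumes plate: "plate d1 d2 A"
begin

lemma plateD: "sorted_intervals A" "gap_chords g A \<subseteq> Omega G \<epsilon>" "left_end A = -\<infinity> \<Longrightarrow> d1 = Left"
    "right_end A = \<infinity> \<Longrightarrow> d2 = Right"
    "left_end A = ereal a \<Longrightarrow> right_end A = ereal c \<Longrightarrow> tangency_param G \<epsilon> d1 a \<le> tangency_param G \<epsilon> d2 c"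
  using plate unfolding plate_def by blast+

lemmas sorted_gaps = plateD(1,2)

abbreviation S where "S \<equiv> region G \<epsilon> (Tangent_Multi d1 d2 A)"

lemma left_end_cases:
  obtains "left_end A = -\<infinity>" | a where "left_end A = ereal a"
proof -
  have "left_end A \<noteq> \<infinity>" using sorted_intervals_nth(2)[OF plateD(1), of 0] ends_nth[OF sorted_gaps] by simp
  then show ?thesis using that by (cases "left_end A") auto
qed

lemma right_end_cases:
  obtains "right_end A = \<infinity>" | c where "right_end A = ereal c"
proof -
  have "right_end A \<noteq> -\<infinity>"
    using sorted_intervals_nth(3)[OF plateD(1), of "length A - 1"] ends_nth[OF sorted_gaps] by simp
  then show ?thesis using that by (cases "right_end A") auto
qed

lemma ends_le: "left_end A = ereal a \<Longrightarrow> right_end A = ereal c \<Longrightarrow> a \<le> c"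
  using ends_bound(2)[OF sorted_gaps left_end_in[OF sorted_gaps]] by fastforce

lemma lower_iff:
  "p \<in> multi_lower G \<epsilon> d1 d2 A \<longleftrightarrow> p \<in> base_curve g A
    \<or> (\<exists>a. left_end A = ereal a \<and> d1 = Right \<and> p \<in> closed_segment (wR a) (g a))
    \<or> (\<exists>c. right_end A = ereal c \<and> d2 = Left \<and> p \<in> closed_segment (g c) (wL c))"
  by (cases rule: left_end_cases; cases rule: right_end_cases)
    (auto simp: multi_lower_def tangent_segment_eq)

lemma upper_iff:
  "q \<in> multi_upper G \<epsilon> d1 d2 A \<longleftrightarrow> (\<exists>s. arc_from d1 A s \<and> arc_to d2 A s \<and> q = h s)
    \<or> (\<exists>a. left_end A = ereal a \<and> d1 = Left \<and> q \<in> closed_segment (g a) (wL a))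
    \<or> (\<exists>c. right_end A = ereal c \<and> d2 = Right \<and> q \<in> closed_segment (wR c) (g c))"
  by (cases rule: left_end_cases; cases rule: right_end_cases)
    (auto simp: multi_upper_def tangent_segment_eq arc_from_def arc_to_def)

lemma upper_arcI: "arc_from d1 A s \<Longrightarrow> arc_to d2 A s \<Longrightarrow> h s \<in> multi_upper G \<epsilon> d1 d2 A"
  and upper_leftI: "left_end A = ereal a \<Longrightarrow> d1 = Left \<Longrightarrow> p \<in> closed_segment (g a) (wL a) \<Longrightarrow> p \<in> multi_upper G \<epsilon> d1 d2 A"
  and upper_rightI: "right_end A = ereal c \<Longrightarrow> d2 = Right \<Longrightarrow> p \<in> closed_segment (wR c) (g c) \<Longrightarrow> p \<in> multi_upper G \<epsilon> d1 d2 A"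
  unfolding upper_iff by (rule disjI1, intro exI[of _ s] conjI refl, assumption+)
    (rule disjI2, rule disjI1, intro exI[of _ a] conjI, assumption+,
     rule disjI2, rule disjI2, intro exI[of _ c] conjI, assumption+)

lemma lower_baseI: "a \<in> params_of A \<Longrightarrow> g a \<in> multi_lower G \<epsilon> d1 d2 A"
  and lower_gapI: "is_gap A r l \<Longrightarrow> p \<in> closed_segment (g r) (g l) \<Longrightarrow> p \<in> multi_lower G \<epsilon> d1 d2 A"
  and lower_rightI: "left_end A = ereal a \<Longrightarrow> d1 = Right \<Longrightarrow> p \<in> closed_segment (wR a) (g a) \<Longrightarrow> p \<in> multi_lower G \<epsilon> d1 d2 A"
  and lower_leftI: "right_end A = ereal c \<Longrightarrow> d2 = Left \<Longrightarrow> p \<in> closed_segment (g c) (wL c) \<Longrightarrow> p \<in> multi_lower G \<epsilon> d1 d2 A"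
  unfolding lower_iff base_curve_iff[OF sorted_gaps]
  by (rule disjI1, rule disjI1, intro bexI[of _ a] refl, assumption)
    (rule disjI1, rule disjI2, intro exI[of _ r] exI[of _ l] conjI, assumption+,
     rule disjI2, rule disjI1, intro exI[of _ a] conjI, assumption+,
     rule disjI2, rule disjI2, intro exI[of _ c] conjI, assumption+)

lemma in_plateI: "p \<in> multi_lower G \<epsilon> d1 d2 A \<Longrightarrow> q \<in> multi_upper G \<epsilon> d1 d2 A \<Longrightarrow> p $ 1 = x $ 1 \<Longrightarrow> q $ 1 = x $ 1
    \<Longrightarrow> p $ 2 \<le> x $ 2 \<Longrightarrow> x $ 2 \<le> q $ 2 \<Longrightarrow> x \<in> S"
  unfolding region.simps between_graphs_def by blast

lemma in_plateE:
  assumes "x \<in> S"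
  obtains p q where "p \<in> multi_lower G \<epsilon> d1 d2 A" "q \<in> multi_upper G \<epsilon> d1 d2 A" "p $ 1 = x $ 1" "q $ 1 = x $ 1"
    "p $ 2 \<le> x $ 2" "x $ 2 \<le> q $ 2"
  using assms unfolding region.simps between_graphs_def by blast

text \<open>Below \<open>y\<close> there is a point \<open>g \<tau>\<close> of the fixed boundary. Its parameter decides what bounds the
  plate there from below: the base curve, or one of the extreme tangents.\<close>

lemma in_plate_under_arc:
  assumes y: "y \<in> Omega G \<epsilon>" and arc: "arc_from d1 A s" "arc_to d2 A s" "h s $ 1 = y $ 1"
    and hl: "\<And>a. left_end A = ereal a \<Longrightarrow> d1 = Right \<Longrightarrow> 0 \<le> free.height (sR a) y"
    and hr: "\<And>c. right_end A = ereal c \<Longrightarrow> d2 = Left \<Longrightarrow> 0 \<le> free.height (sL c) y"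
    and hg: "\<And>p r l. is_gap A r l \<Longrightarrow> p \<in> closed_segment (g r) (g l) \<Longrightarrow> p $ 1 = y $ 1 \<Longrightarrow> p $ 2 \<le> y $ 2"
  shows "y \<in> S"
proof -
  from in_OmegaE[OF y] obtain \<tau> s' where \<tau>: "g \<tau> $ 1 = y $ 1" "g \<tau> $ 2 \<le> y $ 2" and s': "h s' $ 1 = y $ 1" "y $ 2 \<le> h s' $ 2"
    by metis
  have "s' = s" using trans[OF s'(1) arc(3)[symmetric]] by simp
  then have y2: "y $ 2 \<le> h s $ 2" using s'(2) by simp
  have upper: "h s \<in> multi_upper G \<epsilon> d1 d2 A" using arc(1,2) by (rule upper_arcI)
  consider "left_end A \<le> ereal \<tau>" "ereal \<tau> \<le> right_end A" | "\<not> left_end A \<le> ereal \<tau>"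
    | "\<not> ereal \<tau> \<le> right_end A" by argo
  then have "\<exists>p\<in>multi_lower G \<epsilon> d1 d2 A. p $ 1 = y $ 1 \<and> p $ 2 \<le> y $ 2"
  proof cases
    assume in_ends: "left_end A \<le> ereal \<tau>" "ereal \<tau> \<le> right_end A"
    show ?thesis
    proof (cases "\<tau> \<in> params_of A")
      case True
      then show ?thesis using \<tau> lower_baseI by (intro bexI[of _ "g \<tau>"]) simp_all
    next
      case False
      obtain r l where rl: "is_gap A r l" "r < \<tau>" "\<tau> < l" using gap_around[OF sorted_gaps False in_ends] .
      have "g r $ 1 \<le> y $ 1" "y $ 1 \<le> g l $ 1" unfolding \<tau>(1)[symmetric] using rl by simp_all
      then obtain p where p: "p \<in> closed_segment (g r) (g l)" "p $ 1 = y $ 1" by (rule abscissa_on_segment)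
      then show ?thesis using hg[OF rl(1) p] lower_gapI[OF rl(1) p(1)] by (intro bexI[of _ p]) simp_all
    qed
  next
    assume "\<not> left_end A \<le> ereal \<tau>"
    then obtain a where a: "left_end A = ereal a" "\<tau> < a" by (cases rule: left_end_cases) auto
    have ya: "y $ 1 < g a $ 1" unfolding \<tau>(1)[symmetric] using a(2) by simp
    have le: "h (tangency_param G \<epsilon> d1 a) $ 1 \<le> y $ 1" using arc(1) a(1) unfolding arc(3)[symmetric] arc_from_def by simp
    have d1: "d1 = Right"
    proof (cases d1)
      case Left
      then show ?thesis using le ya wL_greater[of a] by (simp add: tangency_param_eq wL_def)
    qed
    have "wR a $ 1 \<le> y $ 1" "y $ 1 \<le> g a $ 1" using le ya d1 by (simp_all add: tangency_param_eq wR_def)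
    then obtain p where p: "p \<in> closed_segment (wR a) (g a)" "p $ 1 = y $ 1" by (rule abscissa_on_segment)
    have "p $ 2 \<le> y $ 2" using hl[OF a(1) d1] on_right_tangent(1)[OF p(1)] p(2) by (simp add: free.height_def)
    then show ?thesis using p(2) lower_rightI[OF a(1) d1 p(1)] by (intro bexI[of _ p]) simp_all
  next
    assume "\<not> ereal \<tau> \<le> right_end A"
    then obtain c where c: "right_end A = ereal c" "c < \<tau>" by (cases rule: right_end_cases) auto
    have yc: "g c $ 1 < y $ 1" unfolding \<tau>(1)[symmetric] using c(2) by simp
    have le: "y $ 1 \<le> h (tangency_param G \<epsilon> d2 c) $ 1" using arc(2) c(1) unfolding arc(3)[symmetric] arc_to_def by simp
    have d2: "d2 = Left"
    proof (cases d2)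
      case Right
      then show ?thesis using le yc wR_less[of c] by (simp add: tangency_param_eq wR_def)
    qed
    have "g c $ 1 \<le> y $ 1" "y $ 1 \<le> wL c $ 1" using le yc d2 by (simp_all add: tangency_param_eq wL_def)
    then obtain p where p: "p \<in> closed_segment (g c) (wL c)" "p $ 1 = y $ 1" by (rule abscissa_on_segment)
    have "p $ 2 \<le> y $ 2" using hr[OF c(1) d2] on_left_tangent(1)[OF p(1)] p(2) by (simp add: free.height_def)
    then show ?thesis using p(2) lower_leftI[OF c(1) d2 p(1)] by (intro bexI[of _ p]) simp_all
  qed
  then obtain p where "p \<in> multi_lower G \<epsilon> d1 d2 A" "p $ 1 = y $ 1" "p $ 2 \<le> y $ 2" by (elim bexE conjE)
  from in_plateI[OF this(1) upper this(2) arc(3) this(3) y2] show ?thesis .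
qed

lemma arc_in_plate:
  assumes arc: "arc_from d1 A s" "arc_to d2 A s"
  shows "h s \<in> S"
proof (rule in_plate_under_arc[OF _ arc refl])
  obtain t where t: "g t $ 1 = h s $ 1" "g t $ 2 < h s $ 2" using free_above by blast
  show "h s \<in> Omega G \<epsilon>" by (rule in_OmegaI[of t _ s]) (use t in simp_all)
  show "p $ 2 \<le> h s $ 2" if "is_gap A r l" "p \<in> closed_segment (g r) (g l)" "p $ 1 = h s $ 1" for p r l
    using gap_chord_below[OF that(1,2) plateD(2,1) that(3)] .
qed (use free.height_nonneg in simp_all)

lemma under_arc:
  assumes arc: "arc_from d1 A s" "arc_to d2 A s"
  obtains p where "p \<in> multi_lower G \<epsilon> d1 d2 A" "p $ 1 = h s $ 1" "free.height s p \<le> 0"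
proof -
  obtain p where "p \<in> multi_lower G \<epsilon> d1 d2 A" "p $ 1 = h s $ 1" "p $ 2 \<le> h s $ 2"
    using in_plateE[OF arc_in_plate[OF arc]] by metis
  then show ?thesis using that[of p] by (simp add: free.height_at_same_abscissa)
qed

text \<open>If the arc does not pass over \<open>g a\<close>, an extreme tangent does, since \<open>g a\<close> lies between the two points
  where the line of that tangent crosses the fixed boundary.\<close>

lemma base_in_plate:
  assumes a: "a \<in> params_of A"
  shows "g a \<in> S"
proof -
  obtain s where s: "h s $ 1 = g a $ 1" using free_over_fixed by blast
  have ga: "g a \<in> multi_lower G \<epsilon> d1 d2 A" by (rule lower_baseI[OF a])
  consider "arc_from d1 A s" "arc_to d2 A s" | "\<not> arc_from d1 A s" | "\<not> arc_to d2 A s" by argo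
  then have "\<exists>q\<in>multi_upper G \<epsilon> d1 d2 A. q $ 1 = g a $ 1 \<and> g a $ 2 \<le> q $ 2"
  proof cases
    assume "arc_from d1 A s" "arc_to d2 A s"
    then have "h s \<in> multi_upper G \<epsilon> d1 d2 A" by (rule upper_arcI)
    then show ?thesis using s above_fixed[OF s[symmetric]] by (intro bexI[of _ "h s"]) auto
  next
    assume "\<not> arc_from d1 A s"
    then obtain b where b: "left_end A = ereal b" "s < tangency_param G \<epsilon> d1 b" unfolding arc_from_def by auto
    have ba: "b \<le> a" using ends_bound(1)[OF sorted_gaps a] b(1) by simp
    have less: "g a $ 1 < h (tangency_param G \<epsilon> d1 b) $ 1" unfolding s[symmetric] using b(2) by simp
    have d1: "d1 = Left"
    proof (cases d1)
      case Right
      then have "g a $ 1 < wR b $ 1" using less by (simp add: tangency_param_eq wR_def)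
      then have "g a $ 1 < g b $ 1" using wR_less[of b] by linarith
      then show ?thesis using ba by simp
    qed
    have w: "g a $ 1 < wL b $ 1" using less d1 by (simp add: tangency_param_eq wL_def)
    then have "g a $ 1 < g (tp (sL b)) $ 1"
      using abscissa_less_tp[of "sL b"] unfolding wL_def by linarith
    then have ht: "free.height (sL b) (g a) \<le> 0" using ba by (simp add: height_le_0_between)
    have "g b $ 1 \<le> g a $ 1" "g a $ 1 \<le> wL b $ 1" using ba w by simp_all
    then obtain q where q: "q \<in> closed_segment (g b) (wL b)" "q $ 1 = g a $ 1" by (rule abscissa_on_segment)
    have "g a $ 2 \<le> q $ 2" using ht on_left_tangent(1)[OF q(1)] q(2) by (simp add: free.height_def)
    then show ?thesis using q(2) upper_leftI[OF b(1) d1 q(1)] by (intro bexI[of _ q]) simp_all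
  next
    assume "\<not> arc_to d2 A s"
    then obtain b where b: "right_end A = ereal b" "tangency_param G \<epsilon> d2 b < s" unfolding arc_to_def by auto
    have ba: "a \<le> b" using ends_bound(2)[OF sorted_gaps a] b(1) by simp
    have less: "h (tangency_param G \<epsilon> d2 b) $ 1 < g a $ 1" unfolding s[symmetric] using b(2) by simp
    have d2: "d2 = Right"
    proof (cases d2)
      case Left
      then have "wL b $ 1 < g a $ 1" using less by (simp add: tangency_param_eq wL_def)
      then have "g b $ 1 < g a $ 1" using wL_greater[of b] by linarith
      then show ?thesis using ba by simp
    qed
    have w: "wR b $ 1 < g a $ 1" using less d2 by (simp add: tangency_param_eq wR_def)
    then have "g (tm (sR b)) $ 1 < g a $ 1"
      using tm_less_abscissa[of "sR b"] unfolding wR_def by linarith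
    then have ht: "free.height (sR b) (g a) \<le> 0" using ba by (simp add: height_le_0_between)
    have "wR b $ 1 \<le> g a $ 1" "g a $ 1 \<le> g b $ 1" using ba w by simp_all
    then obtain q where q: "q \<in> closed_segment (wR b) (g b)" "q $ 1 = g a $ 1" by (rule abscissa_on_segment)
    have "g a $ 2 \<le> q $ 2" using ht on_right_tangent(1)[OF q(1)] q(2) by (simp add: free.height_def)
    then show ?thesis using q(2) upper_rightI[OF b(1) d2 q(1)] by (intro bexI[of _ q]) simp_all
  qed
  then obtain q where "q \<in> multi_upper G \<epsilon> d1 d2 A" "q $ 1 = g a $ 1" "g a $ 2 \<le> q $ 2" by (elim bexE conjE)
  from in_plateI[OF ga this(1) refl this(2) order_refl this(3)] show ?thesis .
qed

text \<open>For every point of the plate there is a tangent line to the arc of its free boundary above it.\<close>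

lemma point_under_tangent:
  assumes x: "x \<in> S"
  obtains p s where "p \<in> multi_lower G \<epsilon> d1 d2 A" "p $ 1 = x $ 1" "p $ 2 \<le> x $ 2"
    "arc_from d1 A s" "arc_to d2 A s" "free.height s x \<le> 0"
proof -
  obtain p q where pq: "p \<in> multi_lower G \<epsilon> d1 d2 A" "q \<in> multi_upper G \<epsilon> d1 d2 A" "p $ 1 = x $ 1" "q $ 1 = x $ 1"
    "p $ 2 \<le> x $ 2" "x $ 2 \<le> q $ 2" using in_plateE[OF x] by metis
  have le: "free.height s x \<le> free.height s q" for s using pq(4,6) by (simp add: free.height_def)
  have "\<exists>s. arc_from d1 A s \<and> arc_to d2 A s \<and> free.height s q = 0"
    using pq(2) unfolding upper_iff
  proof (elim disjE exE conjE)
    fix a assume a: "left_end A = ereal a" "d1 = Left" "q \<in> closed_segment (g a) (wL a)"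
    then have "arc_from d1 A (sL a)" "arc_to d2 A (sL a)" "free.height (sL a) q = 0"
      using on_left_tangent(1)[OF a(3)] plateD(5)[OF a(1)] by (auto simp: arc_from_def arc_to_def tangency_param_eq)
    then show ?thesis by blast
  next
    fix c assume c: "right_end A = ereal c" "d2 = Right" "q \<in> closed_segment (wR c) (g c)"
    then have "arc_from d1 A (sR c)" "arc_to d2 A (sR c)" "free.height (sR c) q = 0"
      using on_right_tangent(1)[OF c(3)] plateD(5)[OF _ c(1)] by (auto simp: arc_from_def arc_to_def tangency_param_eq)
    then show ?thesis by blast
  qed auto
  then show ?thesis using that pq le by metis
qed

lemma lower_abscissa:
  assumes "p \<in> multi_lower G \<epsilon> d1 d2 A"
  shows "left_end A = ereal a \<Longrightarrow> d1 = Right \<Longrightarrow> wR a $ 1 \<le> p $ 1"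
    "right_end A = ereal c \<Longrightarrow> d2 = Left \<Longrightarrow> p $ 1 \<le> wL c $ 1"
    "left_end A = ereal a \<Longrightarrow> p $ 1 = wR a $ 1 \<Longrightarrow> p \<in> closed_segment (wR a) (g a)"
    "right_end A = ereal c \<Longrightarrow> p $ 1 = wL c $ 1 \<Longrightarrow> p \<in> closed_segment (g c) (wL c)"
proof -
  note base = on_base_bounds[OF sorted_gaps base_curve_on_base[OF sorted_gaps]]
  have right: "wR a $ 1 \<le> p $ 1 \<and> (p $ 1 = wR a $ 1 \<longrightarrow> p \<in> closed_segment (wR a) (g a))" if a: "left_end A = ereal a"
    using assms unfolding lower_iff
  proof (elim disjE exE conjE)
    assume "p \<in> base_curve g A"
    then have "g a $ 1 \<le> p $ 1" using base(1) a by blast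
    then show ?thesis using wR_less[of a] by simp
  next
    fix c assume "right_end A = ereal c" "p \<in> closed_segment (g c) (wL c)"
    then have "g c $ 1 \<le> p $ 1" "a \<le> c" using on_left_tangent(2) ends_le[OF a] by blast+
    then have "g a $ 1 \<le> p $ 1" using fixed.c1_le_iff[of a c] by linarith
    then show ?thesis using wR_less[of a] by simp
  next
    fix a' assume "left_end A = ereal a'" "p \<in> closed_segment (wR a') (g a')"
    then show ?thesis using on_right_tangent(2) a by simp
  qed
  have left: "p $ 1 \<le> wL c $ 1 \<and> (p $ 1 = wL c $ 1 \<longrightarrow> p \<in> closed_segment (g c) (wL c))" if c: "right_end A = ereal c"
    using assms unfolding lower_iff
  proof (elim disjE exE conjE)
    assume "p \<in> base_curve g A"
    then have "p $ 1 \<le> g c $ 1" using base(2) c by blast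
    then show ?thesis using wL_greater[of c] by simp
  next
    fix a assume "left_end A = ereal a" "p \<in> closed_segment (wR a) (g a)"
    then have "p $ 1 \<le> g a $ 1" "a \<le> c" using on_right_tangent(3) ends_le[OF _ c] by blast+
    then have "p $ 1 \<le> g c $ 1" using fixed.c1_le_iff[of a c] by linarith
    then show ?thesis using wL_greater[of c] by simp
  next
    fix c' assume "right_end A = ereal c'" "p \<in> closed_segment (g c') (wL c')"
    then show ?thesis using on_left_tangent(3) c by simp
  qed
  show "left_end A = ereal a \<Longrightarrow> d1 = Right \<Longrightarrow> wR a $ 1 \<le> p $ 1"
    "left_end A = ereal a \<Longrightarrow> p $ 1 = wR a $ 1 \<Longrightarrow> p \<in> closed_segment (wR a) (g a)"
    "right_end A = ereal c \<Longrightarrow> d2 = Left \<Longrightarrow> p $ 1 \<le> wL c $ 1"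
    "right_end A = ereal c \<Longrightarrow> p $ 1 = wL c $ 1 \<Longrightarrow> p \<in> closed_segment (g c) (wL c)"
    using left right by blast+
qed

subsection \<open>Optimizers in a plate\<close>

context
  fixes B :: "real^2 \<Rightarrow> real" and k :: real and n :: "real^2"
  assumes affine: "\<And>x. x \<in> S \<Longrightarrow> B x = k + n \<bullet> x"
    and boundary: "\<And>a. g a \<in> S \<Longrightarrow> B (g a) = f a"
begin

lemma affine_on_base: "a \<in> params_of A \<Longrightarrow> f a = k + n \<bullet> g a"
  using affine boundary base_in_plate by metis

text \<open>If the plate begins with a left tangent, then the tangent line at \<open>s\<close> leaves it through the fixed boundary or
  a chord, because it crosses the fixed boundary at \<open>tm s\<close>, not to the left of the beginning of the plate.\<close>

lemma left_crossing_in_plate: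
  assumes fed: "\<And>a. d1 = Right \<Longrightarrow> left_end A = ereal a \<Longrightarrow> left_opt f (sR a) (wR a) (B (wR a))"
    and p: "p \<in> multi_lower G \<epsilon> d1 d2 A" and arc: "arc_from d1 A s" "arc_to d2 A s"
    and c: "free.height s p \<le> c" "c \<le> 0"
  shows "\<exists>y. left_opt f s y (k + n \<bullet> y) \<and> free.height s y = c \<and> y $ 1 \<le> p $ 1"
proof (cases d1)
  case Right
  then obtain a where a: "left_end A = ereal a" using left_end_cases plateD(3) by (metis side.distinct(1))
  have sa: "sR a \<le> s" using arc(1) a Right by (simp add: arc_from_def tangency_param_eq)
  have "wR a \<in> S"
    unfolding wR_def
  proof (rule arc_in_plate)
    show "arc_from d1 A (sR a)" using a Right by (simp add: arc_from_def tangency_param_eq)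
    show "arc_to d2 A (sR a)" using order_trans[OF sa] arc(2) by (simp add: arc_to_def)
  qed
  then have "left_opt f (sR a) (wR a) (k + n \<bullet> wR a)" using fed[OF Right a] affine by simp
  moreover have "a \<in> params_of A" by (rule left_end_in[OF sorted_gaps a])
  moreover have "a \<le> b" if "b \<in> params_of A" for b using ends_bound(1)[OF sorted_gaps that] a by simp
  ultimately have fed': "fed_from_left f (params_of A) a (\<lambda>y. k + n \<bullet> y)" unfolding fed_from_left_def by blast
  show ?thesis
  proof (rule left_crossing[OF gaps_bridged_params[OF sorted_gaps] affine_on_base, where A=a])
    show "(\<exists>a\<in>params_of A. a \<le> tm s) \<or> fed_from_left f (params_of A) a (\<lambda>y. k + n \<bullet> y) \<and> sR a \<le> s"
      using fed' sa by blast
    show "on_base (params_of A) p \<or>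
      fed_from_left f (params_of A) a (\<lambda>y. k + n \<bullet> y) \<and> sR a \<le> s \<and> p \<in> closed_segment (wR a) (g a) \<or>
      (\<exists>C\<in>params_of A. p \<in> closed_segment (g C) (wL C))"
      using p unfolding lower_iff
    proof (elim disjE exE conjE)
      fix c assume "right_end A = ereal c" "p \<in> closed_segment (g c) (wL c)"
      then show ?thesis using right_end_in[OF sorted_gaps] by blast
    qed (use base_curve_on_base[OF sorted_gaps] fed' sa a in auto)
  qed (use c in simp_all)
next
  case Left
  have below: "\<exists>a\<in>params_of A. a \<le> tm s"
  proof (cases rule: left_end_cases)
    case 1
    then show ?thesis using left_unbounded[OF sorted_gaps, of "tm s"] by (meson less_imp_le)
  next
    case (2 a)
    then have "sL a \<le> sL (tm s)" using arc(1) Left by (simp add: arc_from_def tangency_param_eq)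
    then have "a \<le> tm s" by (simp only: sL_le_iff)
    then show ?thesis using left_end_in[OF sorted_gaps 2] by blast
  qed
  show ?thesis
  proof (rule left_crossing[OF gaps_bridged_params[OF sorted_gaps] affine_on_base, where A=0])
    show "(\<exists>a\<in>params_of A. a \<le> tm s) \<or> fed_from_left f (params_of A) 0 (\<lambda>y. k + n \<bullet> y) \<and> sR 0 \<le> s"
      using below by blast
    show "on_base (params_of A) p \<or>
      fed_from_left f (params_of A) 0 (\<lambda>y. k + n \<bullet> y) \<and> sR 0 \<le> s \<and> p \<in> closed_segment (wR 0) (g 0) \<or>
      (\<exists>C\<in>params_of A. p \<in> closed_segment (g C) (wL C))"
      using p unfolding lower_iff
    proof (elim disjE exE conjE)
      fix c assume "right_end A = ereal c" "p \<in> closed_segment (g c) (wL c)"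
      then show ?thesis using right_end_in[OF sorted_gaps] by blast
    qed (use base_curve_on_base[OF sorted_gaps] Left in auto)
  qed (use c in simp_all)
qed

lemma right_crossing_in_plate:
  assumes fed: "\<And>c. d2 = Left \<Longrightarrow> right_end A = ereal c \<Longrightarrow> right_opt f (sL c) (wL c) (B (wL c))"
    and p: "p \<in> multi_lower G \<epsilon> d1 d2 A" and arc: "arc_from d1 A s" "arc_to d2 A s"
    and c: "free.height s p \<le> c" "c \<le> 0"
  shows "\<exists>z. right_opt f s z (k + n \<bullet> z) \<and> free.height s z = c \<and> p $ 1 \<le> z $ 1"
proof (cases d2)
  case Left
  then obtain b where b: "right_end A = ereal b" using right_end_cases plateD(4) by (metis side.distinct(1))
  have sb: "s \<le> sL b" using arc(2) b Left by (simp add: arc_to_def tangency_param_eq)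
  have "wL b \<in> S"
    unfolding wL_def
  proof (rule arc_in_plate)
    show "arc_to d2 A (sL b)" using b Left by (simp add: arc_to_def tangency_param_eq)
    show "arc_from d1 A (sL b)" using order_trans[OF _ sb] arc(1) by (simp add: arc_from_def)
  qed
  then have "right_opt f (sL b) (wL b) (k + n \<bullet> wL b)" using fed[OF Left b] affine by simp
  moreover have "b \<in> params_of A" by (rule right_end_in[OF sorted_gaps b])
  moreover have "a \<le> b" if "a \<in> params_of A" for a using ends_bound(2)[OF sorted_gaps that] b by simp
  ultimately have fed': "fed_from_right f (params_of A) b (\<lambda>y. k + n \<bullet> y)" unfolding fed_from_right_def by blast
  show ?thesis
  proof (rule right_crossing[OF gaps_bridged_params[OF sorted_gaps] affine_on_base, where C=b])
    show "(\<exists>a\<in>params_of A. tp s \<le> a) \<or> fed_from_right f (params_of A) b (\<lambda>y. k + n \<bullet> y) \<and> s \<le> sL b"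
      using fed' sb by blast
    show "on_base (params_of A) p \<or>
      fed_from_right f (params_of A) b (\<lambda>y. k + n \<bullet> y) \<and> s \<le> sL b \<and> p \<in> closed_segment (g b) (wL b) \<or>
      (\<exists>A\<in>params_of A. p \<in> closed_segment (wR A) (g A))"
      using p unfolding lower_iff
    proof (elim disjE exE conjE)
      fix a assume "left_end A = ereal a" "p \<in> closed_segment (wR a) (g a)"
      then show ?thesis using left_end_in[OF sorted_gaps] by blast
    qed (use base_curve_on_base[OF sorted_gaps] fed' sb b in auto)
  qed (use c in simp_all)
next
  case Right
  have above: "\<exists>a\<in>params_of A. tp s \<le> a"
  proof (cases rule: right_end_cases)
    case 1
    then show ?thesis using right_unbounded[OF sorted_gaps, of "tp s"] by (meson less_imp_le)
  next
    case (2 b)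
    then have "sR (tp s) \<le> sR b" using arc(2) Right by (simp add: arc_to_def tangency_param_eq)
    then have "tp s \<le> b" by (simp only: sR_le_iff)
    then show ?thesis using right_end_in[OF sorted_gaps 2] by blast
  qed
  show ?thesis
  proof (rule right_crossing[OF gaps_bridged_params[OF sorted_gaps] affine_on_base, where C=0])
    show "(\<exists>a\<in>params_of A. tp s \<le> a) \<or> fed_from_right f (params_of A) 0 (\<lambda>y. k + n \<bullet> y) \<and> s \<le> sL 0"
      using above by blast
    show "on_base (params_of A) p \<or>
      fed_from_right f (params_of A) 0 (\<lambda>y. k + n \<bullet> y) \<and> s \<le> sL 0 \<and> p \<in> closed_segment (g 0) (wL 0) \<or>
      (\<exists>A\<in>params_of A. p \<in> closed_segment (wR A) (g A))"
      using p unfolding lower_iff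
    proof (elim disjE exE conjE)
      fix a assume "left_end A = ereal a" "p \<in> closed_segment (wR a) (g a)"
      then show ?thesis using left_end_in[OF sorted_gaps] by blast
    qed (use base_curve_on_base[OF sorted_gaps] Right in auto)
  qed (use c in simp_all)
qed

text \<open>The parallel to a tangent line through \<open>x\<close> leaves the plate through its lower boundary or
  through the fixed boundary on both sides, and the value at \<open>x\<close> is the mean of the values there.\<close>

lemma plate_opt:
  assumes fed1: "\<And>a. d1 = Right \<Longrightarrow> left_end A = ereal a \<Longrightarrow> left_opt f (sR a) (wR a) (B (wR a))"
    and fed2: "\<And>c. d2 = Left \<Longrightarrow> right_end A = ereal c \<Longrightarrow> right_opt f (sL c) (wL c) (B (wL c))"
    and x: "x \<in> S"
  shows "\<exists>\<alpha> T. opt f \<alpha> T x (B x)"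
proof -
  obtain p s where p: "p \<in> multi_lower G \<epsilon> d1 d2 A" "p $ 1 = x $ 1" "p $ 2 \<le> x $ 2"
    and arc: "arc_from d1 A s" "arc_to d2 A s" and hx: "free.height s x \<le> 0"
    using point_under_tangent[OF x] by metis
  have "free.height s p \<le> free.height s x" using p by (simp add: free.height_def)
  from left_crossing_in_plate[OF fed1 p(1) arc this hx] right_crossing_in_plate[OF fed2 p(1) arc this hx]
  obtain y z where "left_opt f s y (k + n \<bullet> y)" "free.height s y = free.height s x" "y $ 1 \<le> p $ 1"
    "right_opt f s z (k + n \<bullet> z)" "free.height s z = free.height s x" "p $ 1 \<le> z $ 1" by blast
  then show ?thesis
    using opt_between_crossings[of f s y k n z x] hx p(2) affine[OF x] by simp
qed

text \<open>Follow the tangent at the right end itself: the point of tangency lies between the crossing point on the left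
  and the end of the base curve.\<close>

lemma plate_delivers_right:
  assumes fed: "\<And>a. d1 = Right \<Longrightarrow> left_end A = ereal a \<Longrightarrow> left_opt f (sR a) (wR a) (B (wR a))"
    and c: "d2 = Right" "right_end A = ereal c"
  shows "left_opt f (sR c) (wR c) (B (wR c))"
proof -
  have arc: "arc_from d1 A (sR c)" "arc_to d2 A (sR c)"
    using c plateD(5)[OF _ c(2)] by (simp_all add: arc_from_def arc_to_def tangency_param_eq)
  obtain p where p: "p \<in> multi_lower G \<epsilon> d1 d2 A" "p $ 1 = h (sR c) $ 1" "free.height (sR c) p \<le> 0"
    using under_arc[OF arc] .
  from left_crossing_in_plate[OF fed p(1) arc p(3)] obtain y where
    y: "left_opt f (sR c) y (k + n \<bullet> y)" "free.height (sR c) y = 0" "y $ 1 \<le> wR c $ 1"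
    using p(2) by (auto simp: wR_def)
  obtain \<theta> where \<theta>: "0 \<le> \<theta>" "\<theta> \<le> 1" "wR c = (1 - \<theta>) *\<^sub>R y + \<theta> *\<^sub>R g c"
    using on_line_in_segment[of "sR c" y 0 "g c" "wR c"] y wR_less[of c] by (auto simp: wR_def)
  have "left_opt f (sR c) ((1 - \<theta>) *\<^sub>R y + \<theta> *\<^sub>R g c) ((1 - \<theta>) * (k + n \<bullet> y) + \<theta> * f c)"
    using y wR_less[of c] by (intro left_opt_append \<theta>(1,2)) auto
  moreover have "(1 - \<theta>) * (k + n \<bullet> y) + \<theta> * f c = B (wR c)"
    unfolding affine_on_base[OF right_end_in[OF sorted_gaps c(2)]] affine_combination \<theta>(3)[symmetric]
    using affine[OF arc_in_plate[OF arc]] by (simp add: wR_def)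
  ultimately show ?thesis by (simp flip: \<theta>(3))
qed

lemma plate_delivers_left:
  assumes fed: "\<And>c. d2 = Left \<Longrightarrow> right_end A = ereal c \<Longrightarrow> right_opt f (sL c) (wL c) (B (wL c))"
    and a: "d1 = Left" "left_end A = ereal a"
  shows "right_opt f (sL a) (wL a) (B (wL a))"
proof -
  have arc: "arc_from d1 A (sL a)" "arc_to d2 A (sL a)"
    using a plateD(5)[OF a(2)] by (simp_all add: arc_from_def arc_to_def tangency_param_eq)
  obtain p where p: "p \<in> multi_lower G \<epsilon> d1 d2 A" "p $ 1 = h (sL a) $ 1" "free.height (sL a) p \<le> 0"
    using under_arc[OF arc] .
  from right_crossing_in_plate[OF fed p(1) arc p(3)] obtain z where
    z: "right_opt f (sL a) z (k + n \<bullet> z)" "free.height (sL a) z = 0" "wL a $ 1 \<le> z $ 1"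
    using p(2) by (auto simp: wL_def)
  obtain \<mu> where \<mu>: "0 \<le> \<mu>" "\<mu> \<le> 1" "wL a = (1 - \<mu>) *\<^sub>R g a + \<mu> *\<^sub>R z"
    using on_line_in_segment[of "sL a" "g a" 0 z "wL a"] z wL_greater[of a] by (auto simp: wL_def)
  define \<theta> where "\<theta> = 1 - \<mu>"
  have \<theta>: "0 \<le> \<theta>" "\<theta> \<le> 1" "wL a = (1 - \<theta>) *\<^sub>R z + \<theta> *\<^sub>R g a" using \<mu> by (simp_all add: \<theta>_def add.commute)
  have "right_opt f (sL a) ((1 - \<theta>) *\<^sub>R z + \<theta> *\<^sub>R g a) ((1 - \<theta>) * (k + n \<bullet> z) + \<theta> * f a)"
    using z wL_greater[of a] by (intro right_opt_append \<theta>(1,2)) auto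
  moreover have "(1 - \<theta>) * (k + n \<bullet> z) + \<theta> * f a = B (wL a)"
    unfolding affine_on_base[OF left_end_in[OF sorted_gaps a(2)]] affine_combination \<theta>(3)[symmetric]
    using affine[OF arc_in_plate[OF arc]] by (simp add: wL_def)
  ultimately show ?thesis by (simp flip: \<theta>(3))
qed

end

subsection \<open>Plates near the free boundary\<close>

text \<open>Above the points right below \<open>h s\<close> there are points of the upper boundary. If the arc did not reach
  \<open>s\<close>, they would lie on an extreme tangent, although \<open>h s\<close> has positive height over its line. A plate bounded
  from below by a tangent has a cusp at the point of tangency.\<close>

lemma plate_hit:
  assumes hit: "hit S s"
  shows "left_end A = ereal a \<Longrightarrow> tangency_param G \<epsilon> d1 a \<le> s \<and> (d1 = Right \<longrightarrow> s \<noteq> sR a)"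
    "right_end A = ereal c \<Longrightarrow> s \<le> tangency_param G \<epsilon> d2 c \<and> (d2 = Left \<longrightarrow> s \<noteq> sL c)"
proof -
  have points: "\<exists>\<delta> p q. 0 < \<delta> \<and> \<delta> < \<eta> \<and> p \<in> multi_lower G \<epsilon> d1 d2 A \<and> q \<in> multi_upper G \<epsilon> d1 d2 A \<and>
      p $ 1 = h s $ 1 \<and> q $ 1 = h s $ 1 \<and> p $ 2 < h s $ 2 \<and> h s $ 2 - \<delta> \<le> q $ 2" if "\<eta> > 0" for \<eta>
  proof -
    obtain \<delta> where \<delta>: "0 < \<delta>" "\<delta> < \<eta>" "h s - axis 2 \<delta> \<in> S" using hit \<open>\<eta> > 0\<close> unfolding hit_def by blast
    obtain p q where "p \<in> multi_lower G \<epsilon> d1 d2 A" "q \<in> multi_upper G \<epsilon> d1 d2 A" "p $ 1 = h s $ 1" "q $ 1 = h s $ 1"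
      "p $ 2 \<le> h s $ 2 - \<delta>" "h s $ 2 - \<delta> \<le> q $ 2" using in_plateE[OF \<delta>(3)] by auto
    then show ?thesis using \<delta> by (intro exI[of _ \<delta>] exI[of _ p] exI[of _ q]) auto
  qed
  obtain p where p: "p \<in> multi_lower G \<epsilon> d1 d2 A" "p $ 1 = h s $ 1" "p $ 2 < h s $ 2" using points[of 1] by auto
  have near: "\<exists>q\<in>multi_upper G \<epsilon> d1 d2 A. q $ 1 = h s $ 1 \<and> free.height r q > 0" if "r \<noteq> s" for r
  proof -
    have "free.height r (h s) > 0" using that by (intro free.height_pos) simp
    from points[OF this] obtain \<delta> q where q: "\<delta> < free.height r (h s)" "q \<in> multi_upper G \<epsilon> d1 d2 A"
      "q $ 1 = h s $ 1" "h s $ 2 - \<delta> \<le> q $ 2" by blast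
    then have "free.height r q > 0" by (simp add: free.height_def)
    then show ?thesis using q by blast
  qed
  show "tangency_param G \<epsilon> d1 a \<le> s \<and> (d1 = Right \<longrightarrow> s \<noteq> sR a)" if a: "left_end A = ereal a"
  proof (cases d1)
    case Right
    have "h (sR a) $ 1 \<le> h s $ 1" using lower_abscissa(1)[OF p(1) a Right] p(2) by (simp add: wR_def)
    moreover have "s \<noteq> sR a"
    proof
      assume s: "s = sR a"
      then have "p \<in> closed_segment (wR a) (g a)" using lower_abscissa(3)[OF p(1) a] p(2) by (simp add: wR_def)
      then have "free.height s p = 0" using on_right_tangent(1) s by blast
      then show False using p(2,3) by (simp add: free.height_at_same_abscissa)
    qed
    ultimately show ?thesis using Right by (simp add: tangency_param_eq)
  next
    case Left
    have "sL a \<le> s"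
    proof (rule ccontr)
      assume "\<not> ?thesis"
      then have less: "s < sL a" by simp
      then obtain q where q: "q \<in> multi_upper G \<epsilon> d1 d2 A" "q $ 1 = h s $ 1" "free.height (sL a) q > 0"
        using near[of "sL a"] by auto
      show False
        using q(1) unfolding upper_iff
      proof (elim disjE exE conjE)
        fix s' assume "arc_from d1 A s'" "q = h s'"
        then show False using q(2) less a Left by (simp add: arc_from_def tangency_param_eq)
      next
        fix a' assume "left_end A = ereal a'" "q \<in> closed_segment (g a') (wL a')"
        then show False using on_left_tangent(1) q(3) a by fastforce
      next
        fix c assume c: "right_end A = ereal c" "d2 = Right" "q \<in> closed_segment (wR c) (g c)"
        then have "h (sR c) $ 1 \<le> h s $ 1" using on_right_tangent(2)[OF c(3)] q(2) by (simp add: wR_def)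
        then show False using plateD(5)[OF a c(1)] c(2) Left less by (simp add: tangency_param_eq)
      qed
    qed
    then show ?thesis using Left by (simp add: tangency_param_eq)
  qed
  show "s \<le> tangency_param G \<epsilon> d2 c \<and> (d2 = Left \<longrightarrow> s \<noteq> sL c)" if c: "right_end A = ereal c"
  proof (cases d2)
    case Left
    have "h s $ 1 \<le> h (sL c) $ 1" using lower_abscissa(2)[OF p(1) c Left] p(2) by (simp add: wL_def)
    moreover have "s \<noteq> sL c"
    proof
      assume s: "s = sL c"
      then have "p \<in> closed_segment (g c) (wL c)" using lower_abscissa(4)[OF p(1) c] p(2) by (simp add: wL_def)
      then have "free.height s p = 0" using on_left_tangent(1) s by blast
      then show False using p(2,3) by (simp add: free.height_at_same_abscissa)
    qed
    ultimately show ?thesis using Left by (simp add: tangency_param_eq)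
  next
    case Right
    have "s \<le> sR c"
    proof (rule ccontr)
      assume "\<not> ?thesis"
      then have less: "sR c < s" by simp
      then obtain q where q: "q \<in> multi_upper G \<epsilon> d1 d2 A" "q $ 1 = h s $ 1" "free.height (sR c) q > 0"
        using near[of "sR c"] by auto
      show False
        using q(1) unfolding upper_iff
      proof (elim disjE exE conjE)
        fix s' assume "arc_to d2 A s'" "q = h s'"
        then show False using q(2) less c Right by (simp add: arc_to_def tangency_param_eq)
      next
        fix a assume a: "left_end A = ereal a" "d1 = Left" "q \<in> closed_segment (g a) (wL a)"
        then have "h s $ 1 \<le> h (sL a) $ 1" using on_left_tangent(3)[OF a(3)] q(2) by (simp add: wL_def)
        then show False using plateD(5)[OF a(1) c] a(2) Right less by (simp add: tangency_param_eq)
      next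
        fix c' assume "right_end A = ereal c'" "q \<in> closed_segment (wR c') (g c')"
        then show False using on_right_tangent(1) q(3) c by fastforce
      qed
    qed
    then show ?thesis using Right by (simp add: tangency_param_eq)
  qed
qed

text \<open>A point is above the chord iff it is on the left of the vector from \<open>g r\<close> to \<open>g l\<close>, as measured by
  a determinant.\<close>

lemma eventually_above_gap:
  assumes gap: "is_gap A r l" and off: "h s \<notin> closed_segment (g r) (g l)"
  shows "\<forall>\<^sub>F y in nhds (h s). \<forall>p\<in>closed_segment (g r) (g l). p $ 1 = y $ 1 \<longrightarrow> p $ 2 \<le> y $ 2"
proof -
  define cr where "cr y = (g l $ 1 - g r $ 1) * (y $ 2 - g r $ 2) - (g l $ 2 - g r $ 2) * (y $ 1 - g r $ 1)" for y :: "real^2"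
  have rl: "g r $ 1 < g l $ 1" using is_gap_facts(1)[OF sorted_gaps gap] by simp
  have on: "cr p = 0" "g r $ 1 \<le> p $ 1" "p $ 1 \<le> g l $ 1" if p: "p \<in> closed_segment (g r) (g l)" for p
  proof -
    obtain \<theta> where \<theta>: "0 \<le> \<theta>" "\<theta> \<le> 1" "p = (1 - \<theta>) *\<^sub>R g r + \<theta> *\<^sub>R g l" using p by (auto simp: in_segment)
    have e: "p $ 1 - g r $ 1 = \<theta> * (g l $ 1 - g r $ 1)" "p $ 2 - g r $ 2 = \<theta> * (g l $ 2 - g r $ 2)"
      "g l $ 1 - p $ 1 = (1 - \<theta>) * (g l $ 1 - g r $ 1)"
      unfolding \<theta>(3) by (simp_all add: algebra_simps)
    show "cr p = 0" unfolding cr_def e by simp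
    have "0 \<le> p $ 1 - g r $ 1" "0 \<le> g l $ 1 - p $ 1" unfolding e using \<theta> rl by simp_all
    then show "g r $ 1 \<le> p $ 1" "p $ 1 \<le> g l $ 1" by simp_all
  qed
  have diff: "cr y = (g l $ 1 - g r $ 1) * (y $ 2 - p $ 2)" if "p \<in> closed_segment (g r) (g l)" "p $ 1 = y $ 1" for y p
    using on(1)[OF that(1)] that(2) unfolding cr_def by (simp add: algebra_simps)
  consider "h s $ 1 < g r $ 1" | "g l $ 1 < h s $ 1" | "g r $ 1 \<le> h s $ 1" "h s $ 1 \<le> g l $ 1" by linarith
  then show ?thesis
  proof cases
    case 1
    from eventually_abscissa(2)[OF this] show ?thesis by eventually_elim (use on(2) in fastforce)
  next
    case 2
    from eventually_abscissa(1)[OF this] show ?thesis by eventually_elim (use on(3) in fastforce)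
  next
    case 3
    then obtain p where p: "p \<in> closed_segment (g r) (g l)" "p $ 1 = h s $ 1" by (rule abscissa_on_segment)
    have "p $ 2 \<le> h s $ 2" by (rule gap_chord_below[OF gap p(1) plateD(2,1) p(2)])
    moreover have "p $ 2 \<noteq> h s $ 2" using p off by (metis vec2_eq_iff)
    ultimately have "0 < cr (h s)" using diff[OF p] rl by simp
    moreover have "open {y. 0 < cr y}" unfolding cr_def by (intro open_Collect_less continuous_intros)
    ultimately have "\<forall>\<^sub>F y in nhds (h s). 0 < cr y" unfolding eventually_nhds by blast
    then show ?thesis
    proof eventually_elim
      case (elim y)
      then show ?case using diff rl by (fastforce simp: zero_less_mult_iff)
    qed
  qed
qed

lemma thick_plate:
  assumes s: "\<And>a. left_end A = ereal a \<Longrightarrow> tangency_param G \<epsilon> d1 a < s"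
      "\<And>c. right_end A = ereal c \<Longrightarrow> s < tangency_param G \<epsilon> d2 c"
    and off: "\<And>r l. is_gap A r l \<Longrightarrow> h s \<notin> closed_segment (g r) (g l)"
  shows "thick S s"
proof -
  have "\<forall>\<^sub>F y in nhds (h s). \<forall>a. left_end A = ereal a \<longrightarrow>
      h (tangency_param G \<epsilon> d1 a) $ 1 < y $ 1 \<and> (d1 = Right \<longrightarrow> free.height (sR a) y > 0)"
  proof (cases rule: left_end_cases)
    case (2 a)
    have "\<forall>\<^sub>F y in nhds (h s). d1 = Right \<longrightarrow> free.height (sR a) y > 0"
      using s(1)[OF 2] by (cases d1) (auto intro!: eventually_height_pos free.height_pos simp: tangency_param_eq)
    moreover have "\<forall>\<^sub>F y in nhds (h s). h (tangency_param G \<epsilon> d1 a) $ 1 < y $ 1"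
      using s(1)[OF 2] by (intro eventually_abscissa) simp
    ultimately show ?thesis by eventually_elim (simp add: 2)
  qed simp
  moreover have "\<forall>\<^sub>F y in nhds (h s). \<forall>c. right_end A = ereal c \<longrightarrow>
      y $ 1 < h (tangency_param G \<epsilon> d2 c) $ 1 \<and> (d2 = Left \<longrightarrow> free.height (sL c) y > 0)"
  proof (cases rule: right_end_cases)
    case (2 c)
    have "\<forall>\<^sub>F y in nhds (h s). d2 = Left \<longrightarrow> free.height (sL c) y > 0"
      using s(2)[OF 2] by (cases d2) (auto intro!: eventually_height_pos free.height_pos simp: tangency_param_eq)
    moreover have "\<forall>\<^sub>F y in nhds (h s). y $ 1 < h (tangency_param G \<epsilon> d2 c) $ 1"
      using s(2)[OF 2] by (intro eventually_abscissa) simp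
    ultimately show ?thesis by eventually_elim (simp add: 2)
  qed simp
  moreover have "\<forall>\<^sub>F y in nhds (h s). \<forall>rl\<in>{(r, l). is_gap A r l}.
      \<forall>p\<in>closed_segment (g (fst rl)) (g (snd rl)). p $ 1 = y $ 1 \<longrightarrow> p $ 2 \<le> y $ 2"
  proof (rule eventually_ball_finite[OF finite_gaps[OF sorted_gaps]], rule ballI)
    fix rl assume "rl \<in> {(r, l). is_gap A r l}"
    then have gap: "is_gap A (fst rl) (snd rl)" by (simp add: case_prod_unfold)
    show "\<forall>\<^sub>F y in nhds (h s). \<forall>p\<in>closed_segment (g (fst rl)) (g (snd rl)). p $ 1 = y $ 1 \<longrightarrow> p $ 2 \<le> y $ 2"
      by (rule eventually_above_gap[OF gap off[OF gap]])
  qed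
  ultimately show ?thesis
    unfolding thick_def
  proof eventually_elim
    case (elim y)
    show ?case
    proof
      assume y: "y \<in> Omega G \<epsilon>"
      then obtain s' where s': "h s' $ 1 = y $ 1" using in_OmegaE by metis
      show "y \<in> S"
      proof (rule in_plate_under_arc[OF y _ _ s'])
        show "arc_from d1 A s'" "arc_to d2 A s'"
          using elim(1,2)[folded s'] by (auto simp: arc_from_def arc_to_def less_imp_le)
        show "p $ 2 \<le> y $ 2" if "is_gap A r l" "p \<in> closed_segment (g r) (g l)" "p $ 1 = y $ 1" for p r l
          using elim(3) that by auto
      qed (use elim(1,2) in \<open>auto intro: less_imp_le\<close>)
    qed
  qed
qed

text \<open>A chord in the strip touching the free boundary is tangent to it, so its left end determines the point where it
  touches.\<close>

lemma touched_only_finitely_often: "finite {s. \<exists>r l. is_gap A r l \<and> h s \<in> closed_segment (g r) (g l)}"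
proof (rule finite_subset)
  show "{s. \<exists>r l. is_gap A r l \<and> h s \<in> closed_segment (g r) (g l)} \<subseteq> (\<lambda>(r, l). sL r) ` {(r, l). is_gap A r l}"
  proof clarify
    fix s r l assume gap: "is_gap A r l" and hs: "h s \<in> closed_segment (g r) (g l)"
    note facts = is_gap_facts[OF sorted_gaps gap]
    have "r = tm s"
      by (rule chord_touching_free_boundary(1)[OF subset_trans[OF facts(5) plateD(2)] less_imp_le[OF facts(1)] hs])
    then show "s \<in> (\<lambda>(r, l). sL r) ` {(r, l). is_gap A r l}" using gap by (intro image_eqI[of _ _ "(r, l)"]) auto
  qed
qed (intro finite_imageI finite_gaps[OF sorted_gaps])

lemma eventually_off_finite: "finite X \<Longrightarrow> \<forall>\<^sub>F s in at (s0::real) within T. s \<notin> X"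
proof -
  assume X: "finite X"
  have "open (- (X - {s0}))" using X by (intro open_Compl finite_imp_closed) simp
  then show ?thesis unfolding eventually_at_topological by (intro exI[of _ "- (X - {s0})"]) auto
qed

lemma plate_thick_on_right:
  assumes s0: "\<And>a. left_end A = ereal a \<Longrightarrow> tangency_param G \<epsilon> d1 a \<le> s0"
      "\<And>c. right_end A = ereal c \<Longrightarrow> s0 < tangency_param G \<epsilon> d2 c"
  shows "\<forall>\<^sub>F s in at_right s0. thick S s"
proof -
  obtain b where b: "s0 < b" "\<And>c. right_end A = ereal c \<Longrightarrow> b \<le> tangency_param G \<epsilon> d2 c"
  proof (cases rule: right_end_cases)
    case 1
    then show ?thesis using that[of "s0 + 1"] by simp
  next
    case (2 c)
    then show ?thesis using that[of "tangency_param G \<epsilon> d2 c"] s0(2) by simp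
  qed
  from eventually_at_right_real[OF b(1)] eventually_off_finite[OF touched_only_finitely_often, of s0 "{s0<..}"]
  show ?thesis
  proof eventually_elim
    case (elim s)
    show ?case
    proof (rule thick_plate)
      show "tangency_param G \<epsilon> d1 a < s" if "left_end A = ereal a" for a using s0(1)[OF that] elim by simp
      show "s < tangency_param G \<epsilon> d2 c" if "right_end A = ereal c" for c using b(2)[OF that] elim by simp
    qed (use elim in blast)
  qed
qed

lemma plate_thick_on_left:
  assumes s0: "\<And>a. left_end A = ereal a \<Longrightarrow> tangency_param G \<epsilon> d1 a < s0"
      "\<And>c. right_end A = ereal c \<Longrightarrow> s0 \<le> tangency_param G \<epsilon> d2 c"
  shows "\<forall>\<^sub>F s in at_left s0. thick S s"
proof -
  obtain b where b: "b < s0" "\<And>a. left_end A = ereal a \<Longrightarrow> tangency_param G \<epsilon> d1 a \<le> b"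
  proof (cases rule: left_end_cases)
    case 1
    then show ?thesis using that[of "s0 - 1"] by simp
  next
    case (2 a)
    then show ?thesis using that[of "tangency_param G \<epsilon> d1 a"] s0(1) by simp
  qed
  from eventually_at_left_real[OF b(1)] eventually_off_finite[OF touched_only_finitely_often, of s0 "{..<s0}"]
  show ?thesis
  proof eventually_elim
    case (elim s)
    show ?case
    proof (rule thick_plate)
      show "tangency_param G \<epsilon> d1 a < s" if "left_end A = ereal a" for a using b(2)[OF that] elim by simp
      show "s < tangency_param G \<epsilon> d2 c" if "right_end A = ereal c" for c using s0(2)[OF that] elim by simp
    qed (use elim in blast)
  qed
qed

end


section \<open>Figures at a point of the free boundary\<close>

definition is_plate :: "figure \<Rightarrow> side \<Rightarrow> side \<Rightarrow> intervals \<Rightarrow> bool" where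
  "is_plate F d1 d2 A \<longleftrightarrow> F = Tangent_Multi d1 d2 A \<or>
     (\<exists>u. F = Angle u \<and> d1 = Right \<and> d2 = Left \<and> A = [(ereal u, ereal u)])"

lemma wf_imp_sorted: "wf_intervals A \<Longrightarrow> sorted_intervals A"
  unfolding wf_intervals_def sorted_intervals_def by simp

lemma wf_ends_less:
  assumes wf: "wf_intervals A"
  shows "left_end A < right_end A"
proof -
  note A = wf_imp_sorted[OF wf]
  have ne: "A \<noteq> []" using wf by (simp add: wf_intervals_def)
  then have ends: "left_end A = fst (A ! 0)" "right_end A = snd (A ! (length A - 1))"
    unfolding left_end_def right_end_def by (simp_all add: hd_conv_nth last_conv_nth)
  show ?thesis
  proof (cases "length A \<ge> 2")
    case True
    have "fst (A ! 0) \<le> snd (A ! 0)" using sorted_intervals_nth(1)[OF A] ne by simp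
    also have "\<dots> < fst (A ! (length A - 1))" using sorted_intervals_less[OF A, of 0 "length A - 1"] True by simp
    also have "\<dots> \<le> snd (A ! (length A - 1))" using sorted_intervals_nth(1)[OF A] ne by simp
    finally show ?thesis unfolding ends .
  next
    case False
    moreover have "0 < length A" using ne by simp
    ultimately have "length A = 1" by linarith
    then have "fst (A ! 0) < snd (A ! 0)" using wf hd_conv_nth[OF ne] by (simp add: wf_intervals_def)
    then show ?thesis unfolding ends using \<open>length A = 1\<close> by simp
  qed
qed

lemma angle_region: "region G \<epsilon> (Angle u) = region G \<epsilon> (Tangent_Multi Right Left [(ereal u, ereal u)])"
proof -
  have seg: "ereal_interval (ereal u) (ereal u) = {u}" by (auto simp: ereal_interval_def)
  have "multi_lower G \<epsilon> Right Left [(ereal u, ereal u)] = tangent_segment G \<epsilon> Right u \<union> tangent_segment G \<epsilon> Left u"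
    by (auto simp: multi_lower_def base_curve_def gap_chords_def left_end_def right_end_def seg tangent_segment_eq)
  moreover have "multi_upper G \<epsilon> Right Left [(ereal u, ereal u)]
      = G \<epsilon> ` {tangency_param G \<epsilon> Right u..tangency_param G \<epsilon> Left u}"
    by (auto simp: multi_upper_def left_end_def right_end_def)
  ultimately show ?thesis by (simp add: curv_triangle_def)
qed

lemma plate_if_valid:
  assumes F: "is_plate F d1 d2 A" and valid: "valid_figure G \<epsilon> f F" and cand: "standard_candidate G \<epsilon> f F B"
  shows "plate d1 d2 A" "region G \<epsilon> F = region G \<epsilon> (Tangent_Multi d1 d2 A)"
    "\<exists>k n. (\<forall>x\<in>region G \<epsilon> (Tangent_Multi d1 d2 A). B x = k + n \<bullet> x) \<and>
       (\<forall>a. g a \<in> region G \<epsilon> (Tangent_Multi d1 d2 A) \<longrightarrow> B (g a) = f a)"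
proof -
  have sets: "plate d1 d2 A \<and> region G \<epsilon> F = region G \<epsilon> (Tangent_Multi d1 d2 A)"
    using F unfolding is_plate_def
  proof (elim disjE exE conjE)
    assume "F = Tangent_Multi d1 d2 A"
    then show ?thesis using valid wf_imp_sorted by (auto simp: plate_def)
  next
    fix u assume u: "F = Angle u" "d1 = Right" "d2 = Left" "A = [(ereal u, ereal u)]"
    have "plate d1 d2 A"
      using sR_less_sL[of u] unfolding plate_def u
      by (auto simp: sorted_intervals_def gap_chords_def left_end_def right_end_def tangency_param_eq)
    then show ?thesis using angle_region u by simp
  qed
  then show "plate d1 d2 A" "region G \<epsilon> F = region G \<epsilon> (Tangent_Multi d1 d2 A)" by simp_all
  have "affine_candidate g f (region G \<epsilon> F) B"
    using F cand unfolding is_plate_def by (elim disjE exE conjE) simp_all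
  then show "\<exists>k n. (\<forall>x\<in>region G \<epsilon> (Tangent_Multi d1 d2 A). B x = k + n \<bullet> x) \<and>
       (\<forall>a. g a \<in> region G \<epsilon> (Tangent_Multi d1 d2 A) \<longrightarrow> B (g a) = f a)"
    using sets unfolding affine_candidate_def by metis
qed

lemma plate_arc_nondegenerate:
  assumes F: "is_plate F d1 d2 A" and valid: "valid_figure G \<epsilon> f F" and ends: "left_end A = ereal a" "right_end A = ereal c"
    and d: "d1 = Right \<or> d2 = Left"
  shows "tangency_param G \<epsilon> d1 a < tangency_param G \<epsilon> d2 c"
proof -
  have "a < c \<or> (a = c \<and> d1 = Right \<and> d2 = Left)"
    using F unfolding is_plate_def
  proof (elim disjE exE conjE)
    assume "F = Tangent_Multi d1 d2 A"
    then have "wf_intervals A" using valid by simp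
    then show ?thesis using wf_ends_less ends by fastforce
  next
    fix u assume "A = [(ereal u, ereal u)]" "d1 = Right" "d2 = Left"
    then show ?thesis using ends by (simp add: left_end_def right_end_def)
  qed
  then show ?thesis
  proof
    assume "a < c"
    then have *: "sR a < sR c" "sL a < sL c" by simp_all
    have "sR a < sL c" using *(1) sR_less_sL by (rule order_less_trans)
    then show ?thesis using d * by (cases d1; cases d2) (simp_all add: tangency_param_eq)
  next
    assume "a = c \<and> d1 = Right \<and> d2 = Left"
    then show ?thesis using sR_less_sL by (simp add: tangency_param_eq)
  qed
qed

lemma right_fan_thick_on_right:
  assumes "u1 \<le> ereal (tp s0)" "ereal (tp s0) < u2"
  shows "\<forall>\<^sub>F s in at_right s0. thick (region G \<epsilon> (Tangents Right u1 u2)) s"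
proof -
  obtain t where t: "tp s0 < t" "ereal t < u2" using ereal_dense2[OF assms(2)] by auto
  have "sR (tp s0) < sR t" using t(1) by (simp only: sR_less_iff)
  then have "s0 < sR t" by simp
  from eventually_at_right_real[OF this] show ?thesis
  proof eventually_elim
    case (elim s)
    then have "tp s0 < tp s" "tp s < tp (sR t)" unfolding tp_less_iff by simp_all
    then have "ereal (tp s0) < ereal (tp s)" "ereal (tp s) < ereal t" by simp_all
    then show ?case using thick_right_fan[OF order_le_less_trans[OF assms(1)] order_less_trans[OF _ t(2)]] by simp
  qed
qed

lemma right_fan_thick_on_left:
  assumes "u1 < ereal (tp s0)" "ereal (tp s0) \<le> u2"
  shows "\<forall>\<^sub>F s in at_left s0. thick (region G \<epsilon> (Tangents Right u1 u2)) s"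
proof -
  obtain t where t: "u1 < ereal t" "t < tp s0" using ereal_dense2[OF assms(1)] by auto
  have "sR t < sR (tp s0)" using t(2) by (simp only: sR_less_iff)
  then have "sR t < s0" by simp
  from eventually_at_left_real[OF this] show ?thesis
  proof eventually_elim
    case (elim s)
    then have "tp s < tp s0" "tp (sR t) < tp s" unfolding tp_less_iff by simp_all
    then have "ereal (tp s) < ereal (tp s0)" "ereal t < ereal (tp s)" by simp_all
    then show ?case using thick_right_fan[OF order_less_trans[OF t(1)] order_less_le_trans[OF _ assms(2)]] by simp
  qed
qed

lemma left_fan_thick_on_right:
  assumes "u1 \<le> ereal (tm s0)" "ereal (tm s0) < u2"
  shows "\<forall>\<^sub>F s in at_right s0. thick (region G \<epsilon> (Tangents Left u1 u2)) s"
proof -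
  obtain t where t: "tm s0 < t" "ereal t < u2" using ereal_dense2[OF assms(2)] by auto
  have "sL (tm s0) < sL t" using t(1) by (simp only: sL_less_iff)
  then have "s0 < sL t" by simp
  from eventually_at_right_real[OF this] show ?thesis
  proof eventually_elim
    case (elim s)
    then have "tm s0 < tm s" "tm s < tm (sL t)" unfolding tm_less_iff by simp_all
    then have "ereal (tm s0) < ereal (tm s)" "ereal (tm s) < ereal t" by simp_all
    then show ?case using thick_left_fan[OF order_le_less_trans[OF assms(1)] order_less_trans[OF _ t(2)]] by simp
  qed
qed

lemma left_fan_thick_on_left:
  assumes "u1 < ereal (tm s0)" "ereal (tm s0) \<le> u2"
  shows "\<forall>\<^sub>F s in at_left s0. thick (region G \<epsilon> (Tangents Left u1 u2)) s"
proof -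
  obtain t where t: "u1 < ereal t" "t < tm s0" using ereal_dense2[OF assms(1)] by auto
  have "sL t < sL (tm s0)" using t(2) by (simp only: sL_less_iff)
  then have "sL t < s0" by simp
  from eventually_at_left_real[OF this] show ?thesis
  proof eventually_elim
    case (elim s)
    then have "tm s < tm s0" "tm (sL t) < tm s" unfolding tm_less_iff by simp_all
    then have "ereal (tm s) < ereal (tm s0)" "ereal t < ereal (tm s)" by simp_all
    then show ?case using thick_left_fan[OF order_less_trans[OF t(1)] order_less_le_trans[OF _ assms(2)]] by simp
  qed
qed

subsection \<open>Figures consisting of chords\<close>

text \<open>The long chord tangent to the free boundary at \<open>s\<close> joins \<open>g (tm s)\<close> and \<open>g (tp s)\<close>.\<close>

definition linear_at :: "(real^2 \<Rightarrow> real) \<Rightarrow> real \<Rightarrow> bool" where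
  "linear_at B s \<longleftrightarrow> (\<exists>\<theta>. 0 \<le> \<theta> \<and> \<theta> \<le> 1 \<and> h s = (1 - \<theta>) *\<^sub>R g (tm s) + \<theta> *\<^sub>R g (tp s) \<and>
     B (h s) = (1 - \<theta>) * f (tm s) + \<theta> * f (tp s))"

lemma linear_at_delivers:
  assumes "linear_at B s"
  shows "left_opt f s (h s) (B (h s))" "right_opt f s (h s) (B (h s))"
proof -
  obtain \<theta> where \<theta>: "0 \<le> \<theta>" "\<theta> \<le> 1" "h s = (1 - \<theta>) *\<^sub>R g (tm s) + \<theta> *\<^sub>R g (tp s)"
     "B (h s) = (1 - \<theta>) * f (tm s) + \<theta> * f (tp s)" using assms unfolding linear_at_def by blast
  have chord: "chord_in_strip (tm s) (tp s)" unfolding chord_in_strip_def by (intro exI[of _ s]) simp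
  have le: "tm s \<le> tp s" using tm_less_tp by (rule less_imp_le)
  show "left_opt f s (h s) (B (h s))"
    using left_opt_chord[OF chord le _ \<theta>(1,2), of s f] unfolding \<theta>(4) by (simp flip: \<theta>(3))
  have "right_opt f s ((1 - (1 - \<theta>)) *\<^sub>R g (tp s) + (1 - \<theta>) *\<^sub>R g (tm s)) ((1 - (1 - \<theta>)) * f (tp s) + (1 - \<theta>) * f (tm s))"
    using \<theta>(1,2) by (intro right_opt_chord[OF chord le]) simp_all
  moreover have "(1 - (1 - \<theta>)) *\<^sub>R g (tp s) + (1 - \<theta>) *\<^sub>R g (tm s) = h s" unfolding \<theta>(3) by simp
  moreover have "(1 - (1 - \<theta>)) * f (tp s) + (1 - \<theta>) * f (tm s) = B (h s)" unfolding \<theta>(4) by simp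
  ultimately show "right_opt f s (h s) (B (h s))" by simp
qed

lemma near_closed_set:
  fixes R :: "(real^2) set"
  assumes R: "closed R" and near: "\<And>\<eta>. \<eta> > 0 \<Longrightarrow> \<exists>q\<in>R. q $ 1 = y $ 1 \<and> \<bar>q $ 2 - y $ 2\<bar> < \<eta>"
  shows "y \<in> R"
proof (rule ccontr)
  assume "y \<notin> R"
  then have "y \<in> - R" "open (- R)" using R by (auto simp: open_Compl)
  then obtain e where e: "e > 0" "ball y e \<subseteq> - R" unfolding open_contains_ball by blast
  obtain q where q: "q \<in> R" "q $ 1 = y $ 1" "\<bar>q $ 2 - y $ 2\<bar> < e" using near[OF e(1)] by blast
  have "q - y = axis 2 (q $ 2 - y $ 2)" using q(2) by (simp add: vec2_eq_iff)
  then have "dist y q = \<bar>q $ 2 - y $ 2\<bar>" by (simp add: dist_commute dist_norm norm_vec_def L2_set_def sum_2)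
  then have "q \<in> ball y e" using q(3) by simp
  then show False using e(2) q(1) by blast
qed

lemma chord_value_linear_at:
  assumes chord: "closed_segment (g a) (g c) \<subseteq> Omega G \<epsilon>" "a \<le> c" and \<theta>: "0 \<le> \<theta>" "\<theta> \<le> 1"
    and hs: "h s = (1 - \<theta>) *\<^sub>R g a + \<theta> *\<^sub>R g c" and B: "B (h s) = (1 - \<theta>) * f a + \<theta> * f c"
  shows "linear_at B s"
proof -
  have "h s \<in> closed_segment (g a) (g c)" using \<theta> hs by (auto simp: in_segment)
  from chord_touching_free_boundary[OF chord this] have "a = tm s" "c = tp s" .
  then show ?thesis unfolding linear_at_def using \<theta> hs B by (intro exI[of _ \<theta>]) simp
qed

text \<open>The figure is compact, hence contains \<open>h s\<close> itself, on a chord that must be tangent there.\<close>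

lemma chordal_hit:
  assumes valid: "valid_figure G \<epsilon> f (Chordal a0 b0 a1 b1 b)" and B: "chordal_candidate g f a0 a1 b B"
    and hit: "hit (region G \<epsilon> (Chordal a0 b0 a1 b1 b)) s"
  shows "linear_at B s"
proof -
  let ?R = "region G \<epsilon> (Chordal a0 b0 a1 b1 b)"
  have b: "continuous_on {a0..a1} b" using valid by simp
  have R: "?R = (\<lambda>x. (1 - snd x) *\<^sub>R g (fst x) + snd x *\<^sub>R g (b (fst x))) ` ({a0..a1} \<times> {0..1})"
    by (force simp: in_segment image_iff)
  have gc: "continuous_on UNIV g" by (rule fixed.cont_c)
  have "continuous_on ({a0..a1} \<times> {0..1::real}) (\<lambda>x. g (fst x))"
    by (rule continuous_on_compose2[OF gc]) (auto intro: continuous_intros)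
  moreover have "continuous_on ({a0..a1} \<times> {0..1::real}) (\<lambda>x. b (fst x))"
    by (rule continuous_on_compose2[OF b]) (auto intro: continuous_intros)
  then have "continuous_on ({a0..a1} \<times> {0..1::real}) (\<lambda>x. g (b (fst x)))"
    by (rule continuous_on_compose2[OF gc]) auto
  ultimately have "compact ?R"
    unfolding R by (intro compact_continuous_image continuous_intros compact_Times) auto
  then have "closed ?R" by (rule compact_imp_closed)
  then have "h s \<in> ?R"
  proof (rule near_closed_set)
    fix \<eta> :: real assume "\<eta> > 0"
    then obtain \<delta> where "0 < \<delta>" "\<delta> < \<eta>" "h s - axis 2 \<delta> \<in> ?R" using hit unfolding hit_def by blast
    then show "\<exists>q\<in>?R. q $ 1 = h s $ 1 \<and> \<bar>q $ 2 - h s $ 2\<bar> < \<eta>"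
      by (intro bexI[of _ "h s - axis 2 \<delta>"]) simp_all
  qed
  then obtain a \<theta> where a: "a \<in> {a0..a1}" and \<theta>: "0 \<le> \<theta>" "\<theta> \<le> 1" "h s = (1 - \<theta>) *\<^sub>R g a + \<theta> *\<^sub>R g (b a)"
    by (auto simp: in_segment)
  have "a \<le> b a"
  proof (cases "a = a1")
    case False
    then have "b a1 < b a" using valid a by (auto intro!: monotone_onD[of "{a0..a1}" "(<)" "(>)" b a a1])
    then show ?thesis using valid a by simp
  qed (use valid in simp)
  moreover have "closed_segment (g a) (g (b a)) \<subseteq> Omega G \<epsilon>" using valid a by simp
  moreover have "B (h s) = (1 - \<theta>) * f a + \<theta> * f (b a)"
    using B a \<theta>(1,2) unfolding chordal_candidate_def \<theta>(3) by simp
  ultimately show ?thesis using chord_value_linear_at[of a "b a" \<theta> s B] \<theta> by blast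
qed

lemma chordal_opt:
  assumes valid: "valid_figure G \<epsilon> f (Chordal a0 b0 a1 b1 b)" and B: "chordal_candidate g f a0 a1 b B"
    and x: "x \<in> region G \<epsilon> (Chordal a0 b0 a1 b1 b)"
  shows "\<exists>\<alpha> T. opt f \<alpha> T x (B x)"
proof -
  obtain a \<theta> where a: "a \<in> {a0..a1}" and \<theta>: "0 \<le> \<theta>" "\<theta> \<le> 1" "x = (1 - \<theta>) *\<^sub>R g a + \<theta> *\<^sub>R g (b a)"
    using x by (auto simp: in_segment)
  have chord: "closed_segment (g a) (g (b a)) \<subseteq> Omega G \<epsilon>" using valid a by simp
  have "chord_in_strip a (b a)"
  proof (cases "a \<le> b a")
    case True
    then show ?thesis by (rule chord_in_strip_if_in_Omega[OF chord])
  next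
    case False
    then have "chord_in_strip (b a) a"
      using chord by (intro chord_in_strip_if_in_Omega) (simp_all add: closed_segment_commute)
    then show ?thesis unfolding chord_in_strip_def by blast
  qed
  then obtain s where "free.height s (g a) \<le> 0" "free.height s (g (b a)) \<le> 0" unfolding chord_in_strip_def by blast
  then have "flat_opt f s x ((1 - \<theta>) * f a + \<theta> * f (b a))"
    unfolding \<theta>(3) by (intro flat_opt_combine flat_opt_const \<theta>(1,2))
  moreover have "B x = (1 - \<theta>) * f a + \<theta> * f (b a)"
    using B a \<theta>(1,2) unfolding chordal_candidate_def \<theta>(3) by simp
  ultimately show ?thesis using flat_opt_imp_opt by metis
qed

context
  fixes A :: intervals and a c :: real
  assumes wf: "wf_intervals A" and ends: "left_end A = ereal a" "right_end A = ereal c"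
    and gaps: "gap_chords g A \<subseteq> Omega G \<epsilon>" and closing: "closing_chord g A \<subseteq> Omega G \<epsilon>"
begin

lemma closing_chord_eq: "closing_chord g A = closed_segment (g a) (g c)"
  by (simp add: closing_chord_def ends)

lemma cup_ends_less: "a < c"
  using wf_ends_less[OF wf] ends by simp

lemmas cup_gaps = wf_imp_sorted[OF wf] gaps

lemma in_cupI: "p \<in> base_curve g A \<Longrightarrow> q \<in> closed_segment (g a) (g c) \<Longrightarrow> p $ 1 = x $ 1 \<Longrightarrow> q $ 1 = x $ 1
    \<Longrightarrow> p $ 2 \<le> x $ 2 \<Longrightarrow> x $ 2 \<le> q $ 2 \<Longrightarrow> x \<in> region G \<epsilon> (Closed_Multicup A)"
  unfolding region.simps between_graphs_def closing_chord_eq by blast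

lemma in_cupE:
  assumes "x \<in> region G \<epsilon> (Closed_Multicup A)"
  obtains p q where "p \<in> base_curve g A" "q \<in> closed_segment (g a) (g c)" "p $ 1 = x $ 1" "q $ 1 = x $ 1"
    "p $ 2 \<le> x $ 2" "x $ 2 \<le> q $ 2"
  using assms unfolding region.simps between_graphs_def closing_chord_eq by blast

lemma in_ends: "b \<in> params_of A \<Longrightarrow> a \<le> b \<and> b \<le> c"
  using ends_bound[OF cup_gaps] ends by fastforce

lemma base_in_cup:
  assumes b: "b \<in> params_of A"
  shows "g b \<in> region G \<epsilon> (Closed_Multicup A)"
proof -
  have "g a $ 1 \<le> g b $ 1" "g b $ 1 \<le> g c $ 1" using in_ends[OF b] by simp_all
  then obtain q where q: "q \<in> closed_segment (g a) (g c)" "q $ 1 = g b $ 1" by (rule abscissa_on_segment)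
  have "0 \<le> fixed.height b q" using q(1) fixed.height_nonneg by (auto simp: in_segment fixed.height_affine)
  then have "g b $ 2 \<le> q $ 2" using q(2) by (simp add: fixed.height_at_same_abscissa)
  moreover have "g b \<in> base_curve g A" using b unfolding base_curve_iff[OF cup_gaps] by (intro disjI1 bexI[of _ b]) simp_all
  ultimately show ?thesis using in_cupI[OF _ q(1) refl q(2) order_refl] by blast
qed

lemma cup_below_tangent:
  assumes b: "b \<in> params_of A"
  shows "free.height (sL a) (g b) \<le> 0"
proof -
  have "free.height (sL a) (g c) \<le> 0"
    using chord_below_left_tangent[of a c] closing cup_ends_less by (simp add: closing_chord_eq)
  then show ?thesis using in_ends[OF b] by (simp add: height_le_0_between)
qed

context
  fixes B :: "real^2 \<Rightarrow> real" and k :: real and n :: "real^2"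
  assumes affine: "\<And>x. x \<in> region G \<epsilon> (Closed_Multicup A) \<Longrightarrow> B x = k + n \<bullet> x"
    and boundary: "\<And>a. g a \<in> region G \<epsilon> (Closed_Multicup A) \<Longrightarrow> B (g a) = f a"
begin

lemma affine_on_cup_base: "b \<in> params_of A \<Longrightarrow> f b = k + n \<bullet> g b"
  using affine boundary base_in_cup by metis

text \<open>All points of a closed multicup are mixtures of points of the base curve below one common
  tangent line, which can be taken in any order.\<close>

lemma cup_opt:
  assumes x: "x \<in> region G \<epsilon> (Closed_Multicup A)"
  shows "\<exists>\<alpha> T. opt f \<alpha> T x (B x)"
proof -
  obtain p q where pq: "p \<in> base_curve g A" "q \<in> closed_segment (g a) (g c)" "p $ 1 = x $ 1" "q $ 1 = x $ 1"
    "p $ 2 \<le> x $ 2" "x $ 2 \<le> q $ 2" by (rule in_cupE[OF x])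
  have pts: "flat_opt f (sL a) (g b) (k + n \<bullet> g b)" if "b \<in> params_of A" for b
    using flat_opt_const[OF cup_below_tangent[OF that], of f] affine_on_cup_base[OF that] by simp
  have comb: "flat_opt f (sL a) ((1 - \<theta>) *\<^sub>R y + \<theta> *\<^sub>R z) (k + n \<bullet> ((1 - \<theta>) *\<^sub>R y + \<theta> *\<^sub>R z))"
    if "flat_opt f (sL a) y (k + n \<bullet> y)" "flat_opt f (sL a) z (k + n \<bullet> z)" "0 \<le> \<theta>" "\<theta> \<le> 1" for y z \<theta>
    using flat_opt_combine[OF that] unfolding affine_combination .
  obtain b b' \<theta> where b: "b \<in> params_of A" "b' \<in> params_of A" "0 \<le> \<theta>" "\<theta> \<le> 1" "p = (1 - \<theta>) *\<^sub>R g b + \<theta> *\<^sub>R g b'"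
    using base_curve_on_base[OF cup_gaps pq(1)] unfolding on_base_def by blast
  have p: "flat_opt f (sL a) p (k + n \<bullet> p)" unfolding b(5) by (intro comb pts b)
  obtain \<mu> where \<mu>: "0 \<le> \<mu>" "\<mu> \<le> 1" "q = (1 - \<mu>) *\<^sub>R g a + \<mu> *\<^sub>R g c" using pq(2) by (auto simp: in_segment)
  have q: "flat_opt f (sL a) q (k + n \<bullet> q)"
    unfolding \<mu>(3) by (intro comb pts \<mu> left_end_in[OF cup_gaps ends(1)] right_end_in[OF cup_gaps ends(2)])
  obtain \<nu> where \<nu>: "0 \<le> \<nu>" "\<nu> \<le> 1" "(1 - \<nu>) * q $ 2 + \<nu> * p $ 2 = x $ 2" using level_on_segment[OF pq(5,6)] .
  have "x = (1 - \<nu>) *\<^sub>R q + \<nu> *\<^sub>R p"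
    using \<nu>(3) pq(3,4) by (simp add: vec2_eq_iff algebra_simps)
  then have "flat_opt f (sL a) x (k + n \<bullet> x)" using comb[OF q p \<nu>(1,2)] by simp
  then show ?thesis using flat_opt_imp_opt affine[OF x] by metis
qed

lemma cup_hit:
  assumes hit: "hit (region G \<epsilon> (Closed_Multicup A)) s"
  shows "linear_at B s"
proof -
  have points: "\<exists>\<delta> p q. 0 < \<delta> \<and> \<delta> < \<eta> \<and> p \<in> base_curve g A \<and> q \<in> closed_segment (g a) (g c) \<and>
      p $ 1 = h s $ 1 \<and> q $ 1 = h s $ 1 \<and> p $ 2 < h s $ 2 \<and> h s $ 2 - \<delta> \<le> q $ 2" if "\<eta> > 0" for \<eta>
  proof -
    obtain \<delta> where \<delta>: "0 < \<delta>" "\<delta> < \<eta>" "h s - axis 2 \<delta> \<in> region G \<epsilon> (Closed_Multicup A)"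
      using hit \<open>\<eta> > 0\<close> unfolding hit_def by blast
    obtain p q where "p \<in> base_curve g A" "q \<in> closed_segment (g a) (g c)" "p $ 1 = h s $ 1" "q $ 1 = h s $ 1"
      "p $ 2 \<le> h s $ 2 - \<delta>" "h s $ 2 - \<delta> \<le> q $ 2" using in_cupE[OF \<delta>(3)] by auto
    then show ?thesis using \<delta> by (intro exI[of _ \<delta>] exI[of _ p] exI[of _ q]) auto
  qed
  have hs: "h s \<in> closed_segment (g a) (g c)"
  proof (rule near_closed_set[OF closed_segment])
    fix \<eta> :: real assume "\<eta> > 0"
    from points[OF this] obtain \<delta> q where q: "\<delta> < \<eta>" "q \<in> closed_segment (g a) (g c)" "q $ 1 = h s $ 1"
      "h s $ 2 - \<delta> \<le> q $ 2" by blast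
    have "q \<in> Omega G \<epsilon>" using q(2) closing closing_chord_eq by blast
    from in_OmegaE[OF this] obtain s' where s': "h s' $ 1 = q $ 1" "q $ 2 \<le> h s' $ 2" by metis
    have "s' = s" using trans[OF s'(1) q(3)] by simp
    then show "\<exists>q\<in>closed_segment (g a) (g c). q $ 1 = h s $ 1 \<and> \<bar>q $ 2 - h s $ 2\<bar> < \<eta>"
      using q s'(2) by (intro bexI[of _ q]) auto
  qed
  obtain p where p: "p \<in> base_curve g A" "p $ 1 = h s $ 1" "p $ 2 < h s $ 2" using points[of 1] by auto
  have in_cup: "h s \<in> region G \<epsilon> (Closed_Multicup A)"
    by (rule in_cupI[OF p(1) hs p(2) refl less_imp_le[OF p(3)] order_refl])
  obtain \<theta> where \<theta>: "0 \<le> \<theta>" "\<theta> \<le> 1" "h s = (1 - \<theta>) *\<^sub>R g a + \<theta> *\<^sub>R g c" using hs by (auto simp: in_segment)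
  show ?thesis
  proof (rule chord_value_linear_at[OF _ less_imp_le[OF cup_ends_less] \<theta>])
    show "closed_segment (g a) (g c) \<subseteq> Omega G \<epsilon>" using closing by (simp add: closing_chord_eq)
    show "B (h s) = (1 - \<theta>) * f a + \<theta> * f c"
      unfolding affine[OF in_cup] affine_on_cup_base[OF left_end_in[OF cup_gaps ends(1)]]
        affine_on_cup_base[OF right_end_in[OF cup_gaps ends(2)]] affine_combination \<theta>(3)[symmetric] ..
  qed
qed

end

end

lemma closed_cup:
  assumes valid: "valid_figure G \<epsilon> f (Closed_Multicup A)" and cand: "standard_candidate G \<epsilon> f (Closed_Multicup A) B"
  shows "hit (region G \<epsilon> (Closed_Multicup A)) s \<Longrightarrow> linear_at B s"
    "x \<in> region G \<epsilon> (Closed_Multicup A) \<Longrightarrow> \<exists>\<alpha> T. opt f \<alpha> T x (B x)"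
proof -
  have wf: "wf_intervals A" and fin: "left_end A \<noteq> -\<infinity>" "right_end A \<noteq> \<infinity>"
    and chords: "gap_chords g A \<subseteq> Omega G \<epsilon>" "closing_chord g A \<subseteq> Omega G \<epsilon>" using valid by simp_all
  have ends: "left_end A = ereal (real_of_ereal (left_end A))" "right_end A = ereal (real_of_ereal (right_end A))"
    using left_end_real[OF wf_imp_sorted[OF wf] chords(1) fin(1)] right_end_real[OF wf_imp_sorted[OF wf] chords(1) fin(2)]
    by simp_all
  obtain k n where kn: "\<forall>x\<in>region G \<epsilon> (Closed_Multicup A). B x = k + n \<bullet> x"
    "\<forall>a. g a \<in> region G \<epsilon> (Closed_Multicup A) \<longrightarrow> B (g a) = f a"
    using cand unfolding standard_candidate.simps affine_candidate_def by blast
  note facts = wf ends chords bspec[OF kn(1)] mp[OF spec[OF kn(2)]]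
  show "linear_at B s" if "hit (region G \<epsilon> (Closed_Multicup A)) s"
    using cup_hit[OF facts that] .
  show "\<exists>\<alpha> T. opt f \<alpha> T x (B x)" if "x \<in> region G \<epsilon> (Closed_Multicup A)"
    using cup_opt[OF facts that] .
qed

subsection \<open>The two sides of a point of the free boundary\<close>

text \<open>A figure hit at \<open>s\<close> fills the domain near the points of the free boundary to the right of \<open>s\<close>,
  unless it ends with the right tangent there or meets the free boundary along a tangent chord. In the exceptional
  cases it supplies an optimizer leaning to the left.\<close>

lemma hit_thick_on_right_or_delivering:
  assumes valid: "valid_figure G \<epsilon> f F" and cand: "standard_candidate G \<epsilon> f F B" and hit: "hit (region G \<epsilon> F) s"
  obtains "\<forall>\<^sub>F s' in at_right s. thick (region G \<epsilon> F) s'"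
    | u1 where "F = Tangents Right u1 (ereal (tp s))" "u1 < ereal (tp s)"
    | d1 A where "is_plate F d1 Right A" "right_end A = ereal (tp s)"
    | "linear_at B s"
proof -
  note alternatives = that
  have plates: thesis if F: "is_plate F d1 d2 A" for d1 d2 A
  proof -
    note plate = plate_if_valid[OF F valid cand]
    have h: "hit (region G \<epsilon> (Tangent_Multi d1 d2 A)) s" using hit plate(2) by simp
    show thesis
    proof (cases "\<exists>c. right_end A = ereal c \<and> tangency_param G \<epsilon> d2 c = s")
      case True
      then obtain c where c: "right_end A = ereal c" "tangency_param G \<epsilon> d2 c = s" by blast
      have "d2 \<noteq> Left" using plate_hit(2)[OF plate(1) h c(1)] c(2) by (auto simp: tangency_param_eq)
      then have d2: "d2 = Right" by (cases d2) simp_all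
      then have "sR c = s" using c(2) by (simp add: tangency_param_eq)
      then have "c = tp s" by auto
      then show thesis using alternatives(3) F c(1) d2 by simp
    next
      case False
      have "\<forall>\<^sub>F s' in at_right s. thick (region G \<epsilon> (Tangent_Multi d1 d2 A)) s'"
      proof (rule plate_thick_on_right[OF plate(1)])
        show "tangency_param G \<epsilon> d1 a \<le> s" if "left_end A = ereal a" for a
          using plate_hit(1)[OF plate(1) h that] by simp
        show "s < tangency_param G \<epsilon> d2 c" if "right_end A = ereal c" for c
          using plate_hit(2)[OF plate(1) h that] False that by (metis order_le_less)
      qed
      then show thesis using alternatives(1) plate(2) by simp
    qed
  qed
  show thesis
  proof (cases F)
    case (Tangents d u1 u2)
    show thesis
    proof (cases d)
      case Right
      then have F: "F = Tangents Right u1 u2" using Tangents by simp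
      note ends = right_fan_hit[OF hit[unfolded F]]
      show thesis
      proof (cases "u2 = ereal (tp s)")
        case True
        then show thesis using alternatives(2) F ends by simp
      next
        case False
        then have "ereal (tp s) < u2" using ends(2) by simp
        then show thesis using alternatives(1) right_fan_thick_on_right[OF less_imp_le[OF ends(1)]] F by simp
      qed
    next
      case Left
      then have F: "F = Tangents Left u1 u2" using Tangents by simp
      note ends = left_fan_hit[OF hit[unfolded F]]
      then show thesis using alternatives(1) left_fan_thick_on_right[OF ends] F by simp
    qed
  next
    case (Chordal a0 b0 a1 b1 b)
    have "chordal_candidate g f a0 a1 b B" using cand Chordal by simp
    from chordal_hit[OF valid[unfolded Chordal] this hit[unfolded Chordal]] show thesis by (rule alternatives(4))
  next
    case (Closed_Multicup A)
    from closed_cup(1)[OF valid[unfolded Closed_Multicup] cand[unfolded Closed_Multicup] hit[unfolded Closed_Multicup]]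
    show thesis by (rule alternatives(4))
  next
    case (Angle u)
    then show thesis by (intro plates[of Right Left "[(ereal u, ereal u)]"]) (simp add: is_plate_def)
  next
    case (Tangent_Multi d1 d2 A)
    then show thesis by (intro plates[of d1 d2 A]) (simp add: is_plate_def)
  qed
qed

lemma hit_thick_on_left_or_delivering:
  assumes valid: "valid_figure G \<epsilon> f F" and cand: "standard_candidate G \<epsilon> f F B" and hit: "hit (region G \<epsilon> F) s"
  obtains "\<forall>\<^sub>F s' in at_left s. thick (region G \<epsilon> F) s'"
    | u2 where "F = Tangents Left (ereal (tm s)) u2" "ereal (tm s) < u2"
    | d2 A where "is_plate F Left d2 A" "left_end A = ereal (tm s)"
    | "linear_at B s"
proof -
  note alternatives = that
  have plates: thesis if F: "is_plate F d1 d2 A" for d1 d2 A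
  proof -
    note plate = plate_if_valid[OF F valid cand]
    have h: "hit (region G \<epsilon> (Tangent_Multi d1 d2 A)) s" using hit plate(2) by simp
    show thesis
    proof (cases "\<exists>a. left_end A = ereal a \<and> tangency_param G \<epsilon> d1 a = s")
      case True
      then obtain a where a: "left_end A = ereal a" "tangency_param G \<epsilon> d1 a = s" by blast
      have "d1 \<noteq> Right" using plate_hit(1)[OF plate(1) h a(1)] a(2) by (auto simp: tangency_param_eq)
      then have d1: "d1 = Left" by (cases d1) simp_all
      then have "sL a = s" using a(2) by (simp add: tangency_param_eq)
      then have "a = tm s" by auto
      then show thesis using alternatives(3) F a(1) d1 by simp
    next
      case False
      have "\<forall>\<^sub>F s' in at_left s. thick (region G \<epsilon> (Tangent_Multi d1 d2 A)) s'"
      proof (rule plate_thick_on_left[OF plate(1)])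
        show "tangency_param G \<epsilon> d1 a < s" if "left_end A = ereal a" for a
          using plate_hit(1)[OF plate(1) h that] False that by (metis order_le_less)
        show "s \<le> tangency_param G \<epsilon> d2 c" if "right_end A = ereal c" for c
          using plate_hit(2)[OF plate(1) h that] by simp
      qed
      then show thesis using alternatives(1) plate(2) by simp
    qed
  qed
  show thesis
  proof (cases F)
    case (Tangents d u1 u2)
    show thesis
    proof (cases d)
      case Right
      then have F: "F = Tangents Right u1 u2" using Tangents by simp
      note ends = right_fan_hit[OF hit[unfolded F]]
      then show thesis using alternatives(1) right_fan_thick_on_left[OF ends] F by simp
    next
      case Left
      then have F: "F = Tangents Left u1 u2" using Tangents by simp
      note ends = left_fan_hit[OF hit[unfolded F]]
      show thesis
      proof (cases "u1 = ereal (tm s)")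
        case True
        then show thesis using alternatives(2) F ends by simp
      next
        case False
        then have "u1 < ereal (tm s)" using ends(1) by simp
        then show thesis using alternatives(1) left_fan_thick_on_left[OF _ less_imp_le[OF ends(2)]] F by simp
      qed
    qed
  next
    case (Chordal a0 b0 a1 b1 b)
    have "chordal_candidate g f a0 a1 b B" using cand Chordal by simp
    from chordal_hit[OF valid[unfolded Chordal] this hit[unfolded Chordal]] show thesis by (rule alternatives(4))
  next
    case (Closed_Multicup A)
    from closed_cup(1)[OF valid[unfolded Closed_Multicup] cand[unfolded Closed_Multicup] hit[unfolded Closed_Multicup]]
    show thesis by (rule alternatives(4))
  next
    case (Angle u)
    then show thesis by (intro plates[of Right Left "[(ereal u, ereal u)]"]) (simp add: is_plate_def)
  next
    case (Tangent_Multi d1 d2 A)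
    then show thesis by (intro plates[of d1 d2 A]) (simp add: is_plate_def)
  qed
qed

lemma tangents_region: "region G \<epsilon> (Tangents Right u1 u2) = (\<Union>t\<in>ereal_interval u1 u2. closed_segment (wR t) (g t))"
    "region G \<epsilon> (Tangents Left u1 u2) = (\<Union>t\<in>ereal_interval u1 u2. closed_segment (g t) (wL t))"
  by (simp_all add: tangent_segment_eq)

text \<open>Standard candidates are conditions on the values in the figure.\<close>

lemma standard_candidate_cong:
  assumes "standard_candidate G \<epsilon> f F b" and eq: "\<And>x. x \<in> region G \<epsilon> F \<Longrightarrow> B x = b x"
  shows "standard_candidate G \<epsilon> f F B"
proof (cases F)
  case (Tangents d u1 u2)
  have "B x = b x" if "t \<in> ereal_interval u1 u2" "x \<in> tangent_segment G \<epsilon> d t" for t x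
    using eq[of x] that by (auto simp: Tangents)
  then have "tangents_candidate G \<epsilon> f d u1 u2 B = tangents_candidate G \<epsilon> f d u1 u2 b"
    unfolding tangents_candidate_def by (simp cong: ball_cong)
  then show ?thesis using assms(1) Tangents by simp
next
  case (Chordal a0 b0 a1 b1 c)
  have "B ((1 - s) *\<^sub>R g a + s *\<^sub>R g (c a)) = b ((1 - s) *\<^sub>R g a + s *\<^sub>R g (c a))"
    if "a \<in> {a0..a1}" "s \<in> {0..1}" for a s
    using that by (intro eq) (auto simp: Chordal in_segment)
  then show ?thesis using assms(1) by (simp add: Chordal chordal_candidate_def)
qed (use assms in \<open>simp_all add: affine_candidate_def\<close>)

section \<open>Optimizers for admissible foliations\<close>

text \<open>\<open>starts_at F u\<close>: the figure begins with the right tangent at \<open>u\<close>, and its optimizers continue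
  one for the point of tangency.\<close>

definition starts_at :: "figure \<Rightarrow> real \<Rightarrow> bool" where
  "starts_at F u \<longleftrightarrow> (\<exists>u2. F = Tangents Right (ereal u) u2) \<or> (\<exists>d2 A. is_plate F Right d2 A \<and> left_end A = ereal u)"

definition ends_at :: "figure \<Rightarrow> real \<Rightarrow> bool" where
  "ends_at F u \<longleftrightarrow> (\<exists>u1. F = Tangents Left u1 (ereal u)) \<or> (\<exists>d1 A. is_plate F d1 Left A \<and> right_end A = ereal u)"

lemma starts_at_unique: "starts_at F u \<Longrightarrow> starts_at F u' \<Longrightarrow> u = u'"
  by (cases F) (auto simp: starts_at_def is_plate_def left_end_def)

lemma ends_at_unique: "ends_at F u \<Longrightarrow> ends_at F u' \<Longrightarrow> u = u'"
  by (cases F) (auto simp: ends_at_def is_plate_def right_end_def)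

lemma finite_determined:
  assumes "finite X" and unique: "\<And>F u u'. P F u \<Longrightarrow> P F u' \<Longrightarrow> u = u'"
  shows "finite {u. \<exists>F\<in>X. P F u}"
proof (rule finite_subset)
  show "{u. \<exists>F\<in>X. P F u} \<subseteq> (\<lambda>F. THE u. P F u) ` X"
  proof
    fix u assume "u \<in> {u. \<exists>F\<in>X. P F u}"
    then obtain F where F: "F \<in> X" "P F u" by (elim CollectE bexE)
    have "(THE u. P F u) = u" using F(2) unique[OF _ F(2)] by (rule the_equality)
    then show "u \<in> (\<lambda>F. THE u. P F u) ` X" using F(1) by (intro image_eqI[of _ _ F]) simp_all
  qed
qed (use assms(1) in simp)

text \<open>A figure beginning with a right tangent has a cusp at its point of tangency and lies to the right of it.\<close>

lemma starting_figure:
  assumes valid: "valid_figure G \<epsilon> f F" and cand: "standard_candidate G \<epsilon> f F B" and F: "starts_at F u"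
  shows "\<not> hit (region G \<epsilon> F) (sR u)" "\<forall>\<^sub>F s in at_right (sR u). thick (region G \<epsilon> F) s"
proof -
  have "\<not> hit (region G \<epsilon> F) (sR u) \<and> (\<forall>\<^sub>F s in at_right (sR u). thick (region G \<epsilon> F) s)"
    using F unfolding starts_at_def
  proof (elim disjE exE conjE)
    fix u2 assume F: "F = Tangents Right (ereal u) u2"
    then have "ereal u < u2" using valid by simp
    then have "\<forall>\<^sub>F s in at_right (sR u). thick (region G \<epsilon> F) s"
      unfolding F by (intro right_fan_thick_on_right) simp_all
    moreover have "\<not> hit (region G \<epsilon> F) (sR u)"
      using right_fan_hit(1)[of "ereal u" u2 "sR u"] unfolding F by auto
    ultimately show ?thesis by blast
  next
    fix d2 A assume F: "is_plate F Right d2 A" and u: "left_end A = ereal u"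
    note plate = plate_if_valid[OF F valid cand]
    have "\<not> hit (region G \<epsilon> F) (sR u)" using plate_hit(1)[OF plate(1) _ u] unfolding plate(2) by auto
    moreover have "\<forall>\<^sub>F s in at_right (sR u). thick (region G \<epsilon> F) s"
      unfolding plate(2)
    proof (rule plate_thick_on_right[OF plate(1)])
      show "tangency_param G \<epsilon> Right a \<le> sR u" if "left_end A = ereal a" for a
        using that u by (simp add: tangency_param_eq)
      show "sR u < tangency_param G \<epsilon> d2 c" if "right_end A = ereal c" for c
        using plate_arc_nondegenerate[OF F valid u that] by (simp add: tangency_param_eq)
    qed
    ultimately show ?thesis by blast
  qed
  then show "\<not> hit (region G \<epsilon> F) (sR u)" "\<forall>\<^sub>F s in at_right (sR u). thick (region G \<epsilon> F) s" by simp_all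
qed

lemma ending_figure:
  assumes valid: "valid_figure G \<epsilon> f F" and cand: "standard_candidate G \<epsilon> f F B" and F: "ends_at F u"
  shows "\<not> hit (region G \<epsilon> F) (sL u)" "\<forall>\<^sub>F s in at_left (sL u). thick (region G \<epsilon> F) s"
proof -
  have "\<not> hit (region G \<epsilon> F) (sL u) \<and> (\<forall>\<^sub>F s in at_left (sL u). thick (region G \<epsilon> F) s)"
    using F unfolding ends_at_def
  proof (elim disjE exE conjE)
    fix u1 assume F: "F = Tangents Left u1 (ereal u)"
    then have "u1 < ereal u" using valid by simp
    then have "\<forall>\<^sub>F s in at_left (sL u). thick (region G \<epsilon> F) s"
      unfolding F by (intro left_fan_thick_on_left) simp_all
    moreover have "\<not> hit (region G \<epsilon> F) (sL u)"
      using left_fan_hit(2)[of u1 "ereal u" "sL u"] unfolding F by auto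
    ultimately show ?thesis by blast
  next
    fix d1 A assume F: "is_plate F d1 Left A" and u: "right_end A = ereal u"
    note plate = plate_if_valid[OF F valid cand]
    have "\<not> hit (region G \<epsilon> F) (sL u)" using plate_hit(2)[OF plate(1) _ u] unfolding plate(2) by auto
    moreover have "\<forall>\<^sub>F s in at_left (sL u). thick (region G \<epsilon> F) s"
      unfolding plate(2)
    proof (rule plate_thick_on_left[OF plate(1)])
      show "sL u \<le> tangency_param G \<epsilon> Left c" if "right_end A = ereal c" for c
        using that u by (simp add: tangency_param_eq)
      show "tangency_param G \<epsilon> d1 a < sL u" if "left_end A = ereal a" for a
        using plate_arc_nondegenerate[OF F valid that u] by (simp add: tangency_param_eq)
    qed
    ultimately show ?thesis by blast
  qed
  then show "\<not> hit (region G \<epsilon> F) (sL u)" "\<forall>\<^sub>F s in at_left (sL u). thick (region G \<epsilon> F) s" by simp_all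
qed

context
  fixes \<Gamma> :: "(figure \<times> (real^2 \<Rightarrow> real)) set" and B :: "real^2 \<Rightarrow> real"
  assumes foliation: "admissible_foliation G \<epsilon> f \<Gamma>" and generated: "generated_candidate G \<epsilon> \<Gamma> B"
begin

lemma figureD:
  assumes "(F, b) \<in> \<Gamma>"
  shows "valid_figure G \<epsilon> f F" "standard_candidate G \<epsilon> f F B"
proof -
  have "\<forall>(F, b)\<in>\<Gamma>. valid_figure G \<epsilon> f F \<and> standard_candidate G \<epsilon> f F b"
    using foliation unfolding admissible_foliation_def by (elim conjE)
  from bspec[OF this assms] have *: "valid_figure G \<epsilon> f F \<and> standard_candidate G \<epsilon> f F b"
    unfolding prod.case .
  then show "valid_figure G \<epsilon> f F" by (rule conjunct1)
  have "\<forall>x\<in>region G \<epsilon> F. B x = b x"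
    using bspec[OF generated[unfolded generated_candidate_def] assms] unfolding prod.case .
  then show "standard_candidate G \<epsilon> f F B"
    by (intro standard_candidate_cong[OF conjunct2[OF *]]) (rule bspec)
qed

lemma finite_foliation: "finite \<Gamma>"
  using foliation unfolding admissible_foliation_def by (elim conjE)

lemma covering: "(\<Union>(F, b)\<in>\<Gamma>. region G \<epsilon> F) = Omega G \<epsilon>"
  using foliation unfolding admissible_foliation_def by (elim conjE)

lemma covered:
  assumes "x \<in> Omega G \<epsilon>"
  obtains F b where "(F, b) \<in> \<Gamma>" "x \<in> region G \<epsilon> F"
proof -
  have "x \<in> (\<Union>(F, b)\<in>\<Gamma>. region G \<epsilon> F)" using assms by (simp only: covering)
  then obtain Fb where Fb: "Fb \<in> \<Gamma>" "x \<in> (case Fb of (F, b) \<Rightarrow> region G \<epsilon> F)" by (rule UN_E)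
  have "(fst Fb, snd Fb) \<in> \<Gamma>" using Fb(1) by (simp only: prod.collapse)
  moreover have "x \<in> region G \<epsilon> (fst Fb)" using Fb(2) by (simp only: case_prod_unfold)
  ultimately show ?thesis by (rule that)
qed

lemma disjoint_interiors:
  assumes "(F1, b1) \<in> \<Gamma>" "(F2, b2) \<in> \<Gamma>" "F1 \<noteq> F2"
  shows "interior (region G \<epsilon> F1) \<inter> interior (region G \<epsilon> F2) = {}"
proof -
  have ne: "(F1, b1) \<noteq> (F2, b2)" using assms(3) by simp
  have all: "\<forall>(F1, b1)\<in>\<Gamma>. \<forall>(F2, b2)\<in>\<Gamma>. (F1, b1) \<noteq> (F2, b2) \<longrightarrow>
      interior (region G \<epsilon> F1) \<inter> interior (region G \<epsilon> F2) = {} \<and>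
      C1_glued (region G \<epsilon> F1) b1 (region G \<epsilon> F2) b2"
    using foliation unfolding admissible_foliation_def by (elim conjE)
  from bspec[OF bspec[OF all assms(1), unfolded prod.case] assms(2), unfolded prod.case]
  show ?thesis using ne by (rule conjunct1[OF mp])
qed

lemma some_figure_hit:
  obtains F b where "(F, b) \<in> \<Gamma>" "hit (region G \<epsilon> F) s"
proof (rule ccontr)
  assume no: "\<not> thesis"
  note found = that
  have none: "\<not> hit (region G \<epsilon> F) s" if F: "(F, b) \<in> \<Gamma>" for F b
  proof
    assume "hit (region G \<epsilon> F) s"
    from found[OF F this] no show False by (rule notE[rotated])
  qed
  have "\<forall>\<^sub>F \<delta> in at_right 0. \<forall>Fb\<in>\<Gamma>. h s - axis 2 \<delta> \<notin> region G \<epsilon> (fst Fb)"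
  proof (rule eventually_ball_finite[OF finite_foliation], rule ballI)
    fix Fb assume "Fb \<in> \<Gamma>"
    then have "(fst Fb, snd Fb) \<in> \<Gamma>" by simp
    then have "\<not> hit (region G \<epsilon> (fst Fb)) s" by (rule none)
    then obtain \<eta> where \<eta>: "\<eta> > 0" "\<And>\<delta>. 0 < \<delta> \<Longrightarrow> \<delta> < \<eta> \<Longrightarrow> h s - axis 2 \<delta> \<notin> region G \<epsilon> (fst Fb)"
      unfolding hit_def by blast
    from eventually_at_right_real[OF \<eta>(1)] show "\<forall>\<^sub>F \<delta> in at_right 0. h s - axis 2 \<delta> \<notin> region G \<epsilon> (fst Fb)"
      by eventually_elim (use \<eta>(2) in simp)
  qed
  moreover obtain t where t: "g t $ 1 = h s $ 1" "g t $ 2 < h s $ 2" using free_above by blast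
  then have "0 < h s $ 2 - g t $ 2" by simp
  note eventually_at_right_real[OF this]
  ultimately have "\<forall>\<^sub>F \<delta> in at_right (0::real). False"
  proof eventually_elim
    case (elim \<delta>)
    have "h s - axis 2 \<delta> \<in> Omega G \<epsilon>"
      by (rule in_OmegaI[of t _ s]) (use t elim in \<open>simp_all add: height_below\<close>)
    then obtain F b where F: "(F, b) \<in> \<Gamma>" "h s - axis 2 \<delta> \<in> region G \<epsilon> F" by (rule covered)
    show False using bspec[OF elim(1) F(1)] F(2) by simp
  qed
  then show False by simp
qed

text \<open>At the beginning of a figure, the figure before it ends with the same tangent or with a chord
  tangent to the free boundary, since two figures cannot both be thick to the right of the point of
  tangency. In either case it provides an optimizer there, provided that it has been provided with one
  itself. As the parameters of these beginnings decrease, the process terminates.\<close>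

lemma delivered_from_left:
  assumes "(F0, b0) \<in> \<Gamma>" "starts_at F0 u"
  shows "left_opt f (sR u) (wR u) (B (wR u))"
proof -
  define U where "U = {u. \<exists>F\<in>fst ` \<Gamma>. starts_at F u}"
  have U_I: "u \<in> U" if "(F, b) \<in> \<Gamma>" "starts_at F u" for F b u
    unfolding U_def by (intro CollectI bexI[of _ F] that(2) image_eqI[OF _ that(1)]) simp
  have "finite U"
    unfolding U_def by (intro finite_determined finite_imageI finite_foliation) (rule starts_at_unique)
  have "left_opt f (sR u) (wR u) (B (wR u))" if "u \<in> U" for u
    using that
  proof (induction u rule: measure_induct_rule[of "\<lambda>u. card {v \<in> U. v < u}"])
    case (less u)
    then obtain F0 where F0': "F0 \<in> fst ` \<Gamma>" "starts_at F0 u" unfolding U_def by (elim CollectE bexE)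
    from F0'(1) obtain Fb where Fb: "F0 = fst Fb" "Fb \<in> \<Gamma>" by (rule imageE)
    have F0: "(F0, snd Fb) \<in> \<Gamma>" "starts_at F0 u" using Fb(2) F0'(2) unfolding Fb(1) by simp_all
    note start = starting_figure[OF figureD[OF F0(1)] F0(2)]
    obtain F b where F: "(F, b) \<in> \<Gamma>" "hit (region G \<epsilon> F) (sR u)" by (rule some_figure_hit)
    have smaller: "left_opt f (sR u') (wR u') (B (wR u'))" if "starts_at F u'" "u' < u" for u'
    proof (rule less.IH)
      show "u' \<in> U" using F(1) that(1) by (rule U_I)
      have "{v \<in> U. v < u'} \<subset> {v \<in> U. v < u}" using \<open>u' \<in> U\<close> that(2) by auto
      then show "card {v \<in> U. v < u'} < card {v \<in> U. v < u}"
        using \<open>finite U\<close> by (intro psubset_card_mono) simp_all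
    qed
    have "left_opt f (sR u) (h (sR u)) (B (h (sR u)))"
      using figureD[OF F(1)] F(2)
    proof (cases rule: hit_thick_on_right_or_delivering)
      case 1
      have "\<forall>\<^sub>F s in at_right (sR u). interior (region G \<epsilon> F0) \<inter> interior (region G \<epsilon> F) \<noteq> {}"
        using start(2) 1 by eventually_elim (rule thick_interiors_meet)
      then have "interior (region G \<epsilon> F0) \<inter> interior (region G \<epsilon> F) \<noteq> {}" by simp
      moreover have "F0 \<noteq> F" using start(1) F(2) by blast
      ultimately show ?thesis using disjoint_interiors[OF F0(1) F(1)] by blast
    next
      case (2 u1)
      then have B: "tangents_candidate G \<epsilon> f Right u1 (ereal u) B" and u1: "u1 < ereal u"
        using figureD(2)[OF F(1)] by simp_all
      have "left_opt f (sR u) (wR u) (B (wR u))"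
      proof (rule right_fan_delivers[OF B _ u1])
        show "u \<in> ereal_interval u1 (ereal u)" using u1 by (simp add: ereal_interval_def less_imp_le)
        show "left_opt f (sR u') (wR u') (B (wR u'))" if "u1 = ereal u'" for u'
          using that u1 2 by (intro smaller) (simp_all add: starts_at_def)
      qed
      then show ?thesis by (simp add: wR_def)
    next
      case (3 d1 A)
      then have c: "right_end A = ereal u" by simp
      note plate = plate_if_valid[OF 3(1) figureD[OF F(1)]]
      obtain k n where kn: "\<forall>x\<in>region G \<epsilon> (Tangent_Multi d1 Right A). B x = k + n \<bullet> x"
        "\<forall>a. g a \<in> region G \<epsilon> (Tangent_Multi d1 Right A) \<longrightarrow> B (g a) = f a" using plate(3) by blast
      have "left_opt f (sR u) (wR u) (B (wR u))"
      proof (rule plate_delivers_right[OF plate(1) bspec[OF kn(1)] mp[OF spec[OF kn(2)]] _ refl c])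
        fix a assume a: "d1 = Right" "left_end A = ereal a"
        have "sR a < sR u"
          using plate_arc_nondegenerate[OF 3(1) figureD(1)[OF F(1)] a(2) c] a(1) by (simp add: tangency_param_eq)
        then have "a < u" by simp
        moreover have "starts_at F a" using 3(1) a unfolding starts_at_def by blast
        ultimately show "left_opt f (sR a) (wR a) (B (wR a))" by (intro smaller)
      qed
      then show ?thesis by (simp add: wR_def)
    next
      case 4
      then show ?thesis by (rule linear_at_delivers)
    qed
    then show ?case by (simp add: wR_def)
  qed
  from this[OF U_I[OF assms]] show ?thesis .
qed

lemma delivered_from_right:
  assumes "(F0, b0) \<in> \<Gamma>" "ends_at F0 u"
  shows "right_opt f (sL u) (wL u) (B (wL u))"
proof -
  define U where "U = {u. \<exists>F\<in>fst ` \<Gamma>. ends_at F u}"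
  have U_I: "u \<in> U" if "(F, b) \<in> \<Gamma>" "ends_at F u" for F b u
    unfolding U_def by (intro CollectI bexI[of _ F] that(2) image_eqI[OF _ that(1)]) simp
  have "finite U"
    unfolding U_def by (intro finite_determined finite_imageI finite_foliation) (rule ends_at_unique)
  have "right_opt f (sL u) (wL u) (B (wL u))" if "u \<in> U" for u
    using that
  proof (induction u rule: measure_induct_rule[of "\<lambda>u. card {v \<in> U. u < v}"])
    case (less u)
    then obtain F0 where F0': "F0 \<in> fst ` \<Gamma>" "ends_at F0 u" unfolding U_def by (elim CollectE bexE)
    from F0'(1) obtain Fb where Fb: "F0 = fst Fb" "Fb \<in> \<Gamma>" by (rule imageE)
    have F0: "(F0, snd Fb) \<in> \<Gamma>" "ends_at F0 u" using Fb(2) F0'(2) unfolding Fb(1) by simp_all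
    note start = ending_figure[OF figureD[OF F0(1)] F0(2)]
    obtain F b where F: "(F, b) \<in> \<Gamma>" "hit (region G \<epsilon> F) (sL u)" by (rule some_figure_hit)
    have smaller: "right_opt f (sL u') (wL u') (B (wL u'))" if "ends_at F u'" "u < u'" for u'
    proof (rule less.IH)
      show "u' \<in> U" using F(1) that(1) by (rule U_I)
      have "{v \<in> U. u' < v} \<subset> {v \<in> U. u < v}" using \<open>u' \<in> U\<close> that(2) by auto
      then show "card {v \<in> U. u' < v} < card {v \<in> U. u < v}"
        using \<open>finite U\<close> by (intro psubset_card_mono) simp_all
    qed
    have "right_opt f (sL u) (h (sL u)) (B (h (sL u)))"
      using figureD[OF F(1)] F(2)
    proof (cases rule: hit_thick_on_left_or_delivering)
      case 1
      have "\<forall>\<^sub>F s in at_left (sL u). interior (region G \<epsilon> F0) \<inter> interior (region G \<epsilon> F) \<noteq> {}"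
        using start(2) 1 by eventually_elim (rule thick_interiors_meet)
      then have "interior (region G \<epsilon> F0) \<inter> interior (region G \<epsilon> F) \<noteq> {}" by simp
      moreover have "F0 \<noteq> F" using start(1) F(2) by blast
      ultimately show ?thesis using disjoint_interiors[OF F0(1) F(1)] by blast
    next
      case (2 u2)
      then have B: "tangents_candidate G \<epsilon> f Left (ereal u) u2 B" and u2: "ereal u < u2"
        using figureD(2)[OF F(1)] by simp_all
      have "right_opt f (sL u) (wL u) (B (wL u))"
      proof (rule left_fan_delivers[OF B _ u2])
        show "u \<in> ereal_interval (ereal u) u2" using u2 by (simp add: ereal_interval_def less_imp_le)
        show "right_opt f (sL u') (wL u') (B (wL u'))" if "u2 = ereal u'" for u'
          using that u2 2 by (intro smaller) (simp_all add: ends_at_def)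
      qed
      then show ?thesis by (simp add: wL_def)
    next
      case (3 d2 A)
      then have a: "left_end A = ereal u" by simp
      note plate = plate_if_valid[OF 3(1) figureD[OF F(1)]]
      obtain k n where kn: "\<forall>x\<in>region G \<epsilon> (Tangent_Multi Left d2 A). B x = k + n \<bullet> x"
        "\<forall>a. g a \<in> region G \<epsilon> (Tangent_Multi Left d2 A) \<longrightarrow> B (g a) = f a" using plate(3) by blast
      have "right_opt f (sL u) (wL u) (B (wL u))"
      proof (rule plate_delivers_left[OF plate(1) bspec[OF kn(1)] mp[OF spec[OF kn(2)]] _ refl a])
        fix c assume c: "d2 = Left" "right_end A = ereal c"
        have "sL u < sL c"
          using plate_arc_nondegenerate[OF 3(1) figureD(1)[OF F(1)] a c(2)] c(1) by (simp add: tangency_param_eq)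
        then have "u < c" by simp
        moreover have "ends_at F c" using 3(1) c unfolding ends_at_def by blast
        ultimately show "right_opt f (sL c) (wL c) (B (wL c))" by (intro smaller)
      qed
      then show ?thesis by (simp add: wL_def)
    next
      case 4
      then show ?thesis by (rule linear_at_delivers)
    qed
    then show ?case by (simp add: wL_def)
  qed
  from this[OF U_I[OF assms]] show ?thesis .
qed

lemma opt_everywhere:
  assumes x: "x \<in> Omega G \<epsilon>"
  shows "\<exists>\<alpha> T. opt f \<alpha> T x (B x)"
proof -
  obtain F b where F: "(F, b) \<in> \<Gamma>" and x: "x \<in> region G \<epsilon> F" using x by (rule covered)
  note valid = figureD[OF F]
  have plates: ?thesis if P: "is_plate F d1 d2 A" for d1 d2 A
  proof -
    note plate = plate_if_valid[OF P valid]
    obtain k n where kn: "\<forall>x\<in>region G \<epsilon> (Tangent_Multi d1 d2 A). B x = k + n \<bullet> x"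
      "\<forall>a. g a \<in> region G \<epsilon> (Tangent_Multi d1 d2 A) \<longrightarrow> B (g a) = f a" using plate(3) by blast
    show ?thesis
    proof (rule plate_opt[OF plate(1) bspec[OF kn(1)] mp[OF spec[OF kn(2)]]])
      show "left_opt f (sR a) (wR a) (B (wR a))" if "d1 = Right" "left_end A = ereal a" for a
      proof -
        have "starts_at F a" using P that unfolding starts_at_def by blast
        then show ?thesis by (rule delivered_from_left[OF F])
      qed
      show "right_opt f (sL c) (wL c) (B (wL c))" if "d2 = Left" "right_end A = ereal c" for c
      proof -
        have "ends_at F c" using P that unfolding ends_at_def by blast
        then show ?thesis by (rule delivered_from_right[OF F])
      qed
      show "x \<in> region G \<epsilon> (Tangent_Multi d1 d2 A)" using x plate(2) by simp
    qed
  qed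
  show ?thesis
  proof (cases F)
    case (Tangents d u1 u2)
    show ?thesis
    proof (cases d)
      case Right
      then have F': "F = Tangents Right u1 u2" using Tangents by simp
      then have B: "tangents_candidate G \<epsilon> f Right u1 u2 B" and u: "u1 < u2" using valid by simp_all
      obtain t where t: "t \<in> ereal_interval u1 u2" "x \<in> closed_segment (wR t) (g t)"
        using x unfolding F' tangents_region by blast
      then obtain \<theta> where \<theta>: "0 \<le> \<theta>" "\<theta> \<le> 1" "x = (1 - \<theta>) *\<^sub>R wR t + \<theta> *\<^sub>R g t" by (auto simp: in_segment)
      have "left_opt f (sR t) (wR t) (B (wR t))"
      proof (rule right_fan_delivers[OF B t(1) u])
        show "left_opt f (sR u) (wR u) (B (wR u))" if "u1 = ereal u" for u
          by (rule delivered_from_left[OF F]) (simp add: F' that starts_at_def)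
      qed
      then have "left_opt f (sR t) x ((1 - \<theta>) * B (wR t) + \<theta> * f t)"
        unfolding \<theta>(3) using wR_less[of t] by (intro left_opt_append \<theta>(1,2)) (simp_all add: wR_def)
      moreover have "B x = (1 - \<theta>) * B (wR t) + \<theta> * f t"
        unfolding \<theta>(3) by (rule right_fan_value[OF B]) (use t(1) \<theta>(1,2) in blast)
      ultimately show ?thesis unfolding left_opt_def by auto
    next
      case Left
      then have F': "F = Tangents Left u1 u2" using Tangents by simp
      then have B: "tangents_candidate G \<epsilon> f Left u1 u2 B" and u: "u1 < u2" using valid by simp_all
      obtain t where t: "t \<in> ereal_interval u1 u2" "x \<in> closed_segment (wL t) (g t)"
        using x unfolding F' tangents_region by (auto simp: closed_segment_commute)
      then obtain \<theta> where \<theta>: "0 \<le> \<theta>" "\<theta> \<le> 1" "x = (1 - \<theta>) *\<^sub>R wL t + \<theta> *\<^sub>R g t" by (auto simp: in_segment)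
      have "right_opt f (sL t) (wL t) (B (wL t))"
      proof (rule left_fan_delivers[OF B t(1) u])
        show "right_opt f (sL u) (wL u) (B (wL u))" if "u2 = ereal u" for u
          by (rule delivered_from_right[OF F]) (simp add: F' that ends_at_def)
      qed
      then have "right_opt f (sL t) x ((1 - \<theta>) * B (wL t) + \<theta> * f t)"
        unfolding \<theta>(3) using wL_greater[of t] by (intro right_opt_append \<theta>(1,2)) (simp_all add: wL_def)
      moreover have "B x = (1 - \<theta>) * B (wL t) + \<theta> * f t"
        unfolding \<theta>(3) by (rule left_fan_value[OF B]) (use t(1) \<theta>(1,2) in blast)
      ultimately show ?thesis using right_opt_imp_opt by metis
    qed
  next
    case (Chordal a0 b0 a1 b1 b)
    have "chordal_candidate g f a0 a1 b B" using valid(2) Chordal by simp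
    from chordal_opt[OF valid(1)[unfolded Chordal] this x[unfolded Chordal]] show ?thesis .
  next
    case (Closed_Multicup A)
    from closed_cup(2)[OF valid[unfolded Closed_Multicup] x[unfolded Closed_Multicup]] show ?thesis .
  next
    case (Angle u)
    then show ?thesis by (intro plates[of Right Left "[(ereal u, ereal u)]"]) (simp add: is_plate_def)
  next
    case (Tangent_Multi d1 d2 A)
    then show ?thesis by (intro plates[of d1 d2 A]) (simp add: is_plate_def)
  qed
qed

lemma optimizer_everywhere:
  assumes "x \<in> Omega G \<epsilon>"
  shows "\<exists>I \<phi>. is_optimizer G \<epsilon> f B x I \<phi>"
proof -
  obtain \<alpha> T where "opt f \<alpha> T x (B x)" using opt_everywhere[OF assms] by (elim exE)
  from opt_gives_optimizer[where B=B, OF this refl] show ?thesis .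
qed

end

end

theorem theorem5p3p1:
  fixes emax :: ereal
    and G :: "real \<Rightarrow> real \<Rightarrow> real^2"
    and f :: "real \<Rightarrow> real"
    and \<epsilon> :: real
    and \<Gamma> :: "(figure \<times> (real^2 \<Rightarrow> real)) set"
    and B :: "real^2 \<Rightarrow> real"
    and x :: "real^2"
  assumes "domain_family emax G"
    and "regularity_condition (G 0) f"
    and "summability_condition emax G f"
    and "0 < \<epsilon>" and "ereal \<epsilon> < emax"
    and "admissible_foliation G \<epsilon> f \<Gamma>"
    and "generated_candidate G \<epsilon> \<Gamma> B"
    and "x \<in> Omega G \<epsilon>"
  shows "\<exists>I \<phi>. is_optimizer G \<epsilon> f B x I \<phi>"
proof -
  interpret bellman_domain emax G f \<epsilon>
    using assms(1,2,4,5) by unfold_locales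
  show ?thesis using optimizer_everywhere[OF assms(6-8)] .
qed

end
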